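(* Let $\Omega\subseteq\mathbb{R}^n$ be open and let $P(x,D)=\sum_{|\alpha|\le m}a_\alpha(x)D^\alpha$ be a linear partial differential operator with coefficients $a_\alpha\in\mathcal{E}^{(\mathfrak G)}(\Omega)$. Then $\mathrm{WF}_{(\mathfrak G)}u\subseteq\mathrm{WF}_{(\mathfrak G)}Pu\cup\mathrm{Char}\,P$ for all $u\in\mathcal{D}'(\Omega)$. If $P$ is elliptic, then $\mathrm{WF}_{(\mathfrak G)}u=\mathrm{WF}_{(\mathfrak G)}Pu$.
   Context: $D^\alpha=(-i)^{|\alpha|}\partial^\alpha$. For $s>1$ let $\mathbf G^s=(k!^s)_k$ and $\mathfrak G=\{\mathbf G^s:s>1\}$. $\mathcal{E}^{(\mathfrak G)}(\Omega)=\bigcap_{s>1}\mathcal G^s(\Omega)$, where $\mathcal G^s(\Omega)$ is the Gevrey class: smooth $f$ such that for every relatively compact open $V\subseteq\Omega$ there are $C,\rho>0$ with $|\partial^\alpha f(x)|\le C\rho^{|\alpha|}|\alpha|!^s$ for $x\in V$, $\alpha\in\mathbb N^n$. Wave front set: $u\in\mathcal D'(\Omega)$ is microlocally of class $(\mathfrak G)$ at $(x_0,\xi_0)\in T^*\Omega\setminus\{0\}$ if there exist a neighborhood $V$ of $x_0$, an open conic neighborhood $\Gamma$ of $\xi_0$, and a bounded sequence $(u_N)_N\subseteq\mathcal E'(\Omega)$ with $u_N|_V=u|_V$ such that $\sup_{\xi\in\Gamma,N\in\mathbb N}|\xi|^N|\widehat{u}_N(\xi)|/(Q^N N!^s)<\infty$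 for all $s>1$ and all $Q>0$. $\mathrm{WF}_{(\mathfrak G)}u$ is the set of points of $T^*\Omega\setminus\{0\}$ where $u$ is not microlocally of class $(\mathfrak G)$. $\mathrm{Char}\,P=\{(x,\xi)\in T^*\Omega\setminus\{0\}: P_m(x,\xi)=0\}$ with principal symbol $P_m(x,\xi)=\sum_{|\alpha|=m}a_\alpha(x)\xi^\alpha$; $P$ is elliptic if $\mathrm{Char}\,P=\emptyset$. *)

theory Defs
  imports "HOL-Analysis.Analysis"
begin

definition mabs :: "('n::finite \<Rightarrow> nat) \<Rightarrow> nat" where
  "mabs \<alpha> = sum \<alpha> UNIV"

definition partial :: "'n::finite \<Rightarrow> (real^'n \<Rightarrow> complex) \<Rightarrow> real^'n \<Rightarrow> complex" where
  "partial i f x = vector_derivative (\<lambda>t. f (x + t *\<^sub>R axis i 1)) (at 0)"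

fun iter_partial :: "'n::finite list \<Rightarrow> (real^'n \<Rightarrow> complex) \<Rightarrow> real^'n \<Rightarrow> complex" where
  "iter_partial [] f = f"
| "iter_partial (i # is) f = partial i (iter_partial is f)"

text \<open>partial derivative of multi-order alpha (order irrelevant for smooth functions)\<close>
definition dpartial :: "('n::finite \<Rightarrow> nat) \<Rightarrow> (real^'n \<Rightarrow> complex) \<Rightarrow> real^'n \<Rightarrow> complex" where
  "dpartial \<alpha> f = iter_partial (SOME is. \<forall>i. count_list is i = \<alpha> i) f"

definition Dop :: "('n::finite \<Rightarrow> nat) \<Rightarrow> (real^'n \<Rightarrow> complex) \<Rightarrow> real^'n \<Rightarrow> complex" where
  "Dop \<alpha> f x = (- \<i>) ^ mabs \<alpha> * dpartial \<alpha> f x"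

definition smooth_on :: "(real^'n::finite) set \<Rightarrow> (real^'n \<Rightarrow> complex) \<Rightarrow> bool" where
  "smooth_on \<Omega> f \<longleftrightarrow>
     (\<forall>is. continuous_on \<Omega> (iter_partial is f) \<and>
        (\<forall>i. \<forall>x\<in>\<Omega>. ((\<lambda>t. iter_partial is f (x + t *\<^sub>R axis i 1))
            has_vector_derivative partial i (iter_partial is f) x) (at 0)))"

definition tsupp :: "(real^'n::finite \<Rightarrow> complex) \<Rightarrow> (real^'n) set" where
  "tsupp f = closure {x. f x \<noteq> 0}"

definition test_fun :: "(real^'n::finite) set \<Rightarrow> (real^'n \<Rightarrow> complex) \<Rightarrow> bool" where
  "test_fun \<Omega> \<phi> \<longleftrightarrow> smooth_on UNIV \<phi> \<and> compact (tsupp \<phi>) \<and> tsupp \<phi> \<subseteq> \<Omega>"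

definition distribution :: "(real^'n::finite) set \<Rightarrow> ((real^'n \<Rightarrow> complex) \<Rightarrow> complex) \<Rightarrow> bool" where
  "distribution \<Omega> u \<longleftrightarrow>
     (\<forall>\<phi> \<psi>. test_fun \<Omega> \<phi> \<and> test_fun \<Omega> \<psi> \<longrightarrow> u (\<lambda>x. \<phi> x + \<psi> x) = u \<phi> + u \<psi>) \<and>
     (\<forall>c \<phi>. test_fun \<Omega> \<phi> \<longrightarrow> u (\<lambda>x. c * \<phi> x) = c * u \<phi>) \<and>
     (\<forall>K. compact K \<and> K \<subseteq> \<Omega> \<longrightarrow> (\<exists>C k. \<forall>\<phi> M. test_fun \<Omega> \<phi> \<and> tsupp \<phi> \<subseteq> K \<and>
         (\<forall>\<alpha> x. mabs \<alpha> \<le> k \<and> x \<in> K \<longrightarrow> cmod (dpartial \<alpha> \<phi> x) \<le> M)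
         \<longrightarrow> cmod (u \<phi>) \<le> C * M))"

definition comp_distribution :: "(real^'n::finite) set \<Rightarrow> ((real^'n \<Rightarrow> complex) \<Rightarrow> complex) \<Rightarrow> bool" where
  "comp_distribution \<Omega> u \<longleftrightarrow>
     (\<forall>f g. smooth_on \<Omega> f \<and> smooth_on \<Omega> g \<longrightarrow> u (\<lambda>x. f x + g x) = u f + u g) \<and>
     (\<forall>c f. smooth_on \<Omega> f \<longrightarrow> u (\<lambda>x. c * f x) = c * u f) \<and>
     (\<exists>K C k. compact K \<and> K \<subseteq> \<Omega> \<and> (\<forall>f M. smooth_on \<Omega> f \<and>
         (\<forall>\<alpha> x. mabs \<alpha> \<le> k \<and> x \<in> K \<longrightarrow> cmod (dpartial \<alpha> f x) \<le> M)
         \<longrightarrow> cmod (u f) \<le> C * M))"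

definition bounded_E :: "(real^'n::finite) set \<Rightarrow> (real^'n \<Rightarrow> complex) set \<Rightarrow> bool" where
  "bounded_E \<Omega> B \<longleftrightarrow> (\<forall>f\<in>B. smooth_on \<Omega> f) \<and>
     (\<forall>K \<alpha>. compact K \<and> K \<subseteq> \<Omega> \<longrightarrow> (\<exists>M. \<forall>f\<in>B. \<forall>x\<in>K. cmod (dpartial \<alpha> f x) \<le> M))"

text \<open>bounded sequences in E'(Omega) (strong dual topology)\<close>
definition bounded_seq_E' :: "(real^'n::finite) set \<Rightarrow> (nat \<Rightarrow> (real^'n \<Rightarrow> complex) \<Rightarrow> complex) \<Rightarrow> bool" where
  "bounded_seq_E' \<Omega> U \<longleftrightarrow> (\<forall>N. comp_distribution \<Omega> (U N)) \<and>
     (\<forall>B. bounded_E \<Omega> B \<longrightarrow> (\<exists>M. \<forall>N. \<forall>f\<in>B. cmod (U N f) \<le> M))"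

definition fourier :: "((real^'n::finite \<Rightarrow> complex) \<Rightarrow> complex) \<Rightarrow> real^'n \<Rightarrow> complex" where
  "fourier u \<xi> = u (\<lambda>x. cis (- (x \<bullet> \<xi>)))"

definition microlocal_G :: "(real^'n::finite) set \<Rightarrow> ((real^'n \<Rightarrow> complex) \<Rightarrow> complex) \<Rightarrow> real^'n \<Rightarrow> real^'n \<Rightarrow> bool" where
  "microlocal_G \<Omega> u x0 \<xi>0 \<longleftrightarrow>
     (\<exists>V \<Gamma> U. open V \<and> x0 \<in> V \<and> V \<subseteq> \<Omega> \<and>
        open \<Gamma> \<and> \<xi>0 \<in> \<Gamma> \<and> 0 \<notin> \<Gamma> \<and> (\<forall>\<xi>\<in>\<Gamma>. \<forall>t>0. t *\<^sub>R \<xi> \<in> \<Gamma>) \<and>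
        bounded_seq_E' \<Omega> U \<and> (\<forall>N \<phi>. test_fun V \<phi> \<longrightarrow> U N \<phi> = u \<phi>) \<and>
        (\<forall>s>1. \<forall>Q>0. \<exists>C. \<forall>\<xi>\<in>\<Gamma>. \<forall>N.
           norm \<xi> ^ N * cmod (fourier (U N) \<xi>) / (Q ^ N * fact N powr s) \<le> C))"

definition WF_G :: "(real^'n::finite) set \<Rightarrow> ((real^'n \<Rightarrow> complex) \<Rightarrow> complex) \<Rightarrow> ((real^'n) \<times> (real^'n)) set" where
  "WF_G \<Omega> u = {(x, \<xi>). x \<in> \<Omega> \<and> \<xi> \<noteq> 0 \<and> \<not> microlocal_G \<Omega> u x \<xi>}"

definition gevrey :: "real \<Rightarrow> (real^'n::finite) set \<Rightarrow> (real^'n \<Rightarrow> complex) \<Rightarrow> bool" where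
  "gevrey s \<Omega> f \<longleftrightarrow> smooth_on \<Omega> f \<and>
     (\<forall>V. open V \<and> compact (closure V) \<and> closure V \<subseteq> \<Omega> \<longrightarrow>
        (\<exists>C \<rho>. C > 0 \<and> \<rho> > 0 \<and> (\<forall>x\<in>V. \<forall>\<alpha>.
           cmod (dpartial \<alpha> f x) \<le> C * \<rho> ^ mabs \<alpha> * fact (mabs \<alpha>) powr s)))"

definition EG :: "(real^'n::finite) set \<Rightarrow> (real^'n \<Rightarrow> complex) \<Rightarrow> bool" where
  "EG \<Omega> f \<longleftrightarrow> (\<forall>s>1. gevrey s \<Omega> f)"

text \<open>P u for P = sum_{|alpha|<=m} a_alpha D^alpha, via the transpose:
  (a D^alpha u)(phi) = u((-D)^alpha (a phi))\<close>
definition Pop :: "nat \<Rightarrow> (('n::finite \<Rightarrow> nat) \<Rightarrow> real^'n \<Rightarrow> complex) \<Rightarrow> ((real^'n \<Rightarrow> complex) \<Rightarrow> complex) \<Rightarrow> (real^'n \<Rightarrow> complex) \<Rightarrow> complex" where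
  "Pop m a u \<phi> = (\<Sum>\<alpha>\<in>{\<alpha>. mabs \<alpha> \<le> m}.
      u (\<lambda>x. (-1) ^ mabs \<alpha> * Dop \<alpha> (\<lambda>y. a \<alpha> y * \<phi> y) x))"

definition CharP :: "(real^'n::finite) set \<Rightarrow> nat \<Rightarrow> (('n \<Rightarrow> nat) \<Rightarrow> real^'n \<Rightarrow> complex) \<Rightarrow> ((real^'n) \<times> (real^'n)) set" where
  "CharP \<Omega> m a = {(x, \<xi>). x \<in> \<Omega> \<and> \<xi> \<noteq> 0 \<and>
      (\<Sum>\<alpha>\<in>{\<alpha>. mabs \<alpha> = m}. a \<alpha> x * (\<Prod>i\<in>UNIV. complex_of_real (\<xi> $ i) ^ \<alpha> i)) = 0}"

end

theory Submission
  imports Defs "HOL-Complex_Analysis.Cauchy_Integral_Formula"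
begin

text \<open>
  All cutoff functions are taken once and for all from the non-quasianalytic intersection of the Gevrey
  classes; they are built from \<open>exp (- exp (1 / t))\<close>, whose derivatives are controlled by Cauchy's
  estimates. Then \<open>u\<close> is microlocally regular as soon as the Fourier transform of a single \<open>\<zeta> u\<close> decays in
  a cone. The decay survives multiplication by a Gevrey function \<open>g\<close>: expand \<open>g\<close> in a Fourier series on a
  large cube, use the decay of \<open>u\<close> for the low frequencies and the decay of the Fourier coefficients
  of \<open>g\<close> for the high ones. This gives pseudolocality at once.

  For elliptic regularity write \<open>t = |\<xi>|\<close>, \<open>\<omega> = \<xi> / t\<close> and let \<open>q\<close> be the inverse of the principal symbol. The
  transposed operator maps \<open>exp (- i x \<xi>) q z\<close> to \<open>t ^ m exp (- i x \<xi>) (\<Sum>i. t ^ (- i) T i z)\<close> with \<open>T 0 = id\<close> near the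
  support of the cutoff and \<open>T i\<close> a differential operator of order \<open>i\<close>. The formal Neumann series
  \<open>Z 0 = \<zeta>\<close>, \<open>Z n = - (\<Sum>i = 1..n. T i (Z (n - i)))\<close> satisfies Gevrey bounds of order \<open>n\<close>. Truncating it at an order
  slightly above \<open>N\<close> expresses the Fourier transform of \<open>\<zeta> u\<close> through that of \<open>P u\<close>, with an error of the
  required size \<open>B ^ N N! ^ s / t ^ N\<close>.
\<close>

section \<open>Partial derivatives and smooth functions\<close>

text \<open>The definition of regularity allows a different distribution for each exponent N and
  quantifies over all Q > 0. Neither causes trouble when regularity is to be shown: cutoffs that are
  Gevrey for every s > 1 make the constant sequence admissible, and B ^ N N! ^ s' with s' < s is at
  most a constant times Q ^ N N! ^ s. When regularity is given, the members of the sequence must be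
  treated uniformly; so boundedness is first turned into equicontinuity.

  Term n of the Neumann series has consumed n derivatives of the coefficients. All bounds therefore
  have the form M A ^ |L| (|L| + l)! ^ s for derivatives along L: differentiation raises l, and
  multiplication by a fixed Gevrey function changes only M. The decay estimate charges l to the
  exponent N, so term k, used with exponent N - k, has total order N. The truncation order N + k0,
  with k0 the order of u, makes up for the power t ^ k0 lost in the error terms, where only
  continuity of u is available.

  Fourier series serve instead of transforms because u is a bare functional: finite sums and
  approximation in finitely many derivatives suffice.\<close>

definition has_partial :: "(real^'n::finite \<Rightarrow> complex) \<Rightarrow> 'n \<Rightarrow> complex \<Rightarrow> real^'n \<Rightarrow> bool" where
  "has_partial f i d x \<longleftrightarrow> ((\<lambda>t. f (x + t *\<^sub>R axis i 1)) has_vector_derivative d) (at 0)"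

lemma has_partial_imp: "has_partial f i d x \<Longrightarrow> partial i f x = d"
  unfolding has_partial_def partial_def by (rule vector_derivative_at)

lemma eventually_line:
  assumes "open S" "x \<in> S"
  shows "\<forall>\<^sub>F t in nhds (0::real). x + t *\<^sub>R (axis i 1 :: real^'n::finite) \<in> S"
proof -
  have "((\<lambda>t::real. x + t *\<^sub>R (axis i 1 :: real^'n)) \<longlongrightarrow> x + 0 *\<^sub>R axis i 1) (nhds 0)"
    by (intro tendsto_intros filterlim_ident)
  then show ?thesis using assms topological_tendstoD[of _ x "nhds 0" S] by simp
qed

lemma has_partial_cong:
  assumes "open S" "x \<in> S" "\<And>y. y \<in> S \<Longrightarrow> f y = g y"
  shows "has_partial f i d x \<longleftrightarrow> has_partial g i d x"
  unfolding has_partial_def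
  by (rule has_vector_derivative_cong_ev)
     (use assms eventually_line[OF assms(1,2), of i] in \<open>auto elim: eventually_mono\<close>)

lemma partial_cong:
  assumes "open S" "x \<in> S" "\<And>y. y \<in> S \<Longrightarrow> f y = g y"
  shows "partial i f x = partial i g x"
  unfolding partial_def vector_derivative_def
  using has_partial_cong[of S x f g, OF assms] by (simp add: has_partial_def)

lemma iter_partial_cong:
  assumes "open S" "x \<in> S" "\<And>y. y \<in> S \<Longrightarrow> f y = g y"
  shows "iter_partial L f x = iter_partial L g x"
  using assms(2)
proof (induction L arbitrary: x)
  case (Cons i L)
  then show ?case by (auto intro: partial_cong[OF assms(1)])
qed (use assms in auto)

lemma iter_partial_append: "iter_partial (L @ L') f = iter_partial L (iter_partial L' f)"
  by (induction L) auto

lemma smooth_on_iter_has_partial: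
  "smooth_on S f \<Longrightarrow> x \<in> S \<Longrightarrow> has_partial (iter_partial L f) i (partial i (iter_partial L f) x) x"
  by (auto simp: smooth_on_def has_partial_def)

lemma smooth_on_has_partial:
  "smooth_on S f \<Longrightarrow> x \<in> S \<Longrightarrow> has_partial f i (partial i f x) x"
  using smooth_on_iter_has_partial[of S f x "[]"] by simp

lemma smooth_on_iter_partial:
  assumes "smooth_on S f" shows "smooth_on S (iter_partial L f)"
  using assms unfolding smooth_on_def iter_partial_append[symmetric] by blast

lemma smooth_on_partial: "smooth_on S f \<Longrightarrow> smooth_on S (partial i f)"
  using smooth_on_iter_partial[of S f "[i]"] by simp

lemma smooth_on_continuous: "smooth_on S f \<Longrightarrow> continuous_on S f"
  by (metis iter_partial.simps(1) smooth_on_def)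

lemma smooth_on_continuous_iter: "smooth_on S f \<Longrightarrow> continuous_on S (iter_partial L f)"
  by (metis smooth_on_def)

lemma smooth_on_subset: "smooth_on S f \<Longrightarrow> T \<subseteq> S \<Longrightarrow> smooth_on T f"
  unfolding smooth_on_def using continuous_on_subset by blast

text \<open>Smoothness is the largest property of functions that is closed under taking partial derivatives.\<close>
lemma smooth_on_coinduct:
  assumes "open S" "P f"
    and step: "\<And>g. P g \<Longrightarrow> continuous_on S g \<and> (\<forall>i. \<exists>h. P h \<and> (\<forall>x\<in>S. has_partial g i (h x) x))"
  shows "smooth_on S f"
proof -
  have *: "\<exists>h. P h \<and> (\<forall>x\<in>S. iter_partial L f x = h x)" for L
  proof (induction L)
    case Nil
    then show ?case using assms by auto
  next
    case (Cons i L)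
    then obtain h where h: "P h" "\<forall>x\<in>S. iter_partial L f x = h x" by auto
    obtain k where k: "P k" "\<forall>x\<in>S. has_partial h i (k x) x" using step[OF h(1)] by blast
    have "partial i (iter_partial L f) x = k x" if "x \<in> S" for x
      using partial_cong[OF assms(1) that, of "iter_partial L f" h i] h k that
      by (auto simp: has_partial_imp)
    then show ?case using k(1) by auto
  qed
  show ?thesis unfolding smooth_on_def
  proof (intro allI conjI ballI)
    fix L
    obtain h where h: "P h" "\<forall>x\<in>S. iter_partial L f x = h x" using * by blast
    show "continuous_on S (iter_partial L f)"
      using step[OF h(1)] h(2) by (metis continuous_on_cong)
    fix i x assume x: "x \<in> S"
    obtain k where k: "P k" "\<forall>x\<in>S. has_partial h i (k x) x" using step[OF h(1)] by blast
    have "has_partial (iter_partial L f) i (k x) x"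
      using has_partial_cong[OF assms(1) x, of "iter_partial L f" h] h k x by auto
    then show "((\<lambda>t. iter_partial L f (x + t *\<^sub>R axis i 1)) has_vector_derivative
                 partial i (iter_partial L f) x) (at 0)"
      using has_partial_imp has_partial_def by metis
  qed
qed

lemma has_partial_add: "has_partial f i d x \<Longrightarrow> has_partial g i e x \<Longrightarrow> has_partial (\<lambda>x. f x + g x) i (d + e) x"
  unfolding has_partial_def by (rule has_vector_derivative_add)

lemma has_partial_mult:
  "has_partial f i d x \<Longrightarrow> has_partial g i e x \<Longrightarrow> has_partial (\<lambda>x. f x * g x) i (d * g x + f x * e) x"
  unfolding has_partial_def
  by (drule (1) has_vector_derivative_mult) (simp add: add.commute)

lemma has_partial_const: "has_partial (\<lambda>x. c) i 0 x"
  unfolding has_partial_def by (rule has_vector_derivative_const)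

lemma has_partial_inverse:
  assumes "has_partial f i d x" "f x \<noteq> 0"
  shows "has_partial (\<lambda>x. inverse (f x)) i (- (d * (inverse (f x) * inverse (f x)))) x"
proof -
  have "((\<lambda>t. f (x + t *\<^sub>R axis i 1)) has_derivative (\<lambda>t. t *\<^sub>R d)) (at 0)"
    using assms(1) by (simp add: has_partial_def has_vector_derivative_def)
  from has_derivative_compose[OF this has_derivative_inverse'[of "f (x + 0 *\<^sub>R axis i 1)"]] assms(2)
  have "((\<lambda>t. inverse (f (x + t *\<^sub>R axis i 1))) has_derivative (\<lambda>h. - (inverse (f x) * (h *\<^sub>R d) * inverse (f x)))) (at 0)"
    by simp
  moreover have "(\<lambda>h. - (inverse (f x) * (h *\<^sub>R d) * inverse (f x))) = (\<lambda>h. h *\<^sub>R (- (d * (inverse (f x) * inverse (f x)))))"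
    by (auto simp: scaleR_conv_of_real)
  ultimately show ?thesis by (simp add: has_partial_def has_vector_derivative_def)
qed

lemma smooth_on_const: "open S \<Longrightarrow> smooth_on S (\<lambda>x. c)"
  by (rule smooth_on_coinduct[where P = "\<lambda>f. \<exists>c. f = (\<lambda>x. c)"])
     (auto intro: has_partial_const exI[of _ "\<lambda>x. 0"])

lemma smooth_on_add:
  assumes "open S" "smooth_on S f" "smooth_on S g"
  shows "smooth_on S (\<lambda>x. f x + g x)"
proof (rule smooth_on_coinduct[where P = "\<lambda>h. \<exists>f g. smooth_on S f \<and> smooth_on S g \<and> h = (\<lambda>x. f x + g x)"])
  fix h assume "\<exists>f g. smooth_on S f \<and> smooth_on S g \<and> h = (\<lambda>x. f x + g x)"
  then obtain f g where fg: "smooth_on S f" "smooth_on S g" "h = (\<lambda>x. f x + g x)" by blast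
  show "continuous_on S h \<and> (\<forall>i. \<exists>h'. (\<exists>f g. smooth_on S f \<and> smooth_on S g \<and> h' = (\<lambda>x. f x + g x)) \<and>
     (\<forall>x\<in>S. has_partial h i (h' x) x))"
  proof (intro conjI allI)
    show "continuous_on S h" unfolding fg by (intro continuous_intros smooth_on_continuous fg)
    show "\<exists>h'. (\<exists>f g. smooth_on S f \<and> smooth_on S g \<and> h' = (\<lambda>x. f x + g x)) \<and> (\<forall>x\<in>S. has_partial h i (h' x) x)" for i
      unfolding fg(3) using fg(1,2)
      by (intro exI[of _ "\<lambda>x. partial i f x + partial i g x"])
         (blast intro: has_partial_add smooth_on_has_partial smooth_on_partial)
  qed
qed (use assms in auto)

text \<open>By Leibniz the derivative of a product is a sum of two products, so products alone are
  not invariant under \<open>partial\<close>. Their finite sums are, and they serve as the invariant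
  for \<open>smooth_on_coinduct\<close>.\<close>

inductive sum_of_products :: "(real^'n::finite) set \<Rightarrow> (real^'n \<Rightarrow> complex) \<Rightarrow> bool" for S where
  base: "smooth_on S f \<Longrightarrow> smooth_on S g \<Longrightarrow> sum_of_products S (\<lambda>x. f x * g x)"
| add: "sum_of_products S f \<Longrightarrow> sum_of_products S g \<Longrightarrow> sum_of_products S (\<lambda>x. f x + g x)"

lemma smooth_on_mult:
  assumes "open S" "smooth_on S f" "smooth_on S g"
  shows "smooth_on S (\<lambda>x. f x * g x)"
proof (rule smooth_on_coinduct[where P = "sum_of_products S"])
  fix h assume "sum_of_products S h"
  then show "continuous_on S h \<and> (\<forall>i. \<exists>h'. sum_of_products S h' \<and> (\<forall>x\<in>S. has_partial h i (h' x) x))"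
  proof induction
    case (base f g)
    have "sum_of_products S (\<lambda>x. partial i f x * g x + f x * partial i g x)" for i
      using base by (intro sum_of_products.intros smooth_on_partial)
    moreover have "has_partial (\<lambda>x. f x * g x) i (partial i f x * g x + f x * partial i g x) x" if "x \<in> S" for i x
      by (intro has_partial_mult smooth_on_has_partial[OF base(1)] smooth_on_has_partial[OF base(2)] that)
    moreover have "continuous_on S (\<lambda>x. f x * g x)" by (intro continuous_intros smooth_on_continuous base)
    ultimately show ?case by blast
  next
    case (add f g)
    show ?case
    proof (intro conjI allI)
      show "continuous_on S (\<lambda>x. f x + g x)" using add by (intro continuous_intros) auto
      fix i
      obtain f' g' where "sum_of_products S f'" "\<forall>x\<in>S. has_partial f i (f' x) x"
         "sum_of_products S g'" "\<forall>x\<in>S. has_partial g i (g' x) x" using add by blast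
      then show "\<exists>h'. sum_of_products S h' \<and> (\<forall>x\<in>S. has_partial (\<lambda>x. f x + g x) i (h' x) x)"
        by (intro exI[of _ "\<lambda>x. f' x + g' x"]) (auto intro: has_partial_add sum_of_products.add)
    qed
  qed
qed (use assms in \<open>auto intro: sum_of_products.base\<close>)

lemma smooth_on_cmult: "open S \<Longrightarrow> smooth_on S f \<Longrightarrow> smooth_on S (\<lambda>x. c * f x)"
  by (intro smooth_on_mult smooth_on_const)

lemma smooth_on_diff: "open S \<Longrightarrow> smooth_on S f \<Longrightarrow> smooth_on S g \<Longrightarrow> smooth_on S (\<lambda>x. f x - g x)"
  using smooth_on_add[of S f "\<lambda>x. -1 * g x"] smooth_on_cmult[of S g "-1"] by simp

lemma smooth_on_sum: "open S \<Longrightarrow> (\<And>a. a \<in> A \<Longrightarrow> smooth_on S (f a)) \<Longrightarrow> smooth_on S (\<lambda>x. \<Sum>a\<in>A. f a x)"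
  by (induction A rule: infinite_finite_induct) (auto intro: smooth_on_const smooth_on_add)

text \<open>The invariant is \<open>g x * inverse (f x) ^ k\<close> with smooth \<open>g\<close>: by
  the quotient rule a derivative has the same form with exponent k + 1.\<close>

lemma smooth_on_inverse:
  assumes "open S" "smooth_on S f" "\<And>x. x \<in> S \<Longrightarrow> f x \<noteq> 0"
  shows "smooth_on S (\<lambda>x. inverse (f x))"
proof (rule smooth_on_coinduct[where P = "\<lambda>h. \<exists>g k. smooth_on S g \<and> h = (\<lambda>x. g x * inverse (f x) ^ k)"])
  fix h assume "\<exists>g k. smooth_on S g \<and> h = (\<lambda>x. g x * inverse (f x) ^ k)"
  then obtain g k where g: "smooth_on S g" and h: "h = (\<lambda>x. g x * inverse (f x) ^ k)" by blast
  have pw: "has_partial (\<lambda>x. inverse (f x) ^ k) i (- of_nat k * partial i f x * inverse (f x) ^ Suc k) x"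
    if "x \<in> S" for i k x
  proof (induction k)
    case 0 then show ?case by (simp add: has_partial_const)
  next
    case (Suc k)
    have "has_partial (\<lambda>x. inverse (f x) * inverse (f x) ^ k) i (- (partial i f x * (inverse (f x) * inverse (f x))) * inverse (f x) ^ k
        + inverse (f x) * (- of_nat k * partial i f x * inverse (f x) ^ Suc k)) x"
      by (intro has_partial_mult has_partial_inverse smooth_on_has_partial[OF assms(2)] assms(3) Suc that)
    then show ?case by (simp add: algebra_simps)
  qed
  show "continuous_on S h \<and> (\<forall>i. \<exists>h'. (\<exists>g k. smooth_on S g \<and> h' = (\<lambda>x. g x * inverse (f x) ^ k)) \<and>
     (\<forall>x\<in>S. has_partial h i (h' x) x))"
  proof (intro conjI allI)
    show "continuous_on S h" unfolding h using assms(3)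
      by (intro continuous_intros smooth_on_continuous g assms) auto
    fix i
    let ?g = "\<lambda>x. partial i g x * f x - of_nat k * (g x * partial i f x)"
    have "smooth_on S ?g"
      by (intro smooth_on_diff smooth_on_mult smooth_on_cmult smooth_on_partial assms g)
    moreover have "has_partial h i (?g x * inverse (f x) ^ Suc k) x" if "x \<in> S" for x
    proof -
      have "has_partial h i (partial i g x * inverse (f x) ^ k + g x * (- of_nat k * partial i f x * inverse (f x) ^ Suc k)) x"
        unfolding h by (intro has_partial_mult pw smooth_on_has_partial[OF g] that)
      then show ?thesis using assms(3)[OF that] by (simp add: field_simps)
    qed
    ultimately show "\<exists>h'. (\<exists>g k. smooth_on S g \<and> h' = (\<lambda>x. g x * inverse (f x) ^ k)) \<and> (\<forall>x\<in>S. has_partial h i (h' x) x)"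
      by blast
  qed
next
  show "\<exists>g k. smooth_on S g \<and> (\<lambda>x. inverse (f x)) = (\<lambda>x. g x * inverse (f x) ^ k)"
    by (rule exI[of _ "\<lambda>x. 1"], rule exI[of _ 1]) (simp add: smooth_on_const assms)
qed fact

lemma smooth_on_cong:
  assumes "open S" "smooth_on S f" "\<And>x. x \<in> S \<Longrightarrow> f x = g x"
  shows "smooth_on S g"
proof (rule smooth_on_coinduct[where P = "\<lambda>h. \<exists>f. smooth_on S f \<and> (\<forall>x\<in>S. f x = h x)"])
  fix h assume "\<exists>f. smooth_on S f \<and> (\<forall>x\<in>S. f x = h x)"
  then obtain f where f: "smooth_on S f" "\<forall>x\<in>S. f x = h x" by blast
  have "has_partial h i (partial i f x) x" if "x \<in> S" for i x
    using smooth_on_has_partial[OF f(1) that] has_partial_cong[OF assms(1) that, of f h] f(2) by auto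
  moreover have "continuous_on S h" using f smooth_on_continuous continuous_on_cong by metis
  ultimately show "continuous_on S h \<and> (\<forall>i. \<exists>h'. (\<exists>f. smooth_on S f \<and> (\<forall>x\<in>S. f x = h' x)) \<and>
     (\<forall>x\<in>S. has_partial h i (h' x) x))" using f(1) smooth_on_partial by blast
qed (use assms in auto)

lemma smooth_on_union:
  assumes "smooth_on S f" "smooth_on T f" "open S" "open T"
  shows "smooth_on (S \<union> T) f"
  using assms unfolding smooth_on_def by (auto intro: continuous_on_open_Un)

text \<open>Smoothness is local: \<open>S\<close> and \<open>- K\<close> are open, cover the space,
  and \<open>f\<close> vanishes on the second.\<close>

lemma smooth_on_zero_ext:
  assumes "open S" "smooth_on S f" "closed K" "K \<subseteq> S" "\<And>x. x \<notin> K \<Longrightarrow> f x = 0"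
  shows "smooth_on UNIV f"
proof -
  have "smooth_on (- K) f"
    by (rule smooth_on_cong[of "- K" "\<lambda>x. 0"]) (use assms in \<open>auto intro: smooth_on_const\<close>)
  then have "smooth_on (S \<union> - K) f" using assms by (intro smooth_on_union) auto
  moreover have "S \<union> - K = UNIV" using assms by auto
  ultimately show ?thesis by simp
qed

lemma partial_add: "smooth_on S f \<Longrightarrow> smooth_on S g \<Longrightarrow> x \<in> S \<Longrightarrow> partial i (\<lambda>x. f x + g x) x = partial i f x + partial i g x"
  by (intro has_partial_imp has_partial_add smooth_on_has_partial)

lemma partial_mult: "smooth_on S f \<Longrightarrow> smooth_on S g \<Longrightarrow> x \<in> S \<Longrightarrow>
  partial i (\<lambda>x. f x * g x) x = partial i f x * g x + f x * partial i g x"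
  by (intro has_partial_imp has_partial_mult smooth_on_has_partial)

lemma iter_partial_const: "iter_partial L (\<lambda>x. c) = (\<lambda>x. if L = [] then c else 0)"
proof (induction L)
  case (Cons i L)
  have "partial i (\<lambda>x. d) = (\<lambda>x. 0)" for d using has_partial_const has_partial_imp by blast
  with Cons show ?case by (cases L) auto
qed auto

lemma iter_partial_add:
  assumes "open S" "smooth_on S f" "smooth_on S g" "x \<in> S"
  shows "iter_partial L (\<lambda>x. f x + g x) x = iter_partial L f x + iter_partial L g x"
  using assms(4)
proof (induction L arbitrary: x)
  case (Cons i L)
  have "partial i (iter_partial L (\<lambda>x. f x + g x)) x = partial i (\<lambda>x. iter_partial L f x + iter_partial L g x) x"
    by (rule partial_cong[OF assms(1) Cons.prems]) (use Cons in auto)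
  then show ?case using Cons.prems assms by (simp add: partial_add[of S] smooth_on_iter_partial)
qed auto

lemma iter_partial_cmult:
  assumes "open S" "smooth_on S f" "x \<in> S"
  shows "iter_partial L (\<lambda>x. c * f x) x = c * iter_partial L f x"
  using assms(3)
proof (induction L arbitrary: x)
  case (Cons i L)
  have "partial i (iter_partial L (\<lambda>x. c * f x)) x = partial i (\<lambda>x. c * iter_partial L f x) x"
    by (rule partial_cong[OF assms(1) Cons.prems]) (use Cons in auto)
  also have "\<dots> = c * partial i (iter_partial L f) x"
  proof -
    have "has_partial (\<lambda>x. c * iter_partial L f x) i (0 * iter_partial L f x + c * partial i (iter_partial L f) x) x"
      by (intro has_partial_mult has_partial_const smooth_on_iter_has_partial[OF assms(2) Cons.prems])
    then show ?thesis by (simp add: has_partial_imp)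
  qed
  finally show ?case by simp
qed auto

lemma iter_partial_sum:
  assumes "open S" "\<And>a. a \<in> A \<Longrightarrow> smooth_on S (f a)" "x \<in> S"
  shows "iter_partial L (\<lambda>x. \<Sum>a\<in>A. f a x) x = (\<Sum>a\<in>A. iter_partial L (f a) x)"
  using assms(2)
proof (induction A rule: infinite_finite_induct)
  case (insert a A)
  then have "iter_partial L (\<lambda>x. f a x + (\<Sum>a\<in>A. f a x)) x = iter_partial L (f a) x + iter_partial L (\<lambda>x. \<Sum>a\<in>A. f a x) x"
    by (intro iter_partial_add[OF assms(1)] smooth_on_sum assms(1,3)) auto
  with insert show ?case by simp
qed (auto simp: iter_partial_const)

lemma iter_partial_diff:
  assumes "open S" "smooth_on S f" "smooth_on S g" "x \<in> S"
  shows "iter_partial L (\<lambda>x. f x - g x) x = iter_partial L f x - iter_partial L g x"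
  using iter_partial_add[of S f "\<lambda>x. -1 * g x" x L] iter_partial_cmult[of S g x L "-1"] smooth_on_cmult[of S g "-1"] assms
  by simp

section \<open>Symmetry of mixed partial derivatives\<close>

lemma has_partial_line:
  assumes "has_partial f i d (x + s *\<^sub>R axis i 1)"
  shows "((\<lambda>t. f (x + t *\<^sub>R axis i 1)) has_vector_derivative d) (at s)"
proof -
  have "((\<lambda>t. f (x + s *\<^sub>R axis i 1 + t *\<^sub>R axis i 1)) \<circ> (\<lambda>t. t - s) has_vector_derivative 1 *\<^sub>R d) (at s)"
    by (rule vector_diff_chain_at)
       (use assms in \<open>auto simp: has_partial_def intro!: derivative_eq_intros\<close>)
  moreover have "(\<lambda>t. f (x + s *\<^sub>R axis i 1 + t *\<^sub>R axis i 1)) \<circ> (\<lambda>t. t - s) = (\<lambda>t. f (x + t *\<^sub>R axis i 1))"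
    by (auto simp: algebra_simps)
  ultimately show ?thesis by simp
qed

lemma line_increment_bound:
  fixes f :: "real \<Rightarrow> complex"
  assumes "0 \<le> h" "\<And>t. 0 \<le> t \<Longrightarrow> t \<le> h \<Longrightarrow> (f has_vector_derivative f' t) (at t)"
    "\<And>t. 0 \<le> t \<Longrightarrow> t \<le> h \<Longrightarrow> cmod (f' t) \<le> B"
  shows "cmod (f h - f 0) \<le> B * h"
proof -
  have "cmod (f h - f 0) \<le> B * norm (h - 0)"
  proof (rule differentiable_bound[of "{0..h}" f "\<lambda>t x. x *\<^sub>R f' t"])
    show "onorm (\<lambda>x. x *\<^sub>R f' t) \<le> B" if "t \<in> {0..h}" for t
      using assms(3)[of t] that onorm_scaleR_left[of "\<lambda>x. x" "f' t"] by (simp add: onorm_id)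
  qed (use assms in \<open>auto simp: has_vector_derivative_def intro: has_derivative_at_withinI\<close>)
  with assms show ?thesis by simp
qed

text \<open>Two applications of the mean value inequality: the second difference is an increment in
  direction i of an increment in direction j. After subtraction of the bilinear main term, the
  derivative that remains is the deviation of \<open>partial j (partial i f)\<close> from its value
  at x, which is small by continuity.\<close>

lemma second_difference_estimate:
  assumes "open S" "smooth_on S f" "x \<in> S" "\<epsilon> > 0"
  shows "\<exists>\<delta>>0. \<forall>h. 0 < h \<longrightarrow> h < \<delta> \<longrightarrow>
    cmod (f (x + h *\<^sub>R axis i 1 + h *\<^sub>R axis j 1) - f (x + h *\<^sub>R axis i 1) - f (x + h *\<^sub>R axis j 1) + f x
       - of_real (h\<^sup>2) * partial j (partial i f) x) \<le> \<epsilon> * h\<^sup>2"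
proof -
  let ?c = "partial j (partial i f) x"
  have "continuous_on S (partial j (partial i f))"
    using assms smooth_on_continuous_iter[of S f "[j,i]"] by simp
  then have "continuous (at x) (partial j (partial i f))"
    using assms continuous_on_eq_continuous_at by blast
  then obtain d0 where d0: "d0 > 0" "\<And>y. dist y x < d0 \<Longrightarrow> dist (partial j (partial i f) y) ?c < \<epsilon>"
    using assms(4) unfolding continuous_at_eps_delta by blast
  obtain d1 where d1: "d1 > 0" "ball x d1 \<subseteq> S" using assms open_contains_ball by blast
  \<comment> \<open>Half the minimum, because both coordinates move by up to \<delta>.\<close>
  define \<delta> where "\<delta> = min d0 d1 / 2"
  have pt: "x + s *\<^sub>R axis i 1 + t *\<^sub>R axis j 1 \<in> S \<and> dist (x + s *\<^sub>R axis i 1 + t *\<^sub>R axis j 1) x < d0"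
    if "0 \<le> s" "s < \<delta>" "0 \<le> t" "t < \<delta>" for s t
  proof -
    have "dist (x + s *\<^sub>R axis i 1 + t *\<^sub>R axis j 1) x = norm (s *\<^sub>R axis i (1::real) + t *\<^sub>R axis j 1)"
      by (simp add: dist_norm algebra_simps)
    also have "\<dots> \<le> s + t" using norm_triangle_ineq[of "s *\<^sub>R axis i (1::real)" "t *\<^sub>R axis j 1"] that by simp
    also have "\<dots> < min d0 d1" using that by (simp add: \<delta>_def)
    finally show ?thesis using d1 by (auto simp: dist_commute subset_iff)
  qed
  have "cmod (f (x + h *\<^sub>R axis i 1 + h *\<^sub>R axis j 1) - f (x + h *\<^sub>R axis i 1) - f (x + h *\<^sub>R axis j 1) + f x
       - of_real (h\<^sup>2) * ?c) \<le> \<epsilon> * h\<^sup>2" if h: "0 < h" "h < \<delta>" for h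
  proof -
    define \<phi>' where "\<phi>' = (\<lambda>s. partial i f (x + h *\<^sub>R axis j 1 + s *\<^sub>R axis i 1) - partial i f (x + s *\<^sub>R axis i 1) - of_real h * ?c)"
    define \<phi> where "\<phi> = (\<lambda>s. f (x + h *\<^sub>R axis j 1 + s *\<^sub>R axis i 1) - f (x + s *\<^sub>R axis i 1) - of_real s * (of_real h * ?c))"
    have der: "(\<phi> has_vector_derivative \<phi>' s) (at s)" if s: "0 \<le> s" "s \<le> h" for s
    proof -
      have a: "x + h *\<^sub>R axis j 1 + s *\<^sub>R axis i 1 \<in> S" "x + s *\<^sub>R axis i 1 \<in> S"
        using pt[of s h] pt[of s 0] s h by (auto simp: algebra_simps)
      have "((\<lambda>s. of_real s * (of_real h * ?c)) has_vector_derivative of_real h * ?c) (at s)"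
        by (auto intro!: derivative_eq_intros has_vector_derivative_real_field)
      then show ?thesis unfolding \<phi>_def \<phi>'_def
        by (intro has_vector_derivative_diff has_partial_line smooth_on_has_partial[OF assms(2)] a) auto
    qed
    have bd: "cmod (\<phi>' s) \<le> \<epsilon> * h" if s: "0 \<le> s" "s \<le> h" for s
    proof -
      define \<psi> where "\<psi> = (\<lambda>t. partial i f (x + s *\<^sub>R axis i 1 + t *\<^sub>R axis j 1) - of_real t * ?c)"
      have "cmod (\<psi> h - \<psi> 0) \<le> \<epsilon> * h"
      proof (rule line_increment_bound[where f' = "\<lambda>t. partial j (partial i f) (x + s *\<^sub>R axis i 1 + t *\<^sub>R axis j 1) - ?c"])
        fix t assume t: "0 \<le> t" "t \<le> h"
        have "((\<lambda>t. of_real t * ?c) has_vector_derivative ?c) (at t)"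
          by (auto intro!: derivative_eq_intros has_vector_derivative_real_field)
        then show "(\<psi> has_vector_derivative partial j (partial i f) (x + s *\<^sub>R axis i 1 + t *\<^sub>R axis j 1) - ?c) (at t)"
          unfolding \<psi>_def using pt[of s t] s t h
          by (intro has_vector_derivative_diff has_partial_line smooth_on_has_partial[OF smooth_on_partial[OF assms(2)]]) auto
        show "cmod (partial j (partial i f) (x + s *\<^sub>R axis i 1 + t *\<^sub>R axis j 1) - ?c) \<le> \<epsilon>"
          using d0(2)[of "x + s *\<^sub>R axis i 1 + t *\<^sub>R axis j 1"] pt[of s t] s t h unfolding dist_norm by linarith
      qed (use h in auto)
      moreover have "\<phi>' s = \<psi> h - \<psi> 0" by (simp add: \<phi>'_def \<psi>_def algebra_simps)
      ultimately show ?thesis by simp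
    qed
    have "cmod (\<phi> h - \<phi> 0) \<le> \<epsilon> * h * h"
      by (rule line_increment_bound[where f' = \<phi>']) (use der bd h in auto)
    moreover have "\<phi> h - \<phi> 0 = f (x + h *\<^sub>R axis i 1 + h *\<^sub>R axis j 1) - f (x + h *\<^sub>R axis i 1) - f (x + h *\<^sub>R axis j 1) + f x
       - of_real (h\<^sup>2) * ?c" by (simp add: \<phi>_def algebra_simps power2_eq_square)
    ultimately show ?thesis by (simp add: power2_eq_square mult.assoc)
  qed
  moreover have "\<delta> > 0" using d0 d1 by (simp add: \<delta>_def)
  ultimately show ?thesis by blast
qed

text \<open>The second difference does not change when i and j are swapped, so h^2 times either
  mixed derivative lies within \<epsilon> h^2 of it. Taking a third of the supposed gap as
  \<epsilon> gives a contradiction.\<close>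

lemma partial_commute:
  assumes "open S" "smooth_on S f" "x \<in> S"
  shows "partial i (partial j f) x = partial j (partial i f) x"
proof (rule ccontr)
  let ?a = "partial j (partial i f) x" and ?b = "partial i (partial j f) x"
  assume ne: "?b \<noteq> ?a"
  define \<epsilon> where "\<epsilon> = cmod (?a - ?b) / 3"
  have e: "\<epsilon> > 0" using ne by (simp add: \<epsilon>_def)
  obtain d1 where d1: "d1 > 0" "\<forall>h. 0 < h \<longrightarrow> h < d1 \<longrightarrow>
    cmod (f (x + h *\<^sub>R axis i 1 + h *\<^sub>R axis j 1) - f (x + h *\<^sub>R axis i 1) - f (x + h *\<^sub>R axis j 1) + f x
       - of_real (h\<^sup>2) * ?a) \<le> \<epsilon> * h\<^sup>2" using second_difference_estimate[OF assms e] by blast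
  obtain d2 where d2: "d2 > 0" "\<forall>h. 0 < h \<longrightarrow> h < d2 \<longrightarrow>
    cmod (f (x + h *\<^sub>R axis j 1 + h *\<^sub>R axis i 1) - f (x + h *\<^sub>R axis j 1) - f (x + h *\<^sub>R axis i 1) + f x
       - of_real (h\<^sup>2) * ?b) \<le> \<epsilon> * h\<^sup>2" using second_difference_estimate[OF assms e] by blast
  define h where "h = min d1 d2 / 2"
  have h: "0 < h" "h < d1" "h < d2" using d1 d2 by (auto simp: h_def)
  let ?D = "f (x + h *\<^sub>R axis i 1 + h *\<^sub>R axis j 1) - f (x + h *\<^sub>R axis i 1) - f (x + h *\<^sub>R axis j 1) + f x"
  have 1: "cmod (?D - of_real (h\<^sup>2) * ?a) \<le> \<epsilon> * h\<^sup>2" using d1 h by blast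
  have "?D = f (x + h *\<^sub>R axis j 1 + h *\<^sub>R axis i 1) - f (x + h *\<^sub>R axis j 1) - f (x + h *\<^sub>R axis i 1) + f x"
    by (simp add: algebra_simps)
  then have 2: "cmod (?D - of_real (h\<^sup>2) * ?b) \<le> \<epsilon> * h\<^sup>2" using d2(2)[rule_format, OF h(1,3)] by (simp only:)
  have "cmod (of_real (h\<^sup>2) * ?a - of_real (h\<^sup>2) * ?b) \<le> 2 * \<epsilon> * h\<^sup>2"
    using norm_triangle_ineq4[of "?D - of_real (h\<^sup>2) * ?b" "?D - of_real (h\<^sup>2) * ?a"] 1 2 by simp
  also have "of_real (h\<^sup>2) * ?a - of_real (h\<^sup>2) * ?b = of_real (h\<^sup>2) * (?a - ?b)" by (simp add: algebra_simps)
  finally have "h\<^sup>2 * cmod (?a - ?b) \<le> h\<^sup>2 * (2 * \<epsilon>)" by (simp add: norm_mult norm_power mult.commute)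
  then have "cmod (?a - ?b) \<le> 2 * \<epsilon>" using h by simp
  with e show False by (simp add: \<epsilon>_def)
qed

lemma iter_partial_remove1:
  assumes "open S" "smooth_on S f" "i \<in> set L" "x \<in> S"
  shows "iter_partial L f x = iter_partial (i # remove1 i L) f x"
  using assms(3,4)
proof (induction L arbitrary: x)
  case (Cons j L)
  show ?case
  proof (cases "i = j")
    case False
    then have i: "i \<in> set L" using Cons by auto
    have "partial j (iter_partial L f) x = partial j (partial i (iter_partial (remove1 i L) f)) x"
      by (rule partial_cong[OF assms(1) Cons.prems(2)]) (use Cons.IH[OF i] in auto)
    also have "\<dots> = partial i (partial j (iter_partial (remove1 i L) f)) x"
      by (intro partial_commute[OF assms(1)] smooth_on_iter_partial assms Cons.prems)
    finally show ?thesis using False by simp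
  qed auto
qed auto

lemma iter_partial_mset:
  assumes "open S" "smooth_on S f" "mset L = mset L'" "x \<in> S"
  shows "iter_partial L f x = iter_partial L' f x"
  using assms(3,4)
proof (induction L arbitrary: L' x)
  case (Cons i L)
  have i: "i \<in> set L'" using Cons.prems by (metis list.set_intros(1) set_mset_mset)
  have m: "mset L = mset (remove1 i L')" using Cons.prems by (metis mset_remove1 remove1.simps(2))
  have "partial i (iter_partial L f) x = partial i (iter_partial (remove1 i L') f) x"
    by (rule partial_cong[OF assms(1) Cons.prems(2)]) (use Cons.IH[OF m] in auto)
  then show ?case using iter_partial_remove1[OF assms(1,2) i Cons.prems(2)] by simp
qed auto

section \<open>Multi-indices and lists of directions\<close>

definition mlist :: "('n::finite \<Rightarrow> nat) \<Rightarrow> 'n list" where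
  "mlist \<alpha> = (SOME L. \<forall>i. count_list L i = \<alpha> i)"

lemma dpartial_mlist: "dpartial \<alpha> f = iter_partial (mlist \<alpha>) f"
  by (simp add: dpartial_def mlist_def)

lemma count_mlist: "count_list (mlist \<alpha>) i = (\<alpha> :: 'n::finite \<Rightarrow> nat) i"
proof -
  obtain L where "mset L = Abs_multiset \<alpha>" using ex_mset by blast
  moreover have "count (Abs_multiset \<alpha>) = \<alpha>" by (rule count_Abs_multiset) simp
  ultimately have "\<forall>i. count_list L i = \<alpha> i" unfolding count_mset[symmetric] by simp
  then have "\<forall>i. count_list (mlist \<alpha>) i = \<alpha> i" unfolding mlist_def by (rule someI)
  then show ?thesis by blast
qed

lemma length_mlist: "length (mlist \<alpha>) = mabs \<alpha>"
  using sum_count_set[of "mlist \<alpha>" UNIV] by (simp add: mabs_def count_mlist)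

lemma mabs_count_list: "mabs (count_list L) = length L"
  unfolding mabs_def using sum_count_set[of L UNIV] by simp

text \<open>By \<open>iter_partial_mset\<close> only multiplicities count. This transports
  hypotheses stated with multi-indices to arbitrary lists, over which the inductions on the order of
  differentiation run.\<close>

lemma iter_partial_dpartial:
  assumes "open S" "smooth_on S f" "x \<in> S"
  shows "iter_partial L f x = dpartial (count_list L) f x"
  unfolding dpartial_mlist
  by (rule iter_partial_mset[OF assms(1,2) _ assms(3)])
     (auto intro!: multiset_eqI simp only: count_mset count_mlist)

lemma finite_mabs_le: "finite {\<alpha> :: 'n::finite \<Rightarrow> nat. mabs \<alpha> \<le> m}"
proof (rule finite_subset)
  show "{\<alpha> :: 'n \<Rightarrow> nat. mabs \<alpha> \<le> m} \<subseteq> PiE UNIV (\<lambda>_. {..m})"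
  proof
    fix \<alpha> :: "'n \<Rightarrow> nat" assume "\<alpha> \<in> {\<alpha>. mabs \<alpha> \<le> m}"
    then have "\<alpha> i \<le> m" for i
      using member_le_sum[of i UNIV \<alpha>] by (simp add: mabs_def)
    then show "\<alpha> \<in> PiE UNIV (\<lambda>_. {..m})" by auto
  qed
  show "finite (PiE (UNIV :: 'n set) (\<lambda>_. {..m}))" by (intro finite_PiE) auto
qed

section \<open>Gevrey bounds\<close>

lemma iter_partial_snoc: "iter_partial (L @ [i]) f = iter_partial L (partial i f)"
  by (simp add: iter_partial_append)

text \<open>Pascal's rule, in the form that passes from order b to order b + 1 in the Leibniz
  formula when bounds depend only on the number of derivatives.\<close>

lemma binomial_shift_sum:
  fixes \<alpha> \<eta> :: "nat \<Rightarrow> real"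
  shows "(\<Sum>k\<le>b. real (b choose k) * \<alpha> (Suc k) * \<eta> (b - k)) + (\<Sum>k\<le>b. real (b choose k) * \<alpha> k * \<eta> (Suc (b - k)))
    = (\<Sum>k\<le>Suc b. real (Suc b choose k) * \<alpha> k * \<eta> (Suc b - k))"
proof -
  have "(\<Sum>k\<le>b. real (b choose k) * \<alpha> k * \<eta> (Suc (b - k))) = (\<Sum>k\<le>Suc b. real (b choose k) * \<alpha> k * \<eta> (Suc b - k))"
    by (simp add: binomial_eq_0 Suc_diff_le)
  also have "\<dots> = \<alpha> 0 * \<eta> (Suc b) + (\<Sum>k\<le>b. real (b choose Suc k) * \<alpha> (Suc k) * \<eta> (b - k))"
    by (subst sum.atMost_Suc_shift) simp
  finally show ?thesis
    by (subst sum.atMost_Suc_shift) (simp add: sum.distrib[symmetric] algebra_simps)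
qed

text \<open>The innermost derivative is peeled off, hence the reverse induction: the induction
  hypothesis then applies to the pairs \<open>partial i f\<close>, \<open>g\<close> and
  \<open>f\<close>, \<open>partial i g\<close>, with one of the two bounds shifted by a
  place.\<close>

lemma leibniz_bound:
  assumes "open S" "x \<in> S" "smooth_on S f" "smooth_on S g"
    and "\<And>K. length K \<le> length L \<Longrightarrow> cmod (iter_partial K f x) \<le> \<alpha> (length K)"
    and "\<And>K. length K \<le> length L \<Longrightarrow> cmod (iter_partial K g x) \<le> \<eta> (length K)"
  shows "cmod (iter_partial L (\<lambda>x. f x * g x) x)
    \<le> (\<Sum>k\<le>length L. real (length L choose k) * \<alpha> k * \<eta> (length L - k))"
  using assms(3-)
proof (induction L arbitrary: f g \<alpha> \<eta> rule: rev_induct)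
  case Nil
  from Nil(3)[of "[]"] Nil(4)[of "[]"] show ?case by (auto simp: norm_mult intro!: mult_mono order_trans[OF norm_ge_zero])
next
  case (snoc i L)
  let ?b = "length L"
  have sm: "smooth_on S (\<lambda>x. partial i f x * g x)" "smooth_on S (\<lambda>x. f x * partial i g x)"
    using snoc by (auto intro!: smooth_on_mult smooth_on_partial assms)
  have "iter_partial (L @ [i]) (\<lambda>x. f x * g x) x = iter_partial L (\<lambda>x. partial i f x * g x + f x * partial i g x) x"
    unfolding iter_partial_snoc
    by (rule iter_partial_cong[OF assms(1,2)]) (use snoc in \<open>auto intro: partial_mult\<close>)
  also have "\<dots> = iter_partial L (\<lambda>x. partial i f x * g x) x + iter_partial L (\<lambda>x. f x * partial i g x) x"
    by (intro iter_partial_add[OF assms(1) _ _ assms(2)] sm)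
  finally have "cmod (iter_partial (L @ [i]) (\<lambda>x. f x * g x) x)
     \<le> cmod (iter_partial L (\<lambda>x. partial i f x * g x) x) + cmod (iter_partial L (\<lambda>x. f x * partial i g x) x)"
    by (simp add: norm_triangle_ineq)
  also have "\<dots> \<le> (\<Sum>k\<le>?b. real (?b choose k) * \<alpha> (Suc k) * \<eta> (?b - k)) + (\<Sum>k\<le>?b. real (?b choose k) * \<alpha> k * \<eta> (Suc (?b - k)))"
  proof (rule add_mono)
    show "cmod (iter_partial L (\<lambda>x. partial i f x * g x) x) \<le> (\<Sum>k\<le>?b. real (?b choose k) * \<alpha> (Suc k) * \<eta> (?b - k))"
    proof (rule snoc.IH)
      show "cmod (iter_partial K (partial i f) x) \<le> \<alpha> (Suc (length K))" if "length K \<le> ?b" for K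
        using snoc.prems(3)[of "K @ [i]"] that by (simp add: iter_partial_snoc)
      show "cmod (iter_partial K g x) \<le> \<eta> (length K)" if "length K \<le> ?b" for K
        using snoc.prems(4)[of K] that by simp
    qed (use snoc in \<open>auto intro: smooth_on_partial\<close>)
    show "cmod (iter_partial L (\<lambda>x. f x * partial i g x) x) \<le> (\<Sum>k\<le>?b. real (?b choose k) * \<alpha> k * \<eta> (Suc (?b - k)))"
    proof (rule snoc.IH)
      show "cmod (iter_partial K (partial i g) x) \<le> \<eta> (Suc (length K))" if "length K \<le> ?b" for K
        using snoc.prems(4)[of "K @ [i]"] that by (simp add: iter_partial_snoc)
      show "cmod (iter_partial K f x) \<le> \<alpha> (length K)" if "length K \<le> ?b" for K
        using snoc.prems(3)[of K] that by simp
    qed (use snoc in \<open>auto intro: smooth_on_partial\<close>)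
  qed
  finally show ?case by (simp only: binomial_shift_sum length_append_singleton)
qed

text \<open>The term in which all derivatives fall on \<open>g\<close> is split off, so that
  \<open>g\<close> needs bounds only strictly below the order of \<open>L\<close>. This is what
  allows recursion on the order in \<open>gbd_inverse\<close>.\<close>

lemma leibniz_remainder_bound:
  assumes "open S" "x \<in> S" "smooth_on S f" "smooth_on S g"
    and "\<And>K. length K \<le> length L \<Longrightarrow> cmod (iter_partial K f x) \<le> \<alpha> (length K)"
    and "\<And>K. length K < length L \<Longrightarrow> cmod (iter_partial K g x) \<le> \<eta> (length K)"
  shows "cmod (iter_partial L (\<lambda>x. f x * g x) x - f x * iter_partial L g x)
    \<le> (\<Sum>k<length L. real (length L choose Suc k) * \<alpha> (Suc k) * \<eta> (length L - Suc k))"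
  using assms(3-)
proof (induction L arbitrary: f g \<alpha> \<eta> rule: rev_induct)
  case Nil
  then show ?case by simp
next
  case (snoc i L)
  let ?b = "length L"
  have sm: "smooth_on S (\<lambda>x. partial i f x * g x)" "smooth_on S (\<lambda>x. f x * partial i g x)"
    using snoc by (auto intro!: smooth_on_mult smooth_on_partial assms)
  have "iter_partial (L @ [i]) (\<lambda>x. f x * g x) x = iter_partial L (\<lambda>x. partial i f x * g x + f x * partial i g x) x"
    unfolding iter_partial_snoc
    by (rule iter_partial_cong[OF assms(1,2)]) (use snoc in \<open>auto intro: partial_mult\<close>)
  also have "\<dots> = iter_partial L (\<lambda>x. partial i f x * g x) x + iter_partial L (\<lambda>x. f x * partial i g x) x"
    by (intro iter_partial_add[OF assms(1) _ _ assms(2)] sm)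
  finally have "cmod (iter_partial (L @ [i]) (\<lambda>x. f x * g x) x - f x * iter_partial (L @ [i]) g x)
     \<le> cmod (iter_partial L (\<lambda>x. partial i f x * g x) x)
       + cmod (iter_partial L (\<lambda>x. f x * partial i g x) x - f x * iter_partial L (partial i g) x)"
    using norm_triangle_ineq[of "iter_partial L (\<lambda>x. partial i f x * g x) x"
       "iter_partial L (\<lambda>x. f x * partial i g x) x - f x * iter_partial L (partial i g) x"]
    by (simp add: iter_partial_snoc add_diff_eq)
  also have "\<dots> \<le> (\<Sum>k\<le>?b. real (?b choose k) * \<alpha> (Suc k) * \<eta> (?b - k)) + (\<Sum>k<?b. real (?b choose Suc k) * \<alpha> (Suc k) * \<eta> (Suc (?b - Suc k)))"
  proof (rule add_mono)
    show "cmod (iter_partial L (\<lambda>x. partial i f x * g x) x) \<le> (\<Sum>k\<le>?b. real (?b choose k) * \<alpha> (Suc k) * \<eta> (?b - k))"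
    proof (rule leibniz_bound[where \<alpha> = "\<lambda>k. \<alpha> (Suc k)"])
      show "cmod (iter_partial K (partial i f) x) \<le> \<alpha> (Suc (length K))" if "length K \<le> ?b" for K
        using snoc.prems(3)[of "K @ [i]"] that by (simp add: iter_partial_snoc)
      show "cmod (iter_partial K g x) \<le> \<eta> (length K)" if "length K \<le> ?b" for K
        using snoc.prems(4)[of K] that by simp
    qed (use snoc assms in \<open>auto intro: smooth_on_partial\<close>)
    show "cmod (iter_partial L (\<lambda>x. f x * partial i g x) x - f x * iter_partial L (partial i g) x)
      \<le> (\<Sum>k<?b. real (?b choose Suc k) * \<alpha> (Suc k) * \<eta> (Suc (?b - Suc k)))"
    proof (rule snoc.IH)
      show "cmod (iter_partial K (partial i g) x) \<le> \<eta> (Suc (length K))" if "length K < ?b" for K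
        using snoc.prems(4)[of "K @ [i]"] that by (simp add: iter_partial_snoc)
      show "cmod (iter_partial K f x) \<le> \<alpha> (length K)" if "length K \<le> ?b" for K
        using snoc.prems(3)[of K] that by simp
    qed (use snoc in \<open>auto intro: smooth_on_partial\<close>)
  qed
  \<comment> \<open>The added summand \<open>k = ?b\<close> carries the coefficient
    \<open>?b choose Suc ?b\<close>, which is 0.\<close>
  also have "(\<Sum>k<?b. real (?b choose Suc k) * \<alpha> (Suc k) * \<eta> (Suc (?b - Suc k)))
      = (\<Sum>k\<le>?b. real (?b choose Suc k) * \<alpha> (Suc k) * \<eta> (?b - k))"
    by (simp add: lessThan_Suc_atMost[symmetric] Suc_diff_Suc)
  also have "(\<Sum>k\<le>?b. real (?b choose k) * \<alpha> (Suc k) * \<eta> (?b - k)) + \<dots>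
     = (\<Sum>k<Suc ?b. real (Suc ?b choose Suc k) * \<alpha> (Suc k) * \<eta> (Suc ?b - Suc k))"
    unfolding lessThan_Suc_atMost sum.distrib[symmetric] by (simp add: algebra_simps)
  finally show ?case by simp
qed

text \<open>The shift l counts derivatives already spent: a partial derivative raises l by one and
  multiplies M by A, but leaves the radius A and the order s alone (\<open>gbd_partial\<close>).
  Iterated differential operators are thus tracked without loss in A.\<close>

definition gbd :: "(real^'n::finite) set \<Rightarrow> real \<Rightarrow> real \<Rightarrow> real \<Rightarrow> nat \<Rightarrow> (real^'n \<Rightarrow> complex) \<Rightarrow> bool" where
  "gbd X s M A l f \<longleftrightarrow> (\<forall>x\<in>X. \<forall>L. cmod (iter_partial L f x) \<le> M * A ^ length L * fact (length L + l) powr s)"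

lemma gbdD: "gbd X s M A l f \<Longrightarrow> x \<in> X \<Longrightarrow> cmod (iter_partial L f x) \<le> M * A ^ length L * fact (length L + l) powr s"
  by (simp add: gbd_def)

lemma gbd_nonneg:
  assumes "gbd X s M A l f" "X \<noteq> {}"
  shows "0 \<le> M"
proof -
  obtain x where "x \<in> X" using assms(2) by blast
  from gbdD[OF assms(1) this, where L = "[]"] have "cmod (f x) \<le> M * fact l powr s" by simp
  then have "0 \<le> M * fact l powr s" using norm_ge_zero order_trans by blast
  then show "0 \<le> M" by (simp add: zero_le_mult_iff not_le[symmetric])
qed

lemma gbd_mono:
  fixes X :: "(real^'n::finite) set"
  assumes "gbd X s M A l f" "0 \<le> M" "M \<le> M'" "0 \<le> A" "A \<le> A'" "l \<le> l'" "0 \<le> s"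
  shows "gbd X s M' A' l' f"
  unfolding gbd_def
proof (intro ballI allI)
  fix x and L :: "'n list" assume x: "x \<in> X"
  have "(fact (length L + l) :: real) powr s \<le> fact (length L + l') powr s"
    using assms by (intro powr_mono2) (auto intro: fact_mono)
  then have "M * A ^ length L * fact (length L + l) powr s \<le> M' * A' ^ length L * fact (length L + l') powr s"
    using assms by (intro mult_mono power_mono) auto
  with gbdD[OF assms(1) x, of L] show "cmod (iter_partial L f x) \<le> M' * A' ^ length L * fact (length L + l') powr s" by linarith
qed

lemma gbd_add:
  assumes "open S" "X \<subseteq> S" "smooth_on S f" "smooth_on S g" "gbd X s M A l f" "gbd X s M' A l g"
  shows "gbd X s (M + M') A l (\<lambda>x. f x + g x)"
  unfolding gbd_def
proof (intro ballI allI)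
  fix x L assume x: "x \<in> X"
  then have "x \<in> S" using assms by auto
  then show "cmod (iter_partial L (\<lambda>x. f x + g x) x) \<le> (M + M') * A ^ length L * fact (length L + l) powr s"
    using gbdD[OF assms(5) x, of L] gbdD[OF assms(6) x, of L]
      norm_triangle_ineq[of "iter_partial L f x" "iter_partial L g x"]
    by (simp add: iter_partial_add[OF assms(1,3,4)] algebra_simps)
qed

lemma gbd_cmult:
  assumes "open S" "X \<subseteq> S" "smooth_on S f" "gbd X s M A l f"
  shows "gbd X s (cmod c * M) A l (\<lambda>x. c * f x)"
  unfolding gbd_def
proof (intro ballI allI)
  fix x L assume x: "x \<in> X"
  then have "x \<in> S" using assms by auto
  then show "cmod (iter_partial L (\<lambda>x. c * f x) x) \<le> cmod c * M * A ^ length L * fact (length L + l) powr s"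
    using mult_left_mono[OF gbdD[OF assms(4) x, of L], of "cmod c"]
    by (simp add: iter_partial_cmult[OF assms(1,3)] norm_mult algebra_simps)
qed

lemma gbd_const: "0 \<le> A \<Longrightarrow> gbd X s (cmod c) A 0 (\<lambda>x. c)"
  by (auto simp: gbd_def iter_partial_const intro!: mult_nonneg_nonneg)

lemma gbd_zero: "0 \<le> M \<Longrightarrow> 0 \<le> A \<Longrightarrow> gbd X s M A l (\<lambda>x. 0)"
  by (auto simp: gbd_def iter_partial_const intro!: mult_nonneg_nonneg)

lemma gbd_sum:
  assumes "open S" "X \<subseteq> S" "0 \<le> A" "\<And>a. a \<in> B \<Longrightarrow> smooth_on S (f a)" "\<And>a. a \<in> B \<Longrightarrow> gbd X s (M a) A l (f a)"
  shows "gbd X s (\<Sum>a\<in>B. M a) A l (\<lambda>x. \<Sum>a\<in>B. f a x)"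
  using assms(4,5)
proof (induction B rule: infinite_finite_induct)
  case (insert a B)
  then show ?case using gbd_add[OF assms(1,2), of "f a" "\<lambda>x. \<Sum>a\<in>B. f a x" s "M a" A l "\<Sum>a\<in>B. M a"]
    by (simp add: smooth_on_sum assms)
qed (use assms in \<open>auto intro: gbd_zero\<close>)

lemma gbd_partial: "gbd X s M A l f \<Longrightarrow> gbd X s (M * A) A (Suc l) (partial i f)"
  unfolding gbd_def iter_partial_snoc[symmetric]
proof (intro ballI allI)
  fix x L assume "\<forall>x\<in>X. \<forall>L. cmod (iter_partial L f x) \<le> M * A ^ length L * fact (length L + l) powr s" "x \<in> X"
  then have "cmod (iter_partial (L @ [i]) f x) \<le> M * A ^ length (L @ [i]) * fact (length (L @ [i]) + l) powr s" by blast
  then show "cmod (iter_partial (L @ [i]) f x) \<le> M * A * A ^ length L * fact (length L + Suc l) powr s"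
    by (simp add: mult_ac)
qed

text \<open>As the binomial coefficient is at least 1 and s \<ge> 1, it may be raised to the power
  s. What remains is the s-th power of a factorial identity, with the shift l absorbed by
  monotonicity of the binomial coefficient in its upper entry.\<close>

lemma binomial_fact_powr:
  assumes "k \<le> b" "1 \<le> s"
  shows "real (b choose k) * (fact k powr s * fact (b - k + l) powr s) \<le> fact (b + l) powr s"
proof -
  have c1: "1 \<le> real (b choose k)" using assms by (simp add: Suc_le_eq zero_less_binomial_iff)
  have "real (b choose k) * (fact k powr s * fact (b - k + l) powr s) \<le> real (b choose k) powr s * (fact k powr s * fact (b - k + l) powr s)"
    using powr_mono[OF assms(2) c1] c1 by (intro mult_right_mono) auto
  also have "\<dots> = (real (b choose k) * fact k * fact (b - k + l)) powr s"
    by (simp add: powr_mult)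
  also have "\<dots> \<le> fact (b + l) powr s"
  proof (rule powr_mono2)
    have "real (b choose k) * fact k * fact (b - k + l) \<le> real ((b + l) choose k) * fact k * fact (b + l - k)"
      using assms binomial_right_mono[of b "b + l" k] by (intro mult_mono) (auto simp: fact_mono)
    also have "\<dots> = fact (b + l)"
      by (subst binomial_fact) (use assms in auto)
    finally show "real (b choose k) * fact k * fact (b - k + l) \<le> fact (b + l)" .
  qed (use assms in auto)
  finally show ?thesis .
qed

text \<open>With \<open>2 * \<rho> \<le> A\<close> the Leibniz sum is dominated by a geometric
  series of ratio 1/2. The cost is a factor 2 C that depends neither on the order nor on l, while A
  is unchanged; a radius growing at each multiplication would ruin the Neumann iteration.\<close>

lemma gbd_mult:
  fixes X :: "(real^'n::finite) set"
  assumes "open S" "X \<subseteq> S" "smooth_on S f" "smooth_on S g" "gbd X s C \<rho> 0 f" "gbd X s M A l g"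
    "1 \<le> s" "0 \<le> C" "0 \<le> \<rho>" "0 \<le> M" "2 * \<rho> \<le> A"
  shows "gbd X s (2 * C * M) A l (\<lambda>x. f x * g x)"
  unfolding gbd_def
proof (intro ballI allI)
  fix x and L :: "'n list" assume x: "x \<in> X"
  then have xS: "x \<in> S" using assms by auto
  let ?b = "length L"
  have "cmod (iter_partial L (\<lambda>x. f x * g x) x)
    \<le> (\<Sum>k\<le>?b. real (?b choose k) * (C * \<rho> ^ k * fact k powr s) * (M * A ^ (?b - k) * fact (?b - k + l) powr s))"
    by (rule leibniz_bound[OF assms(1) xS assms(3,4)])
       (use gbdD[OF assms(5) x] gbdD[OF assms(6) x] in auto)
  also have "\<dots> \<le> (\<Sum>k\<le>?b. (C * M * A ^ ?b * fact (?b + l) powr s) * (1/2) ^ k)"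
  proof (rule sum_mono)
    fix k assume k: "k \<in> {..?b}"
    have "\<rho> ^ k * A ^ (?b - k) \<le> (A / 2) ^ k * A ^ (?b - k)"
      using assms by (intro mult_right_mono power_mono) auto
    also have "\<dots> = A ^ ?b * (1/2) ^ k" using k by (simp add: power_divide flip: power_add)
    finally have 1: "\<rho> ^ k * A ^ (?b - k) \<le> A ^ ?b * (1/2) ^ k" .
    have "real (?b choose k) * (C * \<rho> ^ k * fact k powr s) * (M * A ^ (?b - k) * fact (?b - k + l) powr s)
      = (C * M) * ((\<rho> ^ k * A ^ (?b - k)) * (real (?b choose k) * (fact k powr s * fact (?b - k + l) powr s)))"
      by (simp add: mult_ac)
    also have "\<dots> \<le> (C * M) * ((A ^ ?b * (1/2) ^ k) * fact (?b + l) powr s)"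
      by (intro mult_left_mono mult_mono[OF 1] binomial_fact_powr) (use k assms in auto)
    finally show "real (?b choose k) * (C * \<rho> ^ k * fact k powr s) * (M * A ^ (?b - k) * fact (?b - k + l) powr s)
      \<le> (C * M * A ^ ?b * fact (?b + l) powr s) * (1/2) ^ k" by (simp add: mult_ac)
  qed
  also have "\<dots> = (C * M * A ^ ?b * fact (?b + l) powr s) * (\<Sum>k\<le>?b. (1/2) ^ k)"
    by (simp only: sum_distrib_left)
  also have "\<dots> \<le> (C * M * A ^ ?b * fact (?b + l) powr s) * 2"
  proof (rule mult_left_mono)
    have "(\<Sum>k\<le>b. (1/2::real) ^ k) = 2 - (1/2) ^ b" for b by (induction b) auto
    then show "(\<Sum>k\<le>?b. (1/2::real) ^ k) \<le> 2" by simp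
  qed (use assms in auto)
  finally show "cmod (iter_partial L (\<lambda>x. f x * g x) x) \<le> 2 * C * M * A ^ ?b * fact (?b + l) powr s"
    by (simp add: mult_ac)
qed

text \<open>Leibniz for p q = 1 expresses a derivative of q through those of lower order. The radius
  A satisfies A - \<rho> = C \<rho> / c, so the resulting sum is A - \<rho> times a sum of mixed
  powers, that is A ^ b - \<rho> ^ b, and the induction closes with no further constant.\<close>

lemma gbd_inverse:
  assumes "open S" "X \<subseteq> S" "smooth_on S p" "\<And>x. x \<in> S \<Longrightarrow> p x \<noteq> 0" "\<And>x. x \<in> X \<Longrightarrow> c \<le> cmod (p x)"
    "gbd X s C \<rho> 0 p" "0 < c" "1 \<le> s" "0 \<le> C" "0 \<le> \<rho>"
  shows "gbd X s (1 / c) (\<rho> * (1 + C / c)) 0 (\<lambda>x. inverse (p x))"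
  unfolding gbd_def
proof (intro ballI allI)
  fix x L assume x: "x \<in> X"
  then have xS: "x \<in> S" using assms by auto
  define A where "A = \<rho> * (1 + C / c)"
  define q where "q = (\<lambda>x. inverse (p x))"
  have A0: "0 \<le> A" using assms by (simp add: A_def)
  have smq: "smooth_on S q" unfolding q_def by (intro smooth_on_inverse assms)
  have "cmod (iter_partial L q x) \<le> 1 / c * A ^ length L * fact (length L) powr s"
  proof (induction L rule: length_induct)
    case (1 L)
    let ?b = "length L"
    show ?case
    proof (cases "L = []")
      case True
      then show ?thesis using assms(5)[OF x] \<open>0 < c\<close>
        by (simp add: q_def norm_divide inverse_eq_divide frac_le)
    next
      case False
      have "iter_partial L (\<lambda>x. p x * q x) x = iter_partial L (\<lambda>x. 1) x"
        by (rule iter_partial_cong[OF assms(1) xS]) (use assms in \<open>auto simp: q_def\<close>)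
      also have "\<dots> = 0" using False by (simp add: iter_partial_const)
      finally have z: "iter_partial L (\<lambda>x. p x * q x) x = 0" .
      have "c * cmod (iter_partial L q x) \<le> cmod (p x * iter_partial L q x)"
        using assms(5)[OF x] by (simp add: norm_mult mult_right_mono)
      also have "\<dots> = cmod (iter_partial L (\<lambda>x. p x * q x) x - p x * iter_partial L q x)" by (simp add: z)
      also have "\<dots> \<le> (\<Sum>k<?b. real (?b choose Suc k) * (C * \<rho> ^ Suc k * fact (Suc k) powr s)
           * (1 / c * A ^ (?b - Suc k) * fact (?b - Suc k) powr s))"
      proof (rule leibniz_remainder_bound[OF assms(1) xS assms(3) smq])
        show "cmod (iter_partial K p x) \<le> C * \<rho> ^ length K * fact (length K) powr s" for K
          using gbdD[OF assms(6) x, of K] by simp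
      qed (use 1 in auto)
      also have "\<dots> \<le> (\<Sum>k<?b. fact ?b powr s * (C * \<rho> / c) * (A ^ (?b - Suc k) * \<rho> ^ k))"
      proof (rule sum_mono)
        fix k assume k: "k \<in> {..<?b}"
        have "real (?b choose Suc k) * (C * \<rho> ^ Suc k * fact (Suc k) powr s) * (1 / c * A ^ (?b - Suc k) * fact (?b - Suc k) powr s)
          = (real (?b choose Suc k) * (fact (Suc k) powr s * fact (?b - Suc k + 0) powr s)) * ((C * \<rho> / c) * (A ^ (?b - Suc k) * \<rho> ^ k))"
          by (simp add: mult_ac)
        also have "\<dots> \<le> fact (?b + 0) powr s * ((C * \<rho> / c) * (A ^ (?b - Suc k) * \<rho> ^ k))"
          using k assms A0 by (intro mult_right_mono binomial_fact_powr) auto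
        finally show "real (?b choose Suc k) * (C * \<rho> ^ Suc k * fact (Suc k) powr s) * (1 / c * A ^ (?b - Suc k) * fact (?b - Suc k) powr s)
          \<le> fact ?b powr s * (C * \<rho> / c) * (A ^ (?b - Suc k) * \<rho> ^ k)" by (simp add: mult_ac)
      qed
      also have "\<dots> = fact ?b powr s * ((A - \<rho>) * (\<Sum>k<?b. A ^ (?b - Suc k) * \<rho> ^ k))"
        using assms by (simp add: sum_distrib_left A_def algebra_simps)
      also have "(A - \<rho>) * (\<Sum>k<?b. A ^ (?b - Suc k) * \<rho> ^ k) = A ^ ?b - \<rho> ^ ?b"
        using power_diff_sumr2[of \<rho> ?b A] by (simp add: algebra_simps)
      also have "fact ?b powr s * (A ^ ?b - \<rho> ^ ?b) \<le> fact ?b powr s * A ^ ?b"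
        using assms by (intro mult_left_mono) auto
      finally show ?thesis using \<open>0 < c\<close> by (simp add: field_simps)
    qed
  qed
  then show "cmod (iter_partial L (\<lambda>x. inverse (p x)) x) \<le> 1 / c * (\<rho> * (1 + C / c)) ^ length L * fact (length L + 0) powr s"
    by (simp add: q_def A_def)
qed

definition gevrey_global :: "(real^'n::finite \<Rightarrow> complex) \<Rightarrow> bool" where
  "gevrey_global f \<longleftrightarrow> smooth_on UNIV f \<and> (\<forall>s>1. \<exists>C\<ge>0. \<exists>\<rho>\<ge>1. gbd UNIV s C \<rho> 0 f)"

lemma gevrey_global_smooth: "gevrey_global f \<Longrightarrow> smooth_on UNIV f"
  by (simp add: gevrey_global_def)

lemma gevrey_globalE:
  assumes "gevrey_global f" "s > 1"
  obtains C \<rho> where "C \<ge> 0" "\<rho> \<ge> 1" "gbd UNIV s C \<rho> 0 f"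
  using assms by (auto simp: gevrey_global_def)

lemma gevrey_global_const: "gevrey_global (\<lambda>x. c)"
  unfolding gevrey_global_def
proof (intro conjI allI impI)
  show "\<exists>C\<ge>0. \<exists>\<rho>\<ge>1. gbd UNIV s C \<rho> 0 (\<lambda>x. c)" for s
    using gbd_const[of 1 UNIV s c] by (intro exI[of _ "cmod c"] exI[of _ "1::real"] conjI) auto
qed (simp add: smooth_on_const)

lemma gevrey_global_add:
  assumes "gevrey_global f" "gevrey_global g" shows "gevrey_global (\<lambda>x. f x + g x)"
  unfolding gevrey_global_def
proof (intro conjI allI impI)
  show "smooth_on UNIV (\<lambda>x. f x + g x)" using assms by (intro smooth_on_add gevrey_global_smooth) auto
  fix s :: real assume s: "s > 1"
  obtain C \<rho> where 1: "C \<ge> 0" "\<rho> \<ge> 1" "gbd UNIV s C \<rho> 0 f" using gevrey_globalE[OF assms(1) s] .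
  obtain C' \<rho>' where 2: "C' \<ge> 0" "\<rho>' \<ge> 1" "gbd UNIV s C' \<rho>' 0 g" using gevrey_globalE[OF assms(2) s] .
  have "gbd UNIV s (C + C') (max \<rho> \<rho>') 0 (\<lambda>x. f x + g x)"
    using 1 2 s assms by (intro gbd_add[where S = UNIV] gbd_mono[OF 1(3)] gbd_mono[OF 2(3)] gevrey_global_smooth) auto
  with 1 2 show "\<exists>C\<ge>0. \<exists>\<rho>\<ge>1. gbd UNIV s C \<rho> 0 (\<lambda>x. f x + g x)"
    by (intro exI[of _ "C + C'"] exI[of _ "max \<rho> \<rho>'"] conjI) auto
qed

lemma gevrey_global_mult:
  assumes "gevrey_global f" "gevrey_global g" shows "gevrey_global (\<lambda>x. f x * g x)"
  unfolding gevrey_global_def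
proof (intro conjI allI impI)
  show "smooth_on UNIV (\<lambda>x. f x * g x)" using assms by (intro smooth_on_mult gevrey_global_smooth) auto
  fix s :: real assume s: "s > 1"
  obtain C \<rho> where 1: "C \<ge> 0" "\<rho> \<ge> 1" "gbd UNIV s C \<rho> 0 f" using gevrey_globalE[OF assms(1) s] .
  obtain C' \<rho>' where 2: "C' \<ge> 0" "\<rho>' \<ge> 1" "gbd UNIV s C' \<rho>' 0 g" using gevrey_globalE[OF assms(2) s] .
  have "gbd UNIV s (2 * C * C') (max (2 * \<rho>) \<rho>') 0 (\<lambda>x. f x * g x)"
    using 1 2 s assms by (intro gbd_mult[where S = UNIV, OF _ _ _ _ 1(3)] gbd_mono[OF 2(3)] gevrey_global_smooth) auto
  with 1 2 show "\<exists>C\<ge>0. \<exists>\<rho>\<ge>1. gbd UNIV s C \<rho> 0 (\<lambda>x. f x * g x)"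
    by (intro exI[of _ "2 * C * C'"] exI[of _ "max (2 * \<rho>) \<rho>'"] conjI) auto
qed

lemma gevrey_global_prod: "(\<And>a. a \<in> A \<Longrightarrow> gevrey_global (f a)) \<Longrightarrow> gevrey_global (\<lambda>x. \<Prod>a\<in>A. f a x)"
  by (induction A rule: infinite_finite_induct) (auto intro: gevrey_global_const gevrey_global_mult)

lemma gevrey_global_inverse:
  assumes "gevrey_global f" "0 < c" "\<And>x. c \<le> cmod (f x)" shows "gevrey_global (\<lambda>x. inverse (f x))"
  unfolding gevrey_global_def
proof (intro conjI allI impI)
  have nz: "f x \<noteq> 0" for x using assms(2) assms(3)[of x] by auto
  show "smooth_on UNIV (\<lambda>x. inverse (f x))" using assms nz by (intro smooth_on_inverse gevrey_global_smooth) auto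
  fix s :: real assume s: "s > 1"
  obtain C \<rho> where 1: "C \<ge> 0" "\<rho> \<ge> 1" "gbd UNIV s C \<rho> 0 f" using gevrey_globalE[OF assms(1) s] .
  have "gbd UNIV s (1 / c) (\<rho> * (1 + C / c)) 0 (\<lambda>x. inverse (f x))"
    using 1 s assms nz by (intro gbd_inverse[where S = UNIV]) (auto intro: gevrey_global_smooth)
  moreover have "1 \<le> \<rho> * (1 + C / c)" using 1 assms mult_mono[of 1 \<rho> 1 "1 + C / c"] by simp
  ultimately show "\<exists>C\<ge>0. \<exists>\<rho>\<ge>1. gbd UNIV s C \<rho> 0 (\<lambda>x. inverse (f x))" using assms(2)
    by (intro exI[of _ "1 / c"] exI[of _ "\<rho> * (1 + C / c)"] conjI) auto
qed

section \<open>Gevrey cutoff functions\<close>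

text \<open>The usual exp (- t ^ (- a)) is Gevrey only for s \<ge> 1 + 1 / a. The double exponential
  decays so fast at 0 that every s > 1 is reached. The complex variable is there for Cauchy's
  estimates.\<close>

definition flatc :: "complex \<Rightarrow> complex" where "flatc z = exp (- exp (1 / z))"

text \<open>Meant as the k-th derivative of \<open>flat 0\<close>; \<open>flat_deriv\<close>
  confirms this, also at the gluing point 0.\<close>

definition flat :: "nat \<Rightarrow> real \<Rightarrow> real" where
  "flat k t = (if 0 < t then Re ((deriv ^^ k) flatc (of_real t)) else 0)"

lemma flatc_holomorphic: "flatc holomorphic_on {z. 0 < Re z}"
  unfolding flatc_def by (intro holomorphic_intros) auto

text \<open>The radius equals t^2 / (4 (1 + t)^2), which keeps 1 / z within 1/2 of 1 / t. So Im (1 /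
  z) is too small to rotate exp (1 / z) far, and Re (exp (1 / z)) retains at least 7/16 of exp (1 /
  t). This exceeds exp (1 + 1 / t) / 8 because e \<le> 3.\<close>

lemma flatc_bound:
  fixes t :: real and z :: complex
  assumes "0 < t" "cmod (z - of_real t) \<le> 1 / (4 * (1 + 1 / t)\<^sup>2)"
  shows "0 < Re z" "cmod (flatc z) \<le> exp (- (exp (1 + 1 / t) / 8))"
proof -
  define r where "r = 1 / (4 * (1 + 1 / t)\<^sup>2)"
  have r: "r = t\<^sup>2 / (4 * (1 + t)\<^sup>2)" using assms(1) by (simp add: r_def field_simps power2_eq_square)
  have r1: "r \<le> t\<^sup>2 / 4" unfolding r using assms(1) by (intro divide_left_mono) auto
  have "t * 4 \<le> 4 * (1 + t)\<^sup>2" using assms(1) by (simp add: power2_eq_square algebra_simps)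
  then have "t * (t * 4) \<le> t * (4 * (1 + t)\<^sup>2)" using assms(1) by (intro mult_left_mono) auto
  then have r2: "r \<le> t / 4" unfolding r using assms(1) by (simp add: divide_le_eq power2_eq_square mult_ac)
  have zr: "cmod (z - of_real t) \<le> r" using assms by (simp add: r_def)
  have "\<bar>Re z - t\<bar> \<le> r" using abs_Re_le_cmod[of "z - of_real t"] zr by simp
  then have Rez: "Re z \<ge> t / 2" using r2 assms(1) by linarith
  then show pos: "0 < Re z" using assms(1) by linarith
  then have z0: "z \<noteq> 0" by auto
  have "cmod z \<ge> t / 2" using Rez complex_Re_le_cmod order_trans by blast
  then have den: "t * cmod z \<ge> t * (t / 2)" using assms(1) by (intro mult_left_mono) auto
  have "1 / z - 1 / of_real t = (of_real t - z) / (of_real t * z)"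
    using z0 assms(1) by (simp add: field_simps)
  then have "cmod (1 / z - 1 / of_real t) = cmod (z - of_real t) / (t * cmod z)"
    using assms(1) by (simp add: norm_divide norm_mult norm_minus_commute)
  also have "\<dots> \<le> (t\<^sup>2 / 4) / (t * (t / 2))"
    using den zr r1 assms(1) by (intro frac_le) auto
  also have "\<dots> = 1 / 2" using assms(1) by (simp add: power2_eq_square)
  finally have d: "cmod (1 / z - 1 / of_real t) \<le> 1 / 2" .
  have re: "Re (1 / z) \<ge> 1 / t - 1 / 2"
    using abs_Re_le_cmod[of "1 / z - 1 / of_real t"] d by simp
  have im: "\<bar>Im (1 / z)\<bar> \<le> 1 / 2"
    using abs_Im_le_cmod[of "1 / z - 1 / of_real t"] d by simp
  have "cos x \<ge> 1 - x\<^sup>2 / 2" for x :: real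
    using power_mono[OF abs_sin_x_le_abs_x[of "x / 2"], of 2] cos_double_sin[of "x / 2"]
    by (simp add: power2_eq_square)
  moreover have "(Im (1 / z))\<^sup>2 \<le> (1 / 2)\<^sup>2" using power_mono[OF im, of 2] by simp
  ultimately have c: "cos (Im (1 / z)) \<ge> 7 / 8"
    using \<open>\<And>x::real. 1 - x\<^sup>2 / 2 \<le> cos x\<close>[of "Im (1 / z)"] unfolding power_one_over power2_eq_square by linarith
  have e3: "exp (1::real) \<le> 3" by (rule exp_le)
  have "exp (1/2::real) * exp (1/2) = exp 1" by (simp flip: exp_add)
  then have "exp (1/2::real) \<le> 2"
    using e3 mult_strict_mono[of 2 "exp (1/2::real)" 2 "exp (1/2::real)"] by (cases "exp (1/2::real) \<le> 2") auto
  then have e2: "exp (- (1/2::real)) \<ge> 1 / 2" by (simp add: exp_minus field_simps)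
  have "exp (1 + 1 / t) / 8 \<le> exp (1 / t) * (1 / 2) * (7 / 8)"
    using e3 by (simp add: exp_add)
  also have "\<dots> \<le> exp (1 / t) * exp (- (1 / 2)) * cos (Im (1 / z))"
    using e2 c by (intro mult_mono) auto
  also have "\<dots> \<le> exp (Re (1 / z)) * cos (Im (1 / z))"
    using re c by (intro mult_right_mono) (auto simp flip: exp_add)
  also have "\<dots> = Re (exp (1 / z))" by (simp add: Re_exp)
  finally show "cmod (flatc z) \<le> exp (- (exp (1 + 1 / t) / 8))"
    by (simp add: flatc_def)
qed

lemma flat_cauchy:
  assumes "0 < t"
  shows "\<bar>flat k t\<bar> \<le> fact k * (4 * (1 + 1 / t)\<^sup>2) ^ k * exp (- (exp (1 + 1 / t) / 8))"
proof -
  let ?r = "1 / (4 * (1 + 1 / t)\<^sup>2)"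
  have p: "0 < 1 + 1 / t" using assms by (simp add: add_pos_pos)
  have sub: "cball (of_real t) ?r \<subseteq> {z. 0 < Re z}"
    using flatc_bound(1)[OF assms] by (auto simp: dist_norm norm_minus_commute)
  have "cmod ((deriv ^^ k) flatc (of_real t)) \<le> fact k * exp (- (exp (1 + 1 / t) / 8)) / ?r ^ k"
  proof (rule Cauchy_inequality)
    show "flatc holomorphic_on ball (of_real t) ?r"
      using flatc_holomorphic sub ball_subset_cball by (meson holomorphic_on_subset subset_trans)
    show "continuous_on (cball (of_real t) ?r) flatc"
      using flatc_holomorphic sub holomorphic_on_subset holomorphic_on_imp_continuous_on by blast
    show "0 < ?r" using p by simp
    show "cmod (flatc z) \<le> exp (- (exp (1 + 1 / t) / 8))" if "cmod (of_real t - z) = ?r" for z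
      using flatc_bound(2)[OF assms, of z] that by (simp add: norm_minus_commute)
  qed
  also have "\<dots> = fact k * (4 * (1 + 1 / t)\<^sup>2) ^ k * exp (- (exp (1 + 1 / t) / 8))"
    using p by (simp add: power_one_over field_simps)
  finally show ?thesis using assms abs_Re_le_cmod[of "(deriv ^^ k) flatc (of_real t)"] unfolding flat_def by simp
qed

text \<open>With w = exp Y / 8, the power Y ^ (2 p) is at most a constant times w, and w ^ k \<le>
  k! exp w. Taking the p-th root turns k! into k! ^ (1 / p), so the excess over analytic growth
  becomes as small as desired.\<close>

lemma double_exp_decay:
  assumes "(1::real) \<le> Y" "1 \<le> p"
  shows "Y ^ (2 * k) * exp (- (exp Y / 8)) \<le> (8 * fact (2 * p)) ^ k * fact k powr (1 / real p)"
proof -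
  define w where "w = exp Y / 8"
  \<comment> \<open>Only the part exp (- w / p) of the decay is kept, so that the p-th power
    contains exactly exp (- w).\<close>
  define X where "X = Y ^ (2 * k) * exp (- (w / real p))"
  have w0: "w > 0" by (simp add: w_def)
  have X0: "X \<ge> 0" using assms by (simp add: X_def)
  have fp: "Z ^ n / fact n \<le> exp Z" if "0 \<le> Z" for Z :: real and n
    using sum_le_suminf[OF summable_exp_generic[of Z], of "{n}"] that
    by (simp add: exp_def divide_inverse mult.commute)
  have "Y ^ (2 * p) \<le> 8 * fact (2 * p) * w"
    using fp[of Y "2 * p"] assms by (simp add: w_def field_simps)
  then have "(Y ^ (2 * p)) ^ k \<le> (8 * fact (2 * p) * w) ^ k"
    using assms by (intro power_mono) auto
  also have "\<dots> \<le> (8 * fact (2 * p)) ^ k * (fact k * exp w)"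
    using fp[of w k] w0 by (simp add: power_mult_distrib field_simps)
  finally have "(Y ^ (2 * p)) ^ k * exp (- w) \<le> (8 * fact (2 * p)) ^ k * fact k"
    by (simp add: exp_minus field_simps)
  moreover have "X ^ p = (Y ^ (2 * p)) ^ k * exp (- w)"
    using assms by (simp add: X_def power_mult_distrib exp_of_nat_mult[symmetric] mult_ac flip: power_mult)
  ultimately have "X ^ p \<le> (8 * fact (2 * p)) ^ k * fact k" by simp
  then have "(X ^ p) powr (1 / real p) \<le> ((8 * fact (2 * p)) ^ k * fact k) powr (1 / real p)"
    using X0 by (intro powr_mono2) auto
  also have "(X ^ p) powr (1 / real p) = X"
    using X0 assms by (cases "X = 0") (auto simp: powr_powr simp flip: powr_realpow)
  also have "((8 * fact (2 * p)) ^ k * fact k) powr (1 / real p) = ((8 * fact (2 * p)) ^ k) powr (1 / real p) * fact k powr (1 / real p)"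
    by (simp add: powr_mult)
  also have "\<dots> \<le> ((8 * fact (2 * p)) ^ k) powr 1 * fact k powr (1 / real p)"
  proof (intro mult_right_mono powr_mono)
    have "1 \<le> 8 * (fact (2 * p) :: real)" using fact_ge_1[of "2 * p", where 'a = real] by linarith
    then show "1 \<le> (8 * (fact (2 * p)) :: real) ^ k" by (rule one_le_power)
  qed (use assms in auto)
  finally have 1: "X \<le> (8 * fact (2 * p)) ^ k * fact k powr (1 / real p)" by simp
  have "w / real p \<le> w" using w0 assms by (simp add: field_simps)
  then have "Y ^ (2 * k) * exp (- w) \<le> X" unfolding X_def using assms by (intro mult_left_mono) auto
  with 1 show ?thesis by (simp add: w_def)
qed

lemma flat_gevrey:
  assumes "s > 1"
  shows "\<exists>\<rho>\<ge>1. \<forall>k t. \<bar>flat k t\<bar> \<le> \<rho> ^ k * fact k powr s"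
proof -
  obtain p0 where p0: "1 / (s - 1) < real p0" using reals_Archimedean2 by blast
  \<comment> \<open>Cauchy's estimate contributes k! and \<open>double_exp_decay\<close> contributes
    k! ^ (1 / p); together they are of order s once 1 / p \<le> s - 1.\<close>
  define p where "p = Suc p0"
  have p: "1 \<le> p" "1 / real p \<le> s - 1"
    using p0 assms by (auto simp: p_def field_simps intro: order_trans[of _ "s * real p0"])
  define \<rho> where "\<rho> = 4 * (8 * fact (2 * p) :: real)"
  have rho: "\<rho> \<ge> 1" using fact_ge_1[of "2 * p", where 'a = real] unfolding \<rho>_def by linarith
  have "\<bar>flat k t\<bar> \<le> \<rho> ^ k * fact k powr s" for k t
  proof (cases "0 < t")
    case True
    define Y where "Y = 1 + 1 / t"
    have Y: "1 \<le> Y" using True by (simp add: Y_def)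
    have "\<bar>flat k t\<bar> \<le> fact k * (4 * Y\<^sup>2) ^ k * exp (- (exp Y / 8))"
      using flat_cauchy[OF True, of k] by (simp add: Y_def)
    also have "\<dots> = fact k * 4 ^ k * (Y ^ (2 * k) * exp (- (exp Y / 8)))"
      by (simp add: power_mult_distrib power_mult)
    also have "\<dots> \<le> fact k * 4 ^ k * ((8 * fact (2 * p)) ^ k * fact k powr (1 / real p))"
      by (intro mult_left_mono double_exp_decay Y p) auto
    also have "\<dots> = \<rho> ^ k * (fact k powr 1 * fact k powr (1 / real p))"
      unfolding \<rho>_def power_mult_distrib by simp
    also have "\<dots> = \<rho> ^ k * fact k powr (1 + 1 / real p)" by (simp only: powr_add)
    also have "\<dots> \<le> \<rho> ^ k * fact k powr s"
      using p rho by (intro mult_left_mono powr_mono) auto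
    finally show ?thesis .
  qed (use rho in \<open>auto simp: flat_def\<close>)
  with rho show ?thesis by blast
qed

text \<open>Quadratic vanishing at 0 makes the difference quotient there tend to 0 in
  \<open>flat_deriv\<close>. With Y = 1 + 1 / t the factor Y^2 t^2 is at least 1; inserting it
  produces t^2 and one more power of Y^2, which \<open>double_exp_decay\<close> absorbs.\<close>

lemma flat_quadratic: "\<exists>C. \<forall>t. \<bar>flat k t\<bar> \<le> C * t\<^sup>2"
proof -
  define C where "C = fact k * 4 ^ k * ((8 * fact (2 * 1)) ^ Suc k * fact (Suc k) powr (1 / real 1))"
  have "\<bar>flat k t\<bar> \<le> C * t\<^sup>2" for t
  proof (cases "0 < t")
    case True
    define Y where "Y = 1 + 1 / t"
    have Y: "1 \<le> Y" using True by (simp add: Y_def)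
    have Yt: "Y * t \<ge> 1" using True by (simp add: Y_def field_simps)
    then have Yt2: "1 \<le> Y\<^sup>2 * t\<^sup>2" using power_mono[of 1 "Y * t" 2] by (simp add: power_mult_distrib)
    have "\<bar>flat k t\<bar> \<le> fact k * (4 * Y\<^sup>2) ^ k * exp (- (exp Y / 8))"
      using flat_cauchy[OF True, of k] by (simp add: Y_def)
    also have "\<dots> = fact k * 4 ^ k * (Y ^ (2 * k) * exp (- (exp Y / 8))) * 1"
      by (simp add: power_mult_distrib power_mult)
    also have "\<dots> \<le> fact k * 4 ^ k * (Y ^ (2 * k) * exp (- (exp Y / 8))) * (Y\<^sup>2 * t\<^sup>2)"
      using Yt2 Y by (intro mult_left_mono) auto
    also have "\<dots> = fact k * 4 ^ k * (Y ^ (2 * Suc k) * exp (- (exp Y / 8))) * t\<^sup>2"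
      by (simp add: power2_eq_square)
    also have "\<dots> \<le> C * t\<^sup>2"
      unfolding C_def by (intro mult_left_mono mult_right_mono double_exp_decay Y) auto
    finally show ?thesis .
  qed (auto simp: flat_def C_def)
  then show ?thesis by blast
qed

lemma flat_deriv: "(flat k has_real_derivative flat (Suc k) t) (at t)"
proof -
  consider "0 < t" | "t < 0" | "t = 0" by linarith
  then show ?thesis
  proof cases
    case 1
    have op: "open {z. 0 < Re z}" by (simp add: open_halfspace_Re_gt)
    have "((deriv ^^ k) flatc has_field_derivative (deriv ^^ Suc k) flatc (of_real t)) (at (of_real t))"
      using has_field_derivative_higher_deriv[OF flatc_holomorphic op] 1 by simp
    then have "((\<lambda>t. (deriv ^^ k) flatc (of_real t)) has_vector_derivative (deriv ^^ Suc k) flatc (of_real t)) (at t)"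
      by (rule has_vector_derivative_real_field)
    then have "((\<lambda>t. Re ((deriv ^^ k) flatc (of_real t))) has_vector_derivative Re ((deriv ^^ Suc k) flatc (of_real t))) (at t)"
      by (rule bounded_linear.has_vector_derivative[OF bounded_linear_Re])
    then have "((\<lambda>t. Re ((deriv ^^ k) flatc (of_real t))) has_real_derivative flat (Suc k) t) (at t)"
      using 1 by (simp add: has_real_derivative_iff_has_vector_derivative flat_def)
    then show ?thesis
      by (rule has_field_derivative_transform_within_open[of _ _ _ "{0<..}"]) (use 1 in \<open>auto simp: flat_def\<close>)
  next
    case 2
    have "((\<lambda>t. 0) has_real_derivative 0) (at t)" by simp
    then have "(flat k has_real_derivative 0) (at t)"
      by (rule has_field_derivative_transform_within_open[of _ _ _ "{..<0}"]) (use 2 in \<open>auto simp: flat_def\<close>)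
    then show ?thesis using 2 by (simp add: flat_def)
  next
    case 3
    obtain C where C: "\<And>t. \<bar>flat k t\<bar> \<le> C * t\<^sup>2" using flat_quadratic by blast
    have "((\<lambda>h. flat k h / h) \<longlongrightarrow> 0) (at 0)"
    proof (rule Lim_null_comparison)
      have "norm (flat k h / h) \<le> C * \<bar>h\<bar>" if "h \<noteq> 0" for h
      proof -
        have "\<bar>flat k h\<bar> / \<bar>h\<bar> \<le> C * h\<^sup>2 / \<bar>h\<bar>" using C by (intro divide_right_mono) auto
        also have "h\<^sup>2 = \<bar>h\<bar> * \<bar>h\<bar>" by (simp add: power2_eq_square)
        also have "C * (\<bar>h\<bar> * \<bar>h\<bar>) / \<bar>h\<bar> = C * \<bar>h\<bar>" using that by (simp del: abs_mult_self_eq)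
        finally show ?thesis by simp
      qed
      then show "\<forall>\<^sub>F h in at 0. norm (flat k h / h) \<le> C * \<bar>h\<bar>" by (auto simp: eventually_at_filter)
      have "((\<lambda>h. C * \<bar>h\<bar>) \<longlongrightarrow> C * \<bar>0\<bar>) (at 0)" by (intro tendsto_intros)
      then show "((\<lambda>h. C * \<bar>h\<bar>) \<longlongrightarrow> 0) (at 0)" by simp
    qed
    moreover have "flat j 0 = 0" for j by (simp add: flat_def)
    ultimately show ?thesis unfolding 3 DERIV_def by (simp only: add_0 diff_zero)
  qed
qed

section \<open>Cutoff functions in several variables\<close>

lemma flat_0_eq: "flat 0 t = (if 0 < t then exp (- exp (1 / t)) else 0)"
proof -
  have "flatc (of_real t) = of_real (exp (- exp (1 / t)))"
    unfolding flatc_def by (simp add: exp_of_real[symmetric])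
  then show ?thesis by (simp add: flat_def)
qed

lemma flat_0_mono: "t \<le> t' \<Longrightarrow> flat 0 t \<le> flat 0 t'"
  by (auto simp: flat_0_eq intro!: divide_left_mono)

lemma flat_0_nonneg: "0 \<le> flat 0 t" by (simp add: flat_0_eq)

text \<open>The index k is carried along so that partial derivatives of ridges are multiples of
  ridges and the one-variable bounds apply.\<close>

definition ridge :: "'n::finite \<Rightarrow> real \<Rightarrow> real \<Rightarrow> nat \<Rightarrow> real^'n \<Rightarrow> complex" where
  "ridge i c d k x = of_real (flat k (c * x $ i + d))"

lemma has_partial_ridge:
  "has_partial (\<lambda>x. r * ridge i c d k x) j ((if j = i then r * of_real c else 0) * ridge i c d (Suc k) x) x"
proof (cases "j = i")
  case True
  have "((\<lambda>t. flat k (c * x $ i + d + c * t)) has_real_derivative flat (Suc k) (c * x $ i + d + c * 0) * c) (at 0)"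
    by (rule DERIV_chain2[OF flat_deriv]) (auto intro!: derivative_eq_intros)
  then have "((\<lambda>t. of_real (flat k (c * x $ i + d + c * t)) :: complex) has_vector_derivative of_real (flat (Suc k) (c * x $ i + d) * c)) (at 0)"
    by (intro has_vector_derivative_of_real) (simp add: has_real_derivative_iff_has_vector_derivative)
  then have "((\<lambda>t. r * of_real (flat k (c * x $ i + d + c * t)) :: complex) has_vector_derivative r * of_real (flat (Suc k) (c * x $ i + d) * c)) (at 0)"
    by (rule has_vector_derivative_mult_right)
  then show ?thesis using True by (simp add: has_partial_def ridge_def algebra_simps)
qed (auto simp: has_partial_def ridge_def axis_def)

lemma iter_partial_ridge:
  "iter_partial L (ridge i c d 0) = (\<lambda>x. (if set L \<subseteq> {i} then of_real c ^ length L else 0) * ridge i c d (length L) x)"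
proof (induction L)
  case (Cons j L)
  have "partial j (\<lambda>x. r * ridge i c d k x) = (\<lambda>x. (if j = i then r * of_real c else 0) * ridge i c d (Suc k) x)" for r k
    using has_partial_imp[OF has_partial_ridge] by blast
  with Cons show ?case by auto
qed auto

lemma gevrey_global_ridge: "gevrey_global (ridge i c d 0)"
  unfolding gevrey_global_def
proof (intro conjI allI impI)
  show "smooth_on UNIV (ridge i c d 0)"
  proof (rule smooth_on_coinduct[where P = "\<lambda>f. \<exists>r k. f = (\<lambda>x. r * ridge i c d k x)"])
    show "\<exists>r k. ridge i c d 0 = (\<lambda>x. r * ridge i c d k x)"
      by (intro exI[of _ 1] exI[of _ 0]) simp
    fix g assume "\<exists>r k. g = (\<lambda>x. r * ridge i c d k x)"
    then obtain r k where g: "g = (\<lambda>x. r * ridge i c d k x)" by blast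
    have "continuous_on UNIV (flat k)" by (rule DERIV_continuous_on) (rule has_field_derivative_at_within[OF flat_deriv])
    then have "continuous_on UNIV (\<lambda>x::real^'a. flat k (c * x $ i + d))"
      by (rule continuous_on_compose2) (auto intro!: continuous_intros)
    then have "continuous_on UNIV g" unfolding g ridge_def by (intro continuous_intros)
    then show "continuous_on UNIV g \<and> (\<forall>j. \<exists>h. (\<exists>r k. h = (\<lambda>x. r * ridge i c d k x)) \<and> (\<forall>x\<in>UNIV. has_partial g j (h x) x))"
    proof (intro conjI allI)
      fix j
      show "\<exists>h. (\<exists>r k. h = (\<lambda>x. r * ridge i c d k x)) \<and> (\<forall>x\<in>UNIV. has_partial g j (h x) x)"
        unfolding g
        by (rule exI[of _ "\<lambda>x. (if j = i then r * of_real c else 0) * ridge i c d (Suc k) x"])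
           (use has_partial_ridge in blast)
    qed
  qed auto
  fix s :: real assume "s > 1"
  from flat_gevrey[OF this] obtain \<rho> where rho: "\<rho> \<ge> 1" "\<And>k t. \<bar>flat k t\<bar> \<le> \<rho> ^ k * fact k powr s" by blast
  have "gbd UNIV s 1 (max 1 \<bar>c\<bar> * \<rho>) 0 (ridge i c d 0)"
    unfolding gbd_def
  proof (intro ballI allI)
    fix x and L :: "'a list"
    let ?k = "length L"
    have "cmod (iter_partial L (ridge i c d 0) x) \<le> max 1 \<bar>c\<bar> ^ ?k * cmod (ridge i c d ?k x)"
      unfolding iter_partial_ridge by (auto simp: norm_mult norm_power intro!: mult_right_mono power_mono)
    also have "\<dots> \<le> max 1 \<bar>c\<bar> ^ ?k * (\<rho> ^ ?k * fact ?k powr s)"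
      unfolding ridge_def using rho by (intro mult_left_mono) auto
    finally show "cmod (iter_partial L (ridge i c d 0) x) \<le> 1 * (max 1 \<bar>c\<bar> * \<rho>) ^ ?k * fact (?k + 0) powr s"
      by (simp add: power_mult_distrib mult_ac)
  qed
  moreover have "1 \<le> max 1 \<bar>c\<bar> * \<rho>" using rho mult_mono[of 1 "max 1 \<bar>c\<bar>" 1 \<rho>] by simp
  ultimately show "\<exists>C\<ge>0. \<exists>\<rho>\<ge>1. gbd UNIV s C \<rho> 0 (ridge i c d 0)"
    by (intro exI[of _ 1] exI[of _ "max 1 \<bar>c\<bar> * \<rho>"]) auto
qed

definition step :: "real \<Rightarrow> real" where "step t = flat 0 t / (flat 0 t + flat 0 (1 - t))"

text \<open>One of t and 1 - t is at least 1/2. The uniform lower bound is what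
  \<open>gevrey_global_inverse\<close> asks of the denominator of \<open>step\<close>.\<close>

lemma flat_0_add_ge: "flat 0 (1/2) \<le> flat 0 t + flat 0 (1 - t)"
  using flat_0_mono[of "1/2" t] flat_0_mono[of "1/2" "1 - t"] flat_0_nonneg[of t] flat_0_nonneg[of "1 - t"]
  by (cases "t \<ge> 1/2") auto

lemma step_bounds: "0 \<le> step t" "step t \<le> 1"
  using flat_0_nonneg[of t] flat_0_nonneg[of "1 - t"] by (auto simp: step_def divide_le_eq_1)

lemma step_eq_0: "t \<le> 0 \<Longrightarrow> step t = 0"
  by (simp add: step_def flat_0_eq)

lemma step_eq_1: "1 \<le> t \<Longrightarrow> step t = 1"
  by (simp add: step_def flat_0_eq)

lemma gevrey_global_step: "gevrey_global (\<lambda>x. of_real (step (c * x $ i + d)))"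
proof -
  have "gevrey_global (\<lambda>x. ridge i c d 0 x + ridge i (- c) (1 - d) 0 x)"
    by (intro gevrey_global_add gevrey_global_ridge)
  moreover have eq: "ridge i c d 0 x + ridge i (- c) (1 - d) 0 x = of_real (flat 0 (c * x $ i + d) + flat 0 (1 - (c * x $ i + d)))" for x
    by (simp add: ridge_def algebra_simps)
  moreover have "flat 0 (1/2) \<le> cmod (of_real (flat 0 t + flat 0 (1 - t)))" for t
    using flat_0_add_ge[of t] unfolding norm_of_real by linarith
  moreover have "0 < flat 0 (1/2)" by (simp add: flat_0_eq)
  ultimately have "gevrey_global (\<lambda>x. inverse (ridge i c d 0 x + ridge i (- c) (1 - d) 0 x))"
    by (intro gevrey_global_inverse[where c = "flat 0 (1/2)"]) (auto simp only: eq)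
  then have "gevrey_global (\<lambda>x. ridge i c d 0 x * inverse (ridge i c d 0 x + ridge i (- c) (1 - d) 0 x))"
    by (intro gevrey_global_mult gevrey_global_ridge)
  moreover have "ridge i c d 0 x * inverse (ridge i c d 0 x + ridge i (- c) (1 - d) 0 x) = of_real (step (c * x $ i + d))" for x
    unfolding eq by (simp add: step_def ridge_def divide_inverse)
  ultimately show ?thesis by simp
qed

lemma gevrey_cutoff_exists:
  fixes x0 :: "real^'n::finite"
  assumes "r > 0"
  obtains \<zeta> \<delta> where "gevrey_global \<zeta>" "0 < \<delta>" "\<delta> < r" "\<And>x. dist x0 x \<le> \<delta> \<Longrightarrow> \<zeta> x = 1"
    "\<And>x. r \<le> dist x0 x \<Longrightarrow> \<zeta> x = 0" "\<And>x. cmod (\<zeta> x) \<le> 1"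
proof -
  \<comment> \<open>If every coordinate differed by at most 2 d, the l1 norm would be at most r / 2.
    Hence beyond distance r some factor vanishes, while within distance d all factors are 1.\<close>
  define d where "d = r / (4 * real CARD('n))"
  have d: "d > 0" using assms by (simp add: d_def)
  define \<zeta> where "\<zeta> = (\<lambda>x. \<Prod>i\<in>UNIV. of_real (step (1 / d * x $ i + (2 - x0 $ i / d)))
      * of_real (step (- (1 / d) * x $ i + (2 + x0 $ i / d))) :: complex)"
  have a1: "1 / d * x $ i + (2 - x0 $ i / d) = 2 - (x0 $ i - x $ i) / d" for x :: "real^'n" and i
    by (simp add: diff_divide_distrib)
  have a2: "- (1 / d) * x $ i + (2 + x0 $ i / d) = 2 + (x0 $ i - x $ i) / d" for x :: "real^'n" and i
    by (simp add: diff_divide_distrib)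
  show ?thesis
  proof
    show "gevrey_global \<zeta>" unfolding \<zeta>_def by (intro gevrey_global_prod gevrey_global_mult gevrey_global_step)
    show "0 < d" by fact
    have "real CARD('n) \<ge> 1" by (simp add: Suc_leI)
    then have "1 < 4 * real CARD('n)" by linarith
    then have "r < r * (4 * real CARD('n))" using assms by (simp add: mult_less_cancel_left1)
    then show "d < r" using assms by (simp add: d_def divide_less_eq)
    show "\<zeta> x = 1" if "dist x0 x \<le> d" for x
    proof -
      have "\<bar>x0 $ i - x $ i\<bar> \<le> d" for i
        using component_le_norm_cart[of "x0 - x" i] that by (simp add: dist_norm)
      then have "\<bar>x0 $ i - x $ i\<bar> / d \<le> 1" for i using d by simp
      then have "\<bar>(x0 $ i - x $ i) / d\<bar> \<le> 1" for i using d by simp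
      then have "1 \<le> 2 - (x0 $ i - x $ i) / d" "1 \<le> 2 + (x0 $ i - x $ i) / d" for i by (smt (verit))+
      then show ?thesis unfolding \<zeta>_def a1 a2 by (simp add: step_eq_1)
    qed
    show "\<zeta> x = 0" if "r \<le> dist x0 x" for x
    proof -
      have "\<exists>i. \<bar>x0 $ i - x $ i\<bar> \<ge> 2 * d"
      proof (rule ccontr)
        assume "\<not> ?thesis"
        then have "\<bar>(x0 - x) $ i\<bar> \<le> 2 * d" for i by (metis linorder_le_cases not_le vector_minus_component)
        then have "(\<Sum>i\<in>UNIV. \<bar>(x0 - x) $ i\<bar>) \<le> (\<Sum>i\<in>(UNIV::'n set). 2 * d)" by (intro sum_mono)
        then have "norm (x0 - x) \<le> real CARD('n) * (2 * d)" using norm_le_l1_cart[of "x0 - x"] by simp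
        also have "\<dots> = r / 2" by (simp add: d_def)
        finally show False using that assms by (simp add: dist_norm)
      qed
      then obtain i where "\<bar>x0 $ i - x $ i\<bar> \<ge> 2 * d" by blast
      then have "2 \<le> \<bar>(x0 $ i - x $ i) / d\<bar>" using d by (simp add: field_simps)
      then have "2 - (x0 $ i - x $ i) / d \<le> 0 \<or> 2 + (x0 $ i - x $ i) / d \<le> 0" by linarith
      then have "step (2 - (x0 $ i - x $ i) / d) = 0 \<or> step (2 + (x0 $ i - x $ i) / d) = 0"
        using step_eq_0 by blast
      then show ?thesis unfolding \<zeta>_def a1 a2 by (intro prod_zero bexI[of _ i]) auto
    qed
    show "cmod (\<zeta> x) \<le> 1" for x
      unfolding \<zeta>_def prod_norm[symmetric] norm_mult norm_of_real
      by (intro prod_le_1 conjI mult_nonneg_nonneg mult_le_one) (auto simp: step_bounds abs_le_iff intro: order_trans[OF _ step_bounds(1)])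
  qed
qed

section \<open>Fourier series of smooth functions on a cube\<close>

definition cube :: "real \<Rightarrow> (real^'n::finite) set" where
  "cube T = cbox (\<chi> i. - T) (\<chi> i. T)"

definition cint :: "real \<Rightarrow> (real^'n::finite \<Rightarrow> 'b::{banach,second_countable_topology}) \<Rightarrow> 'b" where
  "cint T f = (\<integral>x. indicator (cube T) x *\<^sub>R f x \<partial>lborel)"

text \<open>The lattice dual to the periods 2 T, although the functions expanded below vanish
  outside the cube rather than being periodic.\<close>

definition freq :: "real \<Rightarrow> ('n::finite \<Rightarrow> int) \<Rightarrow> real^'n" where
  "freq T k = (\<chi> i. pi / T * of_int (k i))"

lemma freq_nth [simp]: "freq T k $ i = pi / T * of_int (k i)"
  by (simp add: freq_def)

lemma freq_diff: "freq T (\<lambda>i. k i - j i) = freq T k - freq T j"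
  by (simp add: vec_eq_iff algebra_simps)

lemma freq_add: "freq T (\<lambda>i. k i + j i) = freq T k + freq T j"
  by (simp add: vec_eq_iff algebra_simps)

lemma mem_cube: "x \<in> cube T \<longleftrightarrow> (\<forall>i. \<bar>x $ i\<bar> \<le> T)"
proof -
  have "- T \<le> a \<and> a \<le> T \<longleftrightarrow> \<bar>a\<bar> \<le> T" for a by auto
  then show ?thesis by (simp add: cube_def mem_box_cart)
qed

lemma compact_cube: "compact (cube T)"
  by (simp add: cube_def)

lemma cube_borel [measurable]: "cube T \<in> sets borel"
  by (simp add: cube_def)

lemma measure_cube:
  assumes "T > 0"
  shows "measure lborel (cube T :: (real^'n::finite) set) = (2 * T) ^ CARD('n)"
  using content_cbox_cart[of "\<chi> i. - T" "\<chi> i. T :: real^'n"] assms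
  by (simp add: cube_def cbox_interval[symmetric] content_cbox_if_cart interval_ne_empty_cart)

lemma cint_integrable:
  fixes f :: "real^'n::finite \<Rightarrow> 'b::{banach,second_countable_topology}"
  shows "continuous_on (cube T) f \<Longrightarrow> integrable lborel (\<lambda>x. indicator (cube T) x *\<^sub>R f x)"
  by (rule borel_integrable_compact[OF compact_cube])

lemma cint_add: "continuous_on (cube T) f \<Longrightarrow> continuous_on (cube T) g \<Longrightarrow> cint T (\<lambda>x. f x + g x) = cint T f + cint T g"
  unfolding cint_def by (simp add: scaleR_add_right cint_integrable)

lemma cint_diff: "continuous_on (cube T) f \<Longrightarrow> continuous_on (cube T) g \<Longrightarrow> cint T (\<lambda>x. f x - g x) = cint T f - cint T g"
  unfolding cint_def by (simp add: scaleR_diff_right cint_integrable)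

lemma cint_cmult: "cint T (\<lambda>x. c * f x) = (c::complex) * cint T f"
  unfolding cint_def mult_scaleR_right[symmetric] by (rule integral_mult_right_zero)

lemma cint_sum:
  fixes f :: "'a \<Rightarrow> real^'n::finite \<Rightarrow> complex"
  assumes "\<And>a. a \<in> A \<Longrightarrow> continuous_on (cube T) (f a)"
  shows "cint T (\<lambda>x. \<Sum>a\<in>A. f a x) = (\<Sum>a\<in>A. cint T (f a))"
  unfolding cint_def scaleR_sum_right
  by (rule Bochner_Integration.integral_sum) (use assms in \<open>auto intro: cint_integrable\<close>)

lemma cint_norm_bound:
  fixes f :: "real^'n::finite \<Rightarrow> complex"
  assumes "T > 0" "continuous_on (cube T) f" "\<And>x. x \<in> cube T \<Longrightarrow> cmod (f x) \<le> B"
  shows "cmod (cint T f) \<le> (2 * T) ^ CARD('n) * B"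
proof -
  have "cmod (cint T f) \<le> (\<integral>x. B * indicator (cube T :: (real^'n) set) x \<partial>lborel)"
    unfolding cint_def
  proof (rule Bochner_Integration.integral_norm_bound_integral[OF cint_integrable[OF assms(2)]])
    have "emeasure lborel (cube T :: (real^'n) set) < \<infinity>"
      unfolding cube_def by (rule emeasure_lborel_cbox_finite)
    then show "integrable lborel (\<lambda>x::real^'n. B * indicator (cube T) x)"
      by (intro integrable_mult_right integrable_real_indicator) auto
  qed (use assms(3) in \<open>auto simp: indicator_def\<close>)
  also have "\<dots> = (2 * T) ^ CARD('n) * B" using assms(1) by (simp add: measure_cube)
  finally show ?thesis .
qed

text \<open>Fubini: \<open>lborel\<close> on the vector space is the image of the product of
  one-dimensional measures over \<open>Basis\<close>. That product is indexed by basis vectors, so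
  the factors are re-indexed from i to \<open>axis i 1\<close>.\<close>

lemma integral_prod_coord:
  fixes f :: "'n::finite \<Rightarrow> real \<Rightarrow> complex"
  assumes int: "\<And>i. integrable lborel (f i)"
  shows "(\<integral>x. (\<Prod>i\<in>UNIV. f i (x $ i)) \<partial>(lborel :: (real^'n) measure)) = (\<Prod>i\<in>UNIV. \<integral>t. f i t \<partial>lborel)"
proof -
  define g where "g = (\<lambda>b::real^'n. f (SOME i. b = axis i 1))"
  have g: "g (axis i 1) = f i" for i by (simp add: g_def axis_eq_axis)
  have B: "(Basis :: (real^'n) set) = range (\<lambda>i. axis i 1)" by (auto simp: Basis_vec_def)
  have inj: "inj (\<lambda>i. axis i (1::real) :: real^'n)" by (auto simp: inj_def axis_eq_axis)
  interpret product_sigma_finite "\<lambda>b::real^'n. lborel :: real measure" by standard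
  have meas: "\<And>i. f i \<in> borel_measurable borel" using int borel_measurable_integrable by fastforce
  have gm: "g b \<in> borel_measurable borel" for b unfolding g_def using meas by blast
  have "(\<integral>x. (\<Prod>i\<in>UNIV. f i (x $ i)) \<partial>(lborel :: (real^'n) measure)) = (\<integral>x. (\<Prod>b\<in>Basis. g b (x \<bullet> b)) \<partial>lborel)"
    unfolding B by (subst prod.reindex[OF inj]) (simp add: g inner_axis)
  also have "\<dots> = (\<integral>x. (\<Prod>b\<in>Basis. g b ((\<Sum>b\<in>Basis. x b *\<^sub>R b) \<bullet> b)) \<partial>(\<Pi>\<^sub>M b\<in>Basis. lborel))"
    unfolding lborel_eq[where 'a = "real^'n"] using gm by (subst integral_distr) (auto intro!: borel_measurable_prod)
  also have "\<dots> = (\<integral>x. (\<Prod>b\<in>(Basis::(real^'n) set). g b (x b)) \<partial>(\<Pi>\<^sub>M b\<in>Basis. lborel))"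
    by (intro Bochner_Integration.integral_cong refl prod.cong) simp_all
  also have "\<dots> = (\<Prod>b\<in>(Basis::(real^'n) set). \<integral>t. g b t \<partial>lborel)"
  proof (rule product_integral_prod)
    show "integrable lborel (g b)" for b unfolding g_def using int by blast
  qed simp
  also have "\<dots> = (\<Prod>i\<in>UNIV. \<integral>t. f i t \<partial>lborel)"
    unfolding B by (subst prod.reindex[OF inj]) (simp add: g)
  finally show ?thesis .
qed

lemma integral_cis_interval:
  assumes "T > 0"
  shows "(\<integral>t. indicator {-T..T} t *\<^sub>R cis (t * (pi / T * of_int k)) \<partial>lborel) = (if k = 0 then of_real (2 * T) else 0)"
proof (cases "k = 0")
  case True
  have "(\<integral>t. indicator {-T..T} t *\<^sub>R (1::complex) \<partial>lborel) = of_real (2 * T)"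
    using assms by (simp add: scaleR_conv_of_real)
  with True show ?thesis by simp
next
  case False
  define w where "w = pi / T * of_int k"
  have w: "w \<noteq> 0" using False assms by (simp add: w_def)
  have "(\<integral>t. indicator {-T..T} t *\<^sub>R cis (t * w) \<partial>lborel) = cis (T * w) / (\<i> * of_real w) - cis (- T * w) / (\<i> * of_real w)"
  proof (rule integral_FTC_atLeastAtMost)
    show "continuous_on {-T..T} (\<lambda>t. cis (t * w))" by (intro continuous_intros)
    fix t :: real
    have "((\<lambda>z. exp (\<i> * (z * of_real w)) / (\<i> * of_real w)) has_field_derivative exp (\<i> * (of_real t * of_real w)) * (\<i> * (1 * of_real w)) / (\<i> * of_real w)) (at (of_real t))"
      by (intro DERIV_cdivide DERIV_chain2[OF DERIV_exp] DERIV_cmult DERIV_cmult_right DERIV_ident)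
    also have "exp (\<i> * (of_real t * of_real w)) * (\<i> * (1 * of_real w)) / (\<i> * of_real w) = cis (t * w)"
      using w by (simp add: cis_conv_exp)
    finally have "((\<lambda>t. exp (\<i> * (of_real t * of_real w)) / (\<i> * of_real w)) has_vector_derivative cis (t * w)) (at t)"
      by (rule has_vector_derivative_real_field)
    moreover have "exp (\<i> * (of_real t * of_real w)) = cis (t * w)" for t by (simp add: cis_conv_exp)
    ultimately have "((\<lambda>t. cis (t * w) / (\<i> * of_real w)) has_vector_derivative cis (t * w)) (at t)"
      by simp
    then show "((\<lambda>t. cis (t * w) / (\<i> * of_real w)) has_vector_derivative cis (t * w)) (at t within {-T..T})"
      by (rule has_vector_derivative_at_within)
  qed (use assms in auto)
  also have "T * w = pi * of_int k" using assms by (simp add: w_def)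
  also have "- T * w = - (pi * of_int k)" using assms by (simp add: w_def)
  \<comment> \<open>The antiderivative takes the same value at both ends, as sin (pi k) = 0.\<close>
  also have "cis (pi * of_int k) = cis (- (pi * of_int k))"
    by (simp add: complex_eq_iff sin_int_times_real mult.commute)
  finally show ?thesis using False by (simp add: w_def)
qed

lemma cis_sum: "finite A \<Longrightarrow> cis (\<Sum>a\<in>A. f a) = (\<Prod>a\<in>A. cis (f a))"
  by (induction A rule: finite_induct) (auto simp: cis_mult[symmetric])

lemma cint_cis:
  fixes k :: "'n::finite \<Rightarrow> int"
  assumes "T > 0"
  shows "cint T (\<lambda>x. cis (x \<bullet> freq T k)) = (if k = (\<lambda>i. 0) then of_real ((2 * T) ^ CARD('n)) else 0)"
proof -
  have ind: "indicator (cube T) x = (\<Prod>i\<in>UNIV. indicator {-T..T} (x $ i) :: real)" for x :: "real^'n"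
  proof (cases "x \<in> cube T")
    case True
    then have "\<bar>x $ i\<bar> \<le> T" for i by (simp add: mem_cube)
    then have "x $ i \<in> {-T..T}" for i using abs_le_D1 abs_le_D2 minus_le_iff by (metis atLeastAtMost_iff)
    with True show ?thesis by simp
  next
    case False
    then obtain i where "\<not> \<bar>x $ i\<bar> \<le> T" by (auto simp: mem_cube)
    then have "x $ i \<notin> {-T..T}" by auto
    then have "(\<Prod>i\<in>UNIV. indicator {-T..T} (x $ i) :: real) = 0" by (intro prod_zero bexI[of _ i]) auto
    with False show ?thesis by simp
  qed
  have "cint T (\<lambda>x. cis (x \<bullet> freq T k)) = (\<integral>x. (\<Prod>i\<in>UNIV. indicator {-T..T} (x $ i) *\<^sub>R cis ((x $ i) * (pi / T * of_int (k i)))) \<partial>(lborel :: (real^'n) measure))"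
    unfolding cint_def ind inner_vec_def cis_sum[OF finite] scaleR_conv_of_real
    by (simp add: prod.distrib)
  also have "\<dots> = (\<Prod>i\<in>UNIV. \<integral>t. indicator {-T..T} t *\<^sub>R cis (t * (pi / T * of_int (k i))) \<partial>lborel)"
    by (rule integral_prod_coord) (intro borel_integrable_compact continuous_intros compact_Icc)
  also have "\<dots> = (\<Prod>i\<in>UNIV. if k i = 0 then of_real (2 * T) else 0)"
    unfolding integral_cis_interval[OF assms] ..
  also have "\<dots> = (if k = (\<lambda>i. 0) then of_real ((2 * T) ^ CARD('n)) else 0)"
  proof (cases "k = (\<lambda>i. 0)")
    case False
    then obtain i where "k i \<noteq> 0" by auto
    then have "(\<Prod>i\<in>UNIV. if k i = 0 then complex_of_real (2 * T) else 0) = 0" by (intro prod_zero bexI[of _ i]) auto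
    with False show ?thesis by simp
  qed auto
  finally show ?thesis .
qed

definition fcoef :: "real \<Rightarrow> (real^'n::finite \<Rightarrow> complex) \<Rightarrow> ('n \<Rightarrow> int) \<Rightarrow> complex" where
  "fcoef T h k = cint T (\<lambda>x. h x * cis (- (x \<bullet> freq T k))) / of_real ((2 * T) ^ CARD('n))"

lemma fcoef_bound:
  fixes h :: "real^'n::finite \<Rightarrow> complex"
  assumes "T > 0" "continuous_on (cube T) h" "\<And>x. x \<in> cube T \<Longrightarrow> cmod (h x) \<le> B"
  shows "cmod (fcoef T h k) \<le> B"
proof -
  have "cmod (cint T (\<lambda>x. h x * cis (- (x \<bullet> freq T k)))) \<le> (2 * T) ^ CARD('n) * B"
    by (rule cint_norm_bound[OF assms(1)]) (use assms in \<open>auto intro!: continuous_intros simp: norm_mult\<close>)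
  then show ?thesis unfolding fcoef_def using assms(1)
    by (simp add: norm_divide norm_power norm_mult divide_le_eq mult.commute)
qed

section \<open>Fourier coefficients of derivatives\<close>

lemma vanish_outside_iter:
  assumes "\<And>x. x \<notin> K \<Longrightarrow> f x = 0" "closed K" "x \<notin> K"
  shows "iter_partial L f x = 0"
proof -
  have "iter_partial L f x = iter_partial L (\<lambda>x. 0) x"
    by (rule iter_partial_cong[of "- K"]) (use assms in auto)
  then show ?thesis by (simp add: iter_partial_const)
qed

lemma closed_cube: "closed (cube T)" by (rule compact_imp_closed[OF compact_cube])

lemma smooth_bounded:
  assumes "smooth_on UNIV f" "\<And>x. x \<notin> cube T \<Longrightarrow> f x = 0"
  obtains B where "0 \<le> B" "\<And>x. cmod (iter_partial L f x) \<le> B"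
proof -
  have "continuous_on (cube T) (iter_partial L f)"
    using smooth_on_continuous_iter[OF assms(1)] continuous_on_subset by blast
  then have "bounded (iter_partial L f ` cube T)"
    using compact_continuous_image compact_cube compact_imp_bounded by blast
  then obtain B where B: "\<And>x. x \<in> cube T \<Longrightarrow> cmod (iter_partial L f x) \<le> B"
    unfolding bounded_iff by blast
  have "cmod (iter_partial L f x) \<le> max 0 B" for x
  proof (cases "x \<in> cube T")
    case True with B[OF True] show ?thesis by simp
  next
    case False with vanish_outside_iter[where f = f and L = L, OF assms(2) closed_cube False] show ?thesis by simp
  qed
  then show ?thesis using that by (metis max.cobounded1)
qed

text \<open>Translation invariance of Lebesgue measure makes the integral of each difference quotient vanish.\<close>
lemma integral_partial_eq_0:
  fixes F :: "real^'n::finite \<Rightarrow> complex"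
  assumes "smooth_on UNIV F" "\<And>x. x \<notin> cube T \<Longrightarrow> F x = 0"
  shows "(\<integral>x. partial i F x \<partial>lborel) = 0"
proof -
  let ?e = "axis i (1::real) :: real^'n"
  define t where "t = (\<lambda>n. inverse (real (Suc n)))"
  have t: "0 < t n" "t n \<le> 1" for n by (auto simp: t_def inverse_le_1_iff)
  obtain B where B: "0 \<le> B" "\<And>x. cmod (partial i F x) \<le> B"
    using smooth_bounded[where L = "[i]", OF assms] by auto
  have cont: "continuous_on UNIV F" using assms smooth_on_continuous by blast
  have Fm [measurable]: "F \<in> borel_measurable borel" using cont by (rule borel_measurable_continuous_onI)
  have eqF: "F = (\<lambda>x. indicator (cube T) x *\<^sub>R F x)" using assms(2) by (auto simp: indicator_def)
  have intF: "integrable lborel F"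
    by (subst eqF) (rule cint_integrable[OF continuous_on_subset[OF cont]], simp)
  have shift: "(\<integral>x. F (c + x) \<partial>lborel) = (\<integral>x. F x \<partial>lborel)" "integrable lborel (\<lambda>x. F (c + x))" for c
  proof -
    have "(\<integral>x. F x \<partial>lborel) = (\<integral>x. F x \<partial>distr lborel borel ((+) c))" by (simp only: lborel_distr_plus)
    also have "\<dots> = (\<integral>x. F (c + x) \<partial>lborel)" by (rule integral_distr) auto
    finally show "(\<integral>x. F (c + x) \<partial>lborel) = (\<integral>x. F x \<partial>lborel)" by simp
    have "integrable (distr lborel borel ((+) c)) F" using intF by (simp only: lborel_distr_plus)
    then show "integrable lborel (\<lambda>x. F (c + x))" by (subst (asm) integrable_distr_eq) auto
  qed
  define D where "D = (\<lambda>n x. (F (t n *\<^sub>R ?e + x) - F x) /\<^sub>R t n)"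
  have D0: "(\<integral>x. D n x \<partial>lborel) = 0" for n
    unfolding D_def using shift intF by simp
  have "(\<lambda>n. \<integral>x. D n x \<partial>lborel) \<longlonglongrightarrow> (\<integral>x. partial i F x \<partial>lborel)"
  proof (rule integral_dominated_convergence)
    have "continuous_on UNIV (partial i F)" using smooth_on_continuous[OF smooth_on_partial[OF assms(1)]] .
    then show "partial i F \<in> borel_measurable lborel" using borel_measurable_continuous_onI by auto
    show "D n \<in> borel_measurable lborel" for n unfolding D_def by measurable
    \<comment> \<open>The steps \<open>t n\<close> are at most 1, so all difference quotients vanish
      outside the cube of half-width T + 1; its indicator times B dominates them.\<close>
    have "emeasure lborel (cube (T + 1) :: (real^'n) set) < \<infinity>"
      unfolding cube_def by (rule emeasure_lborel_cbox_finite)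
    then show "integrable lborel (\<lambda>x::real^'n. B * indicator (cube (T + 1)) x)"
      by (intro integrable_mult_right integrable_real_indicator) auto
    show "AE x in lborel. (\<lambda>n. D n x) \<longlonglongrightarrow> partial i F x"
    proof (rule AE_I2)
      fix x
      have "((\<lambda>t. F (x + t *\<^sub>R ?e)) has_vector_derivative partial i F x) (at 0)"
        using smooth_on_has_partial[OF assms(1)] by (simp add: has_partial_def)
      then have "((\<lambda>h. norm (F (x + h *\<^sub>R ?e) - F x - h *\<^sub>R partial i F x) / norm h) \<longlongrightarrow> 0) (at 0)"
        unfolding has_vector_derivative_def has_derivative_iff_norm by simp
      then have "((\<lambda>h. norm ((F (x + h *\<^sub>R ?e) - F x) /\<^sub>R h - partial i F x)) \<longlongrightarrow> 0) (at 0)"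
      proof (rule Lim_transform_eventually)
        have "norm (F (x + h *\<^sub>R ?e) - F x - h *\<^sub>R partial i F x) / norm h = norm ((F (x + h *\<^sub>R ?e) - F x) /\<^sub>R h - partial i F x)"
          if "h \<noteq> 0" for h
        proof -
          have "(F (x + h *\<^sub>R ?e) - F x) /\<^sub>R h - partial i F x = (F (x + h *\<^sub>R ?e) - F x - h *\<^sub>R partial i F x) /\<^sub>R h"
            using that by (simp add: scaleR_diff_right)
          then show ?thesis by (simp add: divide_inverse mult.commute)
        qed
        then show "\<forall>\<^sub>F h in at 0. norm (F (x + h *\<^sub>R ?e) - F x - h *\<^sub>R partial i F x) / norm h = norm ((F (x + h *\<^sub>R ?e) - F x) /\<^sub>R h - partial i F x)"
          unfolding eventually_at_filter by (intro always_eventually) blast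
      qed
      then have "((\<lambda>h. (F (x + h *\<^sub>R ?e) - F x) /\<^sub>R h) \<longlongrightarrow> partial i F x) (at 0)"
        using Lim_null tendsto_norm_zero_iff by blast
      moreover have "filterlim t (at 0) sequentially"
        unfolding filterlim_at t_def using LIMSEQ_inverse_real_of_nat by auto
      ultimately show "(\<lambda>n. D n x) \<longlonglongrightarrow> partial i F x"
        unfolding D_def by (subst add.commute) (rule filterlim_compose)
    qed
    show "AE x in lborel. norm (D n x) \<le> B * indicator (cube (T + 1)) x" for n
    proof (rule AE_I2)
      fix x
      have "cmod (F (x + t n *\<^sub>R ?e) - F (x + 0 *\<^sub>R ?e)) \<le> B * t n"
        by (rule line_increment_bound[where f' = "\<lambda>s. partial i F (x + s *\<^sub>R ?e)"])
           (use t[of n] B in \<open>auto intro: has_partial_line smooth_on_has_partial[OF assms(1)]\<close>)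
      then have 1: "norm (D n x) \<le> B"
        using t(1)[of n] by (simp add: D_def add.commute divide_simps mult.commute)
      show "norm (D n x) \<le> B * indicator (cube (T + 1)) x"
      proof (cases "x \<in> cube (T + 1)")
        case False
        have "x \<notin> cube T"
        proof
          assume "x \<in> cube T"
          then have *: "\<bar>x $ j\<bar> \<le> T" for j by (simp add: mem_cube)
          have "\<bar>x $ j\<bar> \<le> T + 1" for j using *[of j] by linarith
          with False show False by (simp add: mem_cube)
        qed
        moreover have "t n *\<^sub>R ?e + x \<notin> cube T"
        proof
          assume "t n *\<^sub>R ?e + x \<in> cube T"
          then have *: "\<bar>t n * ?e $ j + x $ j\<bar> \<le> T" for j by (simp add: mem_cube)
          have "\<bar>t n * ?e $ j\<bar> \<le> 1" for j using t[of n] by (simp add: axis_def)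
          then have "\<bar>x $ j\<bar> \<le> T + 1" for j using *[of j] by (smt (verit))
          with False show False by (simp add: mem_cube)
        qed
        ultimately show ?thesis using assms(2) False by (simp add: D_def)
      qed (use 1 in auto)
    qed
  qed
  then show ?thesis unfolding D0 using LIMSEQ_unique tendsto_const by blast
qed

lemma continuous_on_cis_inner [continuous_intros]:
  "continuous_on S (\<lambda>x. cis (x \<bullet> \<xi>))" "continuous_on S (\<lambda>x. cis (- (x \<bullet> \<xi>)))"
  by (intro continuous_intros)+

definition expo :: "real^'n::finite \<Rightarrow> real^'n \<Rightarrow> complex" where
  "expo \<xi> x = cis (x \<bullet> \<xi>)"

lemma has_partial_expo: "has_partial (expo \<xi>) i (\<i> * of_real (\<xi> $ i) * expo \<xi> x) x"
proof -
  have "((\<lambda>z. exp (\<i> * (of_real (x \<bullet> \<xi>) + z * of_real (\<xi> $ i)))) has_field_derivative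
      exp (\<i> * (of_real (x \<bullet> \<xi>) + of_real 0 * of_real (\<xi> $ i))) * (\<i> * (0 + 1 * of_real (\<xi> $ i)))) (at (of_real 0))"
    by (intro DERIV_chain2[OF DERIV_exp] DERIV_cmult DERIV_add DERIV_const DERIV_cmult_right DERIV_ident)
  then have "((\<lambda>t. exp (\<i> * (of_real (x \<bullet> \<xi>) + of_real t * of_real (\<xi> $ i)))) has_vector_derivative
      exp (\<i> * (of_real (x \<bullet> \<xi>) + of_real 0 * of_real (\<xi> $ i))) * (\<i> * (0 + 1 * of_real (\<xi> $ i)))) (at 0)"
    by (rule has_vector_derivative_real_field)
  moreover have "exp (\<i> * (of_real (x \<bullet> \<xi>) + of_real t * of_real (\<xi> $ i))) = expo \<xi> (x + t *\<^sub>R axis i 1)" for t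
    by (simp add: expo_def cis_conv_exp inner_add_left inner_axis' algebra_simps)
  ultimately show ?thesis by (simp add: has_partial_def expo_def cis_conv_exp mult_ac)
qed

lemma smooth_expo: "smooth_on UNIV (expo \<xi>)"
proof (rule smooth_on_coinduct[where P = "\<lambda>f. \<exists>c. f = (\<lambda>x. c * expo \<xi> x)"])
  show "\<exists>c. expo \<xi> = (\<lambda>x. c * expo \<xi> x)" by (rule exI[of _ 1]) simp
  fix g assume "\<exists>c. g = (\<lambda>x. c * expo \<xi> x)"
  then obtain c where g: "g = (\<lambda>x. c * expo \<xi> x)" by blast
  have "has_partial g i (c * (\<i> * of_real (\<xi> $ i)) * expo \<xi> x) x" for i x
  proof -
    have "has_partial (\<lambda>x. c * expo \<xi> x) i (0 * expo \<xi> x + c * (\<i> * of_real (\<xi> $ i) * expo \<xi> x)) x"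
      by (intro has_partial_mult has_partial_const has_partial_expo)
    then show ?thesis by (simp add: g mult.assoc)
  qed
  moreover have "continuous_on UNIV g" unfolding g expo_def by (intro continuous_intros)
  ultimately show "continuous_on UNIV g \<and> (\<forall>i. \<exists>h. (\<exists>c. h = (\<lambda>x. c * expo \<xi> x)) \<and> (\<forall>x\<in>UNIV. has_partial g i (h x) x))"
    by blast
qed simp

lemma iter_partial_expo: "iter_partial L (expo \<xi>) x = (\<Prod>i\<leftarrow>L. \<i> * of_real (\<xi> $ i)) * expo \<xi> x"
proof (induction L arbitrary: x)
  case (Cons i L)
  have "partial i (iter_partial L (expo \<xi>)) x = partial i (\<lambda>x. (\<Prod>i\<leftarrow>L. \<i> * of_real (\<xi> $ i)) * expo \<xi> x) x"
    by (rule partial_cong[of UNIV]) (use Cons in auto)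
  also have "\<dots> = 0 * expo \<xi> x + (\<Prod>i\<leftarrow>L. \<i> * of_real (\<xi> $ i)) * (\<i> * of_real (\<xi> $ i) * expo \<xi> x)"
    by (intro has_partial_imp has_partial_mult has_partial_const has_partial_expo)
  finally show ?case by (simp add: mult_ac)
qed simp

lemma norm_expo [simp]: "cmod (expo \<xi> x) = 1"
  by (simp add: expo_def)

lemma expo_mult: "expo \<xi> x * expo \<eta> x = expo (\<xi> + \<eta>) x"
  by (simp add: expo_def cis_mult inner_add_right)

lemma continuous_expo: "continuous_on S (expo \<xi>)"
  unfolding expo_def by (intro continuous_intros)

lemma fcoef_expo: "fcoef T h k = cint T (\<lambda>x. h x * expo (- freq T k) x) / of_real ((2 * T) ^ CARD('n))"
  for h :: "real^'n::finite \<Rightarrow> complex"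
  by (simp add: fcoef_def expo_def)

lemma cint_expo:
  fixes k :: "'n::finite \<Rightarrow> int"
  assumes "T > 0"
  shows "cint T (expo (freq T k)) = (if k = (\<lambda>i. 0) then of_real ((2 * T) ^ CARD('n)) else 0)"
  using cint_cis[OF assms, of k] by (simp add: expo_def[abs_def])

text \<open>Integration by parts. There is no boundary term, because h is smooth on the whole space
  and vanishes outside the cube, so \<open>integral_partial_eq_0\<close> applies to its product with
  the exponential.\<close>

lemma fcoef_partial:
  fixes h :: "real^'n::finite \<Rightarrow> complex"
  assumes "smooth_on UNIV h" "\<And>x. x \<notin> cube T \<Longrightarrow> h x = 0"
  shows "fcoef T (partial i h) k = \<i> * of_real (pi / T * of_int (k i)) * fcoef T h k"
proof -
  let ?e = "expo (- freq T k)"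
  let ?F = "\<lambda>x. h x * ?e x"
  have out: "partial i h x = 0" if "x \<notin> cube T" for x
    using vanish_outside_iter[where L = "[i]", OF assms(2) closed_cube that] by simp
  have c: "continuous_on (cube T) h" "continuous_on (cube T) (partial i h)"
    using smooth_on_continuous[OF assms(1)] smooth_on_continuous[OF smooth_on_partial[OF assms(1)]]
      continuous_on_subset by blast+
  have "partial i ?F x = partial i h x * ?e x + h x * (\<i> * of_real ((- freq T k) $ i) * ?e x)" for x
    by (intro has_partial_imp has_partial_mult has_partial_expo smooth_on_has_partial[OF assms(1)]) auto
  then have pF: "partial i ?F x = partial i h x * ?e x + (- \<i> * of_real (pi / T * of_int (k i))) * (h x * ?e x)" for x
    by (simp add: algebra_simps)
  have "0 = (\<integral>x. partial i ?F x \<partial>lborel)"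
    by (rule integral_partial_eq_0[of _ T, symmetric])
       (use assms in \<open>auto intro: smooth_on_mult smooth_expo\<close>)
  also have "\<dots> = cint T (\<lambda>x. partial i h x * ?e x + (- \<i> * of_real (pi / T * of_int (k i))) * (h x * ?e x))"
    unfolding cint_def pF
    by (intro Bochner_Integration.integral_cong refl) (use assms(2) out in \<open>auto simp: indicator_def\<close>)
  also have "\<dots> = cint T (\<lambda>x. partial i h x * ?e x) + (- \<i> * of_real (pi / T * of_int (k i))) * cint T (\<lambda>x. h x * ?e x)"
    by (subst cint_add) (auto intro!: continuous_intros c continuous_expo simp only: cint_cmult)
  finally have "cint T (\<lambda>x. partial i h x * ?e x) = (\<i> * of_real (pi / T * of_int (k i))) * cint T (\<lambda>x. h x * ?e x)"
    by (simp add: algebra_simps)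
  then show ?thesis unfolding fcoef_expo by simp
qed

lemma fcoef_iter_partial:
  fixes h :: "real^'n::finite \<Rightarrow> complex"
  assumes "smooth_on UNIV h" "\<And>x. x \<notin> cube T \<Longrightarrow> h x = 0"
  shows "fcoef T (iter_partial L h) k = (\<Prod>i\<leftarrow>L. \<i> * of_real (freq T k $ i)) * fcoef T h k"
proof (induction L)
  case (Cons i L)
  have "fcoef T (partial i (iter_partial L h)) k = \<i> * of_real (pi / T * of_int (k i)) * fcoef T (iter_partial L h) k"
    by (rule fcoef_partial) (use assms smooth_on_iter_partial vanish_outside_iter[OF assms(2) closed_cube] in auto)
  with Cons show ?case by simp
qed simp

section \<open>Decay and summability of the coefficients\<close>

definition ksize :: "('n::finite \<Rightarrow> int) \<Rightarrow> real" where
  "ksize k = 1 + (\<Sum>i\<in>UNIV. \<bar>real_of_int (k i)\<bar>)"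

lemma ksize_ge: "1 \<le> ksize k" "1 + \<bar>real_of_int (k i)\<bar> \<le> ksize k"
  using member_le_sum[of i UNIV "\<lambda>i. \<bar>real_of_int (k i)\<bar>"] by (auto simp: ksize_def intro: sum_nonneg)

lemma norm_freq_le:
  assumes "T > 0" shows "norm (freq T k) \<le> pi / T * ksize k"
proof -
  have "norm (freq T k) \<le> (\<Sum>i\<in>UNIV. \<bar>freq T k $ i\<bar>)" by (rule norm_le_l1_cart)
  also have "\<dots> = pi / T * (\<Sum>i\<in>UNIV. \<bar>real_of_int (k i)\<bar>)"
    using assms by (simp add: abs_mult sum_distrib_left)
  also have "\<dots> \<le> pi / T * ksize k" using assms by (intro mult_left_mono) (auto simp: ksize_def)
  finally show ?thesis .
qed

text \<open>Differentiating b times along a coordinate i with |k i| maximal multiplies the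
  coefficient by a factor of modulus (pi |k i| / T) ^ b, and \<open>ksize k\<close> is at most (n +
  1) |k i| in dimension n. So only pure derivatives of g enter; for k = 0 the bound on g itself is
  used.\<close>

lemma fcoef_decay:
  fixes g :: "real^'n::finite \<Rightarrow> complex"
  assumes T: "T > 0" and g: "smooth_on UNIV g" "\<And>x. x \<notin> cube T \<Longrightarrow> g x = 0"
    and B: "\<And>x. cmod (g x) \<le> B" "\<And>x i. cmod (iter_partial (replicate b i) g x) \<le> B"
  shows "ksize k ^ b * cmod (fcoef T g k) \<le> ((real CARD('n) + 1) * max 1 (T / pi)) ^ b * B"
proof -
  define D where "D = max 1 (T / pi)"
  have D: "D \<ge> 1" "D \<ge> T / pi" by (auto simp: D_def)
  have B0: "B \<ge> 0" using B(1)[of 0] norm_ge_zero order_trans by blast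
  have ct: "continuous_on (cube T) (iter_partial L g)" for L
    using smooth_on_continuous_iter[OF g(1)] continuous_on_subset by blast
  obtain i where i: "\<And>j. \<bar>k j\<bar> \<le> \<bar>k i\<bar>"
    using finite_has_maximal2[of "range (\<lambda>j. \<bar>k j\<bar>)" "\<bar>k undefined\<bar>"] by auto (metis linorder_le_cases)
  show ?thesis
  proof (cases "k i = 0")
    case True
    then have "k j = 0" for j using i[of j] by simp
    then have "ksize k = 1" by (simp add: ksize_def)
    moreover have "cmod (fcoef T g k) \<le> B" using fcoef_bound[OF T ct[of "[]"]] B by simp
    moreover have "1 \<le> ((real CARD('n) + 1) * D) ^ b"
      using D mult_mono[of 1 "real CARD('n) + 1" 1 D] by (intro one_le_power) auto
    then have "1 * B \<le> ((real CARD('n) + 1) * D) ^ b * B" using B0 by (rule mult_right_mono)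
    ultimately show ?thesis by (simp add: D_def)
  next
    case False
    define m where "m = \<bar>real_of_int (k i)\<bar>"
    have m: "m \<ge> 1" using False unfolding m_def by (simp flip: of_int_abs)
    have "ksize k \<le> 1 + (\<Sum>j\<in>(UNIV::'n set). m)"
      unfolding ksize_def m_def using i by (intro add_left_mono sum_mono) (simp flip: of_int_abs)
    also have "\<dots> \<le> (real CARD('n) + 1) * m" using m by (simp add: algebra_simps)
    finally have kz: "ksize k \<le> (real CARD('n) + 1) * m" .
    have "cmod (fcoef T (iter_partial (replicate b i) g) k) \<le> B"
      by (rule fcoef_bound[OF T ct]) (rule B(2))
    moreover have "fcoef T (iter_partial (replicate b i) g) k = (\<Prod>i\<leftarrow>replicate b i. \<i> * of_real (freq T k $ i)) * fcoef T g k"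
      by (rule fcoef_iter_partial) (use g in auto)
    then have "fcoef T (iter_partial (replicate b i) g) k = (\<i> * of_real (freq T k $ i)) ^ b * fcoef T g k"
      by (simp only: map_replicate prod_list_replicate)
    moreover have "cmod (\<i> * of_real (freq T k $ i)) = pi / T * m"
      unfolding norm_mult norm_of_real using T by (simp add: m_def abs_mult)
    ultimately have "(pi / T * m) ^ b * cmod (fcoef T g k) \<le> B"
      by (simp only: norm_mult norm_power)
    then have "(T / pi) ^ b * ((pi / T * m) ^ b * cmod (fcoef T g k)) \<le> (T / pi) ^ b * B"
      using T by (intro mult_left_mono) auto
    moreover have "(T / pi) ^ b * (pi / T * m) ^ b = m ^ b"
      using T by (simp flip: power_mult_distrib)
    ultimately have "m ^ b * cmod (fcoef T g k) \<le> (T / pi) ^ b * B" by (simp add: mult.assoc[symmetric])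
    also have "\<dots> \<le> D ^ b * B" using D T B0 by (intro mult_right_mono power_mono) auto
    finally have md: "m ^ b * cmod (fcoef T g k) \<le> D ^ b * B" .
    have "ksize k ^ b * cmod (fcoef T g k) \<le> ((real CARD('n) + 1) * m) ^ b * cmod (fcoef T g k)"
      using kz ksize_ge(1)[of k] by (intro mult_right_mono power_mono) auto
    also have "\<dots> = (real CARD('n) + 1) ^ b * (m ^ b * cmod (fcoef T g k))" by (simp add: power_mult_distrib)
    also have "\<dots> \<le> (real CARD('n) + 1) ^ b * (D ^ b * B)" using md by (intro mult_left_mono) auto
    finally show ?thesis by (simp add: power_mult_distrib D_def mult.assoc)
  qed
qed

lemma int_inverse_squares_bounded:
  "\<exists>S. \<forall>F. finite F \<longrightarrow> (\<Sum>j\<in>F. 1 / (1 + \<bar>real_of_int j\<bar>) ^ 2) \<le> S"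
proof -
  define f where "f = (\<lambda>n::nat. 1 / (1 + real n) ^ 2)"
  have "summable (\<lambda>n. inverse (real (n + 1) ^ 2))"
    using summable_ignore_initial_segment[OF inverse_power_summable[of 2, where 'a = real], of 1] by simp
  then have sf: "summable f" by (simp add: f_def divide_inverse add.commute)
  have part: "(\<Sum>j\<in>F. 1 / (1 + \<bar>real_of_int j\<bar>) ^ 2) \<le> suminf f" if "finite F" "inj_on (\<lambda>j. nat \<bar>j\<bar>) F" for F
  proof -
    have "(\<Sum>j\<in>F. 1 / (1 + \<bar>real_of_int j\<bar>) ^ 2) = sum f ((\<lambda>j. nat \<bar>j\<bar>) ` F)"
      by (subst sum.reindex[OF that(2)]) (simp add: f_def)
    also have "\<dots> \<le> suminf f" by (rule sum_le_suminf[OF sf]) (use that in \<open>auto simp: f_def\<close>)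
    finally show ?thesis .
  qed
  have "(\<Sum>j\<in>F. 1 / (1 + \<bar>real_of_int j\<bar>) ^ 2) \<le> 2 * suminf f" if "finite F" for F
  proof -
    have "(\<Sum>j\<in>F. 1 / (1 + \<bar>real_of_int j\<bar>) ^ 2) = (\<Sum>j\<in>F \<inter> {0..}. 1 / (1 + \<bar>real_of_int j\<bar>) ^ 2) + (\<Sum>j\<in>F - {0..}. 1 / (1 + \<bar>real_of_int j\<bar>) ^ 2)"
      by (rule sum.Int_Diff[OF that])
    moreover have "inj_on (\<lambda>j. nat \<bar>j\<bar>) (F \<inter> {0..})" "inj_on (\<lambda>j. nat \<bar>j\<bar>) (F - {0..})"
      by (auto simp: inj_on_def)
    ultimately show ?thesis using part[of "F \<inter> {0..}"] part[of "F - {0..}"] that by simp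
  qed
  then show ?thesis by blast
qed

text \<open>Each of the n factors (1 + |k i|)^2 is at most ksize k ^ 2, so the sum is dominated by a
  product of n one-dimensional sums; this explains the exponent. A finite set of indices sits in the
  product of its projections.\<close>

lemma ksize_sums_bounded:
  "\<exists>S. \<forall>F. finite F \<longrightarrow> (\<Sum>k\<in>F. 1 / ksize (k :: 'n::finite \<Rightarrow> int) ^ (2 * CARD('n))) \<le> S"
proof -
  obtain S where S: "\<And>F. finite F \<Longrightarrow> (\<Sum>j\<in>F. 1 / (1 + \<bar>real_of_int j\<bar>) ^ 2) \<le> S"
    using int_inverse_squares_bounded by blast
  have "(\<Sum>k\<in>F. 1 / ksize k ^ (2 * CARD('n))) \<le> S ^ CARD('n)" if F: "finite F" for F :: "('n \<Rightarrow> int) set"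
  proof -
    have "(\<Sum>k\<in>F. 1 / ksize k ^ (2 * CARD('n))) \<le> (\<Sum>k\<in>F. \<Prod>i\<in>UNIV. 1 / (1 + \<bar>real_of_int (k i)\<bar>) ^ 2)"
    proof (rule sum_mono)
      fix k :: "'n \<Rightarrow> int"
      have "(\<Prod>i\<in>(UNIV::'n set). (1 + \<bar>real_of_int (k i)\<bar>) ^ 2) \<le> (\<Prod>i\<in>(UNIV::'n set). ksize k ^ 2)"
        using ksize_ge by (intro prod_mono conjI power_mono) auto
      also have "\<dots> = ksize k ^ (2 * CARD('n))" by (simp add: power_mult)
      finally show "1 / ksize k ^ (2 * CARD('n)) \<le> (\<Prod>i\<in>UNIV. 1 / (1 + \<bar>real_of_int (k i)\<bar>) ^ 2)"
        unfolding prod_dividef prod.neutral_const by (intro divide_left_mono mult_pos_pos prod_pos zero_less_power)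
          (use ksize_ge(1)[of k] in auto)
    qed
    also have "\<dots> \<le> (\<Sum>k\<in>PiE UNIV (\<lambda>i. (\<lambda>k. k i) ` F). \<Prod>i\<in>UNIV. 1 / (1 + \<bar>real_of_int (k i)\<bar>) ^ 2)"
      using F by (intro sum_mono2 finite_PiE) (auto intro: prod_nonneg)
    also have "\<dots> = (\<Prod>i\<in>UNIV. \<Sum>j\<in>(\<lambda>k. k i) ` F. 1 / (1 + \<bar>real_of_int j\<bar>) ^ 2)"
      using F by (intro prod_sum_PiE[symmetric]) auto
    also have "\<dots> \<le> (\<Prod>i\<in>(UNIV::'n set). S)"
      using F S by (intro prod_mono conjI sum_nonneg) auto
    finally show ?thesis by simp
  qed
  then show ?thesis by blast
qed

lemma ksize_summable: "(\<lambda>k::'n::finite \<Rightarrow> int. 1 / ksize k ^ (2 * CARD('n))) summable_on UNIV"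
proof (rule nonneg_bdd_above_summable_on)
  show "bdd_above (sum (\<lambda>k::'n \<Rightarrow> int. 1 / ksize k ^ (2 * CARD('n))) ` {F. F \<subseteq> UNIV \<and> finite F})"
    using ksize_sums_bounded[where 'n = 'n] by (auto simp: bdd_above_def)
  show "0 \<le> 1 / ksize k ^ (2 * CARD('n))" for k :: "'n \<Rightarrow> int" using ksize_ge(1)[of k] by simp
qed


section \<open>Uniqueness and inversion for Fourier series\<close>

definition ker1 :: "real \<Rightarrow> real^'n::finite \<Rightarrow> 'n \<Rightarrow> real^'n \<Rightarrow> real" where
  "ker1 T x0 i x = (1 + cos (pi / T * (x $ i - x0 $ i))) / 2"

lemma ker1_bounds: "0 \<le> ker1 T x0 i x" "ker1 T x0 i x \<le> 1"
proof -
  have "-1 \<le> c \<Longrightarrow> 0 \<le> (1 + c) / 2" "c \<le> 1 \<Longrightarrow> (1 + c) / 2 \<le> 1" for c :: real by auto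
  then show "0 \<le> ker1 T x0 i x" "ker1 T x0 i x \<le> 1" unfolding ker1_def using cos_ge_minus_one cos_le_one by blast+
qed

lemma continuous_ker1 [continuous_intros]: "continuous_on S (ker1 T x0 i)"
  unfolding ker1_def[abs_def] by (intro continuous_intros) auto

lemma ker1_expo:
  fixes x0 :: "real^'n::finite" and i :: 'n
  defines "\<delta> \<equiv> (\<lambda>j. if j = i then 1 else 0 :: int)"
  shows "of_real (ker1 T x0 i x) = 1/2 + cis (- (pi / T * x0 $ i)) / 4 * expo (freq T \<delta>) x
     + cis (pi / T * x0 $ i) / 4 * expo (freq T (\<lambda>j. - \<delta> j)) x"
proof -
  have e: "expo (freq T \<delta>) x = cis (pi / T * x $ i)" "expo (freq T (\<lambda>j. - \<delta> j)) x = cis (- (pi / T * x $ i))"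
  proof -
    have "x \<bullet> freq T \<delta> = (\<Sum>j\<in>UNIV. if j = i then pi / T * x $ i else 0)"
      unfolding inner_vec_def by (rule sum.cong) (simp_all add: \<delta>_def)
    moreover have "x \<bullet> freq T (\<lambda>j. - \<delta> j) = (\<Sum>j\<in>UNIV. if j = i then - (pi / T * x $ i) else 0)"
      unfolding inner_vec_def by (rule sum.cong) (simp_all add: \<delta>_def)
    ultimately show "expo (freq T \<delta>) x = cis (pi / T * x $ i)" "expo (freq T (\<lambda>j. - \<delta> j)) x = cis (- (pi / T * x $ i))"
      by (simp_all add: expo_def)
  qed
  have "cis a + cis (- a) = 2 * of_real (cos a)" for a by (simp add: complex_eq_iff)
  from this[of "pi / T * x $ i - pi / T * x0 $ i"]
  have "complex_of_real (cos (pi / T * x $ i - pi / T * x0 $ i)) = (cis (- (pi / T * x0 $ i)) * cis (pi / T * x $ i) + cis (pi / T * x0 $ i) * cis (- (pi / T * x $ i))) / 2"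
    by (simp add: cis_mult)
  then show ?thesis unfolding e ker1_def right_diff_distrib by (simp add: add_divide_distrib)
qed

text \<open>The multipliers p for which all Fourier coefficients of d p vanish. As
  \<open>ker1\<close> is a trigonometric polynomial with frequencies 0 and +-1 in one coordinate,
  multiplication by it only shifts k, so the class is closed under it.\<close>

definition annihilates :: "real \<Rightarrow> (real^'n::finite \<Rightarrow> complex) \<Rightarrow> (real^'n \<Rightarrow> complex) \<Rightarrow> bool" where
  "annihilates T d p \<longleftrightarrow> continuous_on (cube T) p \<and> (\<forall>k. cint T (\<lambda>x. (d x * p x) * expo (freq T k) x) = 0)"

lemma annihilates_ker1:
  assumes d: "continuous_on (cube T) d" and p: "annihilates T d p"
  shows "annihilates T d (\<lambda>x. p x * of_real (ker1 T x0 i x))"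
  unfolding annihilates_def
proof (intro conjI allI)
  have pc: "continuous_on (cube T) p" using p by (simp add: annihilates_def)
  then show "continuous_on (cube T) (\<lambda>x. p x * of_real (ker1 T x0 i x))"
    by (intro continuous_intros)
  fix k :: "'a \<Rightarrow> int"
  define \<delta> where "\<delta> = (\<lambda>j. if j = i then 1 else 0 :: int)"
  have z: "cint T (\<lambda>x. (d x * p x) * expo (freq T k) x) = 0" for k using p by (simp add: annihilates_def)
  let ?u = "\<lambda>k x. (d x * p x) * expo (freq T k) x"
  have c: "continuous_on (cube T) (?u k)" for k by (intro continuous_intros d pc continuous_expo)
  have "d x * (p x * of_real (ker1 T x0 i x)) * expo (freq T k) x = 1/2 * ?u k x + (cis (- (pi / T * x0 $ i)) / 4 * ?u (\<lambda>j. k j + \<delta> j) x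
     + cis (pi / T * x0 $ i) / 4 * ?u (\<lambda>j. k j + - \<delta> j) x)" for x
  proof -
    have "complex_of_real (ker1 T x0 i x) = 1/2 + cis (- (pi / T * x0 $ i)) / 4 * expo (freq T \<delta>) x
     + cis (pi / T * x0 $ i) / 4 * expo (freq T (\<lambda>j. - \<delta> j)) x"
      unfolding \<delta>_def by (rule ker1_expo)
    moreover have "expo (freq T (\<lambda>j. k j + \<delta> j)) x = expo (freq T k) x * expo (freq T \<delta>) x"
      "expo (freq T (\<lambda>j. k j + - \<delta> j)) x = expo (freq T k) x * expo (freq T (\<lambda>j. - \<delta> j)) x"
      by (simp_all only: freq_add expo_mult)
    ultimately show ?thesis by (simp only: distrib_left distrib_right mult_ac add.assoc)
  qed
  then have "cint T (\<lambda>x. d x * (p x * of_real (ker1 T x0 i x)) * expo (freq T k) x) =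
     cint T (\<lambda>x. 1/2 * ?u k x + (cis (- (pi / T * x0 $ i)) / 4 * ?u (\<lambda>j. k j + \<delta> j) x
     + cis (pi / T * x0 $ i) / 4 * ?u (\<lambda>j. k j + - \<delta> j) x))" by presburger
  also have "\<dots> = 0"
    by (subst cint_add, (intro continuous_intros c)+, subst cint_add, (intro continuous_intros c)+)
       (simp only: cint_cmult z mult_zero_right add_0)
  finally show "cint T (\<lambda>x. d x * (p x * of_real (ker1 T x0 i x)) * expo (freq T k) x) = 0" .
qed

text \<open>For an interior point x0 this trigonometric polynomial has value 1 there and values in
  [0, 1) elsewhere in the cube; its powers act as a peak at x0 without any normalisation.\<close>

definition ker :: "real \<Rightarrow> real^'n::finite \<Rightarrow> real^'n \<Rightarrow> real" where
  "ker T x0 x = (\<Prod>i\<in>UNIV. ker1 T x0 i x)"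

lemma annihilates_ker:
  fixes d :: "real^'n::finite \<Rightarrow> complex"
  assumes d: "continuous_on (cube T) d" and z: "\<And>k. cint T (\<lambda>x. d x * expo (freq T k) x) = 0"
  shows "annihilates T d (\<lambda>x. of_real (ker T x0 x ^ m))"
proof (induction m)
  case 0 then show ?case using z by (simp add: annihilates_def)
next
  case (Suc m)
  have "annihilates T d (\<lambda>x. of_real (ker T x0 x ^ m) * of_real (\<Prod>i\<in>A. ker1 T x0 i x))" if "finite A" for A :: "'n set"
    using that
  proof (induction A rule: finite_induct)
    case empty then show ?case using Suc by simp
  next
    case (insert i A)
    from annihilates_ker1[OF d insert.IH, of x0 i] insert show ?case by (simp add: mult_ac)
  qed
  from this[OF finite, of UNIV] show ?case by (simp add: ker_def mult.commute)
qed

lemma ker_bounds: "0 \<le> ker T x0 x" "ker T x0 x \<le> 1"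
  unfolding ker_def using ker1_bounds by (auto intro!: prod_nonneg prod_le_1)

lemma continuous_ker: "continuous_on S (ker T x0)"
  unfolding ker_def[abs_def] by (intro continuous_intros)

text \<open>Since x0 is interior, every coordinate difference is strictly smaller than the period 2
  T, hence the cosine reaches 1 only where the coordinates agree.\<close>

lemma ker_less_1:
  fixes x0 x :: "real^'n::finite"
  assumes "T > 0" "x \<in> cube T" "\<And>i. \<bar>x0 $ i\<bar> < T" "x \<noteq> x0"
  shows "ker T x0 x < 1"
proof -
  obtain i where i: "x $ i \<noteq> x0 $ i" using assms(4) by (auto simp: vec_eq_iff)
  define \<theta> where "\<theta> = pi / T * (x $ i - x0 $ i)"
  have "\<bar>x $ i - x0 $ i\<bar> < 2 * T" using assms(2) assms(3)[of i] unfolding mem_cube by (smt (verit))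
  then have "pi / T * \<bar>x $ i - x0 $ i\<bar> < pi / T * (2 * T)" using assms(1) by (intro mult_strict_left_mono) auto
  moreover have "\<bar>\<theta>\<bar> = pi / T * \<bar>x $ i - x0 $ i\<bar>" using assms(1) by (simp only: \<theta>_def abs_mult) simp
  ultimately have "\<bar>\<theta>\<bar> < 2 * pi" using assms(1) by simp
  moreover have "\<theta> \<noteq> 0" using i assms(1) by (simp add: \<theta>_def)
  ultimately have ne: "cos \<theta> \<noteq> 1"
    using cos_one_2pi_int[of \<theta>] by (auto simp: abs_mult) 
  then have "ker1 T x0 i x < 1"
    using order_le_imp_less_or_eq[OF cos_le_one[of \<theta>]] unfolding ker1_def \<theta>_def[symmetric] by auto
  moreover have "ker T x0 x = ker1 T x0 i x * (\<Prod>j\<in>UNIV - {i}. ker1 T x0 j x)"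
    unfolding ker_def by (rule prod.remove) auto
  moreover have "(\<Prod>j\<in>UNIV - {i}. ker1 T x0 j x) \<le> 1" using ker1_bounds by (intro prod_le_1) auto
  ultimately show ?thesis
    using mult_left_mono[of "\<Prod>j\<in>UNIV - {i}. ker1 T x0 j x" 1 "ker1 T x0 i x"] ker1_bounds(1)[of T x0 i x] by simp
qed

text \<open>The powers of the kernel concentrate at the given point, so a continuous function all of whose
  Fourier coefficients vanish is zero there.\<close>
lemma fourier_uniqueness:
  fixes d :: "real^'n::finite \<Rightarrow> complex" and x0 :: "real^'n"
  assumes T: "T > 0" and d: "continuous_on (cube T) d"
    and z: "\<And>k. cint T (\<lambda>x. d x * expo (freq T k) x) = 0" and x0: "\<And>i. \<bar>x0 $ i\<bar> < T"
  shows "d x0 = 0"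
proof (rule ccontr)
  assume ne: "d x0 \<noteq> 0"
  \<comment> \<open>Normalised to be real with value 1 at x0. Positivity near x0 will contradict the
    vanishing of its integrals against the powers of the kernel.\<close>
  define e where "e = (\<lambda>x. Re (d x / d x0))"
  have ec: "continuous_on (cube T) e" unfolding e_def using ne by (intro continuous_intros d) auto
  have ex0: "e x0 = 1" using ne by (simp add: e_def)
  have int0: "(\<integral>x. indicator (cube T) x *\<^sub>R (e x * ker T x0 x ^ m) \<partial>lborel) = 0" for m
  proof -
    have "cint T (\<lambda>x. d x * of_real (ker T x0 x ^ m) * expo (freq T (\<lambda>i. 0)) x) = 0"
      using annihilates_ker[OF d z, of x0 m] unfolding annihilates_def by blast
    moreover have "expo (freq T (\<lambda>i. 0)) x = 1" for x :: "real^'n"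
      by (simp add: expo_def inner_vec_def)
    ultimately have "cint T (\<lambda>x. d x * of_real (ker T x0 x ^ m)) = 0" by simp
    then have "cint T (\<lambda>x. 1 / d x0 * (d x * of_real (ker T x0 x ^ m))) = 0" by (simp only: cint_cmult mult_zero_right)
    then have "Re (cint T (\<lambda>x. d x / d x0 * of_real (ker T x0 x ^ m))) = 0" by simp
    moreover have "Re (cint T (\<lambda>x. d x / d x0 * of_real (ker T x0 x ^ m)))
      = (\<integral>x. Re (indicator (cube T) x *\<^sub>R (d x / d x0 * of_real (ker T x0 x ^ m))) \<partial>lborel)"
      unfolding cint_def
      by (rule integral_Re[symmetric], rule cint_integrable) (use ne in \<open>auto intro!: continuous_intros d continuous_ker\<close>)
    moreover have "Re (indicator (cube T) x *\<^sub>R (d x / d x0 * of_real (ker T x0 x ^ m))) = indicator (cube T) x *\<^sub>R (e x * ker T x0 x ^ m)" for x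
    proof -
      have "Re (y *\<^sub>R (z * of_real w)) = y *\<^sub>R (Re z * w)" for y w and z :: complex by simp
      then show ?thesis unfolding e_def .
    qed
    ultimately show ?thesis by (simp only:)
  qed
  have "open {x::real^'n. \<forall>i. \<bar>x $ i\<bar> < T}"
  proof -
    have "{x::real^'n. \<forall>i. \<bar>x $ i\<bar> < T} = (\<Inter>i. {x. \<bar>x $ i\<bar> < T})" by auto
    then show ?thesis by (auto intro!: open_INT open_Collect_less continuous_intros)
  qed
  then obtain r where r: "r > 0" "ball x0 r \<subseteq> cube T"
  proof -
    assume o: "open {x::real^'n. \<forall>i. \<bar>x $ i\<bar> < T}"
    have "x0 \<in> {x::real^'n. \<forall>i. \<bar>x $ i\<bar> < T}" using x0 by simp
    from openE[OF o this] obtain r where r: "0 < r" "ball x0 r \<subseteq> {x::real^'n. \<forall>i. \<bar>x $ i\<bar> < T}" .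
    have "{x::real^'n. \<forall>i. \<bar>x $ i\<bar> < T} \<subseteq> cube T" unfolding mem_cube subset_iff by (auto intro: less_imp_le)
    with r that show thesis by blast
  qed
  have "x0 \<in> cube T" using x0 by (auto simp: mem_cube intro: less_imp_le)
  then obtain \<delta>0 where \<delta>0: "\<delta>0 > 0" "\<And>x. x \<in> cube T \<Longrightarrow> dist x x0 < \<delta>0 \<Longrightarrow> dist (e x) (e x0) < 1/2"
    using ec unfolding continuous_on_iff by (metis half_gt_zero_iff zero_less_one)
  define \<delta> where "\<delta> = min r \<delta>0"
  have \<delta>: "\<delta> > 0" "ball x0 \<delta> \<subseteq> cube T" using r \<delta>0 by (auto simp: \<delta>_def)
  have eh: "e x \<ge> 1/2" if "x \<in> ball x0 \<delta>" for x
    using \<delta>0(2)[of x] that \<delta>(2) ex0 by (auto simp: \<delta>_def dist_commute dist_real_def abs_if split: if_splits)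
  obtain B where B: "B > 0" "\<And>x. x \<in> cube T \<Longrightarrow> \<bar>e x\<bar> \<le> B"
  proof -
    have "bounded (e ` cube T)" using compact_continuous_image[OF ec compact_cube] compact_imp_bounded by blast
    then show ?thesis using that unfolding bounded_pos by auto
  qed
  obtain q where q: "0 \<le> q" "q < 1" "\<And>x. x \<in> cube T - ball x0 \<delta> \<Longrightarrow> ker T x0 x \<le> q"
  proof (cases "cube T - ball x0 \<delta> = {}")
    case True
    show ?thesis by (rule that[of 0]) (use True in auto)
  next
    case False
    have "compact (cube T - ball x0 \<delta>)" by (rule compact_diff[OF compact_cube open_ball])
    from continuous_attains_sup[OF this False continuous_ker, of T x0]
    obtain y where y: "y \<in> cube T - ball x0 \<delta>" "\<And>x. x \<in> cube T - ball x0 \<delta> \<Longrightarrow> ker T x0 x \<le> ker T x0 y" by blast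
    moreover have "ker T x0 y < 1" using y \<delta> by (intro ker_less_1[OF T _ x0]) auto
    ultimately show ?thesis using that[of "ker T x0 y"] ker_bounds by blast
  qed
  \<comment> \<open>The kernel is at most q off the ball and at least q' > q on a smaller ball, so
    relative to the latter the contribution from outside is negligible: (q / q') ^ m tends to
    0.\<close>
  define q' where "q' = (1 + q) / 2"
  have q': "q < q'" "0 < q'" "q' < 1" using q by (auto simp: q'_def)
  have "ker T x0 x0 = 1" by (simp add: ker_def ker1_def)
  moreover have "isCont (ker T x0) x0" using continuous_ker[of UNIV T x0] by (simp add: continuous_on_eq_continuous_at)
  ultimately obtain \<delta>1 where \<delta>1: "\<delta>1 > 0" "\<And>x. dist x x0 < \<delta>1 \<Longrightarrow> dist (ker T x0 x) 1 < 1 - q'"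
    using q' unfolding continuous_at_eps_delta by (metis diff_gt_0_iff_gt)
  define \<delta>' where "\<delta>' = min \<delta> \<delta>1"
  have \<delta>': "\<delta>' > 0" "ball x0 \<delta>' \<subseteq> ball x0 \<delta>" using \<delta> \<delta>1 by (auto simp: \<delta>'_def)
  have kq: "ker T x0 x \<ge> q'" if "x \<in> ball x0 \<delta>'" for x
    using \<delta>1(2)[of x] that by (auto simp: \<delta>'_def dist_commute dist_real_def abs_if split: if_splits)
  define v where "v = measure lborel (ball x0 \<delta>')"
  have v: "v > 0" using content_ball_pos[OF \<delta>'(1), of x0] by (simp add: v_def)
  define W where "W = measure lborel (cube T :: (real^'n) set)"
  have ib: "integrable lborel (indicator (ball x0 \<delta>') :: real^'n \<Rightarrow> real)"
    using emeasure_lborel_ball_finite[of x0 \<delta>'] by (intro integrable_real_indicator) auto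
  have ic: "integrable lborel (indicator (cube T) :: real^'n \<Rightarrow> real)"
    unfolding cube_def using emeasure_lborel_cbox_finite by (intro integrable_real_indicator) auto
  have main: "1/2 * v \<le> B * W * (q / q') ^ m" for m
  proof -
    \<comment> \<open>The integrand is at least q' ^ m / 2 on the small ball, nonnegative on the
      rest of the larger ball and at least - B q ^ m elsewhere in the cube.\<close>
    have "(\<integral>x. 1/2 * q' ^ m * indicator (ball x0 \<delta>') x - B * q ^ m * indicator (cube T) x \<partial>lborel)
       \<le> (\<integral>x. indicator (cube T) x *\<^sub>R (e x * ker T x0 x ^ m) \<partial>lborel)"
    proof (rule integral_mono)
      show "integrable lborel (\<lambda>x. 1/2 * q' ^ m * indicator (ball x0 \<delta>') x - B * q ^ m * indicator (cube T) x)"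
        by (intro Bochner_Integration.integrable_diff integrable_mult_right ib ic)
      show "integrable lborel (\<lambda>x. indicator (cube T) x *\<^sub>R (e x * ker T x0 x ^ m))"
        by (intro cint_integrable continuous_intros ec continuous_ker)
      fix x
      have qm: "0 \<le> B * q ^ m" "0 \<le> q' ^ m" using B q q' by auto
      consider "x \<in> ball x0 \<delta>'" | "x \<in> ball x0 \<delta>" "x \<notin> ball x0 \<delta>'" | "x \<in> cube T - ball x0 \<delta>" "x \<notin> ball x0 \<delta>'" | "x \<notin> cube T" "x \<notin> ball x0 \<delta>'"
        using \<delta>(2) \<delta>'(2) by blast
      then show "1/2 * q' ^ m * indicator (ball x0 \<delta>') x - B * q ^ m * indicator (cube T) x \<le> indicator (cube T) x *\<^sub>R (e x * ker T x0 x ^ m)"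
      proof cases
        case 1
        then have x: "x \<in> ball x0 \<delta>" "x \<in> cube T" using \<delta> \<delta>' by auto
        have "1/2 * q' ^ m \<le> e x * ker T x0 x ^ m"
          using eh[OF x(1)] kq[OF 1] q' by (intro mult_mono power_mono) auto
        with 1 x qm show ?thesis by (simp del: mem_ball)
      next
        case 2
        then have x: "x \<in> cube T" using \<delta> by auto
        have "0 \<le> e x * ker T x0 x ^ m" using eh[OF 2(1)] ker_bounds(1)[of T x0 x] by (intro mult_nonneg_nonneg zero_le_power) auto
        with 2 x qm show ?thesis by (simp del: mem_ball)
      next
        case 3
        have "\<bar>e x * ker T x0 x ^ m\<bar> \<le> B * q ^ m"
          unfolding abs_mult power_abs using 3 B q ker_bounds(1)[of T x0 x] by (intro mult_mono power_mono) auto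
        with 3 qm show ?thesis by (simp del: mem_ball)
      next
        case 4 then show ?thesis by (simp del: mem_ball)
      qed
    qed
    also have "\<dots> = 0" by (rule int0)
    also have "(\<integral>x. 1/2 * q' ^ m * indicator (ball x0 \<delta>') x - B * q ^ m * indicator (cube T) x \<partial>lborel) = 1/2 * q' ^ m * v - B * q ^ m * W"
      using ib ic by (simp add: v_def W_def)
    finally show ?thesis using q' by (simp add: power_divide field_simps)
  qed
  have "(\<lambda>m. B * W * (q / q') ^ m) \<longlonglongrightarrow> B * W * 0"
    using q q' by (intro tendsto_intros LIMSEQ_power_zero) (auto simp: abs_div_pos)
  then have "1/2 * v \<le> B * W * 0" by (rule LIMSEQ_le_const) (use main in blast)
  with v show False by simp
qed

text \<open>The series converges uniformly to a continuous G with the same coefficients as h, so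
  both agree at interior points by \<open>fourier_uniqueness\<close>.\<close>

lemma fourier_inversion:
  fixes h :: "real^'n::finite \<Rightarrow> complex" and x0 :: "real^'n"
  assumes T: "T > 0" and h: "smooth_on UNIV h" "\<And>x. x \<notin> cube T \<Longrightarrow> h x = 0" and x0: "\<And>i. \<bar>x0 $ i\<bar> < T"
    and sum: "(\<lambda>k. cmod (fcoef T h k)) summable_on UNIV"
  shows "((\<lambda>k. fcoef T h k * expo (freq T k) x0) has_sum h x0) UNIV"
proof -
  let ?f = "\<lambda>k x. fcoef T h k * expo (freq T k) x"
  define G where "G = (\<lambda>x. \<Sum>\<^sub>\<infinity>k. ?f k x)"
  have ul: "uniform_limit UNIV (\<lambda>F x. \<Sum>k\<in>F. ?f k x) G (finite_subsets_at_top UNIV)"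
    unfolding G_def by (rule Weierstrass_m_test_general[OF _ sum]) (simp add: norm_mult)
  have Gc: "continuous_on UNIV G"
    by (rule uniform_limit_theorem[OF _ ul]) (auto intro!: always_eventually continuous_intros continuous_expo)
  have Gc': "continuous_on (cube T) G" using Gc continuous_on_subset by blast
  have hc: "continuous_on (cube T) h" using smooth_on_continuous[OF h(1)] continuous_on_subset by blast
  let ?V = "complex_of_real ((2 * T) ^ CARD('n))"
  have V: "?V \<noteq> 0" using T by simp
  have "cint T (\<lambda>x. (h x - G x) * expo (freq T k) x) = 0" for k
  proof -
    \<comment> \<open>Integration against the exponential with index k extracts the coefficient with
      index - k.\<close>
    define k' where "k' = (\<lambda>i. - k i)"
    have fk: "freq T k = - freq T k'" by (simp add: k'_def vec_eq_iff)
    have "cmod (cint T (\<lambda>x. (h x - G x) * expo (freq T k) x)) \<le> (2 * T) ^ CARD('n) * \<epsilon>" if e: "\<epsilon> > 0" for \<epsilon>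
    proof -
      have "\<forall>\<^sub>F F in finite_subsets_at_top UNIV. \<forall>x\<in>UNIV. dist (\<Sum>k\<in>F. ?f k x) (G x) < \<epsilon>"
        using ul e unfolding uniform_limit_iff by blast
      moreover have "\<forall>\<^sub>F F in finite_subsets_at_top UNIV. finite F \<and> k' \<in> F"
        unfolding eventually_finite_subsets_at_top by (rule exI[of _ "{k'}"]) auto
      ultimately have "\<forall>\<^sub>F F in finite_subsets_at_top UNIV. (\<forall>x\<in>UNIV. dist (\<Sum>k\<in>F. ?f k x) (G x) < \<epsilon>) \<and> finite F \<and> k' \<in> F"
        by (rule eventually_conj)
      from eventually_happens'[OF finite_subsets_at_top_neq_bot this]
      \<comment> \<open>A partial sum that contains k' has the same coefficient there as h, and it
        is uniformly \<epsilon>-close to G.\<close>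
      obtain F where F: "\<forall>x. dist (\<Sum>k\<in>F. ?f k x) (G x) < \<epsilon>" "finite F" "k' \<in> F" by blast
      let ?S = "\<lambda>x. \<Sum>k\<in>F. ?f k x"
      have Sc: "continuous_on (cube T) ?S" by (intro continuous_intros continuous_expo)
      have "cint T (\<lambda>x. ?S x * expo (freq T k) x) = cint T (\<lambda>x. \<Sum>j\<in>F. fcoef T h j * expo (freq T (\<lambda>i. j i - k' i)) x)"
      proof -
        have "?f j x * expo (freq T k) x = fcoef T h j * expo (freq T (\<lambda>i. j i - k' i)) x" for j x
          unfolding fk by (simp add: freq_diff mult.assoc expo_mult)
        then show ?thesis by (simp only: sum_distrib_right)
      qed
      also have "\<dots> = (\<Sum>j\<in>F. fcoef T h j * cint T (expo (freq T (\<lambda>i. j i - k' i))))"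
      proof (subst cint_sum)
        show "continuous_on (cube T) (\<lambda>x. fcoef T h j * expo (freq T (\<lambda>i. j i - k' i)) x)" for j
          by (intro continuous_intros continuous_expo)
      qed (simp only: cint_cmult)
      also have "\<dots> = (\<Sum>j\<in>F. if j = k' then fcoef T h j * ?V else 0)"
      proof (rule sum.cong)
        fix j
        have "((\<lambda>i. j i - k' i) = (\<lambda>i. 0)) \<longleftrightarrow> j = k'" by (auto simp: fun_eq_iff)
        then show "fcoef T h j * cint T (expo (freq T (\<lambda>i. j i - k' i))) = (if j = k' then fcoef T h j * ?V else 0)"
          unfolding cint_expo[OF T] by simp
      qed simp
      also have "\<dots> = fcoef T h k' * ?V" using F by simp
      also have "\<dots> = cint T (\<lambda>x. h x * expo (freq T k) x)" unfolding fcoef_expo fk using V by simp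
      finally have S: "cint T (\<lambda>x. ?S x * expo (freq T k) x) = cint T (\<lambda>x. h x * expo (freq T k) x)" .
      have "cint T (\<lambda>x. (h x - G x) * expo (freq T k) x) = cint T (\<lambda>x. h x * expo (freq T k) x) - cint T (\<lambda>x. G x * expo (freq T k) x)"
        unfolding left_diff_distrib by (rule cint_diff) (intro continuous_intros hc Gc' continuous_expo)+
      also have "\<dots> = cint T (\<lambda>x. (?S x - G x) * expo (freq T k) x)"
        unfolding left_diff_distrib S[symmetric] by (rule cint_diff[symmetric]) (intro continuous_intros Sc Gc' continuous_expo)+
      finally have eq: "cint T (\<lambda>x. (h x - G x) * expo (freq T k) x) = cint T (\<lambda>x. (?S x - G x) * expo (freq T k) x)" .
      show ?thesis unfolding eq
      proof (rule cint_norm_bound[OF T])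
        show "continuous_on (cube T) (\<lambda>x. (?S x - G x) * expo (freq T k) x)" by (intro continuous_intros Sc Gc' continuous_expo)
        show "cmod ((?S x - G x) * expo (freq T k) x) \<le> \<epsilon>" for x
          using F(1)[rule_format, of x] by (simp add: norm_mult dist_norm)
      qed
    qed
    then have "cmod (cint T (\<lambda>x. (h x - G x) * expo (freq T k) x)) \<le> 0 + \<epsilon>" if "\<epsilon> > 0" for \<epsilon>
      using that[THEN divide_pos_pos, of "(2 * T) ^ CARD('n)"] T by fastforce
    then have "cmod (cint T (\<lambda>x. (h x - G x) * expo (freq T k) x)) \<le> 0" by (rule field_le_epsilon)
    then show ?thesis by simp
  qed
  then have "h x0 - G x0 = 0"
    by (rule fourier_uniqueness[OF T continuous_on_diff[OF hc Gc'] _ x0])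
  then have "h x0 = G x0" by simp
  moreover have "(\<lambda>k. ?f k x0) summable_on UNIV"
    by (rule abs_summable_summable) (use sum in \<open>simp add: norm_mult\<close>)
  ultimately show ?thesis using has_sum_infsum unfolding G_def by metis
qed

section \<open>Distributions and equicontinuity\<close>

lemma test_funI:
  assumes "smooth_on UNIV \<phi>" "compact K" "K \<subseteq> \<Omega>" "\<And>x. x \<notin> K \<Longrightarrow> \<phi> x = 0"
  shows "test_fun \<Omega> \<phi>" "tsupp \<phi> \<subseteq> K"
proof -
  show s: "tsupp \<phi> \<subseteq> K" unfolding tsupp_def
    by (rule closure_minimal) (use assms compact_imp_closed in auto)
  have "compact (tsupp \<phi>)" unfolding tsupp_def
    using compact_Int_closed[OF assms(2) closed_closure, of "{x. \<phi> x \<noteq> 0}"] s[unfolded tsupp_def]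
    by (simp add: inf.absorb2)
  then show "test_fun \<Omega> \<phi>" using s assms by (auto simp: test_fun_def)
qed

lemma distribution_order:
  fixes u :: "(real^'n::finite \<Rightarrow> complex) \<Rightarrow> complex"
  assumes "distribution \<Omega> u" "compact K" "K \<subseteq> \<Omega>"
  obtains C k where "0 \<le> C" "\<And>\<phi> M. smooth_on UNIV \<phi> \<Longrightarrow> (\<And>x. x \<notin> K \<Longrightarrow> \<phi> x = 0) \<Longrightarrow> 0 \<le> M \<Longrightarrow>
     (\<And>L x. length L \<le> k \<Longrightarrow> x \<in> K \<Longrightarrow> cmod (iter_partial L \<phi> x) \<le> M) \<Longrightarrow> cmod (u \<phi>) \<le> C * M"
proof -
  obtain C k where C: "\<And>\<phi> M. test_fun \<Omega> \<phi> \<Longrightarrow> tsupp \<phi> \<subseteq> K \<Longrightarrow>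
         (\<forall>\<alpha> x. mabs \<alpha> \<le> k \<and> x \<in> K \<longrightarrow> cmod (dpartial \<alpha> \<phi> x) \<le> M) \<Longrightarrow> cmod (u \<phi>) \<le> C * M"
    using assms unfolding distribution_def by metis
  show ?thesis
  proof (rule that[of "max C 0" k])
    fix \<phi> :: "real^'n \<Rightarrow> complex" and M
    assume a: "smooth_on UNIV \<phi>" "\<And>x. x \<notin> K \<Longrightarrow> \<phi> x = 0" "0 \<le> M"
      "\<And>L x. length L \<le> k \<Longrightarrow> x \<in> K \<Longrightarrow> cmod (iter_partial L \<phi> x) \<le> M"
    have "cmod (u \<phi>) \<le> C * M"
      by (rule C[OF test_funI[OF a(1) assms(2,3) a(2)]])
         (use a(4) in \<open>auto simp: dpartial_mlist length_mlist\<close>)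
    also have "\<dots> \<le> max C 0 * M" using a(3) by (intro mult_right_mono) auto
    finally show "cmod (u \<phi>) \<le> max C 0 * M" .
  qed simp
qed

lemma distribution_add: "distribution \<Omega> u \<Longrightarrow> test_fun \<Omega> f \<Longrightarrow> test_fun \<Omega> g \<Longrightarrow> u (\<lambda>x. f x + g x) = u f + u g"
  by (simp add: distribution_def)

lemma distribution_cmult: "distribution \<Omega> u \<Longrightarrow> test_fun \<Omega> f \<Longrightarrow> u (\<lambda>x. c * f x) = c * u f"
  by (simp add: distribution_def)

lemma distribution_sum:
  assumes "distribution \<Omega> u" "compact K" "K \<subseteq> \<Omega>" "finite A"
    "\<And>a. a \<in> A \<Longrightarrow> smooth_on UNIV (f a)" "\<And>a x. a \<in> A \<Longrightarrow> x \<notin> K \<Longrightarrow> f a x = 0"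
  shows "u (\<lambda>x. \<Sum>a\<in>A. f a x) = (\<Sum>a\<in>A. u (f a))"
  using assms(4-)
proof (induction A rule: finite_induct)
  case empty
  have "u (\<lambda>x. 0 * (0::complex)) = 0 * u (\<lambda>x. 0)"
    by (rule distribution_cmult[OF assms(1) test_funI(1)[OF smooth_on_const assms(2,3)]]) auto
  then show ?case by simp
next
  case (insert a A)
  have "u (\<lambda>x. f a x + (\<Sum>a\<in>A. f a x)) = u (f a) + u (\<lambda>x. \<Sum>a\<in>A. f a x)"
    by (intro distribution_add[OF assms(1)] test_funI(1)[OF _ assms(2,3)] smooth_on_sum)
       (use insert.prems in auto)
  with insert show ?case by simp
qed

lemma leibniz_uniform_bound:
  fixes f g :: "real^'n::finite \<Rightarrow> complex"
  assumes "open S" "x \<in> S" "smooth_on S f" "smooth_on S g" "length L \<le> k" "0 \<le> \<alpha>" "0 \<le> \<eta>"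
    and "\<And>K. length K \<le> k \<Longrightarrow> cmod (iter_partial K f x) \<le> \<alpha>"
    and "\<And>K. length K \<le> k \<Longrightarrow> cmod (iter_partial K g x) \<le> \<eta>"
  shows "cmod (iter_partial L (\<lambda>x. f x * g x) x) \<le> 2 ^ k * \<alpha> * \<eta>"
proof -
  have "cmod (iter_partial L (\<lambda>x. f x * g x) x) \<le> (\<Sum>j\<le>length L. real (length L choose j) * \<alpha> * \<eta>)"
    by (rule leibniz_bound[OF assms(1-4), where \<alpha> = "\<lambda>_. \<alpha>" and \<eta> = "\<lambda>_. \<eta>"]) (use assms in auto)
  also have "\<dots> = real (\<Sum>j\<le>length L. length L choose j) * \<alpha> * \<eta>"
    by (simp add: sum_distrib_right)
  also have "\<dots> = 2 ^ length L * \<alpha> * \<eta>" by (simp add: choose_row_sum)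
  also have "\<dots> \<le> 2 ^ k * \<alpha> * \<eta>" using assms by (intro mult_right_mono power_increasing) auto
  finally show ?thesis .
qed

lemma iter_partial_bounded_on_compact:
  fixes f :: "real^'n::finite \<Rightarrow> complex"
  assumes "smooth_on S f" "compact K" "K \<subseteq> S"
  obtains B where "0 \<le> B" "\<And>L x. length L \<le> k \<Longrightarrow> x \<in> K \<Longrightarrow> cmod (iter_partial L f x) \<le> B"
proof -
  have "\<exists>B\<ge>0. \<forall>x\<in>K. cmod (iter_partial L f x) \<le> B" for L
  proof -
    have "continuous_on K (iter_partial L f)"
      using smooth_on_continuous_iter[OF assms(1)] assms(3) continuous_on_subset by blast
    then have "bounded (iter_partial L f ` K)" using compact_continuous_image assms(2) compact_imp_bounded by blast
    then show ?thesis unfolding bounded_pos by (auto intro: less_imp_le)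
  qed
  then obtain b where b: "\<And>L. 0 \<le> b L" "\<And>L x. x \<in> K \<Longrightarrow> cmod (iter_partial L f x) \<le> b L" by metis
  have fin: "finite {L :: 'n list. length L \<le> k}"
    using finite_lists_length_le[of "UNIV :: 'n set" k] by simp
  show ?thesis
  proof (rule that[of "\<Sum>L\<in>{L. length L \<le> k}. b L"])
    show "cmod (iter_partial L f x) \<le> (\<Sum>L\<in>{L. length L \<le> k}. b L)" if "length L \<le> k" "x \<in> K" for L x
    proof -
      have "b L \<le> (\<Sum>L\<in>{L. length L \<le> k}. b L)"
        by (rule member_le_sum) (use fin b that in auto)
      with b(2)[OF that(2), of L] show ?thesis by linarith
    qed
  qed (simp add: sum_nonneg b)
qed

lemma comp_distribution_mult:
  fixes w :: "(real^'n::finite \<Rightarrow> complex) \<Rightarrow> complex"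
  assumes "open \<Omega>" "distribution \<Omega> w" "smooth_on UNIV \<zeta>" "compact K" "K \<noteq> {}" "K \<subseteq> \<Omega>" "\<And>x. x \<notin> K \<Longrightarrow> \<zeta> x = 0"
  shows "comp_distribution \<Omega> (\<lambda>\<phi>. w (\<lambda>x. \<zeta> x * \<phi> x))"
proof -
  have sm: "smooth_on UNIV (\<lambda>x. \<zeta> x * f x)" if "smooth_on \<Omega> f" for f
    by (rule smooth_on_zero_ext[OF assms(1) _ compact_imp_closed[OF assms(4)] assms(6)])
       (use assms that smooth_on_subset[OF assms(3)] in \<open>auto intro!: smooth_on_mult\<close>)
  have tf: "test_fun \<Omega> (\<lambda>x. \<zeta> x * f x)" if "smooth_on \<Omega> f" for f
    by (rule test_funI(1)[OF sm[OF that] assms(4,6)]) (use assms in auto)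
  obtain C k where C: "0 \<le> C" "\<And>\<phi> M. smooth_on UNIV \<phi> \<Longrightarrow> (\<And>x. x \<notin> K \<Longrightarrow> \<phi> x = 0) \<Longrightarrow> 0 \<le> M \<Longrightarrow>
     (\<And>L x. length L \<le> k \<Longrightarrow> x \<in> K \<Longrightarrow> cmod (iter_partial L \<phi> x) \<le> M) \<Longrightarrow> cmod (w \<phi>) \<le> C * M"
    using distribution_order[OF assms(2,4,6)] by blast
  obtain B where B: "0 \<le> B" "\<And>L x. length L \<le> k \<Longrightarrow> x \<in> K \<Longrightarrow> cmod (iter_partial L \<zeta> x) \<le> B"
    using iter_partial_bounded_on_compact[OF assms(3,4), of k] by auto
  have bd: "cmod (w (\<lambda>x. \<zeta> x * f x)) \<le> (C * 2 ^ k * B) * M"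
    if f: "smooth_on \<Omega> f" and M: "\<forall>\<alpha> x. mabs \<alpha> \<le> k \<and> x \<in> K \<longrightarrow> cmod (dpartial \<alpha> f x) \<le> M" for f M
  proof -
    have M': "cmod (iter_partial L f x) \<le> M" if "length L \<le> k" "x \<in> K" for L x
      using M iter_partial_dpartial[OF assms(1) f, of x L] that assms(6) by (auto simp: mabs_count_list)
    \<comment> \<open>M is known only as an upper bound on K, so its sign comes from a point of
      K.\<close>
    obtain y where "y \<in> K" using assms(5) by blast
    then have M0: "0 \<le> M" using M'[of "[]" y] norm_ge_zero order_trans by (metis le0 list.size(3))
    have "cmod (w (\<lambda>x. \<zeta> x * f x)) \<le> C * (2 ^ k * B * M)"
    proof (rule C(2)[OF sm[OF f]])
      show "cmod (iter_partial L (\<lambda>x. \<zeta> x * f x) x) \<le> 2 ^ k * B * M" if "length L \<le> k" "x \<in> K" for L x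
        by (rule leibniz_uniform_bound[OF assms(1) _ smooth_on_subset[OF assms(3)] f that(1) B(1) M0])
           (use that assms(6) B M' in auto)
    qed (use assms(7) B M0 in auto)
    then show ?thesis by (simp add: mult_ac)
  qed
  show ?thesis unfolding comp_distribution_def
  proof (intro conjI allI impI)
    show "w (\<lambda>x. \<zeta> x * (f x + g x)) = w (\<lambda>x. \<zeta> x * f x) + w (\<lambda>x. \<zeta> x * g x)"
      if "smooth_on \<Omega> f \<and> smooth_on \<Omega> g" for f g
      using distribution_add[OF assms(2) tf tf, of f g] that by (simp add: distrib_left)
    show "w (\<lambda>x. \<zeta> x * (c * f x)) = c * w (\<lambda>x. \<zeta> x * f x)" if "smooth_on \<Omega> f" for c f
      using distribution_cmult[OF assms(2) tf[OF that], of c] by (simp add: mult_ac)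
    show "\<exists>K C k. compact K \<and> K \<subseteq> \<Omega> \<and> (\<forall>f M. smooth_on \<Omega> f \<and>
         (\<forall>\<alpha> x. mabs \<alpha> \<le> k \<and> x \<in> K \<longrightarrow> cmod (dpartial \<alpha> f x) \<le> M) \<longrightarrow> cmod (w (\<lambda>x. \<zeta> x * f x)) \<le> C * M)"
      by (rule exI[of _ K], rule exI[of _ "C * 2 ^ k * B"], rule exI[of _ k]) (use assms bd in blast)
  qed
qed

lemma bounded_seq_const:
  fixes T :: "(real^'n::finite \<Rightarrow> complex) \<Rightarrow> complex"
  assumes "comp_distribution \<Omega> T"
  shows "bounded_seq_E' \<Omega> (\<lambda>N. T)"
  unfolding bounded_seq_E'_def
proof (intro conjI allI impI assms)
  fix B assume B: "bounded_E \<Omega> B"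
  obtain K C k where K: "compact K" "K \<subseteq> \<Omega>" and C: "\<And>f M. smooth_on \<Omega> f \<Longrightarrow>
         (\<forall>\<alpha> x. mabs \<alpha> \<le> k \<and> x \<in> K \<longrightarrow> cmod (dpartial \<alpha> f x) \<le> M) \<Longrightarrow> cmod (T f) \<le> C * M"
    using assms unfolding comp_distribution_def by metis
  have "\<forall>\<alpha>. \<exists>M. \<forall>f\<in>B. \<forall>x\<in>K. cmod (dpartial \<alpha> f x) \<le> M"
    using B K unfolding bounded_E_def by blast
  then obtain m where m: "\<And>\<alpha> f x. f \<in> B \<Longrightarrow> x \<in> K \<Longrightarrow> cmod (dpartial \<alpha> f x) \<le> m \<alpha>" by metis
  define M where "M = (\<Sum>\<alpha>\<in>{\<alpha>::'n \<Rightarrow> nat. mabs \<alpha> \<le> k}. \<bar>m \<alpha>\<bar>)"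
  have "cmod (T f) \<le> C * M" if "f \<in> B" for f
  proof (rule C)
    show "smooth_on \<Omega> f" using B that by (auto simp: bounded_E_def)
    show "\<forall>\<alpha> x. mabs \<alpha> \<le> k \<and> x \<in> K \<longrightarrow> cmod (dpartial \<alpha> f x) \<le> M"
    proof (intro allI impI)
      fix \<alpha> :: "'n \<Rightarrow> nat" and x assume a: "mabs \<alpha> \<le> k \<and> x \<in> K"
      have "cmod (dpartial \<alpha> f x) \<le> \<bar>m \<alpha>\<bar>" using m[OF that, of x \<alpha>] a by linarith
      also have "\<dots> \<le> M" unfolding M_def
        by (rule member_le_sum) (use a finite_mabs_le[of k] in auto)
      finally show "cmod (dpartial \<alpha> f x) \<le> M" .
    qed
  qed
  then show "\<exists>M. \<forall>N. \<forall>f\<in>B. cmod (T f) \<le> M" by blast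
qed

text \<open>If the family were not equicontinuous, suitably rescaled counterexamples would form a bounded set
  of smooth functions on which the family is unbounded.\<close>
lemma bounded_seq_equicontinuous:
  fixes U :: "nat \<Rightarrow> (real^'n::finite \<Rightarrow> complex) \<Rightarrow> complex"
  assumes "open \<Omega>" "bounded_seq_E' \<Omega> U"
  obtains K C k where "compact K" "K \<subseteq> \<Omega>" "0 \<le> C"
    "\<And>N f M. smooth_on \<Omega> f \<Longrightarrow> 0 \<le> M \<Longrightarrow> (\<And>L x. length L \<le> k \<Longrightarrow> x \<in> K \<Longrightarrow> cmod (iter_partial L f x) \<le> M)
       \<Longrightarrow> cmod (U N f) \<le> C * M"
proof -
  \<comment> \<open>A compact exhaustion of \<Omega>: equicontinuity is tested with derivatives up
    to order j on \<open>E j\<close>, so that one index controls both the set and the order.\<close>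
  obtain E where E: "\<And>n. compact (E n)" "\<And>n. E n \<subseteq> \<Omega>" "\<And>n. E n \<subseteq> interior (E (Suc n))"
    "\<Union> (range E) = \<Omega>" "\<And>K. compact K \<Longrightarrow> K \<subseteq> \<Omega> \<Longrightarrow> \<exists>N. \<forall>n\<ge>N. K \<subseteq> E n"
  proof (rule open_Union_compact_subsets[OF assms(1)], goal_cases)
    case (1 C)
    show ?case by (rule 1(1)[OF 1(2-6)])
  qed
  have lin: "U N (\<lambda>x. c * f x) = c * U N f" if "smooth_on \<Omega> f" for N c f
    using assms(2) that unfolding bounded_seq_E'_def comp_distribution_def by blast
  have "\<exists>j. \<forall>N f M. smooth_on \<Omega> f \<longrightarrow> 0 \<le> M \<longrightarrow> (\<forall>L x. length L \<le> j \<longrightarrow> x \<in> E j \<longrightarrow> cmod (iter_partial L f x) \<le> M)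
       \<longrightarrow> cmod (U N f) \<le> real j * M"
  proof (rule ccontr)
    assume "\<not> ?thesis"
    then have "\<forall>j. \<exists>N f M. smooth_on \<Omega> f \<and> 0 \<le> M \<and> (\<forall>L x. length L \<le> j \<longrightarrow> x \<in> E j \<longrightarrow> cmod (iter_partial L f x) \<le> M)
       \<and> real j * M < cmod (U N f)" by (meson not_le)
    then obtain N f M where f: "\<And>j. smooth_on \<Omega> (f j)" "\<And>j. 0 \<le> M j"
       "\<And>j L x. length L \<le> j \<Longrightarrow> x \<in> E j \<Longrightarrow> cmod (iter_partial L (f j) x) \<le> M j" "\<And>j. real j * M j < cmod (U (N j) (f j))"
      by metis
    \<comment> \<open>Rescaling makes the seminorm of order j on \<open>E j\<close> at most 1 while
      the functional stays at least j. When the seminorm bound is 0, the value of the functional is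
      still nonzero, so the factor can be taken as large as needed.\<close>
    define c where "c = (\<lambda>j. if M j = 0 then real j / cmod (U (N j) (f j)) else 1 / M j)"
    define g where "g = (\<lambda>j x. of_real (c j) * f j x)"
    have gs: "smooth_on \<Omega> (g j)" for j unfolding g_def by (intro smooth_on_cmult assms f)
    have gi: "cmod (iter_partial L (g j) x) \<le> 1" if "length L \<le> j" "x \<in> E j" for L j x
    proof -
      have x: "x \<in> \<Omega>" using that E by blast
      have c0: "0 \<le> c j" using f(2)[of j] by (simp add: c_def)
      have "cmod (iter_partial L (g j) x) = c j * cmod (iter_partial L (f j) x)"
        unfolding g_def iter_partial_cmult[OF assms(1) f(1) x] norm_mult using c0 by simp
      also have "\<dots> \<le> c j * M j" using f(3)[OF that] c0 by (rule mult_left_mono)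
      also have "\<dots> \<le> 1" by (simp add: c_def)
      finally show ?thesis .
    qed
    have gU: "real j \<le> cmod (U (N j) (g j))" for j
    proof -
      have "cmod (U (N j) (g j)) = \<bar>c j\<bar> * cmod (U (N j) (f j))"
        unfolding g_def lin[OF f(1)] norm_mult norm_of_real ..
      moreover have "real j \<le> \<bar>c j\<bar> * cmod (U (N j) (f j))"
      proof (cases "M j = 0")
        case True then show ?thesis using f(4)[of j] by (simp add: c_def)
      next
        case False
        then have "0 < M j" using f(2)[of j] by simp
        then show ?thesis using f(4)[of j] by (simp add: c_def field_simps)
      qed
      ultimately show ?thesis by simp
    qed
    have "bounded_E \<Omega> (range g)" unfolding bounded_E_def
    proof (intro conjI allI impI ballI)
      fix K :: "(real^'n) set" and \<alpha> :: "'n \<Rightarrow> nat" assume K: "compact K \<and> K \<subseteq> \<Omega>"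
      obtain n0 where n0: "\<And>n. n \<ge> n0 \<Longrightarrow> K \<subseteq> E n" using E(5) K by blast
      \<comment> \<open>From J on, \<open>E j\<close> contains K and j is at least the order of
        \<alpha>, so the bound is 1; the finitely many earlier functions are bounded on K one by
        one.\<close>
      define J where "J = max n0 (mabs \<alpha>)"
      have "\<exists>b\<ge>0. \<forall>x\<in>K. cmod (dpartial \<alpha> (g j) x) \<le> b" for j
        using iter_partial_bounded_on_compact[OF gs, of K "mabs \<alpha>" j] K
        unfolding dpartial_mlist by (metis length_mlist order_refl)
      then obtain b where b: "\<And>j. 0 \<le> b j" "\<And>j x. x \<in> K \<Longrightarrow> cmod (dpartial \<alpha> (g j) x) \<le> b j" by metis
      have "cmod (dpartial \<alpha> (g j) x) \<le> 1 + (\<Sum>j<J. b j)" if "x \<in> K" for j x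
      proof (cases "j < J")
        case True
        have "cmod (dpartial \<alpha> (g j) x) \<le> b j" by (rule b(2)[OF that])
        also have "\<dots> \<le> (\<Sum>j<J. b j)" by (rule member_le_sum) (use True b in auto)
        finally show ?thesis by simp
      next
        case False
        have "cmod (dpartial \<alpha> (g j) x) \<le> 1" unfolding dpartial_mlist
        proof (rule gi)
          show "length (mlist \<alpha>) \<le> j" using False by (simp add: J_def length_mlist)
          have "n0 \<le> j" using False by (simp add: J_def)
          with n0 that show "x \<in> E j" by blast
        qed
        moreover have "0 \<le> (\<Sum>j<J. b j)" by (intro sum_nonneg b)
        ultimately show ?thesis by simp
      qed
      then show "\<exists>M. \<forall>f\<in>range g. \<forall>x\<in>K. cmod (dpartial \<alpha> f x) \<le> M" by blast
    qed (use gs in auto)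
    then obtain Mx where Mx: "\<And>N j. cmod (U N (g j)) \<le> Mx"
      using assms(2) unfolding bounded_seq_E'_def by blast
    obtain j where "Mx < real j" using reals_Archimedean2 by blast
    with gU[of j] Mx[of "N j" j] show False by linarith
  qed
  then obtain j where j: "\<And>N f M. smooth_on \<Omega> f \<Longrightarrow> 0 \<le> M \<Longrightarrow> (\<And>L x. length L \<le> j \<Longrightarrow> x \<in> E j \<Longrightarrow> cmod (iter_partial L f x) \<le> M)
       \<Longrightarrow> cmod (U N f) \<le> real j * M" by blast
  show ?thesis by (rule that[OF E(1,2) _ j]) auto
qed

section \<open>From decay in a cone to microlocal regularity\<close>

lemma iter_partial_expo_bound: "cmod (iter_partial L (expo \<xi>) x) \<le> norm \<xi> ^ length L"
proof -
  have "cmod (\<Prod>i\<leftarrow>L. \<i> * of_real (\<xi> $ i)) \<le> norm \<xi> ^ length L"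
  proof (induction L)
    case (Cons i L)
    have "cmod (\<i> * of_real (\<xi> $ i)) \<le> norm \<xi>"
      unfolding norm_mult norm_of_real using component_le_norm_cart[of \<xi> i] by simp
    with Cons show ?case unfolding list.map prod_list.Cons norm_mult[of "\<i> * of_real (\<xi> $ i)"]
      by (simp only: list.size add_Suc_right add_0_right power_Suc) (intro mult_mono norm_ge_zero)
  qed simp
  then show ?thesis unfolding iter_partial_expo norm_mult by simp
qed

lemma iter_partial_expo_bound':
  assumes "length L \<le> k" shows "cmod (iter_partial L (expo \<xi>) x) \<le> (1 + norm \<xi>) ^ k"
proof -
  have "cmod (iter_partial L (expo \<xi>) x) \<le> norm \<xi> ^ length L" by (rule iter_partial_expo_bound)
  also have "\<dots> \<le> (1 + norm \<xi>) ^ length L" by (intro power_mono) auto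
  also have "\<dots> \<le> (1 + norm \<xi>) ^ k" using assms by (intro power_increasing) auto
  finally show ?thesis .
qed

text \<open>Z ^ N \<le> exp Z N! with Z = R ^ (1 / e), raised to the power e. Geometric growth is
  thus absorbed by an arbitrarily small power of the factorial.\<close>

lemma power_le_fact_powr:
  fixes R e :: real
  assumes "R \<ge> 0" "e > 0"
  shows "\<exists>C>0. \<forall>N. R ^ N \<le> C * fact N powr e"
proof -
  define Z where "Z = R powr (1 / e)"
  have "R ^ N \<le> exp Z powr e * fact N powr e" for N
  proof (cases "R = 0")
    case True then show ?thesis by (cases N) (auto simp: Z_def)
  next
    case False
    then have R: "R > 0" using assms by simp
    have "Z ^ N / fact N \<le> exp Z"
      using sum_le_suminf[OF summable_exp_generic[of Z], of "{N}"]
      by (simp add: exp_def divide_inverse mult.commute Z_def)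
    then have "Z ^ N \<le> exp Z * fact N" by (simp add: field_simps)
    then have "(Z ^ N) powr e \<le> (exp Z * fact N) powr e"
      using assms by (intro powr_mono2) (auto simp: Z_def)
    moreover have "(Z ^ N) powr e = R ^ N"
      using R assms by (simp add: Z_def powr_powr flip: powr_realpow powr_realpow')
    ultimately show ?thesis by (simp add: powr_mult)
  qed
  then show ?thesis by (intro exI[of _ "exp Z powr e"]) auto
qed

text \<open>The constant sequence with member \<zeta> w is a witness. The estimate is taken in the
  intermediate order s' = (1 + s) / 2; then B ^ N is at most a constant times Q ^ N N! ^ (s - s'),
  so a single B yields all Q > 0. Covectors of norm below 1 are covered by continuity of \<zeta>
  w.\<close>

lemma microlocal_from_cutoff:
  fixes w :: "(real^'n::finite \<Rightarrow> complex) \<Rightarrow> complex"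
  assumes "open \<Omega>" "distribution \<Omega> w" "smooth_on UNIV \<zeta>" "compact K" "K \<subseteq> \<Omega>" "\<And>x. x \<notin> K \<Longrightarrow> \<zeta> x = 0"
    and V: "open V" "x0 \<in> V" "V \<subseteq> \<Omega>" "\<And>x. x \<in> V \<Longrightarrow> \<zeta> x = 1"
    and \<Gamma>: "open \<Gamma>" "\<xi>0 \<in> \<Gamma>" "0 \<notin> \<Gamma>" "\<And>\<xi> t. \<xi> \<in> \<Gamma> \<Longrightarrow> t > 0 \<Longrightarrow> t *\<^sub>R \<xi> \<in> \<Gamma>"
    and decay: "\<And>s. s > 1 \<Longrightarrow> \<exists>C\<ge>0. \<exists>B\<ge>1. \<forall>\<xi>\<in>\<Gamma>. \<forall>N. 1 \<le> norm \<xi> \<longrightarrow>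
      norm \<xi> ^ N * cmod (w (\<lambda>x. \<zeta> x * expo (- \<xi>) x)) \<le> C * B ^ N * fact N powr s"
  shows "microlocal_G \<Omega> w x0 \<xi>0"
proof -
  define T where "T = (\<lambda>\<phi>. w (\<lambda>x. \<zeta> x * \<phi> x))"
  have "K \<noteq> {}" using V(2,4) assms(6) by force
  then have cd: "comp_distribution \<Omega> T"
    unfolding T_def by (rule comp_distribution_mult[OF assms(1-4) _ assms(5,6)])
  obtain K1 C1 k1 where C1: "compact K1" "K1 \<subseteq> \<Omega>" "0 \<le> C1"
    "\<And>f M. smooth_on \<Omega> f \<Longrightarrow> 0 \<le> M \<Longrightarrow> (\<And>L x. length L \<le> k1 \<Longrightarrow> x \<in> K1 \<Longrightarrow> cmod (iter_partial L f x) \<le> M)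
       \<Longrightarrow> cmod (T f) \<le> C1 * M"
    using bounded_seq_equicontinuous[OF assms(1) bounded_seq_const[OF cd]] by metis
  have small: "cmod (T (expo (- \<xi>))) \<le> C1" if "norm \<xi> \<le> 1" for \<xi>
  proof -
    have "cmod (T (expo (- \<xi>))) \<le> C1 * 1"
    proof (rule C1(4)[OF smooth_on_subset[OF smooth_expo]])
      show "cmod (iter_partial L (expo (- \<xi>)) x) \<le> 1" for L x
        using iter_partial_expo_bound[of L "- \<xi>" x] that power_le_one[of "norm \<xi>" "length L"] by simp
    qed auto
    then show ?thesis by simp
  qed
  have four: "fourier T \<xi> = T (expo (- \<xi>))" for \<xi> by (simp add: fourier_def expo_def[abs_def])
  have D0: "\<exists>C. \<forall>\<xi>\<in>\<Gamma>. \<forall>N. norm \<xi> ^ N * cmod (fourier T \<xi>) / (Q ^ N * fact N powr s) \<le> C"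
    if s: "s > 1" and Q: "Q > 0" for s Q :: real
  proof -
    define s' where "s' = (1 + s) / 2"
    have s': "s' > 1" "s - s' > 0" using s by (auto simp: s'_def)
    obtain C B where CB: "C \<ge> 0" "B \<ge> 1" "\<And>\<xi> N. \<xi> \<in> \<Gamma> \<Longrightarrow> 1 \<le> norm \<xi> \<Longrightarrow>
      norm \<xi> ^ N * cmod (T (expo (- \<xi>))) \<le> C * B ^ N * fact N powr s'"
      using decay[OF s'(1)] unfolding T_def by blast
    obtain D where D: "D > 0" "\<And>N. (B / Q) ^ N \<le> D * fact N powr (s - s')"
      using power_le_fact_powr[of "B / Q" "s - s'"] s' CB Q by auto
    have main: "norm \<xi> ^ N * cmod (T (expo (- \<xi>))) \<le> (C + C1) * B ^ N * fact N powr s'" if "\<xi> \<in> \<Gamma>" for \<xi> N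
    proof (cases "1 \<le> norm \<xi>")
      case True
      have "C * B ^ N * fact N powr s' \<le> (C + C1) * B ^ N * fact N powr s'"
        using C1(3) CB by (intro mult_right_mono) auto
      with CB(3)[OF that True, of N] show ?thesis by linarith
    next
      case False
      have "1 \<le> B ^ N * fact N powr s'"
        using CB s' mult_mono[of 1 "B ^ N" 1 "fact N powr s'"] by (simp add: one_le_power ge_one_powr_ge_zero)
      then have "C1 * 1 \<le> (C + C1) * (B ^ N * fact N powr s')"
        using CB(1) C1(3) by (intro mult_mono) auto
      moreover have "norm \<xi> ^ N * cmod (T (expo (- \<xi>))) \<le> 1 * C1"
        using False small[of \<xi>] by (intro mult_mono power_le_one) auto
      ultimately show ?thesis by (simp add: mult.assoc)
    qed
    have "norm \<xi> ^ N * cmod (fourier T \<xi>) / (Q ^ N * fact N powr s) \<le> (C + C1) * D" if "\<xi> \<in> \<Gamma>" for \<xi> N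
    proof -
      have "B ^ N = Q ^ N * (B / Q) ^ N" using Q by (simp add: power_divide)
      also have "\<dots> \<le> Q ^ N * (D * fact N powr (s - s'))" using D Q by (intro mult_left_mono) auto
      finally have "B ^ N * fact N powr s' \<le> Q ^ N * (D * fact N powr (s - s')) * fact N powr s'"
        by (intro mult_right_mono) auto
      also have "\<dots> = Q ^ N * D * (fact N powr (s - s') * fact N powr s')" by (simp add: mult_ac)
      also have "\<dots> = Q ^ N * D * fact N powr s" by (simp flip: powr_add)
      finally have "(C + C1) * (B ^ N * fact N powr s') \<le> (C + C1) * (Q ^ N * D * fact N powr s)"
        using CB C1 by (intro mult_left_mono) auto
      with main[OF that, of N] have "norm \<xi> ^ N * cmod (T (expo (- \<xi>))) \<le> (C + C1) * D * (Q ^ N * fact N powr s)"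
        by (simp add: mult_ac)
      moreover have "Q ^ N * fact N powr s > 0" using Q by simp
      ultimately show ?thesis unfolding four by (subst pos_divide_le_eq) auto
    qed
    then show ?thesis by blast
  qed
  have W0: "T \<phi> = w \<phi>" if "test_fun V \<phi>" for \<phi>
  proof -
    have "\<phi> x = 0" if "x \<notin> V" for x
      using \<open>test_fun V \<phi>\<close> that closure_subset[of "{x. \<phi> x \<noteq> 0}"] unfolding test_fun_def tsupp_def by auto
    then have "\<zeta> x * \<phi> x = \<phi> x" for x using V(4)[of x] by (cases "x \<in> V") auto
    then have "(\<lambda>x. \<zeta> x * \<phi> x) = \<phi>" by (rule ext)
    then show ?thesis by (simp only: T_def)
  qed
  have D: "\<forall>s>1. \<forall>Q>0. \<exists>C. \<forall>\<xi>\<in>\<Gamma>. \<forall>N.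
           norm \<xi> ^ N * cmod (fourier T \<xi>) / (Q ^ N * fact N powr s) \<le> C"
    by (intro allI impI D0)
  have W: "\<forall>(N::nat) \<phi>. test_fun V \<phi> \<longrightarrow> T \<phi> = w \<phi>" by (intro allI impI W0)
  have G: "\<forall>\<xi>\<in>\<Gamma>. \<forall>t>0. t *\<^sub>R \<xi> \<in> \<Gamma>" using \<Gamma>(4) by simp
  have "open V \<and> x0 \<in> V \<and> V \<subseteq> \<Omega> \<and>
        open \<Gamma> \<and> \<xi>0 \<in> \<Gamma> \<and> 0 \<notin> \<Gamma> \<and> (\<forall>\<xi>\<in>\<Gamma>. \<forall>t>0. t *\<^sub>R \<xi> \<in> \<Gamma>) \<and>
        bounded_seq_E' \<Omega> (\<lambda>N. T) \<and> (\<forall>(N::nat) \<phi>. test_fun V \<phi> \<longrightarrow> T \<phi> = w \<phi>) \<and>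
        (\<forall>s>1. \<forall>Q>0. \<exists>C. \<forall>\<xi>\<in>\<Gamma>. \<forall>N.
           norm \<xi> ^ N * cmod (fourier T \<xi>) / (Q ^ N * fact N powr s) \<le> C)"
    by (intro conjI V(1-3) \<Gamma>(1-3) G bounded_seq_const[OF cd] W D)
  then show ?thesis unfolding microlocal_G_def
    by - (rule exI[of _ V], rule exI[of _ \<Gamma>], rule exI[of _ "\<lambda>N. T"])
qed

text \<open>By (n + p)! \<le> 2 ^ (n + p) p! n! a fixed shift of the factorial costs only a
  geometric factor, which every estimate below tolerates.\<close>

lemma fact_shift_powr:
  assumes "0 \<le> s"
  shows "(fact (n + p) :: real) powr s \<le> (2 ^ p * fact p) powr s * (2 powr s) ^ n * fact n powr s"
proof -
  have "(fact (n + p) :: real) = real ((n + p) choose p) * fact p * fact n"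
    by (subst binomial_fact) auto
  also have "\<dots> \<le> 2 ^ (n + p) * fact p * fact n"
  proof (intro mult_right_mono)
    have "real ((n + p) choose p) \<le> real (2 ^ (n + p))" by (rule of_nat_mono[OF binomial_le_pow2])
    then show "real ((n + p) choose p) \<le> 2 ^ (n + p)" by simp
  qed auto
  finally have "(fact (n + p) :: real) powr s \<le> (2 ^ (n + p) * fact p * fact n) powr s"
    using assms by (intro powr_mono2) auto
  also have "(2 ^ (n + p) * fact p * fact n :: real) = (2 ^ p * fact p) * 2 ^ n * fact n"
    by (simp add: power_add)
  also have "\<dots> powr s = (2 ^ p * fact p) powr s * (2 ^ n) powr s * fact n powr s"
    by (simp only: powr_mult)
  also have "(2 ^ n :: real) powr s = (2 powr s) ^ n"
    by (simp add: powr_powr mult.commute flip: powr_realpow)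
  finally show ?thesis .
qed

section \<open>Approximation by trigonometric polynomials\<close>

lemma summable_tail_small:
  fixes f :: "'a \<Rightarrow> real"
  assumes "f summable_on UNIV" "\<epsilon> > 0"
  obtains F where "finite F" "infsum f (- F) \<le> \<epsilon>"
proof -
  have "(sum f \<longlongrightarrow> infsum f UNIV) (finite_subsets_at_top UNIV)"
    using has_sum_infsum[OF assms(1)] by (simp add: has_sum_def)
  then have "\<forall>\<^sub>F F in finite_subsets_at_top UNIV. dist (sum f F) (infsum f UNIV) < \<epsilon>"
    using assms(2) by (rule tendstoD)
  then obtain F where F: "finite F" "dist (sum f F) (infsum f UNIV) < \<epsilon>"
    unfolding eventually_finite_subsets_at_top by blast
  have "infsum f (UNIV - F) = infsum f UNIV - infsum f F"
    by (rule infsum_Diff) (use assms F in \<open>auto intro: summable_on_finite\<close>)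
  then have "infsum f (- F) \<le> \<epsilon>" using F by (simp add: Compl_eq_Diff_UNIV dist_real_def)
  with F(1) that show ?thesis by blast
qed

lemma prod_list_freq_bound:
  assumes "T > 0"
  shows "cmod (\<Prod>i\<leftarrow>L. \<i> * of_real (freq T k $ i)) \<le> (pi / T * ksize k) ^ length L"
proof (induction L)
  case (Cons i L)
  have "cmod (\<i> * of_real (freq T k $ i)) \<le> pi / T * ksize k"
    unfolding norm_mult norm_of_real using component_le_norm_cart[of "freq T k" i] norm_freq_le[OF assms, of k] by simp
  with Cons show ?case unfolding list.map prod_list.Cons norm_mult[of "\<i> * of_real (freq T k $ i)"]
    by (simp only: list.size add_Suc_right add_0_right power_Suc)
       (intro mult_mono norm_ge_zero, auto intro: order_trans[OF norm_ge_zero])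
qed simp

text \<open>Approximation in k0 derivatives is the topology in which a functional of order k0 is
  continuous. The additional 2 n derivatives of g, in dimension n, make the differentiated series
  absolutely summable. The open cube appears because the inversion holds at interior points.\<close>

lemma fourier_approx:
  fixes g :: "real^'n::finite \<Rightarrow> complex"
  assumes T: "T > 0" and g: "smooth_on UNIV g" "\<And>x. x \<notin> cube T \<Longrightarrow> g x = 0" and e: "\<epsilon> > 0"
  obtains F where "finite F" "\<And>L x. length L \<le> k0 \<Longrightarrow> (\<And>i. \<bar>x $ i\<bar> < T) \<Longrightarrow>
    cmod (iter_partial L (\<lambda>x. g x - (\<Sum>k\<in>F. fcoef T g k * expo (freq T k) x)) x) \<le> \<epsilon>"
proof -
  define n2 where "n2 = 2 * CARD('n)"
  define D where "D = max 1 (pi / T)"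
  have D: "D \<ge> 1" "D \<ge> pi / T" by (auto simp: D_def)
  obtain B where B: "0 \<le> B" "\<And>L x. length L \<le> k0 + n2 \<Longrightarrow> x \<in> cube T \<Longrightarrow> cmod (iter_partial L g x) \<le> B"
    using iter_partial_bounded_on_compact[OF g(1) compact_cube subset_UNIV, of "k0 + n2"] by metis
  have B': "cmod (iter_partial L g x) \<le> B" if "length L \<le> k0 + n2" for L x
    using B(2)[OF that, of x] vanish_outside_iter[of "cube T" g x L, OF g(2) closed_cube] B(1)
    by (cases "x \<in> cube T") auto
  define A where "A = ((real CARD('n) + 1) * max 1 (T / pi)) ^ (k0 + n2) * B"
  have dec: "ksize k ^ k0 * cmod (fcoef T g k) \<le> A * (1 / ksize k ^ n2)" for k
  proof -
    have "ksize k ^ (k0 + n2) * cmod (fcoef T g k) \<le> A" unfolding A_def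
      by (rule fcoef_decay[OF T g]) (use B'[of "[]"] B'[of "replicate (k0 + n2) _"] in auto)
    moreover have "ksize k ^ n2 > 0" using ksize_ge(1)[of k] by simp
    ultimately show ?thesis by (simp add: power_add field_simps)
  qed
  define f where "f = (\<lambda>k. D ^ k0 * (ksize k ^ k0 * cmod (fcoef T g k)))"
  have f0: "f k \<ge> 0" for k using D ksize_ge(1)[of k] by (simp add: f_def)
  have fs: "f summable_on UNIV"
  proof (rule summable_on_comparison_test)
    show "(\<lambda>k::'n \<Rightarrow> int. (D ^ k0 * A) * (1 / ksize k ^ n2)) summable_on UNIV"
      unfolding n2_def by (rule summable_on_cmult_right[OF ksize_summable])
    show "f k \<le> (D ^ k0 * A) * (1 / ksize k ^ n2)" for k
      unfolding f_def mult.assoc using dec[of k] D by (intro mult_left_mono) auto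
  qed (use f0 in auto)
  have coef: "cmod (fcoef T (iter_partial L g) k) \<le> f k" if "length L \<le> k0" for L k
  proof -
    have "fcoef T (iter_partial L g) k = (\<Prod>i\<leftarrow>L. \<i> * of_real (freq T k $ i)) * fcoef T g k"
      by (rule fcoef_iter_partial) (use g in auto)
    then have "cmod (fcoef T (iter_partial L g) k) \<le> (pi / T * ksize k) ^ length L * cmod (fcoef T g k)"
      using prod_list_freq_bound[OF T, of k L] by (simp add: norm_mult mult_right_mono)
    also have "\<dots> \<le> (D * ksize k) ^ k0 * cmod (fcoef T g k)"
    proof (rule mult_right_mono)
      have "(pi / T * ksize k) ^ length L \<le> (D * ksize k) ^ length L"
        using D T ksize_ge(1)[of k] by (intro power_mono mult_right_mono) auto
      also have "1 \<le> D * ksize k" using D ksize_ge(1)[of k] mult_mono[of 1 D 1 "ksize k"] by simp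
      then have "(D * ksize k) ^ length L \<le> (D * ksize k) ^ k0" using that by (rule power_increasing[rotated])
      finally show "(pi / T * ksize k) ^ length L \<le> (D * ksize k) ^ k0" .
    qed simp
    finally show ?thesis by (simp add: f_def power_mult_distrib mult_ac)
  qed
  obtain F where F: "finite F" "infsum f (- F) \<le> \<epsilon>" using summable_tail_small[OF fs e] .
  have sE: "smooth_on UNIV (\<lambda>x. fcoef T g k * expo (freq T k) x)" for k
    by (intro smooth_on_cmult smooth_expo) auto
  have "cmod (iter_partial L (\<lambda>x. g x - (\<Sum>k\<in>F. fcoef T g k * expo (freq T k) x)) x) \<le> \<epsilon>"
    if L: "length L \<le> k0" and x: "\<And>i. \<bar>x $ i\<bar> < T" for L and x :: "real^'n"
  proof -
    let ?c = "\<lambda>k. fcoef T (iter_partial L g) k * expo (freq T k) x"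
    have abs: "(\<lambda>k. cmod (fcoef T (iter_partial L g) k)) summable_on UNIV"
      by (rule summable_on_comparison_test[OF fs]) (use coef[OF L] in auto)
    \<comment> \<open>Derivatives of g are again smooth and vanish outside the cube, so inversion
      holds for each of them, with the coefficients of the termwise differentiated series.\<close>
    have hs: "(?c has_sum iter_partial L g x) UNIV"
      by (rule fourier_inversion[OF T smooth_on_iter_partial[OF g(1)] _ x abs])
         (rule vanish_outside_iter[OF g(2) closed_cube])
    have "iter_partial L (\<lambda>x. g x - (\<Sum>k\<in>F. fcoef T g k * expo (freq T k) x)) x
       = iter_partial L g x - (\<Sum>k\<in>F. fcoef T g k * iter_partial L (expo (freq T k)) x)"
      by (subst iter_partial_diff[of UNIV])
         (use g sE in \<open>auto simp: iter_partial_sum[of UNIV] iter_partial_cmult[of UNIV] smooth_expo intro!: smooth_on_sum\<close>)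
    also have "(\<Sum>k\<in>F. fcoef T g k * iter_partial L (expo (freq T k)) x) = sum ?c F"
    proof (rule sum.cong)
      fix k
      have "fcoef T (iter_partial L g) k = (\<Prod>i\<leftarrow>L. \<i> * of_real (freq T k $ i)) * fcoef T g k"
        by (rule fcoef_iter_partial) (use g in auto)
      then show "fcoef T g k * iter_partial L (expo (freq T k)) x = ?c k"
        unfolding iter_partial_expo by (simp only: mult_ac)
    qed simp
    also have "iter_partial L g x - sum ?c F = infsum ?c (- F)"
    proof -
      have "(?c has_sum sum ?c F) F" using F(1) by (rule has_sum_finite)
      then have "(?c has_sum (iter_partial L g x - sum ?c F)) (UNIV - F)" using hs by (intro has_sum_Diff) auto
      then show ?thesis by (simp add: infsumI Compl_eq_Diff_UNIV)
    qed
    also have "cmod (infsum ?c (- F)) \<le> infsum (\<lambda>k. cmod (?c k)) (- F)"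
      by (rule norm_infsum_bound) (use abs summable_on_subset_banach in \<open>fastforce simp: norm_mult\<close>)
    also have "\<dots> \<le> infsum f (- F)"
    proof (rule infsum_mono)
      show "(\<lambda>k. cmod (?c k)) summable_on - F"
        using summable_on_subset_banach[OF abs, of "- F"] by (simp add: norm_mult)
      show "f summable_on - F" using summable_on_subset_banach[OF fs, of "- F"] by simp
      show "cmod (?c k) \<le> f k" for k using coef[OF L, of k] by (simp add: norm_mult)
    qed
    also have "\<dots> \<le> \<epsilon>" by (rule F(2))
    finally show ?thesis .
  qed
  then show ?thesis using that F(1) by blast
qed

section \<open>Microlocal decay of products\<close>

lemma comp_distribution_add: "comp_distribution \<Omega> u \<Longrightarrow> smooth_on \<Omega> f \<Longrightarrow> smooth_on \<Omega> g \<Longrightarrow> u (\<lambda>x. f x + g x) = u f + u g"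
  unfolding comp_distribution_def by blast

lemma comp_distribution_cmult: "comp_distribution \<Omega> u \<Longrightarrow> smooth_on \<Omega> f \<Longrightarrow> u (\<lambda>x. c * f x) = c * u f"
  unfolding comp_distribution_def by blast

lemma comp_distribution_lincomb:
  assumes "comp_distribution \<Omega> u" "open \<Omega>" "finite A" "\<And>a. a \<in> A \<Longrightarrow> smooth_on \<Omega> (f a)"
  shows "u (\<lambda>x. \<Sum>a\<in>A. c a * f a x) = (\<Sum>a\<in>A. c a * u (f a))"
  using assms(3,4)
proof (induction A rule: finite_induct)
  case empty
  have "u (\<lambda>x. 0 * (0::complex)) = 0 * u (\<lambda>x. 0)"
    by (rule comp_distribution_cmult[OF assms(1) smooth_on_const[OF assms(2)]])
  then show ?case by simp
next
  case (insert a A)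
  have "u (\<lambda>x. c a * f a x + (\<Sum>a\<in>A. c a * f a x)) = u (\<lambda>x. c a * f a x) + u (\<lambda>x. \<Sum>a\<in>A. c a * f a x)"
    by (intro comp_distribution_add[OF assms(1)] smooth_on_sum smooth_on_cmult assms(2)) (use insert.prems in auto)
  also have "u (\<lambda>x. c a * f a x) = c a * u (f a)"
    by (rule comp_distribution_cmult[OF assms(1)]) (use insert.prems in auto)
  finally show ?case using insert by simp
qed

text \<open>Takes the place of interchanging u with the Fourier series of g: finite partial sums are
  controlled by R, and the remainder becomes small in the seminorm that bounds u. The covector is
  fixed here, so its size only enters the choice of \<epsilon>'.\<close>

lemma functional_fourier_bound:
  fixes u :: "(real^'n::finite \<Rightarrow> complex) \<Rightarrow> complex" and K :: "(real^'n) set"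
  assumes \<Omega>: "open \<Omega>" and u: "comp_distribution \<Omega> u" and K: "K \<subseteq> \<Omega>" "\<And>x i. x \<in> K \<Longrightarrow> \<bar>x $ i\<bar> < T" and C0: "0 \<le> C0"
    and cont: "\<And>f M. smooth_on \<Omega> f \<Longrightarrow> 0 \<le> M \<Longrightarrow> (\<And>L x. length L \<le> k0 \<Longrightarrow> x \<in> K \<Longrightarrow> cmod (iter_partial L f x) \<le> M)
       \<Longrightarrow> cmod (u f) \<le> C0 * M"
    and T: "T > 0" and g: "smooth_on UNIV g" "\<And>x. x \<notin> cube T \<Longrightarrow> g x = 0"
    and R: "\<And>F. finite F \<Longrightarrow> (\<Sum>k\<in>F. cmod (fcoef T g k) * cmod (u (expo (freq T k - \<xi>)))) \<le> R"
  shows "cmod (u (\<lambda>x. g x * expo (- \<xi>) x)) \<le> R"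
proof (rule field_le_epsilon)
  fix \<epsilon> :: real assume \<epsilon>: "\<epsilon> > 0"
  define Z where "Z = C0 * (2 ^ k0 * (1 + norm \<xi>) ^ k0)"
  have Z: "Z \<ge> 0" using C0 by (simp add: Z_def)
  define \<epsilon>' where "\<epsilon>' = \<epsilon> / (Z + 1)"
  have \<epsilon>': "\<epsilon>' > 0" using \<epsilon> Z by (simp add: \<epsilon>'_def)
  have "Z * \<epsilon>' \<le> (Z + 1) * \<epsilon>'" using \<epsilon>' by (intro mult_right_mono) auto
  also have "\<dots> = \<epsilon>" using Z by (simp add: \<epsilon>'_def)
  finally have Ze: "Z * \<epsilon>' \<le> \<epsilon>" .
  obtain F where F: "finite F" "\<And>L x. length L \<le> k0 \<Longrightarrow> (\<And>i. \<bar>x $ i\<bar> < T) \<Longrightarrow>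
    cmod (iter_partial L (\<lambda>x. g x - (\<Sum>k\<in>F. fcoef T g k * expo (freq T k) x)) x) \<le> \<epsilon>'"
    using fourier_approx[OF T g \<epsilon>', of k0] by blast
  define d where "d = (\<lambda>x. g x - (\<Sum>k\<in>F. fcoef T g k * expo (freq T k) x))"
  have ds: "smooth_on UNIV d" unfolding d_def
    by (intro smooth_on_diff g smooth_on_sum smooth_on_cmult smooth_expo) auto
  have de: "smooth_on UNIV (\<lambda>x. d x * expo (- \<xi>) x)" by (intro smooth_on_mult ds smooth_expo) auto
  have eq: "g x * expo (- \<xi>) x = d x * expo (- \<xi>) x + (\<Sum>k\<in>F. fcoef T g k * expo (freq T k - \<xi>) x)" for x
    by (simp add: d_def left_diff_distrib sum_distrib_right mult.assoc expo_mult)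
  have "u (\<lambda>x. g x * expo (- \<xi>) x) = u (\<lambda>x. d x * expo (- \<xi>) x) + u (\<lambda>x. \<Sum>k\<in>F. fcoef T g k * expo (freq T k - \<xi>) x)"
    unfolding eq
    by (rule comp_distribution_add[OF u]; rule smooth_on_subset[of UNIV])
       (auto intro!: de smooth_on_sum smooth_on_cmult smooth_expo)
  also have "u (\<lambda>x. \<Sum>k\<in>F. fcoef T g k * expo (freq T k - \<xi>) x) = (\<Sum>k\<in>F. fcoef T g k * u (expo (freq T k - \<xi>)))"
    by (rule comp_distribution_lincomb[OF u \<Omega> F(1)]) (rule smooth_on_subset[OF smooth_expo subset_UNIV])
  finally have "cmod (u (\<lambda>x. g x * expo (- \<xi>) x)) \<le> cmod (u (\<lambda>x. d x * expo (- \<xi>) x)) + cmod (\<Sum>k\<in>F. fcoef T g k * u (expo (freq T k - \<xi>)))"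
    by (simp only: norm_triangle_ineq)
  also have "cmod (\<Sum>k\<in>F. fcoef T g k * u (expo (freq T k - \<xi>))) \<le> (\<Sum>k\<in>F. cmod (fcoef T g k) * cmod (u (expo (freq T k - \<xi>))))"
    by (rule order_trans[OF norm_sum]) (simp add: norm_mult)
  also have "\<dots> \<le> R" by (rule R[OF F(1)])
  also have "cmod (u (\<lambda>x. d x * expo (- \<xi>) x)) \<le> C0 * (2 ^ k0 * \<epsilon>' * (1 + norm \<xi>) ^ k0)"
  proof (rule cont)
    show "smooth_on \<Omega> (\<lambda>x. d x * expo (- \<xi>) x)" by (rule smooth_on_subset[OF de subset_UNIV])
    show "cmod (iter_partial L (\<lambda>x. d x * expo (- \<xi>) x) x) \<le> 2 ^ k0 * \<epsilon>' * (1 + norm \<xi>) ^ k0"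
      if "length L \<le> k0" "x \<in> K" for L x
    proof (rule leibniz_uniform_bound[OF open_UNIV UNIV_I ds smooth_expo that(1)])
      show "cmod (iter_partial J d x) \<le> \<epsilon>'" if "length J \<le> k0" for J
        unfolding d_def by (rule F(2)[OF that K(2)[OF \<open>x \<in> K\<close>]])
      show "cmod (iter_partial J (expo (- \<xi>)) x) \<le> (1 + norm \<xi>) ^ k0" if "length J \<le> k0" for J
        using iter_partial_expo_bound'[OF that, of "- \<xi>" x] by simp
    qed (use \<epsilon>' in auto)
  qed (use \<epsilon>' in auto)
  also have "\<dots> = Z * \<epsilon>'" by (simp add: Z_def mult_ac)
  also have "\<dots> \<le> \<epsilon>" by (rule Ze)
  finally show "cmod (u (\<lambda>x. g x * expo (- \<xi>) x)) \<le> R + \<epsilon>" by simp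
qed

definition conic_nbhd :: "real^'n::finite \<Rightarrow> real \<Rightarrow> (real^'n) set" where
  "conic_nbhd \<xi>0 \<delta> = {\<xi>. \<xi> \<noteq> 0 \<and> norm (\<xi> /\<^sub>R norm \<xi> - \<xi>0 /\<^sub>R norm \<xi>0) < \<delta>}"

text \<open>The constants depend on s and the radius A only; M enters linearly and the shift l is
  added to N. This uniformity lets the estimate be applied to all terms of the Neumann series, whose
  shift grows with the index.\<close>

definition microlocal_decay :: "((real^'n::finite \<Rightarrow> complex) \<Rightarrow> complex) \<Rightarrow> (real^'n) set \<Rightarrow> (real^'n) set \<Rightarrow> bool" where
  "microlocal_decay f X \<Gamma> \<longleftrightarrow> (\<forall>s>1. \<forall>A\<ge>1. \<exists>C\<ge>0. \<exists>B\<ge>1. \<forall>g M l N \<xi>.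
     smooth_on UNIV g \<longrightarrow> (\<forall>x. x \<notin> X \<longrightarrow> g x = 0) \<longrightarrow> gbd UNIV s M A l g \<longrightarrow> \<xi> \<in> \<Gamma> \<longrightarrow> 1 \<le> norm \<xi> \<longrightarrow>
     norm \<xi> ^ N * cmod (f (\<lambda>x. g x * expo (- \<xi>) x)) \<le> C * M * B ^ (N + l) * fact (N + l) powr s)"

text \<open>Split the frequencies of the test function into those small compared with
  the given covector, where the decay in the cone is available, and the rest, where the Fourier
  coefficients of the test function decay.\<close>
lemma microlocal_decay_term:
  fixes \<xi> \<omega> \<eta> :: "real^'n::finite"
  assumes \<delta>: "0 < \<delta>" "\<delta> \<le> 1/2" and ball: "ball \<omega> (2 * \<delta>) \<subseteq> \<Gamma>" and con: "\<And>\<xi> t. \<xi> \<in> \<Gamma> \<Longrightarrow> t > 0 \<Longrightarrow> t *\<^sub>R \<xi> \<in> \<Gamma>"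
    and \<xi>: "1 \<le> norm \<xi>" "norm (\<xi> /\<^sub>R norm \<xi> - \<omega>) < \<delta>"
    and dec: "\<And>\<zeta>. \<zeta> \<in> \<Gamma> \<Longrightarrow> norm \<zeta> ^ N * F \<zeta> \<le> C1" and F0: "\<And>\<zeta>. 0 \<le> F \<zeta>"
    and pol: "\<And>\<zeta>. F \<zeta> \<le> C0 * (1 + norm \<zeta>) ^ k0" and C: "0 \<le> C0" "0 \<le> C1"
    and \<eta>: "norm \<eta> \<le> h * \<kappa>" "1 \<le> \<kappa>" "0 \<le> h" and E: "E = 1 + (1 / \<delta> + 1) * h"
  shows "norm \<xi> ^ N * F (\<xi> - \<eta>) \<le> 2 ^ N * C1 + C0 * (E * \<kappa>) ^ (N + k0)"
proof (cases "norm \<eta> \<le> \<delta> * norm \<xi>")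
  case True
  let ?\<zeta> = "(\<xi> - \<eta>) /\<^sub>R norm \<xi>"
  have "norm (\<eta> /\<^sub>R norm \<xi>) \<le> \<delta>" using True \<xi> \<delta> by (simp add: divide_le_eq divide_inverse[symmetric] mult.commute)
  moreover have "?\<zeta> - \<omega> = (\<xi> /\<^sub>R norm \<xi> - \<omega>) - \<eta> /\<^sub>R norm \<xi>" by (simp add: algebra_simps)
  moreover have "norm (\<xi> /\<^sub>R norm \<xi> - \<omega> - \<eta> /\<^sub>R norm \<xi>) \<le> norm (\<xi> /\<^sub>R norm \<xi> - \<omega>) + norm (\<eta> /\<^sub>R norm \<xi>)"
    by (rule norm_triangle_ineq4)
  ultimately have "norm (?\<zeta> - \<omega>) < 2 * \<delta>" using \<xi>(2) by (simp only:)
  then have "?\<zeta> \<in> \<Gamma>" using ball by (auto simp: dist_norm norm_minus_commute)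
  then have "norm \<xi> *\<^sub>R ?\<zeta> \<in> \<Gamma>" by (rule con) (use \<xi> in auto)
  moreover have "\<xi> \<noteq> 0" using \<xi>(1) by auto
  then have "norm \<xi> *\<^sub>R ?\<zeta> = \<xi> - \<eta>" by simp
  ultimately have G: "\<xi> - \<eta> \<in> \<Gamma>" by (simp only:)
  \<comment> \<open>Because \<delta> \<le> 1/2, the shifted covector keeps at least half the length,
    hence the factor 2 ^ N.\<close>
  have "\<delta> * norm \<xi> \<le> 1/2 * norm \<xi>" using \<delta> \<xi> by (intro mult_right_mono) auto
  then have "norm \<xi> \<le> 2 * norm (\<xi> - \<eta>)" using norm_triangle_ineq2[of \<xi> \<eta>] True by linarith
  then have "norm \<xi> ^ N \<le> (2 * norm (\<xi> - \<eta>)) ^ N" by (intro power_mono) auto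
  then have "norm \<xi> ^ N * F (\<xi> - \<eta>) \<le> 2 ^ N * (norm (\<xi> - \<eta>) ^ N * F (\<xi> - \<eta>))"
    using F0[of "\<xi> - \<eta>"] mult_right_mono by (fastforce simp: power_mult_distrib mult.assoc)
  also have "\<dots> \<le> 2 ^ N * C1" using dec[OF G] by (intro mult_left_mono) auto
  also have "\<dots> \<le> 2 ^ N * C1 + C0 * (E * \<kappa>) ^ (N + k0)"
    using C \<eta> \<delta> E by (simp add: zero_le_mult_iff)
  finally show ?thesis .
next
  case False
  have h\<kappa>: "0 \<le> h * \<kappa>" using \<eta> by simp
  have "norm \<xi> \<le> norm \<eta> / \<delta>" using False \<delta> by (simp add: field_simps)
  also have "\<dots> \<le> 1 / \<delta> * (h * \<kappa>)" using \<eta> \<delta> by (simp add: divide_right_mono)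
  finally have x1: "norm \<xi> \<le> 1 / \<delta> * (h * \<kappa>)" .
  \<comment> \<open>The three summands dominate 1, the norm of \<xi> and the norm of \<eta>, in this
    order.\<close>
  have Ek: "E * \<kappa> = \<kappa> + 1 / \<delta> * (h * \<kappa>) + h * \<kappa>" by (simp add: E algebra_simps)
  have x2: "norm \<xi> \<le> E * \<kappa>" using x1 h\<kappa> \<eta> unfolding Ek by linarith
  have "1 + norm (\<xi> - \<eta>) \<le> 1 + (norm \<xi> + norm \<eta>)" using norm_triangle_ineq4[of \<xi> \<eta>] by simp
  also have "\<dots> \<le> E * \<kappa>" using x1 \<eta> unfolding Ek by linarith
  finally have x3: "1 + norm (\<xi> - \<eta>) \<le> E * \<kappa>" .
  have "norm \<xi> ^ N * F (\<xi> - \<eta>) \<le> (E * \<kappa>) ^ N * (C0 * (E * \<kappa>) ^ k0)"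
  proof (rule mult_mono)
    show "norm \<xi> ^ N \<le> (E * \<kappa>) ^ N" using x2 by (intro power_mono) auto
    have "F (\<xi> - \<eta>) \<le> C0 * (1 + norm (\<xi> - \<eta>)) ^ k0" by (rule pol)
    also have "\<dots> \<le> C0 * (E * \<kappa>) ^ k0" using x3 C by (intro mult_left_mono power_mono) auto
    finally show "F (\<xi> - \<eta>) \<le> C0 * (E * \<kappa>) ^ k0" .
    show "0 \<le> (E * \<kappa>) ^ N" using x2 order_trans[OF norm_ge_zero] by (intro zero_le_power) blast
  qed (rule F0)
  also have "\<dots> \<le> 2 ^ N * C1 + C0 * (E * \<kappa>) ^ (N + k0)" using C by (simp add: power_add mult_ac)
  finally show ?thesis .
qed

text \<open>For each N a different member of the bounded sequence stands for f near x0, namely the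
  one whose index is the exponent. Equicontinuity supplies a common compact set and a common order
  k0, so the constants of the frequency splitting do not depend on N.\<close>

lemma microlocal_imp_decay:
  fixes f :: "(real^'n::finite \<Rightarrow> complex) \<Rightarrow> complex"
  assumes \<Omega>: "open \<Omega>" and mic: "microlocal_G \<Omega> f x0 \<xi>0"
  obtains r \<delta> where "0 < r" "cball x0 r \<subseteq> \<Omega>" "0 < \<delta>" "microlocal_decay f (cball x0 r) (conic_nbhd \<xi>0 \<delta>)"
proof -
  obtain V \<Gamma> U where V: "open V" "x0 \<in> V" "V \<subseteq> \<Omega>"
    and \<Gamma>: "open \<Gamma>" "\<xi>0 \<in> \<Gamma>" "0 \<notin> \<Gamma>" and con: "\<forall>\<xi>\<in>\<Gamma>. \<forall>t>0. t *\<^sub>R \<xi> \<in> \<Gamma>"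
    and U: "bounded_seq_E' \<Omega> U" and UV: "\<forall>N \<phi>. test_fun V \<phi> \<longrightarrow> U N \<phi> = f \<phi>"
    and dec: "\<forall>s>1. \<forall>Q>0. \<exists>C. \<forall>\<xi>\<in>\<Gamma>. \<forall>N. norm \<xi> ^ N * cmod (fourier (U N) \<xi>) / (Q ^ N * fact N powr s) \<le> C"
    using mic unfolding microlocal_G_def by (elim exE conjE)
  have con': "t *\<^sub>R \<xi> \<in> \<Gamma>" if "\<xi> \<in> \<Gamma>" "t > 0" for \<xi> t using con that by blast
  have cd: "comp_distribution \<Omega> (U N)" for N using U by (simp add: bounded_seq_E'_def)
  obtain K C0 k0 where K: "compact K" "K \<subseteq> \<Omega>" and C0: "0 \<le> C0"
    and cont: "\<And>N f M. smooth_on \<Omega> f \<Longrightarrow> 0 \<le> M \<Longrightarrow> (\<And>L x. length L \<le> k0 \<Longrightarrow> x \<in> K \<Longrightarrow> cmod (iter_partial L f x) \<le> M)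
       \<Longrightarrow> cmod (U N f) \<le> C0 * M"
    using bounded_seq_equicontinuous[OF \<Omega> U] by metis
  obtain r where r: "r > 0" "cball x0 r \<subseteq> V" using V open_contains_cball by blast
  have "bounded (K \<union> cball x0 r)" using K compact_imp_bounded by auto
  then obtain b where b: "b > 0" "\<And>x. x \<in> K \<union> cball x0 r \<Longrightarrow> norm x \<le> b" unfolding bounded_pos by blast
  \<comment> \<open>The extra 1 keeps K and the ball inside the open cube, where the Fourier
    approximation is valid.\<close>
  define T where "T = b + 1"
  have T: "T > 0" using b by (simp add: T_def)
  have coord: "\<bar>x $ i\<bar> < T" if "x \<in> K \<union> cball x0 r" for x :: "real^'n" and i
    using component_le_norm_cart[of x i] b(2)[OF that] by (simp add: T_def)
  have "\<xi>0 \<noteq> 0" using \<Gamma> by auto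
  define \<omega> where "\<omega> = \<xi>0 /\<^sub>R norm \<xi>0"
  have "\<omega> \<in> \<Gamma>" unfolding \<omega>_def using \<open>\<xi>0 \<noteq> 0\<close> by (intro con' \<Gamma>) auto
  then obtain e where e: "e > 0" "ball \<omega> e \<subseteq> \<Gamma>" using \<Gamma>(1) open_contains_ball by blast
  define \<delta> where "\<delta> = min (e / 2) (1 / 2)"
  have \<delta>: "0 < \<delta>" "\<delta> \<le> 1/2" "ball \<omega> (2 * \<delta>) \<subseteq> \<Gamma>" using e by (auto simp: \<delta>_def)
  define n2 where "n2 = 2 * CARD('n)"
  obtain S0' where S0': "\<And>F. finite F \<Longrightarrow> (\<Sum>k\<in>F. 1 / ksize (k :: 'n \<Rightarrow> int) ^ n2) \<le> S0'"
    using ksize_sums_bounded[where 'n = 'n] unfolding n2_def by blast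
  have S0: "0 \<le> S0'" using S0'[of "{}"] by simp
  define h where "h = pi / T"
  have h: "h \<ge> 0" using T by (simp add: h_def)
  define E where "E = 1 + (1 / \<delta> + 1) * h"
  have E: "E \<ge> 1" using \<delta> h by (simp add: E_def)
  define G0 where "G0 = (real CARD('n) + 1) * max 1 (T / pi)"
  have G0: "G0 \<ge> 1" using mult_mono[of 1 "real CARD('n) + 1" 1 "max 1 (T / pi)"] by (simp add: G0_def)
  have pol: "cmod (U N (expo (- \<zeta>))) \<le> C0 * (1 + norm \<zeta>) ^ k0" for N \<zeta>
    by (rule cont[OF smooth_on_subset[OF smooth_expo subset_UNIV]])
       (use iter_partial_expo_bound'[of _ k0 "- \<zeta>"] in auto)
  have "microlocal_decay f (cball x0 r) (conic_nbhd \<xi>0 \<delta>)"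
    unfolding microlocal_decay_def
  proof (intro allI impI)
    fix s A :: real assume s: "1 < s" and A: "1 \<le> A"
    \<comment> \<open>The choice Q = 1 is enough here: geometric factors are collected in B.\<close>
    obtain C1' where C1': "\<And>\<xi> N. \<xi> \<in> \<Gamma> \<Longrightarrow> norm \<xi> ^ N * cmod (fourier (U N) \<xi>) / (1 ^ N * fact N powr s) \<le> C1'"
      using dec s by (meson zero_less_one)
    define C1 where "C1 = max C1' 0"
    have C1: "C1 \<ge> 0" "norm \<xi> ^ N * cmod (U N (expo (- \<xi>))) \<le> C1 * fact N powr s" if "\<xi> \<in> \<Gamma>" for \<xi> N
    proof -
      have "norm \<xi> ^ N * cmod (fourier (U N) \<xi>) / (fact N powr s) \<le> C1" using C1'[OF that, of N] by (simp add: C1_def)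
      then show "norm \<xi> ^ N * cmod (U N (expo (- \<xi>))) \<le> C1 * fact N powr s"
        by (simp add: divide_le_eq fourier_def expo_def[abs_def])
    qed (simp add: C1_def)
    have C10: "C1 \<ge> 0" by (simp add: C1_def)
    define G where "G = G0 * A"
    have G: "G \<ge> 1" using G0 A mult_mono[of 1 G0 1 A] by (simp add: G_def)
    define p where "p = k0 + n2"
    define W where "W = (2 ^ p * fact p :: real) powr s"
    define B where "B = 2 * E * G * 2 powr s"
    define C where "C = S0' * (C1 * G ^ n2 + C0 * E ^ k0 * G ^ p) * W"
    have W: "W \<ge> 0" by (simp add: W_def)
    have tp: "(2::real) powr s \<ge> 1" using s by (intro ge_one_powr_ge_zero) auto
    have EG: "E * G \<ge> 1" using E G mult_mono[of 1 E 1 G] by simp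
    then have "2 * (E * G) \<ge> 1" by linarith
    then have B: "B \<ge> 1" using tp mult_mono[of 1 "2 * (E * G)" 1 "2 powr s"] by (simp add: B_def mult.assoc)
    have C: "C \<ge> 0" unfolding C_def using S0 C10 C0 E G W by (intro mult_nonneg_nonneg add_nonneg_nonneg) auto
    have main: "norm \<xi> ^ N * cmod (f (\<lambda>x. g x * expo (- \<xi>) x)) \<le> C * M * B ^ (N + l) * fact (N + l) powr s"
      if g: "smooth_on UNIV g" "\<forall>x. x \<notin> cball x0 r \<longrightarrow> g x = 0" "gbd UNIV s M A l g" and \<xi>: "\<xi> \<in> conic_nbhd \<xi>0 \<delta>" "1 \<le> norm \<xi>"
      for g M l N \<xi>
    proof -
      have M: "0 \<le> M" using gbd_nonneg[OF g(3)] by simp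
      have g': "g x = 0" if "x \<notin> cube T" for x
      proof -
        have "x \<notin> cball x0 r" using that coord[of x] by (auto simp: mem_cube intro: less_imp_le)
        then show ?thesis using g(2) by blast
      qed
      have gd: "ksize k ^ b * cmod (fcoef T g k) \<le> G ^ b * M * fact (b + l) powr s" for k b
      proof -
        have "ksize k ^ b * cmod (fcoef T g k) \<le> G0 ^ b * (M * A ^ b * fact (b + l) powr s)"
          unfolding G0_def
        proof (rule fcoef_decay[OF T g(1) g'])
          fix x
          have "cmod (g x) \<le> M * 1 * fact l powr s" using gbdD[OF g(3), of x "[]"] by simp
          also have "\<dots> \<le> M * A ^ b * fact (b + l) powr s"
            using M A s by (intro mult_mono powr_mono2 mult_left_mono one_le_power) (auto intro: fact_mono)
          finally show "cmod (g x) \<le> M * A ^ b * fact (b + l) powr s" .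
          show "cmod (iter_partial (replicate b i) g x) \<le> M * A ^ b * fact (b + l) powr s" for i
            using gbdD[OF g(3), of x "replicate b i"] by simp
        qed
        then show ?thesis by (simp add: G_def power_mult_distrib mult_ac)
      qed
      \<comment> \<open>X uses n2 derivatives of g, as needed for summability over the frequencies.
        Y uses N + k0 + n2 of them: the first N + k0 pay for the powers of \<open>ksize k\<close>
        that arise at high frequencies.\<close>
      define X where "X = G ^ n2 * M * fact (n2 + l) powr s"
      define Y where "Y = G ^ (N + p) * M * fact (N + p + l) powr s"
      have X: "cmod (fcoef T g k) \<le> X * (1 / ksize k ^ n2)" for k
        using gd[of k n2] ksize_ge(1)[of k] by (simp add: X_def field_simps)
      have Y: "ksize k ^ (N + k0) * cmod (fcoef T g k) \<le> Y * (1 / ksize k ^ n2)" for k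
        using gd[of k "N + p"] ksize_ge(1)[of k] by (simp add: Y_def p_def field_simps power_add)
      define R0 where "R0 = 2 ^ N * (C1 * fact N powr s) * X + C0 * E ^ (N + k0) * Y"
      have R00: "R0 \<ge> 0" unfolding R0_def X_def Y_def using C10 C0 E G M by (intro add_nonneg_nonneg mult_nonneg_nonneg) auto
      have trm: "norm \<xi> ^ N * (cmod (fcoef T g k) * cmod (U N (expo (freq T k - \<xi>)))) \<le> R0 * (1 / ksize k ^ n2)" for k
      proof -
        have "norm \<xi> ^ N * cmod (U N (expo (- (\<xi> - freq T k)))) \<le> 2 ^ N * (C1 * fact N powr s) + C0 * (E * ksize k) ^ (N + k0)"
        proof (rule microlocal_decay_term[where \<omega> = \<omega> and \<delta> = \<delta> and \<Gamma> = \<Gamma> and h = h])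
          show "norm (\<xi> /\<^sub>R norm \<xi> - \<omega>) < \<delta>" using \<xi>(1) by (simp add: conic_nbhd_def \<omega>_def)
          show "norm (freq T k) \<le> h * ksize k" unfolding h_def by (rule norm_freq_le[OF T])
          show "norm \<zeta> ^ N * cmod (U N (expo (- \<zeta>))) \<le> C1 * fact N powr s" if "\<zeta> \<in> \<Gamma>" for \<zeta> by (rule C1(2)[OF that])
        qed (use \<delta> con' \<xi> C0 C10 pol ksize_ge(1) h E_def in auto)
        then have "cmod (fcoef T g k) * (norm \<xi> ^ N * cmod (U N (expo (freq T k - \<xi>))))
           \<le> cmod (fcoef T g k) * (2 ^ N * (C1 * fact N powr s) + C0 * (E * ksize k) ^ (N + k0))"
          by (intro mult_left_mono) auto
        also have "\<dots> = (2 ^ N * (C1 * fact N powr s)) * cmod (fcoef T g k) + (C0 * E ^ (N + k0)) * (ksize k ^ (N + k0) * cmod (fcoef T g k))"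
          by (simp add: algebra_simps power_mult_distrib)
        also have "\<dots> \<le> (2 ^ N * (C1 * fact N powr s)) * (X * (1 / ksize k ^ n2)) + (C0 * E ^ (N + k0)) * (Y * (1 / ksize k ^ n2))"
          by (intro add_mono mult_left_mono X Y) (use C10 C0 E in auto)
        also have "\<dots> = R0 * (1 / ksize k ^ n2)" by (simp add: R0_def algebra_simps)
        finally show ?thesis by (simp add: mult_ac)
      qed
      have "norm \<xi> > 0" using \<xi>(2) by linarith
      then have pos: "norm \<xi> ^ N > 0" by (rule zero_less_power)
      have "cmod (U N (\<lambda>x. g x * expo (- \<xi>) x)) \<le> R0 * S0' / norm \<xi> ^ N"
      proof (rule functional_fourier_bound[OF \<Omega> cd K(2) _ C0 cont T g(1) g'])
        show "\<bar>x $ i\<bar> < T" if "x \<in> K" for x :: "real^'n" and i using coord that by blast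
        fix F :: "('n \<Rightarrow> int) set" assume F: "finite F"
        have "norm \<xi> ^ N * (\<Sum>k\<in>F. cmod (fcoef T g k) * cmod (U N (expo (freq T k - \<xi>)))) \<le> (\<Sum>k\<in>F. R0 * (1 / ksize k ^ n2))"
          unfolding sum_distrib_left by (rule sum_mono) (rule trm)
        also have "\<dots> \<le> R0 * S0'" unfolding sum_distrib_left[symmetric] by (intro mult_left_mono S0' F R00)
        finally show "(\<Sum>k\<in>F. cmod (fcoef T g k) * cmod (U N (expo (freq T k - \<xi>)))) \<le> R0 * S0' / norm \<xi> ^ N"
          using pos by (simp add: le_divide_eq mult.commute)
      qed
      then have 1: "norm \<xi> ^ N * cmod (U N (\<lambda>x. g x * expo (- \<xi>) x)) \<le> S0' * R0"
        using pos by (simp add: le_divide_eq mult.commute)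
      have fp: "fact (N + l + p) powr s \<le> W * (2 powr s) ^ (N + l) * fact (N + l) powr s"
        unfolding W_def by (rule fact_shift_powr) (use s in auto)
      \<comment> \<open>The low frequencies produce N! from the decay of \<open>U N\<close> and (n2
        + l)! from g; a product of factorials is at most the factorial of the sum.\<close>
      have "fact N powr s * fact (n2 + l) powr s \<le> (fact (N + l + p) :: real) powr s"
      proof -
        have "fact N * fact (n2 + l) \<le> (fact (N + (n2 + l)) :: real)" 
          using fact_fact_dvd_fact[of N "n2 + l"] dvd_imp_le[of "fact N * fact (n2 + l)" "fact (N + (n2 + l))"]
          by (metis fact_gt_zero of_nat_fact of_nat_le_iff of_nat_mult)
        also have "\<dots> \<le> fact (N + l + p)" by (rule fact_mono) (simp add: p_def)
        finally have "(fact N * fact (n2 + l) :: real) powr s \<le> fact (N + l + p) powr s"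
          using s by (intro powr_mono2) auto
        then show ?thesis by (simp only: powr_mult)
      qed
      with fp have fX: "fact N powr s * fact (n2 + l) powr s \<le> W * (2 powr s) ^ (N + l) * fact (N + l) powr s" by linarith
      have fY: "fact (N + p + l) powr s \<le> W * (2 powr s) ^ (N + l) * fact (N + l) powr s"
        using fp by (simp add: add_ac)
      let ?Q = "(2 powr s) ^ (N + l) * fact (N + l) powr s"
      have EGn: "(2 * (E * G)) ^ (N + l) \<ge> 2 ^ N" "(2 * (E * G)) ^ (N + l) \<ge> E ^ N * G ^ N"
      proof -
        have "(2::real) ^ N \<le> 2 ^ (N + l)" by (intro power_increasing) auto
        also have "\<dots> \<le> (2 * (E * G)) ^ (N + l)" using EG by (intro power_mono) auto
        finally show "(2 * (E * G)) ^ (N + l) \<ge> 2 ^ N" .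
        have "(E * G) ^ N \<le> (E * G) ^ (N + l)" using EG by (intro power_increasing) auto
        also have "\<dots> \<le> (2 * (E * G)) ^ (N + l)" using EG by (intro power_mono) auto
        finally show "(2 * (E * G)) ^ (N + l) \<ge> E ^ N * G ^ N" by (simp add: power_mult_distrib)
      qed
      have "2 ^ N * (C1 * fact N powr s) * X = 2 ^ N * (C1 * G ^ n2 * M) * (fact N powr s * fact (n2 + l) powr s)"
        by (simp add: X_def mult_ac)
      also have "\<dots> \<le> (2 * (E * G)) ^ (N + l) * (C1 * G ^ n2 * M) * (W * (2 powr s) ^ (N + l) * fact (N + l) powr s)"
        by (intro mult_mono mult_right_mono EGn fX mult_nonneg_nonneg) (use C10 G M E in auto)
      also have "\<dots> = C1 * G ^ n2 * W * M * B ^ (N + l) * fact (N + l) powr s"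
        by (simp add: B_def power_mult_distrib mult_ac)
      finally have b1: "2 ^ N * (C1 * fact N powr s) * X \<le> C1 * G ^ n2 * W * M * B ^ (N + l) * fact (N + l) powr s" .
      have "C0 * E ^ (N + k0) * Y = (E ^ N * G ^ N) * (C0 * E ^ k0 * G ^ p * M) * fact (N + p + l) powr s"
        by (simp add: Y_def power_add mult_ac)
      also have "\<dots> \<le> (2 * (E * G)) ^ (N + l) * (C0 * E ^ k0 * G ^ p * M) * (W * (2 powr s) ^ (N + l) * fact (N + l) powr s)"
        by (intro mult_mono mult_right_mono EGn fY mult_nonneg_nonneg) (use C0 G M E in auto)
      also have "\<dots> = C0 * E ^ k0 * G ^ p * W * M * B ^ (N + l) * fact (N + l) powr s"
        by (simp add: B_def power_mult_distrib mult_ac)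
      finally have b2: "C0 * E ^ (N + k0) * Y \<le> C0 * E ^ k0 * G ^ p * W * M * B ^ (N + l) * fact (N + l) powr s" .
      have "S0' * R0 \<le> S0' * (C1 * G ^ n2 * W * M * B ^ (N + l) * fact (N + l) powr s + C0 * E ^ k0 * G ^ p * W * M * B ^ (N + l) * fact (N + l) powr s)"
        unfolding R0_def using b1 b2 S0 by (intro mult_left_mono add_mono) auto
      also have "\<dots> = C * M * B ^ (N + l) * fact (N + l) powr s"
        by (simp add: C_def algebra_simps)
      finally have 2: "S0' * R0 \<le> C * M * B ^ (N + l) * fact (N + l) powr s" .
      have "test_fun V (\<lambda>x. g x * expo (- \<xi>) x)"
        by (rule test_funI(1)[OF _ compact_cball r(2)]) (use g in \<open>auto intro!: smooth_on_mult smooth_expo\<close>)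
      then have "U N (\<lambda>x. g x * expo (- \<xi>) x) = f (\<lambda>x. g x * expo (- \<xi>) x)" using UV by blast
      with 1 2 show ?thesis by simp
    qed
    show "\<exists>C\<ge>0. \<exists>B\<ge>1. \<forall>g M l N \<xi>. smooth_on UNIV g \<longrightarrow> (\<forall>x. x \<notin> cball x0 r \<longrightarrow> g x = 0) \<longrightarrow> gbd UNIV s M A l g \<longrightarrow>
       \<xi> \<in> conic_nbhd \<xi>0 \<delta> \<longrightarrow> 1 \<le> norm \<xi> \<longrightarrow>
       norm \<xi> ^ N * cmod (f (\<lambda>x. g x * expo (- \<xi>) x)) \<le> C * M * B ^ (N + l) * fact (N + l) powr s"
      by (rule exI[of _ C], rule conjI[OF C], rule exI[of _ B], rule conjI[OF B]) (intro allI impI, rule main)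
  qed
  moreover have "cball x0 r \<subseteq> \<Omega>" using r V by blast
  ultimately show ?thesis using that r(1) \<delta>(1) by blast
qed

section \<open>The transposed operator on oscillating test functions\<close>

text \<open>Conjugation by exp (- i t x \<omega>) turns \<open>\<i> * partial k\<close> into
  multiplication by \<open>t * \<omega> $ k\<close> plus \<open>\<i> * partial k\<close>.
  \<open>symop \<omega> L j\<close> is the coefficient of t ^ (length L - j) in the product of these
  factors over L: j of them differentiate, the others multiply by components of \<omega>.\<close>

fun symop :: "real^'n::finite \<Rightarrow> 'n list \<Rightarrow> nat \<Rightarrow> (real^'n \<Rightarrow> complex) \<Rightarrow> real^'n \<Rightarrow> complex" where
  "symop \<omega> [] 0 w = w"
| "symop \<omega> [] (Suc j) w = (\<lambda>x. 0)"
| "symop \<omega> (i # L) 0 w = (\<lambda>x. of_real (\<omega> $ i) * symop \<omega> L 0 w x)"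
| "symop \<omega> (i # L) (Suc j) w = (\<lambda>x. of_real (\<omega> $ i) * symop \<omega> L (Suc j) w x + \<i> * partial i (symop \<omega> L j w) x)"

lemma smooth_symop: "smooth_on UNIV w \<Longrightarrow> smooth_on UNIV (symop \<omega> L j w)"
  by (induction \<omega> L j w rule: symop.induct)
     (auto intro!: smooth_on_const smooth_on_add smooth_on_cmult smooth_on_partial)

lemma symop_zero: "length L < j \<Longrightarrow> symop \<omega> L j w = (\<lambda>x. 0)"
proof (induction \<omega> L j w rule: symop.induct)
  case (4 \<omega> i L j w)
  have "partial i (\<lambda>x. 0) = (\<lambda>x. 0)" using has_partial_const has_partial_imp by blast
  with 4 show ?case by simp
qed auto

lemma symop_vanish:
  assumes "\<And>x. x \<notin> K \<Longrightarrow> w x = 0" "closed K" "x \<notin> K"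
  shows "symop \<omega> L j w x = 0"
  using assms
proof (induction \<omega> L j w arbitrary: x rule: symop.induct)
  case (4 \<omega> i L j w)
  have "iter_partial [i] (symop \<omega> L j w) x = 0"
    by (rule vanish_outside_iter[of K]) (use 4 in auto)
  with 4 show ?case by simp
qed auto

lemma symop_0: "symop \<omega> L 0 w x = (\<Prod>i\<leftarrow>L. of_real (\<omega> $ i)) * w x"
  by (induction L) (auto simp: mult_ac)

text \<open>Each direction in L offers two choices, whence 2 ^ length L; each derivative contributes
  a factor A to the constant and 1 to the shift.\<close>

lemma gbd_symop:
  fixes w :: "real^'n::finite \<Rightarrow> complex" and \<omega> :: "real^'n"
  assumes "smooth_on UNIV w" "gbd UNIV s M A l w" "0 \<le> M" "1 \<le> A" "0 \<le> s" "\<And>i. \<bar>\<omega> $ i\<bar> \<le> 1"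
  shows "gbd UNIV s (2 ^ length L * A ^ j * M) A (l + j) (symop \<omega> L j w)"
  using assms
proof (induction \<omega> L j w rule: symop.induct)
  case (1 \<omega> w) then show ?case by simp
next
  case (2 \<omega> j w) then show ?case by (auto intro!: gbd_zero)
next
  case (3 \<omega> i L w)
  have "gbd UNIV s (cmod (of_real (\<omega> $ i)) * (2 ^ length L * A ^ 0 * M)) A (l + 0) (\<lambda>x. of_real (\<omega> $ i) * symop \<omega> L 0 w x)"
    by (rule gbd_cmult[of UNIV]) (use 3 in \<open>auto intro: smooth_symop\<close>)
  then show ?case
  proof (simp only: symop.simps, elim gbd_mono)
    have "\<bar>\<omega> $ i\<bar> * (2 ^ length L * M) \<le> 2 * (2 ^ length L * M)"
      using 3(7)[of i] \<open>0 \<le> M\<close> by (intro mult_right_mono) auto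
    then show "cmod (of_real (\<omega> $ i)) * (2 ^ length L * A ^ 0 * M) \<le> 2 ^ length (i # L) * A ^ 0 * M" by simp
  qed (use 3 in auto)
next
  case (4 \<omega> i L j w)
  have s: "smooth_on UNIV (symop \<omega> L k w)" for k using 4 by (intro smooth_symop)
  have a: "gbd UNIV s (cmod (of_real (\<omega> $ i)) * (2 ^ length L * A ^ Suc j * M)) A (l + Suc j) (\<lambda>x. of_real (\<omega> $ i) * symop \<omega> L (Suc j) w x)"
    by (rule gbd_cmult[of UNIV]) (use 4 s in auto)
  have b: "gbd UNIV s (cmod \<i> * (2 ^ length L * A ^ j * M * A)) A (Suc (l + j)) (\<lambda>x. \<i> * partial i (symop \<omega> L j w) x)"
  proof (rule gbd_cmult[OF open_UNIV subset_UNIV smooth_on_partial[OF s] gbd_partial])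
    show "gbd UNIV s (2 ^ length L * A ^ j * M) A (l + j) (symop \<omega> L j w)" using 4 by simp
  qed
  have c: "gbd UNIV s (cmod (of_real (\<omega> $ i)) * (2 ^ length L * A ^ Suc j * M) + cmod \<i> * (2 ^ length L * A ^ j * M * A)) A (l + Suc j)
     (\<lambda>x. of_real (\<omega> $ i) * symop \<omega> L (Suc j) w x + \<i> * partial i (symop \<omega> L j w) x)"
    by (rule gbd_add[of UNIV]) (use a b s in \<open>auto intro!: smooth_on_cmult smooth_on_partial\<close>)
  show ?case unfolding symop.simps
  proof (rule gbd_mono[OF c])
    have "\<bar>\<omega> $ i\<bar> * (2 ^ length L * A ^ Suc j * M) \<le> 1 * (2 ^ length L * A ^ Suc j * M)"
      using 4(8)[of i] 4 by (intro mult_right_mono) auto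
    then show "cmod (of_real (\<omega> $ i)) * (2 ^ length L * A ^ Suc j * M) + cmod \<i> * (2 ^ length L * A ^ j * M * A) \<le> 2 ^ length (i # L) * A ^ Suc j * M"
      by (simp add: mult_ac)
  qed (use 4 in auto)
qed

lemma iter_partial_expo_conj:
  fixes w :: "real^'n::finite \<Rightarrow> complex"
  assumes w: "smooth_on UNIV w"
  shows "\<i> ^ length L * iter_partial L (\<lambda>x. w x * expo (- (t *\<^sub>R \<omega>)) x) x
    = (\<Sum>j\<le>length L. of_real (t ^ (length L - j)) * symop \<omega> L j w x) * expo (- (t *\<^sub>R \<omega>)) x"
proof (induction L arbitrary: x)
  case Nil then show ?case by simp
next
  case (Cons i L)
  let ?e = "expo (- (t *\<^sub>R \<omega>))" and ?l = "length L"
  define q where "q = (\<lambda>x. \<Sum>j\<le>?l. of_real (t ^ (?l - j)) * symop \<omega> L j w x)"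
  have sm: "smooth_on UNIV (symop \<omega> L j w)" for j by (rule smooth_symop[OF w])
  have qs: "smooth_on UNIV q" unfolding q_def by (intro smooth_on_sum smooth_on_cmult sm) auto
  have pq: "partial i q x = (\<Sum>j\<le>?l. of_real (t ^ (?l - j)) * partial i (symop \<omega> L j w) x)"
    using iter_partial_sum[of UNIV "{..?l}" "\<lambda>j x. of_real (t ^ (?l - j)) * symop \<omega> L j w x" x "[i]"]
      iter_partial_cmult[OF open_UNIV sm UNIV_I, where L = "[i]"]
    by (simp add: q_def smooth_on_cmult sm)
  have IH: "iter_partial L (\<lambda>x. w x * ?e x) x = inverse (\<i> ^ ?l) * (q x * ?e x)" for x
    using Cons[of x] by (simp add: q_def field_simps)
  have "partial i (iter_partial L (\<lambda>x. w x * ?e x)) x = partial i (\<lambda>x. inverse (\<i> ^ ?l) * (q x * ?e x)) x"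
    unfolding IH[abs_def] ..
  also have "\<dots> = 0 * (q x * ?e x) + inverse (\<i> ^ ?l) * (partial i q x * ?e x + q x * (\<i> * of_real ((- (t *\<^sub>R \<omega>)) $ i) * ?e x))"
    by (intro has_partial_imp has_partial_mult has_partial_const has_partial_expo smooth_on_has_partial[OF qs] UNIV_I)
  finally have D: "partial i (iter_partial L (\<lambda>x. w x * ?e x)) x = inverse (\<i> ^ ?l) * (partial i q x * ?e x + q x * (\<i> * of_real (- (t * \<omega> $ i)) * ?e x))"
    by simp
  have "\<i> * (y * e + z * (\<i> * of_real (- v) * e)) = (\<i> * y + of_real v * z) * e" for y z e :: complex and v :: real
  proof -
    have "\<i> * (z * (\<i> * of_real (- v) * e)) = (\<i> * \<i>) * (z * of_real (- v) * e)" by (simp only: mult_ac)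
    also have "\<dots> = of_real v * z * e" by simp
    finally show ?thesis unfolding distrib_left distrib_right by (simp only: mult.assoc)
  qed
  moreover have "\<i> ^ Suc ?l * (inverse (\<i> ^ ?l) * Y) = \<i> * Y" for Y by simp
  ultimately have "\<i> ^ Suc ?l * partial i (iter_partial L (\<lambda>x. w x * ?e x)) x = (\<i> * partial i q x + of_real (t * \<omega> $ i) * q x) * ?e x"
    unfolding D by (simp only:)
  also have "\<i> * partial i q x + of_real (t * \<omega> $ i) * q x = (\<Sum>j\<le>Suc ?l. of_real (t ^ (Suc ?l - j)) * symop \<omega> (i # L) j w x)"
  proof -
    have "of_real (t * \<omega> $ i) * q x = (\<Sum>j\<le>?l. of_real (t ^ (Suc ?l - j)) * (of_real (\<omega> $ i) * symop \<omega> L j w x))"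
      unfolding q_def sum_distrib_left by (rule sum.cong) (auto simp: Suc_diff_le)
    \<comment> \<open>The added summand j = Suc ?l vanishes, since there are no more derivatives
      than directions.\<close>
    also have "\<dots> = (\<Sum>j\<le>Suc ?l. of_real (t ^ (Suc ?l - j)) * (of_real (\<omega> $ i) * symop \<omega> L j w x))"
      by (simp add: symop_zero)
    also have "\<dots> = of_real (t ^ Suc ?l) * (of_real (\<omega> $ i) * symop \<omega> L 0 w x)
       + (\<Sum>j\<le>?l. of_real (t ^ (?l - j)) * (of_real (\<omega> $ i) * symop \<omega> L (Suc j) w x))"
      by (subst sum.atMost_Suc_shift) simp
    finally have 1: "of_real (t * \<omega> $ i) * q x = of_real (t ^ Suc ?l) * (of_real (\<omega> $ i) * symop \<omega> L 0 w x)
       + (\<Sum>j\<le>?l. of_real (t ^ (?l - j)) * (of_real (\<omega> $ i) * symop \<omega> L (Suc j) w x))" .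
    have 2: "\<i> * partial i q x = (\<Sum>j\<le>?l. of_real (t ^ (?l - j)) * (\<i> * partial i (symop \<omega> L j w) x))"
      unfolding pq sum_distrib_left by (rule sum.cong) auto
    show ?thesis unfolding 1 2
      by (subst sum.atMost_Suc_shift) (simp add: distrib_left sum.distrib)
  qed
  finally show ?case by simp
qed

section \<open>The operator acting on distributions\<close>

lemma smooth_mult_cutoff:
  fixes a \<phi> :: "real^'n::finite \<Rightarrow> complex"
  assumes "open \<Omega>" "smooth_on \<Omega> a" "smooth_on UNIV \<phi>" "closed K" "K \<subseteq> \<Omega>" "\<And>x. x \<notin> K \<Longrightarrow> \<phi> x = 0"
  shows "smooth_on UNIV (\<lambda>x. a x * \<phi> x)"
  by (rule smooth_on_zero_ext[OF assms(1) _ assms(4,5)])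
     (use assms smooth_on_subset[OF assms(3) subset_UNIV] in \<open>auto intro!: smooth_on_mult\<close>)

lemma test_fun_vanish: "test_fun \<Omega> \<phi> \<Longrightarrow> x \<notin> tsupp \<phi> \<Longrightarrow> \<phi> x = 0"
  unfolding tsupp_def using closure_subset[of "{x. \<phi> x \<noteq> 0}"] by auto

lemma test_funD:
  assumes "test_fun \<Omega> \<phi>"
  shows "smooth_on UNIV \<phi>" "compact (tsupp \<phi>)" "closed (tsupp \<phi>)" "tsupp \<phi> \<subseteq> \<Omega>"
  using assms by (auto simp: test_fun_def tsupp_def)

lemma distribution_plus:
  fixes u v :: "(real^'n::finite \<Rightarrow> complex) \<Rightarrow> complex"
  assumes "distribution \<Omega> u" "distribution \<Omega> v"
  shows "distribution \<Omega> (\<lambda>\<phi>. u \<phi> + v \<phi>)"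
  unfolding distribution_def
proof (intro conjI allI impI)
  fix \<phi> \<psi> assume "test_fun \<Omega> \<phi> \<and> test_fun \<Omega> \<psi>"
  then show "u (\<lambda>x. \<phi> x + \<psi> x) + v (\<lambda>x. \<phi> x + \<psi> x) = u \<phi> + v \<phi> + (u \<psi> + v \<psi>)"
    by (simp add: distribution_add[OF assms(1)] distribution_add[OF assms(2)])
next
  fix c \<phi> assume "test_fun \<Omega> \<phi>"
  then show "u (\<lambda>x. c * \<phi> x) + v (\<lambda>x. c * \<phi> x) = c * (u \<phi> + v \<phi>)"
    by (simp add: distribution_cmult[OF assms(1)] distribution_cmult[OF assms(2)] distrib_left)
next
  fix K :: "(real^'n) set" assume K: "compact K \<and> K \<subseteq> \<Omega>"
  obtain C k where u: "\<And>\<phi> M. test_fun \<Omega> \<phi> \<and> tsupp \<phi> \<subseteq> K \<and>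
         (\<forall>\<alpha> x. mabs \<alpha> \<le> k \<and> x \<in> K \<longrightarrow> cmod (dpartial \<alpha> \<phi> x) \<le> M) \<Longrightarrow> cmod (u \<phi>) \<le> C * M"
    using assms(1) K unfolding distribution_def by metis
  obtain C' k' where v: "\<And>\<phi> M. test_fun \<Omega> \<phi> \<and> tsupp \<phi> \<subseteq> K \<and>
         (\<forall>\<alpha> x. mabs \<alpha> \<le> k' \<and> x \<in> K \<longrightarrow> cmod (dpartial \<alpha> \<phi> x) \<le> M) \<Longrightarrow> cmod (v \<phi>) \<le> C' * M"
    using assms(2) K unfolding distribution_def by metis
  have "cmod (u \<phi> + v \<phi>) \<le> (C + C') * M" if "test_fun \<Omega> \<phi> \<and> tsupp \<phi> \<subseteq> K \<and>
         (\<forall>\<alpha> x. mabs \<alpha> \<le> max k k' \<and> x \<in> K \<longrightarrow> cmod (dpartial \<alpha> \<phi> x) \<le> M)" for \<phi> M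
  proof -
    have "cmod (u \<phi>) \<le> C * M" by (rule u) (use that in auto)
    moreover have "cmod (v \<phi>) \<le> C' * M" by (rule v) (use that in auto)
    ultimately show ?thesis using norm_triangle_ineq[of "u \<phi>" "v \<phi>"] by (simp add: distrib_right)
  qed
  then show "\<exists>C k. \<forall>\<phi> M. test_fun \<Omega> \<phi> \<and> tsupp \<phi> \<subseteq> K \<and>
         (\<forall>\<alpha> x. mabs \<alpha> \<le> k \<and> x \<in> K \<longrightarrow> cmod (dpartial \<alpha> \<phi> x) \<le> M) \<longrightarrow> cmod (u \<phi> + v \<phi>) \<le> C * M" by blast
qed

lemma distribution_zero: "distribution \<Omega> (\<lambda>\<phi>. 0)"
  unfolding distribution_def by (auto intro!: exI[of _ 0])

lemma distribution_finite_sum: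
  "finite A \<Longrightarrow> (\<And>a. a \<in> A \<Longrightarrow> distribution \<Omega> (u a)) \<Longrightarrow> distribution \<Omega> (\<lambda>\<phi>. \<Sum>a\<in>A. u a \<phi>)"
  by (induction A rule: finite_induct) (auto intro: distribution_zero distribution_plus)

lemma distribution_coeff_deriv:
  fixes u :: "(real^'n::finite \<Rightarrow> complex) \<Rightarrow> complex"
  assumes \<Omega>: "open \<Omega>" and u: "distribution \<Omega> u" and a: "smooth_on \<Omega> a"
  shows "distribution \<Omega> (\<lambda>\<phi>. u (\<lambda>x. c * iter_partial J (\<lambda>y. a y * \<phi> y) x))"
proof -
  have am: "smooth_on UNIV (\<lambda>x. a x * \<phi> x)" if "test_fun \<Omega> \<phi>" for \<phi>
    using test_funD[OF that] test_fun_vanish[OF that] by (intro smooth_mult_cutoff[OF \<Omega> a]) auto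
  have van: "iter_partial J (\<lambda>y. a y * \<phi> y) x = 0" if "\<And>x. x \<notin> K \<Longrightarrow> \<phi> x = 0" "closed K" "x \<notin> K" for \<phi> K x
    by (rule vanish_outside_iter[of K]) (use that in auto)
  have sm: "smooth_on UNIV (\<lambda>x. c * iter_partial J (\<lambda>y. a y * \<phi> y) x)" if "test_fun \<Omega> \<phi>" for c \<phi>
    by (intro smooth_on_cmult smooth_on_iter_partial am that) auto
  have tf: "test_fun \<Omega> (\<lambda>x. c * iter_partial J (\<lambda>y. a y * \<phi> y) x)" if "test_fun \<Omega> \<phi>" for c \<phi>
    by (rule test_funI(1)[OF sm[OF that] test_funD(2)[OF that] test_funD(4)[OF that]])
       (use van[OF test_fun_vanish[OF that] test_funD(3)[OF that]] in auto)
  show ?thesis unfolding distribution_def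
  proof (intro conjI allI impI)
    fix \<phi> \<psi> assume t: "test_fun \<Omega> \<phi> \<and> test_fun \<Omega> \<psi>"
    have "c * iter_partial J (\<lambda>y. a y * (\<phi> y + \<psi> y)) x = c * iter_partial J (\<lambda>y. a y * \<phi> y) x + c * iter_partial J (\<lambda>y. a y * \<psi> y) x" for x
      unfolding distrib_left using t by (subst iter_partial_add[of UNIV]) (auto simp: am distrib_left)
    then show "u (\<lambda>x. c * iter_partial J (\<lambda>y. a y * (\<phi> y + \<psi> y)) x) =
      u (\<lambda>x. c * iter_partial J (\<lambda>y. a y * \<phi> y) x) + u (\<lambda>x. c * iter_partial J (\<lambda>y. a y * \<psi> y) x)"
      using distribution_add[OF u tf tf, of \<phi> \<psi>] t by simp
  next
    fix d \<phi> assume t: "test_fun \<Omega> \<phi>"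
    have "c * iter_partial J (\<lambda>y. a y * (d * \<phi> y)) x = d * (c * iter_partial J (\<lambda>y. a y * \<phi> y) x)" for x
      using iter_partial_cmult[OF open_UNIV am[OF t] UNIV_I, of J d x] by (simp add: mult_ac)
    then show "u (\<lambda>x. c * iter_partial J (\<lambda>y. a y * (d * \<phi> y)) x) = d * u (\<lambda>x. c * iter_partial J (\<lambda>y. a y * \<phi> y) x)"
      using distribution_cmult[OF u tf[OF t], of d] by (simp only:)
  next
    fix K :: "(real^'n) set" assume K: "compact K \<and> K \<subseteq> \<Omega>"
    obtain C k where C: "0 \<le> C" "\<And>\<phi> M. smooth_on UNIV \<phi> \<Longrightarrow> (\<And>x. x \<notin> K \<Longrightarrow> \<phi> x = 0) \<Longrightarrow> 0 \<le> M \<Longrightarrow>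
     (\<And>L x. length L \<le> k \<Longrightarrow> x \<in> K \<Longrightarrow> cmod (iter_partial L \<phi> x) \<le> M) \<Longrightarrow> cmod (u \<phi>) \<le> C * M"
      using distribution_order[OF u, of K] K by blast
    let ?k = "k + length J"
    obtain B where B: "0 \<le> B" "\<And>L x. length L \<le> ?k \<Longrightarrow> x \<in> K \<Longrightarrow> cmod (iter_partial L a x) \<le> B"
      using iter_partial_bounded_on_compact[OF a, of K ?k] K by blast
    \<comment> \<open>On the empty set the hypothesis says nothing about M, which may be negative.
      The constant 0 covers this case, where u is applied to the zero function.\<close>
    define C' where "C' = (if K = {} then 0 else C * (cmod c * (2 ^ ?k * B)))"
    have "cmod (u (\<lambda>x. c * iter_partial J (\<lambda>y. a y * \<phi> y) x)) \<le> C' * M" if t: "test_fun \<Omega> \<phi> \<and> tsupp \<phi> \<subseteq> K \<and>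
         (\<forall>\<alpha> x. mabs \<alpha> \<le> ?k \<and> x \<in> K \<longrightarrow> cmod (dpartial \<alpha> \<phi> x) \<le> M)" for \<phi> M
    proof -
      have z: "\<phi> x = 0" if "x \<notin> K" for x using t that test_fun_vanish by blast
      have ph: "cmod (iter_partial L \<phi> x) \<le> M" if "length L \<le> ?k" "x \<in> K" for L x
        using t iter_partial_dpartial[OF open_UNIV test_funD(1) UNIV_I, of \<Omega> \<phi> L x] that by (auto simp: mabs_count_list)
      show ?thesis
      proof (cases "K = {}")
        case True
        have "(\<lambda>x. c * iter_partial J (\<lambda>y. a y * \<phi> y) x) = (\<lambda>x. 0)"
          using van[of K \<phi>] z True by auto
        moreover have "cmod (u (\<lambda>x. 0)) \<le> C * 0"
          by (rule C(2)) (auto simp: smooth_on_const iter_partial_const)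
        ultimately show ?thesis using True by (simp add: C'_def)
      next
        case False
        then obtain y where "y \<in> K" by blast
        with ph[of "[]" y] have "cmod (\<phi> y) \<le> M" by simp
        then have M0: "0 \<le> M" by (rule order_trans[OF norm_ge_zero])
        have "cmod (u (\<lambda>x. c * iter_partial J (\<lambda>y. a y * \<phi> y) x)) \<le> C * (cmod c * (2 ^ ?k * B * M))"
        proof (rule C(2)[OF sm])
          show "test_fun \<Omega> \<phi>" using t by blast
          then have am': "smooth_on UNIV (\<lambda>x. a x * \<phi> x)" by (rule am)
          show "c * iter_partial J (\<lambda>y. a y * \<phi> y) x = 0" if "x \<notin> K" for x
            using van[OF z compact_imp_closed that] K by simp
          show "0 \<le> cmod c * (2 ^ ?k * B * M)" using B M0 by simp
          fix L :: "'n list" and x assume Lx: "length L \<le> k" "x \<in> K"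
          have "iter_partial L (\<lambda>x. c * iter_partial J (\<lambda>y. a y * \<phi> y) x) x = c * iter_partial (L @ J) (\<lambda>y. a y * \<phi> y) x"
            unfolding iter_partial_append by (rule iter_partial_cmult[OF open_UNIV smooth_on_iter_partial[OF am'] UNIV_I])
          moreover have "cmod (iter_partial (L @ J) (\<lambda>y. a y * \<phi> y) x) \<le> 2 ^ ?k * B * M"
            by (rule leibniz_uniform_bound[OF \<Omega> _ a smooth_on_subset[OF test_funD(1)[OF \<open>test_fun \<Omega> \<phi>\<close>] subset_UNIV] _ B(1) M0])
               (use Lx K B ph in auto)
          ultimately show "cmod (iter_partial L (\<lambda>x. c * iter_partial J (\<lambda>y. a y * \<phi> y) x) x) \<le> cmod c * (2 ^ ?k * B * M)"
            by (simp add: norm_mult mult_left_mono)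
        qed
        then show ?thesis using False by (simp add: C'_def mult_ac)
      qed
    qed
    then show "\<exists>C k. \<forall>\<phi> M. test_fun \<Omega> \<phi> \<and> tsupp \<phi> \<subseteq> K \<and>
         (\<forall>\<alpha> x. mabs \<alpha> \<le> k \<and> x \<in> K \<longrightarrow> cmod (dpartial \<alpha> \<phi> x) \<le> M) \<longrightarrow>
         cmod (u (\<lambda>x. c * iter_partial J (\<lambda>y. a y * \<phi> y) x)) \<le> C * M" by blast
  qed
qed

text \<open>The sign of the transpose and the factor of \<open>Dop\<close> combine to (-1) ^ k (- i)
  ^ k = i ^ k, the power that \<open>iter_partial_expo_conj\<close> expects.\<close>

lemma Pop_eq: "Pop m a u \<phi> = (\<Sum>\<alpha>\<in>{\<alpha>. mabs \<alpha> \<le> m}. u (\<lambda>x. \<i> ^ mabs \<alpha> * iter_partial (mlist \<alpha>) (\<lambda>y. a \<alpha> y * \<phi> y) x))"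
proof -
  have "(-1) ^ k * ((- \<i>) ^ k * z) = \<i> ^ k * z" for k z
    by (simp add: mult.assoc[symmetric] power_mult_distrib[symmetric])
  then show ?thesis unfolding Pop_def Dop_def dpartial_mlist by (simp only:)
qed

lemma distribution_Pop:
  fixes u :: "(real^'n::finite \<Rightarrow> complex) \<Rightarrow> complex"
  assumes "open \<Omega>" "distribution \<Omega> u" "\<And>\<alpha>. mabs \<alpha> \<le> m \<Longrightarrow> smooth_on \<Omega> (a \<alpha>)"
  shows "distribution \<Omega> (Pop m a u)"
  unfolding Pop_eq[abs_def]
  by (intro distribution_finite_sum finite_mabs_le distribution_coeff_deriv) (use assms in auto)

text \<open>The coefficients a are regular on \<Omega> only. Wherever w is nonzero they may be
  exchanged for globally smooth b, to which the calculus of \<open>symop\<close> applies.\<close>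

lemma Pop_expo:
  fixes u :: "(real^'n::finite \<Rightarrow> complex) \<Rightarrow> complex"
  assumes u: "distribution \<Omega> u" and K: "compact K" "K \<subseteq> \<Omega>" and w: "smooth_on UNIV w" "\<And>x. x \<notin> K \<Longrightarrow> w x = 0"
    and b: "\<And>\<alpha>. mabs \<alpha> \<le> m \<Longrightarrow> smooth_on UNIV (b \<alpha>)" "\<And>\<alpha> x. mabs \<alpha> \<le> m \<Longrightarrow> a \<alpha> x * w x = b \<alpha> x * w x"
  shows "Pop m a u (\<lambda>x. w x * expo (- (t *\<^sub>R \<omega>)) x) =
    (\<Sum>\<alpha>\<in>{\<alpha>. mabs \<alpha> \<le> m}. \<Sum>j\<le>mabs \<alpha>. of_real (t ^ (mabs \<alpha> - j)) *
       u (\<lambda>x. symop \<omega> (mlist \<alpha>) j (\<lambda>x. b \<alpha> x * w x) x * expo (- (t *\<^sub>R \<omega>)) x))"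
  unfolding Pop_eq
proof (rule sum.cong[OF refl])
  fix \<alpha> :: "'n \<Rightarrow> nat" assume "\<alpha> \<in> {\<alpha>. mabs \<alpha> \<le> m}"
  then have \<alpha>: "mabs \<alpha> \<le> m" by simp
  let ?e = "expo (- (t *\<^sub>R \<omega>))" and ?w = "\<lambda>x. b \<alpha> x * w x" and ?L = "mlist \<alpha>"
  have ws: "smooth_on UNIV ?w" by (intro smooth_on_mult w b \<alpha>) auto
  have eq: "a \<alpha> x * (w x * ?e x) = ?w x * ?e x" for x using b(2)[OF \<alpha>, of x] by (simp add: mult.assoc[symmetric])
  have sm: "smooth_on UNIV (\<lambda>x. symop \<omega> ?L j ?w x * ?e x)" for j
    by (intro smooth_on_mult smooth_symop ws smooth_expo) auto
  have van: "symop \<omega> ?L j ?w x * ?e x = 0" if "x \<notin> K" for j x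
    using symop_vanish[of K ?w x \<omega> ?L j] w(2) compact_imp_closed[OF K(1)] that by simp
  have "(\<lambda>x. \<i> ^ mabs \<alpha> * iter_partial ?L (\<lambda>y. a \<alpha> y * (w y * ?e y)) x)
    = (\<lambda>x. \<Sum>j\<le>mabs \<alpha>. of_real (t ^ (mabs \<alpha> - j)) * (symop \<omega> ?L j ?w x * ?e x))"
    unfolding eq using iter_partial_expo_conj[OF ws, of ?L t \<omega>]
    by (simp add: length_mlist sum_distrib_right mult.assoc)
  then have "u (\<lambda>x. \<i> ^ mabs \<alpha> * iter_partial ?L (\<lambda>y. a \<alpha> y * (w y * ?e y)) x)
    = u (\<lambda>x. \<Sum>j\<le>mabs \<alpha>. of_real (t ^ (mabs \<alpha> - j)) * (symop \<omega> ?L j ?w x * ?e x))" by (rule arg_cong)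
  also have "\<dots> = (\<Sum>j\<le>mabs \<alpha>. u (\<lambda>x. of_real (t ^ (mabs \<alpha> - j)) * (symop \<omega> ?L j ?w x * ?e x)))"
    by (rule distribution_sum[OF u K]) (use sm van in \<open>auto intro!: smooth_on_cmult\<close>)
  also have "\<dots> = (\<Sum>j\<le>mabs \<alpha>. of_real (t ^ (mabs \<alpha> - j)) * u (\<lambda>x. symop \<omega> ?L j ?w x * ?e x))"
    by (intro sum.cong refl distribution_cmult[OF u] test_funI(1)[OF sm K van])
  finally show "u (\<lambda>x. \<i> ^ mabs \<alpha> * iter_partial ?L (\<lambda>y. a \<alpha> y * (w y * ?e y)) x)
    = (\<Sum>j\<le>mabs \<alpha>. of_real (t ^ (mabs \<alpha> - j)) * u (\<lambda>x. symop \<omega> ?L j ?w x * ?e x))" .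
qed

section \<open>Localised coefficients and conic neighbourhoods\<close>

lemma EG_smooth: "EG \<Omega> a \<Longrightarrow> smooth_on \<Omega> a"
  unfolding EG_def gevrey_def by (metis less_add_same_cancel1 zero_less_one)

text \<open>The local Gevrey bounds of a are used on the relatively compact ball of radius r'.
  Outside the smaller closed ball of radius r the product vanishes with all derivatives, so the
  bound is global.\<close>

lemma gevrey_global_cutoff_mult:
  fixes a \<zeta> :: "real^'n::finite \<Rightarrow> complex"
  assumes \<Omega>: "open \<Omega>" and a: "EG \<Omega> a" and \<zeta>: "gevrey_global \<zeta>" "\<And>x. r \<le> dist x0 x \<Longrightarrow> \<zeta> x = 0"
    and r: "r < r'" "cball x0 r' \<subseteq> \<Omega>"
  shows "gevrey_global (\<lambda>x. \<zeta> x * a x)"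
  unfolding gevrey_global_def
proof (intro conjI allI impI)
  have as: "smooth_on \<Omega> a" by (rule EG_smooth[OF a])
  have \<zeta>s: "smooth_on UNIV \<zeta>" by (rule gevrey_global_smooth[OF \<zeta>(1)])
  have sub: "cball x0 r \<subseteq> \<Omega>" using r by (meson less_imp_le order_trans subset_cball)
  have z: "\<zeta> x = 0" if "x \<notin> cball x0 r" for x using \<zeta>(2)[of x] that by simp
  have "smooth_on UNIV (\<lambda>x. a x * \<zeta> x)" by (rule smooth_mult_cutoff[OF \<Omega> as \<zeta>s closed_cball sub z])
  then show "smooth_on UNIV (\<lambda>x. \<zeta> x * a x)" by (simp add: mult.commute)
  fix s :: real assume s: "s > 1"
  let ?V = "ball x0 r'"
  have "closure ?V \<subseteq> cball x0 r'" by (rule closure_minimal) auto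
  then have V: "open ?V \<and> compact (closure ?V) \<and> closure ?V \<subseteq> \<Omega>"
    using r compact_closure bounded_ball by auto
  have "gevrey s \<Omega> a" using a s unfolding EG_def by blast
  then obtain C1 \<rho>1 where 1: "C1 > 0" "\<rho>1 > 0" "\<forall>x\<in>?V. \<forall>\<alpha>. cmod (dpartial \<alpha> a x) \<le> C1 * \<rho>1 ^ mabs \<alpha> * fact (mabs \<alpha>) powr s"
    using V unfolding gevrey_def by blast
  have VO: "?V \<subseteq> \<Omega>" using V closure_subset by blast
  have ga: "gbd ?V s C1 \<rho>1 0 a" unfolding gbd_def
  proof (intro ballI allI)
    fix x and L :: "'n list" assume x: "x \<in> ?V"
    have "iter_partial L a x = dpartial (count_list L) a x"
      by (rule iter_partial_dpartial[OF \<Omega> as]) (use x VO in blast)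
    then show "cmod (iter_partial L a x) \<le> C1 * \<rho>1 ^ length L * fact (length L + 0) powr s"
      using 1(3)[rule_format, OF x, of "count_list L"] by (simp add: mabs_count_list)
  qed
  obtain C2 \<rho>2 where 2: "C2 \<ge> 0" "\<rho>2 \<ge> 1" "gbd UNIV s C2 \<rho>2 0 \<zeta>" using gevrey_globalE[OF \<zeta>(1) s] .
  define A where "A = max (2 * \<rho>2) \<rho>1"
  have g1: "gbd ?V s C2 \<rho>2 0 \<zeta>" using 2(3) by (simp add: gbd_def)
  have g2: "gbd ?V s C1 A 0 a" by (rule gbd_mono[OF ga]) (use 1 s in \<open>auto simp: A_def\<close>)
  have "gbd ?V s (2 * C2 * C1) A 0 (\<lambda>x. \<zeta> x * a x)"
    by (rule gbd_mult[OF \<Omega> VO smooth_on_subset[OF \<zeta>s subset_UNIV] as g1 g2]) (use 1 2 s in \<open>auto simp: A_def\<close>)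
  moreover have "iter_partial L (\<lambda>x. \<zeta> x * a x) x = 0" if "x \<notin> ?V" for x L
    by (rule vanish_outside_iter[of "cball x0 r"]) (use z that r in auto)
  moreover have "0 \<le> 2 * C2 * C1 * A ^ n * fact (n + 0) powr s" for n using 1 2 by (simp add: A_def)
  ultimately have "gbd UNIV s (2 * C2 * C1) A 0 (\<lambda>x. \<zeta> x * a x)"
    unfolding gbd_def by (metis norm_zero)
  moreover have "A \<ge> 1" using 2 by (simp add: A_def)
  ultimately show "\<exists>C\<ge>0. \<exists>\<rho>\<ge>1. gbd UNIV s C \<rho> 0 (\<lambda>x. \<zeta> x * a x)"
    using 1 2 by (intro exI[of _ "2 * C2 * C1"] conjI exI[of _ A]) auto
qed

lemma gevrey_global_uniform:
  assumes "finite A" "\<And>a. a \<in> A \<Longrightarrow> gevrey_global (f a)" "s > 1"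
  obtains C \<rho> where "C \<ge> 0" "\<rho> \<ge> 1" "\<And>a. a \<in> A \<Longrightarrow> gbd UNIV s C \<rho> 0 (f a)"
proof -
  have "\<exists>C\<ge>0. \<exists>\<rho>\<ge>1. \<forall>a\<in>A. gbd UNIV s C \<rho> 0 (f a)"
    using assms(1,2)
  proof (induction A rule: finite_induct)
    case empty then show ?case by (auto intro!: exI[of _ 0] exI[of _ 1])
  next
    case (insert a A)
    obtain C \<rho> where 1: "C \<ge> 0" "\<rho> \<ge> 1" "\<forall>a\<in>A. gbd UNIV s C \<rho> 0 (f a)" using insert by blast
    obtain C' \<rho>' where 2: "C' \<ge> 0" "\<rho>' \<ge> 1" "gbd UNIV s C' \<rho>' 0 (f a)"
      using gevrey_globalE[of "f a" s] insert.prems assms(3) by blast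
    have "gbd UNIV s (max C C') (max \<rho> \<rho>') 0 (f a')" if "a' \<in> insert a A" for a'
    proof (cases "a' = a")
      case True
      show ?thesis unfolding True by (rule gbd_mono[OF 2(3)]) (use 2 assms in auto)
    next
      case False
      then have "gbd UNIV s C \<rho> 0 (f a')" using 1 that by blast
      then show ?thesis by (rule gbd_mono) (use 1 assms in auto)
    qed
    moreover have "max C C' \<ge> 0" "max \<rho> \<rho>' \<ge> 1" using 1 2 by auto
    ultimately show ?case by blast
  qed
  then show ?thesis using that by blast
qed

lemma open_conic_nbhd: "open (conic_nbhd \<xi>0 \<delta>)"
proof -
  have "continuous_on (- {0}) (\<lambda>\<xi>. norm (\<xi> /\<^sub>R norm \<xi> - \<xi>0 /\<^sub>R norm \<xi>0))" by (intro continuous_intros) auto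
  then have "open ((\<lambda>\<xi>. norm (\<xi> /\<^sub>R norm \<xi> - \<xi>0 /\<^sub>R norm \<xi>0)) -` {..<\<delta>} \<inter> - {0})"
    by (rule continuous_on_open_vimage[THEN iffD1, rule_format, rotated]) auto
  moreover have "(\<lambda>\<xi>. norm (\<xi> /\<^sub>R norm \<xi> - \<xi>0 /\<^sub>R norm \<xi>0)) -` {..<\<delta>} \<inter> - {0} = conic_nbhd \<xi>0 \<delta>"
    by (auto simp: conic_nbhd_def)
  ultimately show ?thesis by simp
qed

lemma conic_nbhd_props:
  assumes "\<xi>0 \<noteq> 0" "\<delta> > 0"
  shows "\<xi>0 \<in> conic_nbhd \<xi>0 \<delta>" "0 \<notin> conic_nbhd \<xi>0 \<delta>" "\<And>\<xi> t. \<xi> \<in> conic_nbhd \<xi>0 \<delta> \<Longrightarrow> t > 0 \<Longrightarrow> t *\<^sub>R \<xi> \<in> conic_nbhd \<xi>0 \<delta>"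
proof -
  show "\<xi>0 \<in> conic_nbhd \<xi>0 \<delta>" "0 \<notin> conic_nbhd \<xi>0 \<delta>" using assms by (auto simp: conic_nbhd_def)
  fix \<xi> t assume x: "\<xi> \<in> conic_nbhd \<xi>0 \<delta>" and t: "(t::real) > 0"
  then have eq: "(t *\<^sub>R \<xi>) /\<^sub>R norm (t *\<^sub>R \<xi>) = \<xi> /\<^sub>R norm \<xi>" by (simp add: field_simps)
  show "t *\<^sub>R \<xi> \<in> conic_nbhd \<xi>0 \<delta>" using x t by (simp only: conic_nbhd_def mem_Collect_eq eq) simp
qed

lemma microlocal_from_cutoff_ball:
  fixes w :: "(real^'n::finite \<Rightarrow> complex) \<Rightarrow> complex"
  assumes \<Omega>: "open \<Omega>" and w: "distribution \<Omega> w" and \<zeta>: "smooth_on UNIV \<zeta>" "\<And>x. x \<notin> cball x0 r \<Longrightarrow> \<zeta> x = 0"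
    and r: "cball x0 r \<subseteq> \<Omega>" and d: "0 < d" "\<And>x. dist x0 x \<le> d \<Longrightarrow> \<zeta> x = 1" and \<xi>0: "\<xi>0 \<noteq> 0" "\<delta> > 0"
    and decay: "\<And>s. s > 1 \<Longrightarrow> \<exists>C\<ge>0. \<exists>B\<ge>1. \<forall>\<xi>\<in>conic_nbhd \<xi>0 \<delta>. \<forall>N. 1 \<le> norm \<xi> \<longrightarrow>
      norm \<xi> ^ N * cmod (w (\<lambda>x. \<zeta> x * expo (- \<xi>) x)) \<le> C * B ^ N * fact N powr s"
  shows "microlocal_G \<Omega> w x0 \<xi>0"
proof (rule microlocal_from_cutoff[OF \<Omega> w \<zeta>(1) compact_cball r \<zeta>(2) open_ball[of x0 d] _ _ _ open_conic_nbhd conic_nbhd_props[OF \<xi>0] decay])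
  have "x \<in> cball x0 r" if "x \<in> ball x0 d" for x using d(2)[of x] \<zeta>(2)[of x] that by fastforce
  then show "ball x0 d \<subseteq> \<Omega>" using r by blast
qed (use d in auto)

section \<open>Pseudolocality\<close>

lemma norm_unit_component: "\<bar>(\<xi> /\<^sub>R norm \<xi>) $ i\<bar> \<le> 1" for \<xi> :: "real^'n::finite"
proof -
  have "\<bar>(\<xi> /\<^sub>R norm \<xi>) $ i\<bar> \<le> norm (\<xi> /\<^sub>R norm \<xi>)" by (rule component_le_norm_cart)
  also have "\<dots> \<le> 1" by (cases "\<xi> = 0") auto
  finally show ?thesis .
qed

text \<open>Nested cutoffs: \<zeta>1 is 1 on the support of \<zeta>, so a may be replaced by the
  globally Gevrey b = \<zeta>1 a. After \<open>Pop_expo\<close> each term is u against an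
  oscillating amplitude whose Gevrey bounds are uniform in \<xi>, so the decay of u applies.\<close>

lemma microlocal_Pop:
  fixes u :: "(real^'n::finite \<Rightarrow> complex) \<Rightarrow> complex"
  assumes \<Omega>: "open \<Omega>" and a: "\<And>\<alpha>. mabs \<alpha> \<le> m \<Longrightarrow> EG \<Omega> (a \<alpha>)" and u: "distribution \<Omega> u"
    and \<xi>0: "\<xi>0 \<noteq> 0" and mic: "microlocal_G \<Omega> u x0 \<xi>0"
  shows "microlocal_G \<Omega> (Pop m a u) x0 \<xi>0"
proof -
  obtain r \<delta> where r: "0 < r" "cball x0 r \<subseteq> \<Omega>" and \<delta>: "0 < \<delta>" and dec: "microlocal_decay u (cball x0 r) (conic_nbhd \<xi>0 \<delta>)"
    using microlocal_imp_decay[OF \<Omega> mic] .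
  obtain \<zeta>1 d1 where z1: "gevrey_global \<zeta>1" "0 < d1" "d1 < r / 2" "\<And>x. dist x0 x \<le> d1 \<Longrightarrow> \<zeta>1 x = 1"
    "\<And>x. r / 2 \<le> dist x0 x \<Longrightarrow> \<zeta>1 x = 0" "\<And>x. cmod (\<zeta>1 x) \<le> 1"
    using gevrey_cutoff_exists[of "r / 2" x0] r by auto
  obtain \<zeta> d0 where z: "gevrey_global \<zeta>" "0 < d0" "d0 < d1" "\<And>x. dist x0 x \<le> d0 \<Longrightarrow> \<zeta> x = 1"
    "\<And>x. d1 \<le> dist x0 x \<Longrightarrow> \<zeta> x = 0" "\<And>x. cmod (\<zeta> x) \<le> 1"
  proof (rule gevrey_cutoff_exists[OF z1(2), of x0], goal_cases)
    case (1 \<zeta> d)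
    show ?case by (rule 1(1)[OF 1(2-7)])
  qed
  define b where "b = (\<lambda>\<alpha> x. \<zeta>1 x * a \<alpha> x)"
  have b: "gevrey_global (b \<alpha>)" if "mabs \<alpha> \<le> m" for \<alpha>
    unfolding b_def
    by (rule gevrey_global_cutoff_mult[OF \<Omega> a[OF that] z1(1) _ _ r(2), where r = "r / 2"]) (use z1(5) r in auto)
  have ab: "a \<alpha> x * \<zeta> x = b \<alpha> x * \<zeta> x" for \<alpha> x
    using z1(4)[of x] z(5)[of x] by (cases "dist x0 x \<le> d1") (auto simp: b_def)
  have zs: "smooth_on UNIV \<zeta>" by (rule gevrey_global_smooth[OF z(1)])
  have zv: "\<zeta> x = 0" if "x \<notin> cball x0 d1" for x using z(5)[of x] that by simp
  have sub: "cball x0 d1 \<subseteq> cball x0 r" using z1 r by (intro subset_cball) auto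
  then have sub': "cball x0 d1 \<subseteq> \<Omega>" using r by blast
  have w: "distribution \<Omega> (Pop m a u)" by (rule distribution_Pop[OF \<Omega> u EG_smooth[OF a]])
  let ?I = "{\<alpha>::'n \<Rightarrow> nat. mabs \<alpha> \<le> m}"
  show ?thesis
  proof (rule microlocal_from_cutoff_ball[OF \<Omega> w zs zv sub' z(2,4) \<xi>0 \<delta>])
    fix s :: real assume s: "s > 1"
    obtain C1 \<rho>1 where 1: "C1 \<ge> 0" "\<rho>1 \<ge> 1" "gbd UNIV s C1 \<rho>1 0 \<zeta>" using gevrey_globalE[OF z(1) s] .
    obtain Cb \<rho> where 2: "Cb \<ge> 0" "\<rho> \<ge> 1" "\<And>\<alpha>. \<alpha> \<in> ?I \<Longrightarrow> gbd UNIV s Cb \<rho> 0 (b \<alpha>)"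
      using gevrey_global_uniform[of ?I b s] finite_mabs_le[of m] b s by auto
    define A where "A = max (2 * \<rho>) \<rho>1"
    have A: "A \<ge> 1" using 1 by (simp add: A_def)
    define M1 where "M1 = 2 * Cb * C1"
    have M1: "0 \<le> M1" using 1 2 by (simp add: M1_def)
    have gz: "gbd UNIV s C1 A 0 \<zeta>" by (rule gbd_mono[OF 1(3)]) (use 1 s in \<open>auto simp: A_def\<close>)
    have bs: "smooth_on UNIV (b \<alpha>)" if "\<alpha> \<in> ?I" for \<alpha> using b that by (auto intro: gevrey_global_smooth)
    have gb: "gbd UNIV s M1 A 0 (\<lambda>x. b \<alpha> x * \<zeta> x)" if "\<alpha> \<in> ?I" for \<alpha>
      unfolding M1_def
      by (rule gbd_mult[OF open_UNIV subset_UNIV bs[OF that] zs 2(3)[OF that] gz]) (use 1 2 s in \<open>auto simp: A_def\<close>)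
    obtain C B where C: "C \<ge> 0" and B: "B \<ge> 1" and D: "\<And>g M l N \<xi>.
     smooth_on UNIV g \<Longrightarrow> (\<And>x. x \<notin> cball x0 r \<Longrightarrow> g x = 0) \<Longrightarrow> gbd UNIV s M A l g \<Longrightarrow> \<xi> \<in> conic_nbhd \<xi>0 \<delta> \<Longrightarrow> 1 \<le> norm \<xi> \<Longrightarrow>
     norm \<xi> ^ N * cmod (u (\<lambda>x. g x * expo (- \<xi>) x)) \<le> C * M * B ^ (N + l) * fact (N + l) powr s"
    proof -
      from dec[unfolded microlocal_decay_def, rule_format, OF s A] that show thesis by blast
    qed
    define H where "H = C * (2 ^ m * A ^ m * M1)"
    have H: "H \<ge> 0" using C A M1 by (simp add: H_def)
    define W where "W = (2 ^ m * fact m :: real) powr s"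
    define C' where "C' = real (card ?I) * (real (Suc m) * (H * B ^ m * W))"
    have main: "norm \<xi> ^ N * cmod (Pop m a u (\<lambda>x. \<zeta> x * expo (- \<xi>) x)) \<le> C' * (B * 2 powr s) ^ N * fact N powr s"
      if \<xi>: "\<xi> \<in> conic_nbhd \<xi>0 \<delta>" "1 \<le> norm \<xi>" for \<xi> N
    proof -
      define \<omega> where "\<omega> = \<xi> /\<^sub>R norm \<xi>"
      define t where "t = norm \<xi>"
      have t: "t \<ge> 1" using \<xi> by (simp add: t_def)
      have "\<xi> \<noteq> 0" using \<xi> by auto
      then have t\<omega>: "t *\<^sub>R \<omega> = \<xi>" by (simp add: t_def \<omega>_def)
      have om: "\<bar>\<omega> $ i\<bar> \<le> 1" for i unfolding \<omega>_def by (rule norm_unit_component)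
      let ?h = "\<lambda>\<alpha> j. symop \<omega> (mlist \<alpha>) j (\<lambda>x. b \<alpha> x * \<zeta> x)"
      have P: "Pop m a u (\<lambda>x. \<zeta> x * expo (- \<xi>) x) =
         (\<Sum>\<alpha>\<in>?I. \<Sum>j\<le>mabs \<alpha>. of_real (t ^ (mabs \<alpha> - j)) * u (\<lambda>x. ?h \<alpha> j x * expo (- \<xi>) x))"
        unfolding t\<omega>[symmetric]
        by (rule Pop_expo[OF u compact_cball sub' zs zv _ ab]) (use bs in auto)
      have trm: "t ^ N * cmod (of_real (t ^ (mabs \<alpha> - j)) * u (\<lambda>x. ?h \<alpha> j x * expo (- \<xi>) x))
         \<le> H * B ^ (N + m) * fact (N + m) powr s" if \<alpha>: "\<alpha> \<in> ?I" and j: "j \<le> mabs \<alpha>" for \<alpha> j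
      proof -
        have hs: "smooth_on UNIV (?h \<alpha> j)" by (intro smooth_symop smooth_on_mult bs \<alpha> zs) auto
        have hv: "?h \<alpha> j x = 0" if "x \<notin> cball x0 r" for x
          by (rule symop_vanish[of "cball x0 d1"]) (use zv sub that in auto)
        have hg: "gbd UNIV s (2 ^ length (mlist \<alpha>) * A ^ j * M1) A (0 + j) (?h \<alpha> j)"
          by (rule gbd_symop[OF _ gb[OF \<alpha>] M1 A _ om]) (use s bs \<alpha> zs in \<open>auto intro: smooth_on_mult\<close>)
        \<comment> \<open>The power of t is moved into the exponent of the decay estimate; with the
          shift j the total is N + mabs \<alpha>, at most N + m.\<close>
        let ?N = "N + (mabs \<alpha> - j)"
        have le: "?N + (0 + j) \<le> N + m" using \<alpha> j by simp
        have "t ^ N * cmod (of_real (t ^ (mabs \<alpha> - j)) * u (\<lambda>x. ?h \<alpha> j x * expo (- \<xi>) x)) = norm \<xi> ^ ?N * cmod (u (\<lambda>x. ?h \<alpha> j x * expo (- \<xi>) x))"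
          using t unfolding norm_mult norm_of_real by (simp add: power_add t_def[symmetric])
        also have "\<dots> \<le> C * (2 ^ length (mlist \<alpha>) * A ^ j * M1) * B ^ (?N + (0 + j)) * fact (?N + (0 + j)) powr s"
          by (rule D[OF hs hv hg \<xi>])
        also have "\<dots> \<le> H * B ^ (N + m) * fact (N + m) powr s"
        proof (intro mult_mono)
          have "A ^ j \<le> A ^ m" using A \<alpha> j by (intro power_increasing) auto
          moreover have "(2::real) ^ length (mlist \<alpha>) \<le> 2 ^ m" using \<alpha> by (intro power_increasing) (auto simp: length_mlist)
          ultimately show "C * (2 ^ length (mlist \<alpha>) * A ^ j * M1) \<le> H"
            unfolding H_def using C M1 A by (intro mult_left_mono mult_right_mono mult_mono) auto
          show "B ^ (?N + (0 + j)) \<le> B ^ (N + m)" by (rule power_increasing[OF le B])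
          show "fact (?N + (0 + j)) powr s \<le> (fact (N + m) :: real) powr s"
            by (rule powr_mono2) (use s fact_mono[OF le] in auto)
        qed (use H B in auto)
        finally show ?thesis .
      qed
      let ?R = "H * B ^ (N + m) * fact (N + m) powr s"
      have R0: "0 \<le> ?R" using H B by simp
      have "norm \<xi> ^ N * cmod (Pop m a u (\<lambda>x. \<zeta> x * expo (- \<xi>) x))
        \<le> t ^ N * (\<Sum>\<alpha>\<in>?I. \<Sum>j\<le>mabs \<alpha>. cmod (of_real (t ^ (mabs \<alpha> - j)) * u (\<lambda>x. ?h \<alpha> j x * expo (- \<xi>) x)))"
        unfolding P t_def[symmetric] using t
        by (intro mult_left_mono order_trans[OF norm_sum] sum_mono norm_sum) auto
      also have "\<dots> = (\<Sum>\<alpha>\<in>?I. \<Sum>j\<le>mabs \<alpha>. t ^ N * cmod (of_real (t ^ (mabs \<alpha> - j)) * u (\<lambda>x. ?h \<alpha> j x * expo (- \<xi>) x)))"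
        by (simp only: sum_distrib_left)
      also have "\<dots> \<le> (\<Sum>\<alpha>\<in>?I. \<Sum>j\<le>mabs \<alpha>. ?R)" by (intro sum_mono trm) auto
      also have "\<dots> \<le> (\<Sum>\<alpha>\<in>?I. real (Suc m) * ?R)"
      proof (rule sum_mono)
        fix \<alpha> :: "'n \<Rightarrow> nat" assume "\<alpha> \<in> ?I"
        then have "real (Suc (mabs \<alpha>)) * ?R \<le> real (Suc m) * ?R" using R0 by (intro mult_right_mono) auto
        then show "(\<Sum>j\<le>mabs \<alpha>. ?R) \<le> real (Suc m) * ?R" by simp
      qed
      also have "\<dots> = real (card ?I) * (real (Suc m) * ?R)" by simp
      also have "\<dots> \<le> real (card ?I) * (real (Suc m) * (H * B ^ (N + m) * (W * (2 powr s) ^ N * fact N powr s)))"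
        unfolding W_def using H B s by (intro mult_left_mono fact_shift_powr mult_nonneg_nonneg) auto
      also have "\<dots> = C' * (B * 2 powr s) ^ N * fact N powr s"
        by (simp add: C'_def power_mult_distrib power_add mult_ac)
      finally show ?thesis .
    qed
    have "C' \<ge> 0" using H B by (simp add: C'_def W_def)
    moreover have "B * 2 powr s \<ge> 1" using B s ge_one_powr_ge_zero[of 2 s] mult_mono[of 1 B 1 "2 powr s"] by simp
    ultimately show "\<exists>C\<ge>0. \<exists>B\<ge>1. \<forall>\<xi>\<in>conic_nbhd \<xi>0 \<delta>. \<forall>N. 1 \<le> norm \<xi> \<longrightarrow>
      norm \<xi> ^ N * cmod (Pop m a u (\<lambda>x. \<zeta> x * expo (- \<xi>) x)) \<le> C * B ^ N * fact N powr s"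
      using main by blast
  qed
qed

text \<open>Collects, over all \<alpha>, the part with t ^ (m - i) of the transposed operator acting
  on the amplitude q z: a term of \<open>Pop_expo\<close> carries t ^ (mabs \<alpha> - j), so j = i
  + mabs \<alpha> - m. The condition m \<le> i + mabs \<alpha> keeps this natural subtraction
  exact.\<close>

definition ptrans :: "real^'n::finite \<Rightarrow> nat \<Rightarrow> (('n \<Rightarrow> nat) \<Rightarrow> real^'n \<Rightarrow> complex) \<Rightarrow> (real^'n \<Rightarrow> complex) \<Rightarrow> nat \<Rightarrow>
    (real^'n \<Rightarrow> complex) \<Rightarrow> real^'n \<Rightarrow> complex" where
  "ptrans \<omega> m b q i z x = (\<Sum>\<alpha>\<in>{\<alpha>. mabs \<alpha> \<le> m \<and> m \<le> i + mabs \<alpha>}.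
     symop \<omega> (mlist \<alpha>) (i + mabs \<alpha> - m) (\<lambda>x. b \<alpha> x * (q x * z x)) x)"

text \<open>Term n needs all earlier terms, so the primitive recursion carries their whole
  list.\<close>

primrec neumann_list :: "(nat \<Rightarrow> ('a \<Rightarrow> complex) \<Rightarrow> 'a \<Rightarrow> complex) \<Rightarrow> ('a \<Rightarrow> complex) \<Rightarrow> nat \<Rightarrow> ('a \<Rightarrow> complex) list" where
  "neumann_list T z 0 = [z]"
| "neumann_list T z (Suc n) = neumann_list T z n @ [\<lambda>x. - (\<Sum>i\<in>{1..Suc n}. T i (neumann_list T z n ! (Suc n - i)) x)]"

definition neumann :: "(nat \<Rightarrow> ('a \<Rightarrow> complex) \<Rightarrow> 'a \<Rightarrow> complex) \<Rightarrow> ('a \<Rightarrow> complex) \<Rightarrow> nat \<Rightarrow> 'a \<Rightarrow> complex" where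
  "neumann T z n = neumann_list T z n ! n"

lemma length_neumann_list: "length (neumann_list T z n) = Suc n"
  by (induction n) auto

lemma neumann_list_nth: "k \<le> n \<Longrightarrow> neumann_list T z n ! k = neumann T z k"
proof (induction n)
  case (Suc n)
  show ?case
  proof (cases "k = Suc n")
    case False
    then have "k \<le> n" using Suc by simp
    then show ?thesis using Suc by (simp add: nth_append length_neumann_list)
  qed (simp add: neumann_def)
qed (simp add: neumann_def)

lemma neumann_0: "neumann T z 0 = z"
  by (simp add: neumann_def)

lemma neumann_Suc: "neumann T z (Suc n) = (\<lambda>x. - (\<Sum>i\<in>{1..Suc n}. T i (neumann T z (Suc n - i)) x))"
proof -
  have "neumann T z (Suc n) = (\<lambda>x. - (\<Sum>i\<in>{1..Suc n}. T i (neumann_list T z n ! (Suc n - i)) x))"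
    by (simp add: neumann_def nth_append length_neumann_list)
  also have "\<dots> = (\<lambda>x. - (\<Sum>i\<in>{1..Suc n}. T i (neumann T z (Suc n - i)) x))"
    by (intro ext arg_cong[where f = uminus] sum.cong refl, subst neumann_list_nth) auto
  finally show ?thesis .
qed

lemma finite_ptrans_index: "finite {\<alpha>::'n::finite \<Rightarrow> nat. mabs \<alpha> \<le> m \<and> m \<le> i + mabs \<alpha>}"
  by (rule finite_subset[OF _ finite_mabs_le[of m]]) auto

lemma smooth_ptrans:
  assumes "\<And>\<alpha>. mabs \<alpha> \<le> m \<Longrightarrow> smooth_on UNIV (b \<alpha>)" "smooth_on UNIV q" "smooth_on UNIV z"
  shows "smooth_on UNIV (ptrans \<omega> m b q i z)"
  unfolding ptrans_def[abs_def] by (intro smooth_on_sum smooth_symop smooth_on_mult) (use assms in auto)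

lemma ptrans_vanish:
  assumes "\<And>x. x \<notin> S \<Longrightarrow> z x = 0" "closed S" "x \<notin> S"
  shows "ptrans \<omega> m b q i z x = 0"
  unfolding ptrans_def by (intro sum.neutral ballI symop_vanish[of S]) (use assms in auto)

lemma ptrans_large: "m < i \<Longrightarrow> ptrans \<omega> m b q i z x = 0"
  unfolding ptrans_def by (intro sum.neutral ballI) (auto simp: symop_zero length_mlist)

text \<open>The cost is a constant independent of i, a factor A ^ i and i units of shift. The factor
  4 Cb Cq comes from two uses of \<open>gbd_mult\<close>, for q and for b \<alpha>; the radius A is
  kept, as \<open>2 * \<rho> \<le> A\<close>.\<close>

lemma gbd_ptrans:
  fixes \<omega> :: "real^'n::finite"
  assumes b: "\<And>\<alpha>. mabs \<alpha> \<le> m \<Longrightarrow> smooth_on UNIV (b \<alpha>)" "\<And>\<alpha>. mabs \<alpha> \<le> m \<Longrightarrow> gbd UNIV s Cb \<rho> 0 (b \<alpha>)"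
    and q: "smooth_on UNIV q" "gbd UNIV s Cq \<rho> 0 q" and z: "smooth_on UNIV z" "gbd UNIV s M A l z"
    and s: "1 \<le> s" and pos: "0 \<le> Cb" "0 \<le> Cq" "0 \<le> M" "0 \<le> \<rho>" "2 * \<rho> \<le> A" "1 \<le> A" and om: "\<And>i. \<bar>\<omega> $ i\<bar> \<le> 1"
  shows "gbd UNIV s (real (card {\<alpha>::'n \<Rightarrow> nat. mabs \<alpha> \<le> m}) * 2 ^ m * (4 * Cb * Cq) * A ^ i * M) A (l + i) (ptrans \<omega> m b q i z)"
proof -
  let ?I = "{\<alpha>::'n \<Rightarrow> nat. mabs \<alpha> \<le> m \<and> m \<le> i + mabs \<alpha>}" and ?J = "{\<alpha>::'n \<Rightarrow> nat. mabs \<alpha> \<le> m}"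
  define X where "X = 2 ^ m * A ^ i * (2 * Cb * (2 * Cq * M))"
  have qz: "smooth_on UNIV (\<lambda>x. q x * z x)" by (intro smooth_on_mult q z) auto
  have gqz: "gbd UNIV s (2 * Cq * M) A l (\<lambda>x. q x * z x)"
    by (rule gbd_mult[OF open_UNIV subset_UNIV q(1) z(1) q(2) z(2)]) (use pos s in auto)
  have "gbd UNIV s (\<Sum>\<alpha>\<in>?I. X) A (l + i) (\<lambda>x. \<Sum>\<alpha>\<in>?I. symop \<omega> (mlist \<alpha>) (i + mabs \<alpha> - m) (\<lambda>x. b \<alpha> x * (q x * z x)) x)"
  proof (rule gbd_sum[of UNIV])
    fix \<alpha> assume \<alpha>: "\<alpha> \<in> ?I"
    then have bs: "smooth_on UNIV (\<lambda>x. b \<alpha> x * (q x * z x))" by (intro smooth_on_mult qz b) auto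
    then show "smooth_on UNIV (symop \<omega> (mlist \<alpha>) (i + mabs \<alpha> - m) (\<lambda>x. b \<alpha> x * (q x * z x)))" by (rule smooth_symop)
    have "gbd UNIV s (2 * Cb * (2 * Cq * M)) A l (\<lambda>x. b \<alpha> x * (q x * z x))"
      by (rule gbd_mult[OF open_UNIV subset_UNIV b(1) qz b(2) gqz]) (use \<alpha> pos s in auto)
    then have "gbd UNIV s (2 ^ length (mlist \<alpha>) * A ^ (i + mabs \<alpha> - m) * (2 * Cb * (2 * Cq * M))) A (l + (i + mabs \<alpha> - m))
       (symop \<omega> (mlist \<alpha>) (i + mabs \<alpha> - m) (\<lambda>x. b \<alpha> x * (q x * z x)))"
      by (rule gbd_symop[OF bs]) (use pos s om in auto)
    then show "gbd UNIV s X A (l + i) (symop \<omega> (mlist \<alpha>) (i + mabs \<alpha> - m) (\<lambda>x. b \<alpha> x * (q x * z x)))"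
    proof (rule gbd_mono)
      have "(2::real) ^ length (mlist \<alpha>) \<le> 2 ^ m" using \<alpha> by (intro power_increasing) (auto simp: length_mlist)
      moreover have "A ^ (i + mabs \<alpha> - m) \<le> A ^ i" using \<alpha> pos by (intro power_increasing) auto
      ultimately show "2 ^ length (mlist \<alpha>) * A ^ (i + mabs \<alpha> - m) * (2 * Cb * (2 * Cq * M)) \<le> X"
        unfolding X_def using pos by (intro mult_right_mono mult_mono) auto
    qed (use pos s \<alpha> in auto)
  qed (use pos in auto)
  then show ?thesis unfolding ptrans_def[abs_def]
  proof (rule gbd_mono)
    have X0: "0 \<le> X" using pos by (simp add: X_def)
    have "real (card ?I) \<le> real (card ?J)" by (simp add: card_mono finite_mabs_le Collect_mono)
    then have "real (card ?I) * X \<le> real (card ?J) * X" using X0 by (rule mult_right_mono)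
    then show "(\<Sum>\<alpha>\<in>?I. X) \<le> real (card ?J) * 2 ^ m * (4 * Cb * Cq) * A ^ i * M" by (simp add: X_def mult_ac)
    show "0 \<le> (\<Sum>\<alpha>\<in>?I. X)" using X0 by (simp add: sum_nonneg)
  qed (use pos s in auto)
qed

lemma smooth_neumann:
  assumes "\<And>i z. smooth_on UNIV z \<Longrightarrow> smooth_on UNIV (T i z)" "smooth_on UNIV \<zeta>"
  shows "smooth_on UNIV (neumann T \<zeta> n)"
proof (induction n rule: less_induct)
  case (less n)
  show ?case
  proof (cases n)
    case 0 then show ?thesis using assms by (simp add: neumann_0)
  next
    case (Suc k)
    have "smooth_on UNIV (\<lambda>x. -1 * (\<Sum>i\<in>{1..Suc k}. T i (neumann T \<zeta> (Suc k - i)) x))"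
      by (intro smooth_on_cmult smooth_on_sum assms less) (use Suc in auto)
    then show ?thesis unfolding Suc neumann_Suc by simp
  qed
qed

lemma neumann_vanish:
  assumes "\<And>i z x. (\<And>x. x \<notin> S \<Longrightarrow> z x = 0) \<Longrightarrow> x \<notin> S \<Longrightarrow> T i z x = 0" "\<And>x. x \<notin> S \<Longrightarrow> \<zeta> x = 0" "x \<notin> S"
  shows "neumann T \<zeta> n x = 0"
  using assms(3)
proof (induction n arbitrary: x rule: less_induct)
  case (less n)
  show ?case
  proof (cases n)
    case 0 then show ?thesis using assms less by (simp add: neumann_0)
  next
    case (Suc k)
    have "(\<Sum>i\<in>{1..Suc k}. T i (neumann T \<zeta> (Suc k - i)) x) = 0"
    proof (intro sum.neutral ballI)
      fix i assume i: "i \<in> {1..Suc k}"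
      show "T i (neumann T \<zeta> (Suc k - i)) x = 0"
        by (rule assms(1)[OF _ less.prems]) (use less.IH[of "Suc k - i"] i Suc in auto)
    qed
    then show ?thesis unfolding Suc neumann_Suc by simp
  qed
qed

text \<open>The rate B = A (1 + c0) solves the recursion: c0 times the sum of A ^ i B ^ (n - i) over
  i = 1..n equals B ^ n - A ^ n. Hence the growth is geometric, with the shift equal to the
  index.\<close>

lemma gbd_neumann:
  fixes T :: "nat \<Rightarrow> (real^'n::finite \<Rightarrow> complex) \<Rightarrow> real^'n \<Rightarrow> complex"
  assumes sm: "\<And>i z. smooth_on UNIV z \<Longrightarrow> smooth_on UNIV (T i z)" "smooth_on UNIV \<zeta>"
    and T: "\<And>i z M l. smooth_on UNIV z \<Longrightarrow> gbd UNIV s M A l z \<Longrightarrow> 0 \<le> M \<Longrightarrow> gbd UNIV s (c0 * A ^ i * M) A (l + i) (T i z)"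
    and \<zeta>: "gbd UNIV s M0 A 0 \<zeta>" and pos: "0 \<le> c0" "1 \<le> A" "0 \<le> M0" "0 \<le> s"
  shows "gbd UNIV s (M0 * (A * (1 + c0)) ^ n) A n (neumann T \<zeta> n)"
proof (induction n rule: less_induct)
  case (less n)
  show ?case
  proof (cases n)
    case 0 then show ?thesis using \<zeta> by (simp add: neumann_0)
  next
    case (Suc k)
    define B where "B = A * (1 + c0)"
    have AB: "A \<le> B" "0 \<le> B" using pos mult_left_mono[of 1 "1 + c0" A] by (auto simp: B_def)
    let ?M = "\<lambda>i. c0 * A ^ i * (M0 * B ^ (n - i))"
    have sZ: "smooth_on UNIV (neumann T \<zeta> j)" for j by (rule smooth_neumann) (use sm in auto)
    have "gbd UNIV s (\<Sum>i\<in>{1..n}. ?M i) A n (\<lambda>x. \<Sum>i\<in>{1..n}. T i (neumann T \<zeta> (n - i)) x)"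
    proof (rule gbd_sum[of UNIV])
      fix i assume i: "i \<in> {1..n}"
      have "gbd UNIV s (?M i) A (n - i + i) (T i (neumann T \<zeta> (n - i)))"
        unfolding B_def by (rule T[OF sZ less]) (use i pos in auto)
      then show "gbd UNIV s (?M i) A n (T i (neumann T \<zeta> (n - i)))" using i by simp
    qed (use pos sZ sm in auto)
    then have "gbd UNIV s (cmod (-1) * (\<Sum>i\<in>{1..n}. ?M i)) A n (\<lambda>x. -1 * (\<Sum>i\<in>{1..n}. T i (neumann T \<zeta> (n - i)) x))"
      by (intro gbd_cmult[of UNIV] smooth_on_sum sm sZ) auto
    then have g: "gbd UNIV s (\<Sum>i\<in>{1..n}. ?M i) A n (neumann T \<zeta> n)"
      unfolding Suc neumann_Suc by simp
    have S: "c0 * (\<Sum>i\<in>{1..j}. A ^ i * B ^ (j - i)) = B ^ j - A ^ j" for j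
    proof (induction j)
      case (Suc j)
      have "(\<Sum>i\<in>{1..Suc j}. A ^ i * B ^ (Suc j - i)) = B * (\<Sum>i\<in>{1..j}. A ^ i * B ^ (j - i)) + A ^ Suc j"
        by (simp add: sum_distrib_left Suc_diff_le mult_ac)
      then have "c0 * (\<Sum>i\<in>{1..Suc j}. A ^ i * B ^ (Suc j - i)) = B * (B ^ j - A ^ j) + c0 * A ^ Suc j"
        by (simp add: Suc[symmetric] algebra_simps)
      also have "\<dots> = B ^ Suc j - A ^ Suc j" by (simp add: B_def algebra_simps)
      finally show ?case .
    qed simp
    have "(\<Sum>i\<in>{1..n}. ?M i) = M0 * (c0 * (\<Sum>i\<in>{1..n}. A ^ i * B ^ (n - i)))"
      by (simp add: sum_distrib_left mult_ac)
    also have "\<dots> \<le> M0 * B ^ n" unfolding S using pos by (intro mult_left_mono) auto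
    finally have le: "(\<Sum>i\<in>{1..n}. ?M i) \<le> M0 * B ^ n" .
    show ?thesis unfolding B_def[symmetric]
      by (rule gbd_mono[OF g _ le]) (use pos AB in \<open>auto intro!: sum_nonneg\<close>)
  qed
qed

text \<open>Both sides carry the factor \<open>t ^ (K + m)\<close> so that only nonnegative powers of \<open>t\<close> occur.\<close>
lemma parametrix_identity:
  fixes u :: "(real^'n::finite \<Rightarrow> complex) \<Rightarrow> complex" and \<omega> :: "real^'n" and t :: real
  assumes u: "distribution \<Omega> u" and S: "compact S" "S \<subseteq> \<Omega>"
    and \<zeta>: "smooth_on UNIV \<zeta>" "\<And>x. x \<notin> S \<Longrightarrow> \<zeta> x = 0"
    and b: "\<And>\<alpha>. mabs \<alpha> \<le> m \<Longrightarrow> smooth_on UNIV (b \<alpha>)" "\<And>\<alpha> x. x \<in> S \<Longrightarrow> a \<alpha> x = b \<alpha> x"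
    and q: "smooth_on UNIV q" "\<And>x. x \<in> S \<Longrightarrow> (\<Sum>\<alpha>\<in>{\<alpha>. mabs \<alpha> = m}. (\<Prod>i\<leftarrow>mlist \<alpha>. of_real (\<omega> $ i)) * b \<alpha> x) * q x = 1"
  defines "Z \<equiv> neumann (ptrans \<omega> m b q) \<zeta>" and "e \<equiv> expo (- (t *\<^sub>R \<omega>))"
  shows "of_real (t ^ (K + m)) * u (\<lambda>x. \<zeta> x * e x) =
     (\<Sum>k\<le>K. of_real (t ^ (K - k)) * Pop m a u (\<lambda>x. (q x * Z k x) * e x))
     - (\<Sum>(i, k)\<in>{(i, k). i \<le> m \<and> k \<le> K \<and> K < i + k}. of_real (t ^ (K + m - (i + k))) * u (\<lambda>x. ptrans \<omega> m b q i (Z k) x * e x))"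
proof -
  let ?T = "ptrans \<omega> m b q"
  have cS: "closed S" using S compact_imp_closed by blast
  have sT: "smooth_on UNIV (?T i z)" if "smooth_on UNIV z" for i z by (rule smooth_ptrans[OF b(1) q(1) that])
  have sZ: "smooth_on UNIV (Z k)" for k unfolding Z_def by (rule smooth_neumann[OF sT \<zeta>(1)])
  have vT: "?T i z x = 0" if "\<And>x. x \<notin> S \<Longrightarrow> z x = 0" "x \<notin> S" for i z x
    by (rule ptrans_vanish[of S]) (use that cS in auto)
  have vZ: "Z k x = 0" if "x \<notin> S" for k x unfolding Z_def by (rule neumann_vanish[of S]) (use vT \<zeta>(2) that in auto)
  have se: "smooth_on UNIV e" unfolding e_def by (rule smooth_expo)
  define Aik where "Aik = (\<lambda>i k. u (\<lambda>x. ?T i (Z k) x * e x))"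
  \<comment> \<open>On S the function q inverts the principal symbol, and off S the term
    \<open>Z n\<close> is zero.\<close>
  have T0: "?T 0 (Z n) x = Z n x" for n x
  proof -
    have "?T 0 (Z n) x = (\<Sum>\<alpha>\<in>{\<alpha>. mabs \<alpha> = m}. symop \<omega> (mlist \<alpha>) 0 (\<lambda>x. b \<alpha> x * (q x * Z n x)) x)"
      unfolding ptrans_def by (rule sum.cong) auto
    also have "\<dots> = (\<Sum>\<alpha>\<in>{\<alpha>. mabs \<alpha> = m}. (\<Prod>i\<leftarrow>mlist \<alpha>. of_real (\<omega> $ i)) * b \<alpha> x) * q x * Z n x"
      by (simp add: symop_0 sum_distrib_right sum_distrib_left mult_ac)
    also have "\<dots> = Z n x" using q(2)[of x] vZ[of x n] by (cases "x \<in> S") auto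
    finally show ?thesis .
  qed
  \<comment> \<open>The recursion of the Neumann series read backwards: the terms of total order n >
    0 add up to 0.\<close>
  have cancel: "(\<Sum>i\<le>n. ?T i (Z (n - i)) x) = (if n = 0 then \<zeta> x else 0)" for n x
  proof (cases n)
    case 0 then show ?thesis using T0[of 0 x] by (simp add: Z_def neumann_0)
  next
    case (Suc k)
    have "(\<Sum>i\<le>n. ?T i (Z (n - i)) x) = ?T 0 (Z n) x + (\<Sum>i\<in>{1..n}. ?T i (Z (n - i)) x)"
      using sum.atLeast_Suc_atMost[of 0 n "\<lambda>i. ?T i (Z (n - i)) x"] by (simp add: atMost_atLeast0)
    also have "\<dots> = 0" unfolding T0 Suc by (simp add: Z_def neumann_Suc)
    finally show ?thesis using Suc by simp
  qed
  have Asum: "(\<Sum>i\<le>n. Aik i (n - i)) = (if n = 0 then u (\<lambda>x. \<zeta> x * e x) else 0)" for n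
  proof -
    have "(\<Sum>i\<le>n. Aik i (n - i)) = u (\<lambda>x. \<Sum>i\<le>n. ?T i (Z (n - i)) x * e x)"
      unfolding Aik_def
      by (rule distribution_sum[OF u S, symmetric]) (use vT[OF vZ] in \<open>auto intro!: smooth_on_mult sT sZ se\<close>)
    also have "(\<lambda>x. \<Sum>i\<le>n. ?T i (Z (n - i)) x * e x) = (\<lambda>x. (if n = 0 then \<zeta> x else 0) * e x)"
      by (rule ext) (simp only: sum_distrib_right[symmetric] cancel)
    also have "u \<dots> = (if n = 0 then u (\<lambda>x. \<zeta> x * e x) else 0)"
      using distribution_sum[OF u S, of "{}" "\<lambda>_ _. 0"] by simp
    finally show ?thesis .
  qed
  have Alarge: "Aik i k = 0" if "m < i" for i k
    unfolding Aik_def ptrans_large[OF that] using distribution_sum[OF u S, of "{}" "\<lambda>_ _. 0"] by simp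
  have Fk: "Pop m a u (\<lambda>x. (q x * Z k x) * e x) = (\<Sum>i\<le>m. of_real (t ^ (m - i)) * Aik i k)" for k
  proof -
    let ?w = "\<lambda>x. q x * Z k x"
    let ?h = "\<lambda>\<alpha> j. symop \<omega> (mlist \<alpha>) j (\<lambda>x. b \<alpha> x * ?w x)"
    let ?g = "\<lambda>\<alpha> j. u (\<lambda>x. ?h \<alpha> j x * e x)"
    let ?I = "{\<alpha>::'n \<Rightarrow> nat. mabs \<alpha> \<le> m}"
    have ws: "smooth_on UNIV ?w" by (intro smooth_on_mult q sZ) auto
    have wv: "?w x = 0" if "x \<notin> S" for x using vZ[OF that] by simp
    have hs: "smooth_on UNIV (\<lambda>x. ?h \<alpha> j x * e x)" if "mabs \<alpha> \<le> m" for \<alpha> j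
      by (intro smooth_on_mult smooth_symop b ws se that) auto
    have hv: "?h \<alpha> j x * e x = 0" if "x \<notin> S" for \<alpha> j x
      using symop_vanish[of S "\<lambda>x. b \<alpha> x * ?w x" x \<omega> "mlist \<alpha>" j] cS vZ that by simp
    have ab: "a \<alpha> x * ?w x = b \<alpha> x * ?w x" for \<alpha> x using b(2)[of x \<alpha>] wv[of x] by (cases "x \<in> S") auto
    have P: "Pop m a u (\<lambda>x. ?w x * e x) = (\<Sum>\<alpha>\<in>?I. \<Sum>j\<le>mabs \<alpha>. of_real (t ^ (mabs \<alpha> - j)) * ?g \<alpha> j)"
      unfolding e_def by (rule Pop_expo[OF u S ws wv b(1) ab])
    have Ak: "Aik i k = (\<Sum>\<alpha>\<in>{\<alpha>\<in>?I. m \<le> i + mabs \<alpha>}. ?g \<alpha> (i + mabs \<alpha> - m))" for i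
    proof -
      have "Aik i k = u (\<lambda>x. \<Sum>\<alpha>\<in>{\<alpha>\<in>?I. m \<le> i + mabs \<alpha>}. ?h \<alpha> (i + mabs \<alpha> - m) x * e x)"
        unfolding Aik_def ptrans_def sum_distrib_right by simp
      also have "\<dots> = (\<Sum>\<alpha>\<in>{\<alpha>\<in>?I. m \<le> i + mabs \<alpha>}. ?g \<alpha> (i + mabs \<alpha> - m))"
        by (rule distribution_sum[OF u S]) (use finite_ptrans_index[of m i] hs hv in auto)
      finally show ?thesis .
    qed
    \<comment> \<open>Regrouping by powers of t: for fixed \<alpha> the substitution j = i + mabs
      \<alpha> - m maps the admissible i bijectively onto 0..mabs \<alpha>.\<close>
    have "(\<Sum>i\<le>m. of_real (t ^ (m - i)) * Aik i k) = (\<Sum>i\<le>m. \<Sum>\<alpha>\<in>{\<alpha>\<in>?I. m \<le> i + mabs \<alpha>}. of_real (t ^ (m - i)) * ?g \<alpha> (i + mabs \<alpha> - m))"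
      unfolding Ak sum_distrib_left ..
    also have "\<dots> = (\<Sum>\<alpha>\<in>?I. \<Sum>i\<in>{i\<in>{..m}. m \<le> i + mabs \<alpha>}. of_real (t ^ (m - i)) * ?g \<alpha> (i + mabs \<alpha> - m))"
      by (rule sum.swap_restrict) (auto simp: finite_mabs_le)
    also have "\<dots> = (\<Sum>\<alpha>\<in>?I. \<Sum>j\<le>mabs \<alpha>. of_real (t ^ (mabs \<alpha> - j)) * ?g \<alpha> j)"
    proof (rule sum.cong[OF refl])
      fix \<alpha> :: "'n \<Rightarrow> nat" assume "\<alpha> \<in> ?I"
      then have \<alpha>: "mabs \<alpha> \<le> m" by simp
      show "(\<Sum>i\<in>{i\<in>{..m}. m \<le> i + mabs \<alpha>}. of_real (t ^ (m - i)) * ?g \<alpha> (i + mabs \<alpha> - m)) = (\<Sum>j\<le>mabs \<alpha>. of_real (t ^ (mabs \<alpha> - j)) * ?g \<alpha> j)"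
        by (rule sum.reindex_bij_witness[of _ "\<lambda>j. j + m - mabs \<alpha>" "\<lambda>i. i + mabs \<alpha> - m"]) (use \<alpha> in auto)
    qed
    finally show ?thesis using P by simp
  qed
  let ?G = "\<lambda>i k. of_real (t ^ (K + m - (i + k))) * Aik i k"
  have "(\<Sum>k\<le>K. of_real (t ^ (K - k)) * Pop m a u (\<lambda>x. (q x * Z k x) * e x)) = (\<Sum>k\<le>K. \<Sum>i\<le>m. ?G i k)"
    unfolding Fk sum_distrib_left
  proof (intro sum.cong refl)
    fix k i assume ki: "k \<in> {..K}" "i \<in> {..m}"
    then have "K + m - (i + k) = (K - k) + (m - i)" by auto
    then show "of_real (t ^ (K - k)) * (of_real (t ^ (m - i)) * Aik i k) = ?G i k" by (simp add: power_add)
  qed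
  also have "\<dots> = (\<Sum>i\<le>m. \<Sum>k\<le>K. ?G i k)" by (rule sum.swap)
  also have "\<dots> = (\<Sum>(i, k)\<in>{..m} \<times> {..K}. ?G i k)" by (rule sum.cartesian_product)
  \<comment> \<open>Pairs with i + k \<le> K cancel along diagonals, except for i + k = 0; the pairs
    beyond are the truncation error.\<close>
  also have "\<dots> = (\<Sum>(i, k)\<in>{(i, k). i \<le> m \<and> k \<le> K \<and> i + k \<le> K}. ?G i k) + (\<Sum>(i, k)\<in>{(i, k). i \<le> m \<and> k \<le> K \<and> K < i + k}. ?G i k)"
  proof -
    have fin: "finite ({..m} \<times> {..K})" by simp
    have "(\<Sum>(i, k)\<in>{..m} \<times> {..K}. ?G i k) = (\<Sum>(i, k)\<in>{..m} \<times> {..K} \<inter> {(i, k). i + k \<le> K}. ?G i k) + (\<Sum>(i, k)\<in>{..m} \<times> {..K} - {(i, k). i + k \<le> K}. ?G i k)"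
      by (rule sum.Int_Diff[OF fin])
    moreover have "{..m} \<times> {..K} \<inter> {(i, k). i + k \<le> K} = {(i, k). i \<le> m \<and> k \<le> K \<and> i + k \<le> K}"
      "{..m} \<times> {..K} - {(i, k). i + k \<le> K} = {(i, k). i \<le> m \<and> k \<le> K \<and> K < i + k}" by auto
    ultimately show ?thesis by (simp only:)
  qed
  also have "(\<Sum>(i, k)\<in>{(i, k). i \<le> m \<and> k \<le> K \<and> i + k \<le> K}. ?G i k) = (\<Sum>(i, k)\<in>{(i, k). i + k \<le> K}. ?G i k)"
  proof (rule sum.mono_neutral_left)
    show "finite {(i, k). i + k \<le> K}" by (rule finite_subset[of _ "{..K} \<times> {..K}"]) auto
    show "\<forall>p\<in>{(i, k). i + k \<le> K} - {(i, k). i \<le> m \<and> k \<le> K \<and> i + k \<le> K}. (case p of (i, k) \<Rightarrow> ?G i k) = 0"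
    proof
      fix p assume p: "p \<in> {(i, k). i + k \<le> K} - {(i, k). i \<le> m \<and> k \<le> K \<and> i + k \<le> K}"
      obtain i k where ik: "p = (i, k)" by (cases p)
      then have "m < i" using p by auto
      then show "(case p of (i, k) \<Rightarrow> ?G i k) = 0" using Alarge ik by simp
    qed
  qed auto
  also have "\<dots> = (\<Sum>n\<le>K. \<Sum>i\<le>n. ?G i (n - i))" by (rule sum.triangle_reindex_eq)
  also have "\<dots> = (\<Sum>n\<le>K. of_real (t ^ (K + m - n)) * (\<Sum>i\<le>n. Aik i (n - i)))"
    by (intro sum.cong refl) (simp add: sum_distrib_left)
  also have "\<dots> = (\<Sum>n\<le>K. if n = 0 then of_real (t ^ (K + m)) * u (\<lambda>x. \<zeta> x * e x) else 0)"
    unfolding Asum by (intro sum.cong refl) simp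
  also have "\<dots> = of_real (t ^ (K + m)) * u (\<lambda>x. \<zeta> x * e x)" by simp
  finally show ?thesis unfolding Aik_def by simp
qed


section \<open>The principal symbol\<close>

lemma prod_list_mlist: "(\<Prod>i\<leftarrow>mlist \<alpha>. f i) = (\<Prod>i\<in>UNIV. (f i :: complex) ^ \<alpha> i)" for \<alpha> :: "'n::finite \<Rightarrow> nat"
proof -
  have "(\<Prod>i\<leftarrow>L. f i) = (\<Prod>i\<in>UNIV. f i ^ count_list L i)" for L
  proof (induction L)
    case (Cons j L)
    have "(\<Prod>i\<in>UNIV. f i ^ count_list (j # L) i) = (\<Prod>i\<in>UNIV. (if i = j then f j else 1) * f i ^ count_list L i)"
      by (rule prod.cong) auto
    also have "\<dots> = f j * (\<Prod>i\<in>UNIV. f i ^ count_list L i)" by (simp add: prod.distrib)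
    finally show ?case using Cons by simp
  qed simp
  from this[of "mlist \<alpha>"] show ?thesis by (simp add: count_mlist)
qed

definition psym :: "nat \<Rightarrow> (('n::finite \<Rightarrow> nat) \<Rightarrow> real^'n \<Rightarrow> complex) \<Rightarrow> real^'n \<Rightarrow> real^'n \<Rightarrow> complex" where
  "psym m a x \<xi> = (\<Sum>\<alpha>\<in>{\<alpha>. mabs \<alpha> = m}. a \<alpha> x * (\<Prod>i\<in>UNIV. complex_of_real (\<xi> $ i) ^ \<alpha> i))"

lemma psym_scaleR: "psym m a x (t *\<^sub>R \<xi>) = of_real (t ^ m) * psym m a x \<xi>"
  unfolding psym_def sum_distrib_left
proof (rule sum.cong[OF refl])
  fix \<alpha> :: "'a \<Rightarrow> nat" assume "\<alpha> \<in> {\<alpha>. mabs \<alpha> = m}"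
  then have "(\<Prod>i\<in>UNIV. complex_of_real t ^ \<alpha> i) = of_real (t ^ m)"
    by (simp add: power_sum[symmetric] mabs_def)
  then show "a \<alpha> x * (\<Prod>i\<in>UNIV. complex_of_real ((t *\<^sub>R \<xi>) $ i) ^ \<alpha> i) = of_real (t ^ m) * (a \<alpha> x * (\<Prod>i\<in>UNIV. complex_of_real (\<xi> $ i) ^ \<alpha> i))"
    by (simp add: power_mult_distrib prod.distrib mult_ac)
qed

lemma psym_near:
  fixes x0 \<omega>0 :: "real^'n::finite"
  assumes "open \<Omega>" "x0 \<in> \<Omega>" "\<And>\<alpha>. mabs \<alpha> \<le> m \<Longrightarrow> continuous_on \<Omega> (a \<alpha>)" "\<epsilon> > 0"
  obtains d where "d > 0" "\<And>x \<omega>. x \<in> \<Omega> \<Longrightarrow> dist x0 x < d \<Longrightarrow> norm (\<omega> - \<omega>0) < d \<Longrightarrow> cmod (psym m a x \<omega> - psym m a x0 \<omega>0) \<le> \<epsilon>"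
proof -
  have ca: "continuous_on (\<Omega> \<times> UNIV) (\<lambda>z. a \<alpha> (fst z))" if "\<alpha> \<in> {\<alpha>. mabs \<alpha> = m}" for \<alpha>
    by (rule continuous_on_compose2[OF assms(3) continuous_on_fst[OF continuous_on_id]]) (use that in auto)
  have cc: "continuous_on (\<Omega> \<times> UNIV) (\<lambda>z. complex_of_real ((snd z :: real^'n) $ i))" for i
    by (intro continuous_intros)
  have "continuous_on (\<Omega> \<times> UNIV) (\<lambda>z. psym m a (fst z) (snd z))"
    unfolding psym_def
    by (rule continuous_on_sum, rule continuous_on_mult[OF ca], assumption, rule continuous_on_prod, rule continuous_on_power[OF cc])
  then obtain d where d: "d > 0" "\<And>z. z \<in> \<Omega> \<times> UNIV \<Longrightarrow> dist z (x0, \<omega>0) < d \<Longrightarrow>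
     dist (psym m a (fst z) (snd z)) (psym m a x0 \<omega>0) < \<epsilon>"
    using assms(2,4) unfolding continuous_on_iff by (metis UNIV_I fst_conv mem_Sigma_iff snd_conv)
  show ?thesis
  proof (rule that[of "d / 2"])
    fix x \<omega> assume x: "x \<in> \<Omega>" "dist x0 x < d / 2" "norm (\<omega> - \<omega>0) < d / 2"
    have "dist (x, \<omega>) (x0, \<omega>0) \<le> dist x x0 + dist \<omega> \<omega>0"
      unfolding dist_Pair_Pair by (rule sqrt_sum_squares_le_sum) auto
    also have "\<dots> < d" using x(2,3) unfolding dist_norm[of \<omega>] dist_commute[of x] by linarith
    finally show "cmod (psym m a x \<omega> - psym m a x0 \<omega>0) \<le> \<epsilon>"
      using d(2)[of "(x, \<omega>)"] x(1) by (simp add: dist_norm)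
  qed (use d in auto)
qed

section \<open>Elliptic regularity\<close>

text \<open>Balance of powers: the parametrix identity is divided by t ^ (K + m). The terms with P u
  decay by hypothesis; each error term carries at most t ^ m from the expansion and t ^ k0 from the
  order k0 of u. With K = N + k0 exactly t ^ (- N) remains, and the factorials exceed N! only by a
  fixed shift.\<close>

lemma microlocal_elliptic:
  fixes u :: "(real^'n::finite \<Rightarrow> complex) \<Rightarrow> complex"
  assumes \<Omega>: "open \<Omega>" and x0: "x0 \<in> \<Omega>" and a: "\<And>\<alpha>. mabs \<alpha> \<le> m \<Longrightarrow> EG \<Omega> (a \<alpha>)" and u: "distribution \<Omega> u"
    and \<xi>0: "\<xi>0 \<noteq> 0" and mic: "microlocal_G \<Omega> (Pop m a u) x0 \<xi>0" and ell: "psym m a x0 \<xi>0 \<noteq> 0"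
  shows "microlocal_G \<Omega> u x0 \<xi>0"
proof -
  obtain r1 \<delta>1 where r1: "0 < r1" "cball x0 r1 \<subseteq> \<Omega>" and \<delta>1: "0 < \<delta>1"
    and dec: "microlocal_decay (Pop m a u) (cball x0 r1) (conic_nbhd \<xi>0 \<delta>1)"
    using microlocal_imp_decay[OF \<Omega> mic] .
  define \<omega>0 where "\<omega>0 = \<xi>0 /\<^sub>R norm \<xi>0"
  define p0 where "p0 = psym m a x0 \<omega>0"
  have "\<xi>0 = norm \<xi>0 *\<^sub>R \<omega>0" using \<xi>0 by (simp add: \<omega>0_def)
  then have "psym m a x0 \<xi>0 = of_real (norm \<xi>0 ^ m) * p0" unfolding p0_def using psym_scaleR by metis
  with ell have p0: "p0 \<noteq> 0" by auto
  obtain d where d: "d > 0" "\<And>x \<omega>. x \<in> \<Omega> \<Longrightarrow> dist x0 x < d \<Longrightarrow> norm (\<omega> - \<omega>0) < d \<Longrightarrow> cmod (psym m a x \<omega> - p0) \<le> cmod p0 / 2"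
  proof (rule psym_near[OF \<Omega> x0, of m a "cmod p0 / 2" \<omega>0], goal_cases)
    case (1 \<alpha>)
    then show ?case by (intro smooth_on_continuous EG_smooth a)
  next
    case 2
    then show ?case using p0 by simp
  next
    case (3 d)
    show ?case by (rule 3(1)[OF 3(2) 3(3)[folded p0_def]])
  qed
  \<comment> \<open>Within distance r, and for directions within \<delta> of \<omega>0, the symbol
    differs from p0 by at most half the modulus of p0, and the decay of P u is available.\<close>
  define r where "r = min r1 d / 2"
  have r: "0 < r" "r < r1" "r < d" using r1 d by (auto simp: r_def)
  define \<delta> where "\<delta> = min \<delta>1 d"
  have \<delta>: "0 < \<delta>" "\<delta> \<le> \<delta>1" "\<delta> \<le> d" using \<delta>1 d by (auto simp: \<delta>_def)
  obtain \<zeta>1 d1 where z1: "gevrey_global \<zeta>1" "0 < d1" "d1 < r" "\<And>x. dist x0 x \<le> d1 \<Longrightarrow> \<zeta>1 x = 1"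
    "\<And>x. r \<le> dist x0 x \<Longrightarrow> \<zeta>1 x = 0" "\<And>x. cmod (\<zeta>1 x) \<le> 1"
    using gevrey_cutoff_exists[OF r(1), of x0] by blast
  obtain \<zeta> d0 where z: "gevrey_global \<zeta>" "0 < d0" "d0 < d1" "\<And>x. dist x0 x \<le> d0 \<Longrightarrow> \<zeta> x = 1"
    "\<And>x. d1 \<le> dist x0 x \<Longrightarrow> \<zeta> x = 0" "\<And>x. cmod (\<zeta> x) \<le> 1"
    using gevrey_cutoff_exists[OF z1(2), of x0] by blast
  let ?S = "cball x0 d1"
  have sub1: "?S \<subseteq> cball x0 r1" using z1 r by (intro subset_cball) auto
  then have sub: "?S \<subseteq> \<Omega>" using r1 by blast
  have zs: "smooth_on UNIV \<zeta>" by (rule gevrey_global_smooth[OF z(1)])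
  have zv: "\<zeta> x = 0" if "x \<notin> ?S" for x using z(5)[of x] that by simp
  let ?I = "{\<alpha>::'n \<Rightarrow> nat. mabs \<alpha> \<le> m}" and ?J = "{\<alpha>::'n \<Rightarrow> nat. mabs \<alpha> = m}"
  define b where "b = (\<lambda>\<alpha> x. \<zeta>1 x * a \<alpha> x)"
  have bg: "gevrey_global (b \<alpha>)" if "mabs \<alpha> \<le> m" for \<alpha>
    unfolding b_def
    by (rule gevrey_global_cutoff_mult[OF \<Omega> a[OF that] z1(1) _ _ r1(2), where r = r]) (use z1(5) r r1 in auto)
  have bs: "smooth_on UNIV (b \<alpha>)" if "mabs \<alpha> \<le> m" for \<alpha> by (rule gevrey_global_smooth[OF bg[OF that]])
  have ab: "a \<alpha> x = b \<alpha> x" if "x \<in> ?S" for \<alpha> x using z1(4)[of x] that by (simp add: b_def)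
  \<comment> \<open>Interpolates between the symbol, where \<zeta>1 = 1, and the constant p0, where
    \<zeta>1 = 0 (see \<open>pte\<close>). For directions near \<omega>0 it is bounded away from 0
    on the whole space, so its inverse is globally Gevrey with bounds uniform in \<omega>.\<close>
  define pt where "pt = (\<lambda>\<omega> x. (\<Sum>\<alpha>\<in>?J. (\<Prod>i\<leftarrow>mlist \<alpha>. of_real (\<omega> $ i)) * b \<alpha> x) + p0 * (1 + (-1) * \<zeta>1 x))"
  define q where "q = (\<lambda>\<omega> x. inverse (pt \<omega> x))"
  have zs1: "smooth_on UNIV \<zeta>1" by (rule gevrey_global_smooth[OF z1(1)])
  have pts: "smooth_on UNIV (pt \<omega>)" for \<omega>
    unfolding pt_def by (intro smooth_on_add smooth_on_sum smooth_on_cmult smooth_on_const bs zs1) auto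
  have pte: "pt \<omega> x = p0 + \<zeta>1 x * (psym m a x \<omega> - p0)" for \<omega> x
    unfolding pt_def psym_def prod_list_mlist b_def by (simp add: sum_distrib_left algebra_simps)
  have ptn: "cmod p0 / 2 \<le> cmod (pt \<omega> x)" if "norm (\<omega> - \<omega>0) < d" for \<omega> x
  proof -
    have "cmod (\<zeta>1 x * (psym m a x \<omega> - p0)) \<le> cmod p0 / 2"
    proof (cases "r \<le> dist x0 x")
      case True then show ?thesis using z1(5) by simp
    next
      case False
      then have "x \<in> cball x0 r1" using r by simp
      then have "cmod (psym m a x \<omega> - p0) \<le> cmod p0 / 2" using False r r1 that by (intro d(2)) auto
      then have "cmod (\<zeta>1 x) * cmod (psym m a x \<omega> - p0) \<le> 1 * (cmod p0 / 2)"
        using z1(6) by (intro mult_mono) auto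
      then show ?thesis by (simp add: norm_mult)
    qed
    then show ?thesis unfolding pte using norm_diff_ineq[of p0 "\<zeta>1 x * (psym m a x \<omega> - p0)"] by linarith
  qed
  have c0: "0 < cmod p0 / 2" using p0 by simp
  have pt0: "pt \<omega> x \<noteq> 0" if "norm (\<omega> - \<omega>0) < d" for \<omega> x using ptn[OF that, of x] c0 by auto
  have qs: "smooth_on UNIV (q \<omega>)" if "norm (\<omega> - \<omega>0) < d" for \<omega>
    unfolding q_def by (intro smooth_on_inverse pts pt0 that) auto
  have pq: "(\<Sum>\<alpha>\<in>?J. (\<Prod>i\<leftarrow>mlist \<alpha>. of_real (\<omega> $ i)) * b \<alpha> x) * q \<omega> x = 1"
    if "norm (\<omega> - \<omega>0) < d" "x \<in> ?S" for \<omega> x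
  proof -
    have "(\<Sum>\<alpha>\<in>?J. (\<Prod>i\<leftarrow>mlist \<alpha>. of_real (\<omega> $ i)) * b \<alpha> x) = pt \<omega> x"
      using z1(4)[of x] that by (simp add: pt_def)
    then show ?thesis using pt0[OF that(1), of x] by (simp add: q_def)
  qed
  show ?thesis
  proof (rule microlocal_from_cutoff_ball[OF \<Omega> u zs zv sub z(2,4) \<xi>0 \<delta>(1)])
    fix s :: real assume s: "s > 1"
    obtain C1 \<rho>1 where 1: "C1 \<ge> 0" "\<rho>1 \<ge> 1" "gbd UNIV s C1 \<rho>1 0 \<zeta>" using gevrey_globalE[OF z(1) s] .
    obtain C2 \<rho>2 where 2: "C2 \<ge> 0" "\<rho>2 \<ge> 1" "gbd UNIV s C2 \<rho>2 0 \<zeta>1" using gevrey_globalE[OF z1(1) s] .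
    obtain Cb \<rho>b where 3: "Cb \<ge> 0" "\<rho>b \<ge> 1" "\<And>\<alpha>. \<alpha> \<in> ?I \<Longrightarrow> gbd UNIV s Cb \<rho>b 0 (b \<alpha>)"
      using gevrey_global_uniform[of ?I b s] finite_mabs_le[of m] bg s by auto
    define \<rho>p where "\<rho>p = max \<rho>2 \<rho>b"
    define Cp where "Cp = (\<Sum>\<alpha>\<in>?J. Cb) + cmod p0 * (1 + 1 * C2)"
    have Cp: "0 \<le> Cp" using 2 3 by (auto simp: Cp_def intro!: add_nonneg_nonneg sum_nonneg)
    have rp: "1 \<le> \<rho>p" using 2 by (simp add: \<rho>p_def)
    have gb: "gbd UNIV s Cb \<rho>p 0 (b \<alpha>)" if "mabs \<alpha> \<le> m" for \<alpha>
      by (rule gbd_mono[OF 3(3)]) (use that 3 s in \<open>auto simp: \<rho>p_def\<close>)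
    have gp: "gbd UNIV s Cp \<rho>p 0 (pt \<omega>)" if om: "\<And>i. \<bar>\<omega> $ i\<bar> \<le> 1" for \<omega> :: "real^'n"
      unfolding pt_def Cp_def
    proof (rule gbd_add[of UNIV])
      show "gbd UNIV s (\<Sum>\<alpha>\<in>?J. Cb) \<rho>p 0 (\<lambda>x. \<Sum>\<alpha>\<in>?J. (\<Prod>i\<leftarrow>mlist \<alpha>. of_real (\<omega> $ i)) * b \<alpha> x)"
      proof (rule gbd_sum[of UNIV])
        fix \<alpha> assume \<alpha>: "\<alpha> \<in> ?J"
        show "smooth_on UNIV (\<lambda>x. (\<Prod>i\<leftarrow>mlist \<alpha>. of_real (\<omega> $ i)) * b \<alpha> x)" using \<alpha> by (intro smooth_on_cmult bs) auto
        have "cmod (\<Prod>i\<leftarrow>mlist \<alpha>. of_real (\<omega> $ i)) \<le> 1"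
          unfolding prod_list_mlist prod_norm[symmetric] norm_power norm_of_real
          using om by (intro prod_le_1 conjI power_le_one) auto
        then have le: "cmod (\<Prod>i\<leftarrow>mlist \<alpha>. of_real (\<omega> $ i)) * Cb \<le> Cb" using 3(1) mult_right_mono by fastforce
        have "gbd UNIV s (cmod (\<Prod>i\<leftarrow>mlist \<alpha>. of_real (\<omega> $ i)) * Cb) \<rho>p 0 (\<lambda>x. (\<Prod>i\<leftarrow>mlist \<alpha>. of_real (\<omega> $ i)) * b \<alpha> x)"
          by (rule gbd_cmult[of UNIV]) (use bs gb \<alpha> in auto)
        then show "gbd UNIV s Cb \<rho>p 0 (\<lambda>x. (\<Prod>i\<leftarrow>mlist \<alpha>. of_real (\<omega> $ i)) * b \<alpha> x)"
          by (rule gbd_mono) (use le 3 rp s in auto)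
      qed (use rp in auto)
      have g1: "gbd UNIV s C2 \<rho>p 0 \<zeta>1" by (rule gbd_mono[OF 2(3)]) (use 2 s in \<open>auto simp: \<rho>p_def\<close>)
      have "gbd UNIV s (cmod (-1) * C2) \<rho>p 0 (\<lambda>x. (-1) * \<zeta>1 x)" by (rule gbd_cmult[of UNIV]) (use zs1 g1 in auto)
      moreover have "gbd UNIV s (cmod 1) \<rho>p 0 (\<lambda>x::real^'n. 1)" by (rule gbd_const) (use rp in auto)
      ultimately have "gbd UNIV s (cmod 1 + cmod (-1) * C2) \<rho>p 0 (\<lambda>x. 1 + (-1) * \<zeta>1 x)"
        by (intro gbd_add[OF open_UNIV subset_UNIV] smooth_on_const smooth_on_cmult zs1 open_UNIV)
      then have "gbd UNIV s (cmod p0 * (cmod 1 + cmod (-1) * C2)) \<rho>p 0 (\<lambda>x. p0 * (1 + (-1) * \<zeta>1 x))"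
        by (intro gbd_cmult[OF open_UNIV subset_UNIV] smooth_on_add smooth_on_const smooth_on_cmult zs1 open_UNIV)
      then show "gbd UNIV s (cmod p0 * (1 + 1 * C2)) \<rho>p 0 (\<lambda>x. p0 * (1 + (-1) * \<zeta>1 x))" by simp
      show "smooth_on UNIV (\<lambda>x. \<Sum>\<alpha>\<in>?J. (\<Prod>i\<leftarrow>mlist \<alpha>. of_real (\<omega> $ i)) * b \<alpha> x)"
        by (intro smooth_on_sum smooth_on_cmult bs open_UNIV) simp
      show "smooth_on UNIV (\<lambda>x. p0 * (1 + (-1) * \<zeta>1 x))"
        by (intro smooth_on_add smooth_on_const smooth_on_cmult zs1 open_UNIV)
    qed auto
    define Cq where "Cq = 1 / (cmod p0 / 2)"
    define \<rho> where "\<rho> = \<rho>p * (1 + Cp / (cmod p0 / 2))"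
    have Cq: "0 \<le> Cq" by (simp add: Cq_def)
    have "1 * \<rho>p \<le> (1 + Cp / (cmod p0 / 2)) * \<rho>p" using Cp rp by (intro mult_right_mono) auto
    then have rho: "\<rho>p \<le> \<rho>" by (simp add: \<rho>_def mult.commute)
    have gq: "gbd UNIV s Cq \<rho> 0 (q \<omega>)" if "\<And>i. \<bar>\<omega> $ i\<bar> \<le> 1" "norm (\<omega> - \<omega>0) < d" for \<omega> :: "real^'n"
      unfolding q_def Cq_def \<rho>_def
      by (rule gbd_inverse[OF open_UNIV subset_UNIV pts pt0[OF that(2)] ptn[OF that(2)] gp[OF that(1)] c0]) (use s Cp rp in auto)
    have gb': "gbd UNIV s Cb \<rho> 0 (b \<alpha>)" if "mabs \<alpha> \<le> m" for \<alpha>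
      by (rule gbd_mono[OF gb[OF that]]) (use 3 s rp rho in auto)
    \<comment> \<open>At least twice the common radius of b and q, so that multiplication by them
      does not enlarge it.\<close>
    define A where "A = max (2 * \<rho>) \<rho>1"
    have A: "1 \<le> A" "2 * \<rho> \<le> A" using 1 by (auto simp: A_def)
    have rho0: "0 \<le> \<rho>" using rp rho by linarith
    have gz: "gbd UNIV s C1 A 0 \<zeta>" by (rule gbd_mono[OF 1(3)]) (use 1 s in \<open>auto simp: A_def\<close>)
    define c where "c = real (card ?I) * 2 ^ m * (4 * Cb * Cq)"
    have c: "0 \<le> c" using 3 Cq by (simp add: c_def)
    define B where "B = A * (1 + c)"
    have B: "1 \<le> B" using A c mult_mono[of 1 A 1 "1 + c"] by (simp add: B_def)
    obtain Ck B2 where Ck: "Ck \<ge> 0" and B2: "B2 \<ge> 1" and D: "\<And>g M l N \<xi>.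
     smooth_on UNIV g \<Longrightarrow> (\<And>x. x \<notin> cball x0 r1 \<Longrightarrow> g x = 0) \<Longrightarrow> gbd UNIV s M A l g \<Longrightarrow> \<xi> \<in> conic_nbhd \<xi>0 \<delta>1 \<Longrightarrow> 1 \<le> norm \<xi> \<Longrightarrow>
     norm \<xi> ^ N * cmod (Pop m a u (\<lambda>x. g x * expo (- \<xi>) x)) \<le> Ck * M * B2 ^ (N + l) * fact (N + l) powr s"
    proof -
      from dec[unfolded microlocal_decay_def, rule_format, OF s A(1)] that show thesis by blast
    qed
    obtain Cu k0 where Cu: "0 \<le> Cu" and uo: "\<And>\<phi> M. smooth_on UNIV \<phi> \<Longrightarrow> (\<And>x. x \<notin> ?S \<Longrightarrow> \<phi> x = 0) \<Longrightarrow> 0 \<le> M \<Longrightarrow>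
     (\<And>L x. length L \<le> k0 \<Longrightarrow> x \<in> ?S \<Longrightarrow> cmod (iter_partial L \<phi> x) \<le> M) \<Longrightarrow> cmod (u \<phi>) \<le> Cu * M"
      using distribution_order[OF u compact_cball sub] by blast
    \<comment> \<open>In the error terms the index sum is at most K + m and up to k0 further
      derivatives are taken, so their factorial is at most (K + P)!.\<close>
    define P where "P = k0 + m"
    \<comment> \<open>The first summand belongs to the terms with P u, the second to the error
      terms: Suc m counts the values of i, and the two powers of 2 come from the Leibniz rule and
      from (1 + t) ^ k0 \<le> (2 t) ^ k0.\<close>
    define H where "H = Ck * (2 * Cq * C1) + real (Suc m) * 2 ^ k0 * (Cu * 2 ^ k0 * (c * A ^ (m + k0) * C1))"
    have H: "0 \<le> H" using Ck Cq 1 Cu c A by (simp add: H_def)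
    define W where "W = (2 ^ (k0 + P) * fact (k0 + P) :: real) powr s"
    define B3 where "B3 = 2 * B * B2"
    have "1 \<le> B * B2" using B B2 mult_mono[of 1 B 1 B2] by simp
    then have B3: "1 \<le> B3" by (simp add: B3_def)
    define C' where "C' = H * B3 ^ k0 * W"
    have main: "norm \<xi> ^ N * cmod (u (\<lambda>x. \<zeta> x * expo (- \<xi>) x)) \<le> C' * (B3 * 2 powr s) ^ N * fact N powr s"
      if \<xi>: "\<xi> \<in> conic_nbhd \<xi>0 \<delta>" "1 \<le> norm \<xi>" for \<xi> N
    proof -
      define \<omega> where "\<omega> = \<xi> /\<^sub>R norm \<xi>"
      define t where "t = norm \<xi>"
      have t: "t \<ge> 1" using \<xi> by (simp add: t_def)
      have "\<xi> \<noteq> 0" using \<xi> by auto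
      then have t\<omega>: "t *\<^sub>R \<omega> = \<xi>" by (simp add: t_def \<omega>_def)
      have om: "\<bar>\<omega> $ i\<bar> \<le> 1" for i unfolding \<omega>_def by (rule norm_unit_component)
      have omd: "norm (\<omega> - \<omega>0) < d" using \<xi>(1) \<delta> by (simp add: conic_nbhd_def \<omega>_def \<omega>0_def)
      have \<xi>1: "\<xi> \<in> conic_nbhd \<xi>0 \<delta>1" using \<xi>(1) \<delta> by (simp add: conic_nbhd_def)
      define Q where "Q = q \<omega>"
      have Qs: "smooth_on UNIV Q" unfolding Q_def by (rule qs[OF omd])
      have Qg: "gbd UNIV s Cq \<rho> 0 Q" unfolding Q_def by (rule gq[OF om omd])
      define T where "T = ptrans \<omega> m b Q"
      define Z where "Z = neumann T \<zeta>"
      have sT: "smooth_on UNIV (T i v)" if "smooth_on UNIV v" for i v unfolding T_def by (rule smooth_ptrans[OF bs Qs that])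
      have gT: "gbd UNIV s (c * A ^ i * M) A (l + i) (T i v)" if "smooth_on UNIV v" "gbd UNIV s M A l v" "0 \<le> M" for i v M l
        unfolding T_def c_def
        by (rule gbd_ptrans[OF bs gb' Qs Qg that(1,2) _ 3(1) Cq that(3) rho0 A(2,1) om]) (use s in auto)
      have vT: "T i v x = 0" if "\<And>x. x \<notin> ?S \<Longrightarrow> v x = 0" "x \<notin> ?S" for i v x
        unfolding T_def by (rule ptrans_vanish[of ?S]) (use that in auto)
      have sZ: "smooth_on UNIV (Z k)" for k unfolding Z_def by (rule smooth_neumann[OF sT zs])
      have vZ: "Z k x = 0" if "x \<notin> ?S" for k x unfolding Z_def by (rule neumann_vanish[of ?S]) (use vT zv that in auto)
      have gZ: "gbd UNIV s (C1 * B ^ k) A k (Z k)" for k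
        unfolding Z_def B_def by (rule gbd_neumann[OF sT zs gT gz c A(1) 1(1)]) (use s in auto)
      define K where "K = N + k0"
      define E where "E = {(i, k). i \<le> m \<and> k \<le> K \<and> K < i + k}"
      let ?e = "expo (- \<xi>)"
      let ?F = "\<lambda>k. Pop m a u (\<lambda>x. (Q x * Z k x) * ?e x)" and ?a = "\<lambda>i k. u (\<lambda>x. T i (Z k) x * ?e x)"
      have id: "of_real (t ^ (K + m)) * u (\<lambda>x. \<zeta> x * ?e x) =
         (\<Sum>k\<le>K. of_real (t ^ (K - k)) * ?F k) - (\<Sum>(i, k)\<in>E. of_real (t ^ (K + m - (i + k))) * ?a i k)"
        unfolding E_def Z_def T_def t\<omega>[symmetric]
        by (rule parametrix_identity[OF u compact_cball sub zs zv bs ab Qs]) (use pq[OF omd] Q_def in auto)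
      define \<Phi> where "\<Phi> = B ^ K * B2 ^ K * fact (K + P) powr s"
      have \<Phi>0: "0 \<le> \<Phi>" using B B2 by (simp add: \<Phi>_def)
      have t1: "cmod (of_real (t ^ (K - k)) * ?F k) \<le> t ^ k0 * (Ck * (2 * Cq * C1) * \<Phi>)" if k: "k \<le> K" for k
      proof -
        let ?N = "N - k"
        have le: "?N + k \<le> K" using k by (simp add: K_def)
        have "cmod (of_real (t ^ (K - k)) * ?F k) = t ^ (K - k) * cmod (?F k)" using t by (simp add: norm_mult norm_power)
        also have "\<dots> \<le> t ^ (k0 + ?N) * cmod (?F k)"
          using t by (intro mult_right_mono power_increasing) (auto simp: K_def)
        also have "\<dots> = t ^ k0 * (norm \<xi> ^ ?N * cmod (?F k))" by (simp add: power_add t_def)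
        also have "\<dots> \<le> t ^ k0 * (Ck * (2 * Cq * (C1 * B ^ k)) * B2 ^ (?N + k) * fact (?N + k) powr s)"
        proof (intro mult_left_mono D \<xi>1 \<xi>(2))
          show "smooth_on UNIV (\<lambda>x. Q x * Z k x)" by (intro smooth_on_mult Qs sZ) auto
          show "Q x * Z k x = 0" if "x \<notin> cball x0 r1" for x
          proof -
            have "x \<notin> ?S" using sub1 that by blast
            from vZ[OF this, of k] show ?thesis by simp
          qed
          show "gbd UNIV s (2 * Cq * (C1 * B ^ k)) A k (\<lambda>x. Q x * Z k x)"
            by (rule gbd_mult[OF open_UNIV subset_UNIV Qs sZ Qg gZ]) (use s Cq rho0 1 B A in auto)
        qed (use t in auto)
        also have "\<dots> \<le> t ^ k0 * (Ck * (2 * Cq * (C1 * B ^ K)) * B2 ^ K * fact (K + P) powr s)"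
        proof (intro mult_left_mono mult_mono power_increasing powr_mono2)
          show "(fact (?N + k) :: real) \<le> fact (K + P)" by (rule fact_mono) (use le in simp)
        qed (use le k t Ck Cq 1 B B2 s in auto)
        also have "\<dots> = t ^ k0 * (Ck * (2 * Cq * C1) * \<Phi>)" by (simp add: \<Phi>_def mult_ac)
        finally show ?thesis .
      qed
      have t2: "cmod (of_real (t ^ (K + m - (i + k))) * ?a i k) \<le> t ^ m * (2 ^ k0 * t ^ k0 * (Cu * 2 ^ k0 * (c * A ^ (m + k0) * C1)) * \<Phi>)"
        if ik: "(i, k) \<in> E" for i k
      proof -
        have ik': "i \<le> m" "k \<le> K" "K < i + k" using ik by (auto simp: E_def)
        define Y where "Y = c * A ^ (m + k0) * C1 * B ^ K * fact (K + P) powr s"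
        have Y0: "0 \<le> Y" using c A 1 B by (simp add: Y_def)
        have Yb: "cmod (iter_partial L (T i (Z k)) x) \<le> Y" if "length L \<le> k0" for L x
        proof -
          have "gbd UNIV s (c * A ^ i * (C1 * B ^ k)) A (k + i) (T i (Z k))"
            by (rule gT[OF sZ gZ]) (use 1 B in auto)
          then have "cmod (iter_partial L (T i (Z k)) x) \<le> c * A ^ i * (C1 * B ^ k) * A ^ length L * fact (length L + (k + i)) powr s"
            by (rule gbdD) simp
          also have "\<dots> = c * (A ^ (i + length L)) * C1 * B ^ k * fact (length L + (k + i)) powr s"
            by (simp add: power_add mult_ac)
          also have "\<dots> \<le> Y" unfolding Y_def
          proof (intro mult_mono mult_left_mono power_increasing powr_mono2)
            show "(fact (length L + (k + i)) :: real) \<le> fact (K + P)" by (rule fact_mono) (use that ik' in \<open>simp add: P_def\<close>)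
          qed (use that ik' c A 1 B s in auto)
          finally show ?thesis .
        qed
        \<comment> \<open>Decay of u is what is being proved, so only its order k0 is available
          here; differentiating the exponential costs (1 + t) ^ k0.\<close>
        have "cmod (?a i k) \<le> Cu * (2 ^ k0 * Y * (1 + t) ^ k0)"
        proof (rule uo)
          show "smooth_on UNIV (\<lambda>x. T i (Z k) x * ?e x)" by (intro smooth_on_mult sT sZ smooth_expo) auto
          show "T i (Z k) x * ?e x = 0" if "x \<notin> ?S" for x using vT[OF vZ that] by simp
          show "cmod (iter_partial L (\<lambda>x. T i (Z k) x * ?e x) x) \<le> 2 ^ k0 * Y * (1 + t) ^ k0" if "length L \<le> k0" for L x
          proof (rule leibniz_uniform_bound[OF open_UNIV UNIV_I sT[OF sZ] smooth_expo that Y0 _ Yb])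
            show "cmod (iter_partial J ?e x) \<le> (1 + t) ^ k0" if "length J \<le> k0" for J
              using iter_partial_expo_bound'[OF that, of "- \<xi>" x] by (simp add: t_def)
          qed (use t in auto)
        qed (use Y0 t in auto)
        also have "\<dots> \<le> Cu * (2 ^ k0 * Y * (2 ^ k0 * t ^ k0))"
          unfolding power_mult_distrib[symmetric] using Cu Y0 t by (intro mult_left_mono power_mono) auto
        finally have ub: "cmod (?a i k) \<le> Cu * (2 ^ k0 * Y * (2 ^ k0 * t ^ k0))" .
        have "cmod (of_real (t ^ (K + m - (i + k))) * ?a i k) = t ^ (K + m - (i + k)) * cmod (?a i k)"
          using t by (simp add: norm_mult norm_power)
        \<comment> \<open>Since K < i + k, the remaining power of t is below m.\<close>
        also have "\<dots> \<le> t ^ m * (Cu * (2 ^ k0 * Y * (2 ^ k0 * t ^ k0)))"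
          using ub t ik' by (intro mult_mono power_increasing) auto
        also have "\<dots> = t ^ m * (2 ^ k0 * t ^ k0 * (Cu * 2 ^ k0 * (c * A ^ (m + k0) * C1)) * (B ^ K * 1 * fact (K + P) powr s))"
          by (simp add: Y_def mult_ac)
        also have "\<dots> \<le> t ^ m * (2 ^ k0 * t ^ k0 * (Cu * 2 ^ k0 * (c * A ^ (m + k0) * C1)) * \<Phi>)"
          unfolding \<Phi>_def using t Cu c A 1 B B2
          by (intro mult_left_mono mult_right_mono one_le_power mult_nonneg_nonneg) auto
        finally show ?thesis .
      qed
      have finE: "finite E" and cardE: "card E \<le> Suc m * Suc K"
      proof -
        have "E \<subseteq> {..m} \<times> {..K}" by (auto simp: E_def)
        then show "finite E" "card E \<le> Suc m * Suc K"
          using card_mono[of "{..m} \<times> {..K}" E] finite_subset[of E "{..m} \<times> {..K}"] by (auto simp: card_cartesian_product)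
      qed
      let ?X = "t ^ m * (2 ^ k0 * t ^ k0 * (Cu * 2 ^ k0 * (c * A ^ (m + k0) * C1)) * \<Phi>)"
      have X0: "0 \<le> ?X" using t Cu c A 1 \<Phi>0 by (intro mult_nonneg_nonneg) auto
      have "t ^ (K + m) * cmod (u (\<lambda>x. \<zeta> x * ?e x)) = cmod (of_real (t ^ (K + m)) * u (\<lambda>x. \<zeta> x * ?e x))"
        using t by (simp add: norm_mult norm_power)
      also have "\<dots> \<le> cmod (\<Sum>k\<le>K. of_real (t ^ (K - k)) * ?F k) + cmod (\<Sum>(i, k)\<in>E. of_real (t ^ (K + m - (i + k))) * ?a i k)"
        unfolding id by (rule norm_triangle_ineq4)
      also have "cmod (\<Sum>k\<le>K. of_real (t ^ (K - k)) * ?F k) \<le> (\<Sum>k\<le>K. t ^ k0 * (Ck * (2 * Cq * C1) * \<Phi>))"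
        by (rule order_trans[OF norm_sum]) (intro sum_mono t1, simp)
      also have "\<dots> = real (Suc K) * (t ^ k0 * (Ck * (2 * Cq * C1) * \<Phi>))" by simp
      also have "\<dots> \<le> real (Suc K) * (t ^ (k0 + m) * (Ck * (2 * Cq * C1) * \<Phi>))"
        using t Ck Cq 1 \<Phi>0 by (intro mult_left_mono mult_right_mono power_increasing mult_nonneg_nonneg) auto
      also have "cmod (\<Sum>(i, k)\<in>E. of_real (t ^ (K + m - (i + k))) * ?a i k) \<le> (\<Sum>p\<in>E. ?X)"
        by (rule order_trans[OF norm_sum]) (intro sum_mono, use t2 in auto)
      also have "\<dots> = real (card E) * ?X" by simp
      also have "\<dots> \<le> real (Suc m * Suc K) * ?X" using cardE X0 by (intro mult_right_mono) linarith+
      also have "real (Suc K) * (t ^ (k0 + m) * (Ck * (2 * Cq * C1) * \<Phi>)) + real (Suc m * Suc K) * ?X = t ^ (k0 + m) * (real (Suc K) * (H * \<Phi>))"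
        unfolding H_def of_nat_mult by (simp only: distrib_left distrib_right power_add mult_ac)
      \<comment> \<open>The number of summands is proportional to K + 1; 2 ^ K absorbs it into the
        geometric factor B3.\<close>
      also have "\<dots> \<le> t ^ (k0 + m) * (2 ^ K * (H * \<Phi>))"
      proof (intro mult_left_mono mult_right_mono)
        have "Suc K \<le> 2 ^ K" using less_exp[of K] by (rule Suc_leI)
        then have "real (Suc K) \<le> real (2 ^ K)" by (rule of_nat_mono)
        then show "real (Suc K) \<le> 2 ^ K" by simp
      qed (use H \<Phi>0 t in auto)
      also have "t ^ (K + m) = t ^ (k0 + m) * t ^ N" by (simp add: K_def power_add mult_ac)
      finally have "t ^ (k0 + m) * (t ^ N * cmod (u (\<lambda>x. \<zeta> x * ?e x))) \<le> t ^ (k0 + m) * (2 ^ K * (H * \<Phi>))"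
        by (simp add: mult.assoc)
      then have "t ^ N * cmod (u (\<lambda>x. \<zeta> x * ?e x)) \<le> 2 ^ K * (H * \<Phi>)" using t by simp
      also have "\<dots> = H * B3 ^ K * fact (N + (k0 + P)) powr s"
        by (simp add: \<Phi>_def B3_def K_def power_mult_distrib mult_ac add_ac)
      also have "\<dots> \<le> H * B3 ^ K * (W * (2 powr s) ^ N * fact N powr s)"
        unfolding W_def using H B3 s by (intro mult_left_mono fact_shift_powr mult_nonneg_nonneg) auto
      also have "\<dots> = C' * (B3 * 2 powr s) ^ N * fact N powr s"
        by (simp add: C'_def K_def power_add power_mult_distrib mult_ac)
      finally show ?thesis by (simp add: t_def)
    qed
    have "C' \<ge> 0" using H B3 by (simp add: C'_def W_def)
    moreover have "B3 * 2 powr s \<ge> 1" using B3 s ge_one_powr_ge_zero[of 2 s] mult_mono[of 1 B3 1 "2 powr s"] by simp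
    ultimately show "\<exists>C\<ge>0. \<exists>B\<ge>1. \<forall>\<xi>\<in>conic_nbhd \<xi>0 \<delta>. \<forall>N. 1 \<le> norm \<xi> \<longrightarrow>
      norm \<xi> ^ N * cmod (u (\<lambda>x. \<zeta> x * expo (- \<xi>) x)) \<le> C * B ^ N * fact N powr s"
      using main by blast
  qed
qed

theorem theorem1p7:
  fixes \<Omega> :: "(real^'n::finite) set" and m :: nat
    and a :: "('n \<Rightarrow> nat) \<Rightarrow> real^'n \<Rightarrow> complex"
    and u :: "(real^'n \<Rightarrow> complex) \<Rightarrow> complex"
  assumes "open \<Omega>"
    and "\<And>\<alpha>. mabs \<alpha> \<le> m \<Longrightarrow> EG \<Omega> (a \<alpha>)"
    and "distribution \<Omega> u"
  shows "WF_G \<Omega> u \<subseteq> WF_G \<Omega> (Pop m a u) \<union> CharP \<Omega> m a \<and>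
         (CharP \<Omega> m a = {} \<longrightarrow> WF_G \<Omega> u = WF_G \<Omega> (Pop m a u))"
proof -
  have 1: "WF_G \<Omega> u \<subseteq> WF_G \<Omega> (Pop m a u) \<union> CharP \<Omega> m a"
  proof
    fix z assume z: "z \<in> WF_G \<Omega> u"
    obtain x \<xi> where x: "z = (x, \<xi>)" by (cases z)
    with z have w: "x \<in> \<Omega>" "\<xi> \<noteq> 0" "\<not> microlocal_G \<Omega> u x \<xi>" by (auto simp: WF_G_def)
    show "z \<in> WF_G \<Omega> (Pop m a u) \<union> CharP \<Omega> m a"
    proof (cases "psym m a x \<xi> = 0")
      case True
      then show ?thesis using w x by (simp add: CharP_def psym_def)
    next
      case False
      have "\<not> microlocal_G \<Omega> (Pop m a u) x \<xi>"
      proof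
        assume mic: "microlocal_G \<Omega> (Pop m a u) x \<xi>"
        have "microlocal_G \<Omega> u x \<xi>"
          by (rule microlocal_elliptic[OF assms(1) w(1) _ assms(3) w(2) mic False]) (rule assms(2))
        with w(3) show False by blast
      qed
      then show ?thesis using w x by (simp add: WF_G_def)
    qed
  qed
  \<comment> \<open>Pseudolocality; when the characteristic set is empty, the first inclusion
    becomes the reverse of this one.\<close>
  have 2: "WF_G \<Omega> (Pop m a u) \<subseteq> WF_G \<Omega> u"
  proof -
    have "microlocal_G \<Omega> (Pop m a u) x \<xi>" if "\<xi> \<noteq> 0" "microlocal_G \<Omega> u x \<xi>" for x \<xi>
      by (rule microlocal_Pop[OF assms(1) _ assms(3) that]) (rule assms(2))
    then show ?thesis by (auto simp: WF_G_def)
  qed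
  from 1 2 show ?thesis by blast
qed

end
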